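(* Let $2\le n<\infty$. Let $\mathfrak{N}_n:=\{z\in\bigcup_{m\ge1}(\mathcal{V}_{n,m})_1: z\text{ is nonperiodic}\}$ and $\mathfrak{I}_n:=\{z\in\bigcup_{m\ge1}(\mathcal{V}_{n,m})_1: z\text{ is indecomposable}\}$. Let $\mathcal{P}_{n,sub}$ be the set of all pure sub-Cuntz states on $\mathcal{O}_n$ (of all orders $m\ge 1$), and let $\mathrm{Spec}\,\mathcal{O}_n$ be the set of all unitary equivalence classes of irreducible representations of $\mathcal{O}_n$. Then the following hold: (i) The map $q:\mathfrak{N}_n\to\mathcal{P}_{n,sub}$, $q(z):=\tilde{\omega}_z$, is bijective. (ii) The map $r:\mathfrak{I}_n\to\mathrm{Spec}\,\mathcal{O}_n$, $r(z):=[\pi_z]$, is injective, where $[\pi_z]$ denotes the unitary equivalence class of the GNS representation $\pi_z$ by $\tilde{\omega}_z$.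
   Context: $\mathcal{O}_n$ ($2\le n<\infty$) is the Cuntz algebra, the universal C$^*$-algebra generated by $s_1,\ldots,s_n$ with $s_i^*s_j=\delta_{ij}I$ and $\sum_{i=1}^n s_is_i^*=I$. For $J=(j_1,\ldots,j_k)\in\{1,\ldots,n\}^k$, $s_J:=s_{j_1}\cdots s_{j_k}$. $\mathcal{V}_{n,m}:=\ell^2(\{1,\ldots,n\}^m)$ is the Hilbert space with orthonormal basis $\{e_J: J\in\{1,\ldots,n\}^m\}$, identified with $(\mathbb{C}^n)^{\otimes m}$ via $e_J\leftrightarrow e_{j_1}\otimes\cdots\otimes e_{j_m}$, so that $\mathcal{V}_{n,m}\otimes\mathcal{V}_{n,l}=\mathcal{V}_{n,m+l}$. $(\mathcal{V}_{n,m})_1$ is the set of unit vectors. For $z=\sum z_Je_J\in(\mathcal{V}_{n,m})_1$, a sub-Cuntz state on $\mathcal{O}_n$ by $z$ (of order $m$) is a state $\omega$ on $\mathcal{O}_n$ with $\omega(s_J)=\overline{z_J}$ for all $J\in\{1,\ldots,n\}^m$. $z$ is nonperiodic if $z=x^{\otimes p}$ for some $p\ge 1$ and some $x\in\bigcup_{k\ge1}\mathcal{V}_{n,k}$ implies $p=1$. For a nonperiodic unit vector $z$ there is exactly one sub-Cuntz state by $z$, denoted $\tilde{\omega}_z$, and it is pure. $z$ is indecomposable if it cannot be written as $z_1\otimes z_2$ with $z_1,z_2\in\bigcup_{k\ge1}\mathcal{V}_{n,k}$; indecomposable vectors are nonperiodic. *)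

theory Defs
  imports
    Complex_Main
    "HOL-Library.Nonpos_Ints"
    "HOL-Algebra.Algebraic_Closure_Type"
begin

section \<open>Hausdorff completion of a pseudometric\<close>

definition cauchy_seqs :: "'v set \<Rightarrow> ('v \<Rightarrow> 'v \<Rightarrow> real) \<Rightarrow> (nat \<Rightarrow> 'v) set" where
  "cauchy_seqs V d =
     {u. (\<forall>k. u k \<in> V) \<and> (\<forall>e>0. \<exists>N. \<forall>j\<ge>N. \<forall>k\<ge>N. d (u j) (u k) < e)}"

definition null_rel :: "'v set \<Rightarrow> ('v \<Rightarrow> 'v \<Rightarrow> real) \<Rightarrow> ((nat \<Rightarrow> 'v) \<times> (nat \<Rightarrow> 'v)) set" where
  "null_rel V d = {(u, v). u \<in> cauchy_seqs V d \<and> v \<in> cauchy_seqs V d \<and>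
     (\<lambda>k. d (u k) (v k)) \<longlonglongrightarrow> 0}"

definition hausdorff_completion :: "'v set \<Rightarrow> ('v \<Rightarrow> 'v \<Rightarrow> real) \<Rightarrow> (nat \<Rightarrow> 'v) set set" where
  "hausdorff_completion V d = cauchy_seqs V d // null_rel V d"


section \<open>Universal C*-algebras\<close>

record 'a star_algebra = "(complex, 'a) module" +
  star :: "'a \<Rightarrow> 'a"

record 'a normed_star_algebra = "'a star_algebra" +
  alg_norm :: "'a \<Rightarrow> real"

definition cstar_seminorm :: "('a, 'm) star_algebra_scheme \<Rightarrow> ('a \<Rightarrow> real) \<Rightarrow> bool" where
  "cstar_seminorm F p \<longleftrightarrow>
     (\<forall>a\<in>carrier F. 0 \<le> p a) \<and>
     (\<forall>a\<in>carrier F. \<forall>b\<in>carrier F. p (a \<oplus>\<^bsub>F\<^esub> b) \<le> p a + p b) \<and>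
     (\<forall>c. \<forall>a\<in>carrier F. p (c \<odot>\<^bsub>F\<^esub> a) = cmod c * p a) \<and>
     (\<forall>a\<in>carrier F. \<forall>b\<in>carrier F. p (a \<otimes>\<^bsub>F\<^esub> b) \<le> p a * p b) \<and>
     (\<forall>a\<in>carrier F. p (star F a \<otimes>\<^bsub>F\<^esub> a) = (p a)\<^sup>2)"

text \<open>The supremum is meaningful only when it is finite at every element of \<open>F\<close>.  For the Cuntz
  relations it is: any admissible \<open>p\<close> satisfies \<open>p (s\<^sub>i)\<^sup>2 = p (s\<^sub>i* s\<^sub>i) = p 1 \<le> 1\<close>.\<close>

definition universal_seminorm :: "('a, 'm) star_algebra_scheme \<Rightarrow> 'a set \<Rightarrow> 'a \<Rightarrow> real" where
  "universal_seminorm F R a = (SUP p \<in> {p. cstar_seminorm F p \<and> (\<forall>r\<in>R. p r = 0)}. p a)"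

definition universal_dist :: "('a, 'm) star_algebra_scheme \<Rightarrow> 'a set \<Rightarrow> 'a \<Rightarrow> 'a \<Rightarrow> real" where
  "universal_dist F R a b = universal_seminorm F R (a \<ominus>\<^bsub>F\<^esub> b)"

abbreviation universal_class ::
    "('a, 'm) star_algebra_scheme \<Rightarrow> 'a set \<Rightarrow> (nat \<Rightarrow> 'a) \<Rightarrow> (nat \<Rightarrow> 'a) set" where
  "universal_class F R u \<equiv> null_rel (carrier F) (universal_dist F R) `` {u}"

text \<open>The universal C*-algebra of the *-algebra \<open>F\<close> subject to the relations \<open>r = 0\<close>, \<open>r \<in> R\<close>: the
  Hausdorff completion of \<open>F\<close> in the largest C*-seminorm that vanishes on \<open>R\<close>.  The operations are
  induced by the termwise operations on Cauchy sequences.\<close>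

definition universal_cstar ::
    "('a, 'm) star_algebra_scheme \<Rightarrow> 'a set \<Rightarrow> (nat \<Rightarrow> 'a) set normed_star_algebra" where
  "universal_cstar F R =
     \<lparr> carrier = hausdorff_completion (carrier F) (universal_dist F R),
       monoid.mult = (\<lambda>P Q. \<Union>u\<in>P. \<Union>v\<in>Q. universal_class F R (\<lambda>k. u k \<otimes>\<^bsub>F\<^esub> v k)),
       monoid.one = universal_class F R (\<lambda>k. \<one>\<^bsub>F\<^esub>),
       ring.zero = universal_class F R (\<lambda>k. \<zero>\<^bsub>F\<^esub>),
       ring.add = (\<lambda>P Q. \<Union>u\<in>P. \<Union>v\<in>Q. universal_class F R (\<lambda>k. u k \<oplus>\<^bsub>F\<^esub> v k)),
       module.smult = (\<lambda>c P. \<Union>u\<in>P. universal_class F R (\<lambda>k. c \<odot>\<^bsub>F\<^esub> u k)),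
       star = (\<lambda>P. \<Union>u\<in>P. universal_class F R (\<lambda>k. star F (u k))),
       alg_norm = (\<lambda>P. the_elem (\<Union>u\<in>P. {lim (\<lambda>k. universal_seminorm F R (u k))})) \<rparr>"


section \<open>Functions on words\<close>

text \<open>Concatenation product, determined by \<open>\<delta>\<^sub>J \<cdot> \<delta>\<^sub>K = \<delta>\<^sub>J\<^sub>K\<close>.  It serves both as the product of
  noncommutative polynomials and as the tensor product of homogeneous tensors.\<close>

definition word_conv :: "('g list \<Rightarrow> complex) \<Rightarrow> ('g list \<Rightarrow> complex) \<Rightarrow> 'g list \<Rightarrow> complex" where
  "word_conv f g w = (\<Sum>k\<le>length w. f (take k w) * g (drop k w))"

definition word_delta :: "'g list \<Rightarrow> 'g list \<Rightarrow> complex" where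
  "word_delta J w = (if w = J then 1 else 0)"

datatype 'g letter = Gen 'g | Adj 'g

fun adj_letter :: "'g letter \<Rightarrow> 'g letter" where
  "adj_letter (Gen i) = Adj i"
| "adj_letter (Adj i) = Gen i"

text \<open>The free unital *-algebra on the set of generators \<open>G\<close>: noncommutative polynomials in the
  letters \<open>Gen i\<close> and their formal adjoints \<open>Adj i\<close>.\<close>

definition free_star_algebra :: "'g set \<Rightarrow> ('g letter list \<Rightarrow> complex) star_algebra" where
  "free_star_algebra G =
     \<lparr> carrier = {f. finite {w. f w \<noteq> 0} \<and> {w. f w \<noteq> 0} \<subseteq> lists (Gen ` G \<union> Adj ` G)},
       monoid.mult = word_conv,
       monoid.one = word_delta [],
       ring.zero = (\<lambda>w. 0),
       ring.add = (\<lambda>f g w. f w + g w),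
       module.smult = (\<lambda>c f w. c * f w),
       star = (\<lambda>f w. cnj (f (rev (map adj_letter w)))) \<rparr>"


section \<open>The Cuntz algebra\<close>

definition cuntz_relations :: "nat \<Rightarrow> (nat letter list \<Rightarrow> complex) set" where
  "cuntz_relations n =
     {(\<lambda>w. word_delta [Adj i, Gen j] w - (if i = j then word_delta [] w else 0)) | i j.
        i \<in> {1..n} \<and> j \<in> {1..n}} \<union>
     {(\<lambda>w. (\<Sum>i=1..n. word_delta [Gen i, Adj i] w) - word_delta [] w)}"

type_synonym cuntz_elem = "(nat \<Rightarrow> nat letter list \<Rightarrow> complex) set"

definition cuntz :: "nat \<Rightarrow> cuntz_elem normed_star_algebra" where
  "cuntz n = universal_cstar (free_star_algebra {1..n}) (cuntz_relations n)"

definition cuntz_gen :: "nat \<Rightarrow> nat \<Rightarrow> cuntz_elem" where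
  "cuntz_gen n i =
     universal_class (free_star_algebra {1..n}) (cuntz_relations n) (\<lambda>k. word_delta [Gen i])"

definition cuntz_word :: "nat \<Rightarrow> nat list \<Rightarrow> cuntz_elem" where
  "cuntz_word n J = foldr (\<lambda>i a. cuntz_gen n i \<otimes>\<^bsub>cuntz n\<^esub> a) J \<one>\<^bsub>cuntz n\<^esub>"


section \<open>States\<close>

definition states :: "('a, 'm) star_algebra_scheme \<Rightarrow> ('a \<Rightarrow> complex) set" where
  "states A = {\<omega> \<in> extensional (carrier A).
     (\<forall>a\<in>carrier A. \<forall>b\<in>carrier A. \<omega> (a \<oplus>\<^bsub>A\<^esub> b) = \<omega> a + \<omega> b) \<and>
     (\<forall>c. \<forall>a\<in>carrier A. \<omega> (c \<odot>\<^bsub>A\<^esub> a) = c * \<omega> a) \<and>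
     (\<forall>a\<in>carrier A. \<omega> (star A a \<otimes>\<^bsub>A\<^esub> a) \<in> \<real>\<^sub>\<ge>\<^sub>0) \<and>
     \<omega> \<one>\<^bsub>A\<^esub> = 1}"

definition pure_states :: "('a, 'm) star_algebra_scheme \<Rightarrow> ('a \<Rightarrow> complex) set" where
  "pure_states A = {\<omega> \<in> states A.
     \<forall>\<phi>\<in>states A. \<forall>\<psi>\<in>states A. \<forall>t::real. 0 < t \<and> t < 1 \<and>
       (\<forall>a\<in>carrier A. \<omega> a = of_real t * \<phi> a + of_real (1 - t) * \<psi> a) \<longrightarrow> \<phi> = \<omega> \<and> \<psi> = \<omega>}"


section \<open>Hilbert space representations\<close>

text \<open>The ring multiplication and unit that the record type \<open>module\<close> carries are unused here.
  Inner products are linear in the second argument.\<close>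

record 'h inner_space = "(complex, 'h) module" +
  hinner :: "'h \<Rightarrow> 'h \<Rightarrow> complex"

definition hnorm :: "('h, 'm) inner_space_scheme \<Rightarrow> 'h \<Rightarrow> real" where
  "hnorm H x = sqrt (Re (hinner H x x))"

definition hdist :: "('h, 'm) inner_space_scheme \<Rightarrow> 'h \<Rightarrow> 'h \<Rightarrow> real" where
  "hdist H x y = hnorm H (x \<ominus>\<^bsub>H\<^esub> y)"

locale complex_hilbert_space = Module.module ring_of_type_algebra H
  for H :: "('h, 'm) inner_space_scheme" (structure) +
  assumes inner_add_right: "\<lbrakk>x \<in> carrier H; y \<in> carrier H; z \<in> carrier H\<rbrakk>
      \<Longrightarrow> hinner H x (y \<oplus>\<^bsub>H\<^esub> z) = hinner H x y + hinner H x z"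
    and inner_smult_right: "\<lbrakk>x \<in> carrier H; y \<in> carrier H\<rbrakk>
      \<Longrightarrow> hinner H x (c \<odot>\<^bsub>H\<^esub> y) = c * hinner H x y"
    and inner_commute: "\<lbrakk>x \<in> carrier H; y \<in> carrier H\<rbrakk> \<Longrightarrow> hinner H y x = cnj (hinner H x y)"
    and inner_self_nonneg: "x \<in> carrier H \<Longrightarrow> hinner H x x \<in> \<real>\<^sub>\<ge>\<^sub>0"
    and inner_self_eq_0: "\<lbrakk>x \<in> carrier H; hinner H x x = 0\<rbrakk> \<Longrightarrow> x = \<zero>\<^bsub>H\<^esub>"
    and complete: "u \<in> cauchy_seqs (carrier H) (hdist H)
      \<Longrightarrow> \<exists>x\<in>carrier H. (\<lambda>k. hdist H (u k) x) \<longlonglongrightarrow> 0"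

definition linear_op :: "('h, 'm) inner_space_scheme \<Rightarrow> ('k, 'l) inner_space_scheme \<Rightarrow>
    ('h \<Rightarrow> 'k) \<Rightarrow> bool" where
  "linear_op H K T \<longleftrightarrow> T \<in> carrier H \<rightarrow> carrier K \<and>
     (\<forall>x\<in>carrier H. \<forall>y\<in>carrier H. T (x \<oplus>\<^bsub>H\<^esub> y) = T x \<oplus>\<^bsub>K\<^esub> T y) \<and>
     (\<forall>c. \<forall>x\<in>carrier H. T (c \<odot>\<^bsub>H\<^esub> x) = c \<odot>\<^bsub>K\<^esub> T x)"

definition bounded_op :: "('h, 'm) inner_space_scheme \<Rightarrow> ('h \<Rightarrow> 'h) \<Rightarrow> bool" where
  "bounded_op H T \<longleftrightarrow> linear_op H H T \<and> (\<exists>B. \<forall>x\<in>carrier H. hnorm H (T x) \<le> B * hnorm H x)"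

type_synonym ('a, 'h) rep = "'h inner_space \<times> ('a \<Rightarrow> 'h \<Rightarrow> 'h)"

text \<open>Representations are unital *-representations by bounded operators.\<close>

fun representation :: "('a, 'm) star_algebra_scheme \<Rightarrow> ('a, 'h) rep \<Rightarrow> bool" where
  "representation A (H, \<pi>) \<longleftrightarrow> complex_hilbert_space H \<and>
     (\<forall>a\<in>carrier A. bounded_op H (\<pi> a)) \<and>
     (\<forall>a\<in>carrier A. \<forall>b\<in>carrier A. \<forall>x\<in>carrier H. \<pi> (a \<oplus>\<^bsub>A\<^esub> b) x = \<pi> a x \<oplus>\<^bsub>H\<^esub> \<pi> b x) \<and>
     (\<forall>c. \<forall>a\<in>carrier A. \<forall>x\<in>carrier H. \<pi> (c \<odot>\<^bsub>A\<^esub> a) x = c \<odot>\<^bsub>H\<^esub> \<pi> a x) \<and>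
     (\<forall>a\<in>carrier A. \<forall>b\<in>carrier A. \<forall>x\<in>carrier H. \<pi> (a \<otimes>\<^bsub>A\<^esub> b) x = \<pi> a (\<pi> b x)) \<and>
     (\<forall>x\<in>carrier H. \<pi> \<one>\<^bsub>A\<^esub> x = x) \<and>
     (\<forall>a\<in>carrier A. \<forall>x\<in>carrier H. \<forall>y\<in>carrier H.
        hinner H (\<pi> (star A a) x) y = hinner H x (\<pi> a y))"

definition closed_subspace :: "('h, 'm) inner_space_scheme \<Rightarrow> 'h set \<Rightarrow> bool" where
  "closed_subspace H K \<longleftrightarrow> submodule K (ring_of_type_algebra :: complex ring) H \<and>
     (\<forall>u x. (\<forall>k. u k \<in> K) \<and> x \<in> carrier H \<and> (\<lambda>k. hdist H (u k) x) \<longlonglongrightarrow> 0 \<longrightarrow> x \<in> K)"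

fun irreducible_rep :: "('a, 'm) star_algebra_scheme \<Rightarrow> ('a, 'h) rep \<Rightarrow> bool" where
  "irreducible_rep A (H, \<pi>) \<longleftrightarrow> representation A (H, \<pi>) \<and> carrier H \<noteq> {\<zero>\<^bsub>H\<^esub>} \<and>
     (\<forall>K. closed_subspace H K \<and> (\<forall>a\<in>carrier A. \<pi> a ` K \<subseteq> K) \<longrightarrow>
        K = {\<zero>\<^bsub>H\<^esub>} \<or> K = carrier H)"

fun intertwining_unitary :: "('a, 'm) star_algebra_scheme \<Rightarrow> ('a, 'h) rep \<Rightarrow> ('a, 'k) rep \<Rightarrow>
    ('h \<Rightarrow> 'k) \<Rightarrow> bool" where
  "intertwining_unitary A (H, \<pi>) (K, \<rho>) U \<longleftrightarrow>
     linear_op H K U \<and> bij_betw U (carrier H) (carrier K) \<and>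
     (\<forall>x\<in>carrier H. \<forall>y\<in>carrier H. hinner K (U x) (U y) = hinner H x y) \<and>
     (\<forall>a\<in>carrier A. \<forall>x\<in>carrier H. U (\<pi> a x) = \<rho> a (U x))"

definition unitary_equiv ::
    "('a, 'm) star_algebra_scheme \<Rightarrow> (('a, 'h) rep \<times> ('a, 'h) rep) set" where
  "unitary_equiv A = {(\<rho>, \<sigma>). representation A \<rho> \<and> representation A \<sigma> \<and>
     (\<exists>U. intertwining_unitary A \<rho> \<sigma> U)}"

text \<open>The GNS Hilbert space of a state \<open>\<omega>\<close> is the Hausdorff completion of \<open>A\<close> in the
  semi-inner product \<open>(a, b) \<mapsto> \<omega> (a* b)\<close>, and \<open>A\<close> acts by left multiplication.\<close>

definition gns_dist :: "('a, 'm) star_algebra_scheme \<Rightarrow> ('a \<Rightarrow> complex) \<Rightarrow> 'a \<Rightarrow> 'a \<Rightarrow> real" where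
  "gns_dist A \<omega> a b = sqrt (Re (\<omega> (star A (a \<ominus>\<^bsub>A\<^esub> b) \<otimes>\<^bsub>A\<^esub> (a \<ominus>\<^bsub>A\<^esub> b))))"

abbreviation gns_class ::
    "('a, 'm) star_algebra_scheme \<Rightarrow> ('a \<Rightarrow> complex) \<Rightarrow> (nat \<Rightarrow> 'a) \<Rightarrow> (nat \<Rightarrow> 'a) set" where
  "gns_class A \<omega> u \<equiv> null_rel (carrier A) (gns_dist A \<omega>) `` {u}"

definition gns_space ::
    "('a, 'm) star_algebra_scheme \<Rightarrow> ('a \<Rightarrow> complex) \<Rightarrow> (nat \<Rightarrow> 'a) set inner_space" where
  "gns_space A \<omega> =
     \<lparr> carrier = hausdorff_completion (carrier A) (gns_dist A \<omega>),
       monoid.mult = undefined,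
       monoid.one = undefined,
       ring.zero = gns_class A \<omega> (\<lambda>k. \<zero>\<^bsub>A\<^esub>),
       ring.add = (\<lambda>P Q. \<Union>u\<in>P. \<Union>v\<in>Q. gns_class A \<omega> (\<lambda>k. u k \<oplus>\<^bsub>A\<^esub> v k)),
       module.smult = (\<lambda>c P. \<Union>u\<in>P. gns_class A \<omega> (\<lambda>k. c \<odot>\<^bsub>A\<^esub> u k)),
       hinner = (\<lambda>P Q. the_elem (\<Union>u\<in>P. \<Union>v\<in>Q. {lim (\<lambda>k. \<omega> (star A (u k) \<otimes>\<^bsub>A\<^esub> v k))})) \<rparr>"

definition gns_rep ::
    "('a, 'm) star_algebra_scheme \<Rightarrow> ('a \<Rightarrow> complex) \<Rightarrow> ('a, (nat \<Rightarrow> 'a) set) rep" where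
  "gns_rep A \<omega> = (gns_space A \<omega>, \<lambda>a P. \<Union>u\<in>P. gns_class A \<omega> (\<lambda>k. a \<otimes>\<^bsub>A\<^esub> u k))"

text \<open>The set of unitary equivalence classes has to be formed over Hilbert spaces with elements in
  one fixed type.  The type of the GNS spaces loses nothing: every irreducible representation, on
  whatever Hilbert space, is cyclic, hence unitarily equivalent to a GNS representation.\<close>

definition cstar_spectrum ::
    "('a, 'm) star_algebra_scheme \<Rightarrow> ('a, (nat \<Rightarrow> 'a) set) rep set set" where
  "cstar_spectrum A = {\<rho>. irreducible_rep A \<rho>} // unitary_equiv A"


section \<open>Sub-Cuntz states\<close>

definition words :: "nat \<Rightarrow> nat \<Rightarrow> nat list set" where
  "words n m = {J \<in> lists {1..n}. length J = m}"

text \<open>The spaces \<open>\<V>\<^sub>n\<^sub>,\<^sub>m\<close> are realised inside one space of functions on words, so that their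
  union over \<open>m\<close> makes sense; distinct ones intersect in \<open>0\<close> only.\<close>

definition tensors :: "nat \<Rightarrow> nat \<Rightarrow> (nat list \<Rightarrow> complex) set" where
  "tensors n m = {z. \<forall>J. J \<notin> words n m \<longrightarrow> z J = 0}"

definition unit_tensors :: "nat \<Rightarrow> nat \<Rightarrow> (nat list \<Rightarrow> complex) set" where
  "unit_tensors n m = {z \<in> tensors n m. (\<Sum>J\<in>words n m. (cmod (z J))\<^sup>2) = 1}"

abbreviation tensor ::
    "(nat list \<Rightarrow> complex) \<Rightarrow> (nat list \<Rightarrow> complex) \<Rightarrow> nat list \<Rightarrow> complex" where
  "tensor \<equiv> word_conv"

lemma tensor_append:
  assumes "x \<in> tensors n m" "y \<in> tensors n l" "length J = m" "length K = l"
  shows "tensor x y (J @ K) = x J * y K"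
proof -
  have "x (take k (J @ K)) = 0" if "k \<le> length (J @ K)" "k \<noteq> m" for k
  proof -
    have "length (take k (J @ K)) \<noteq> m"
      using that by simp
    then show ?thesis
      using assms(1) unfolding tensors_def words_def by blast
  qed
  then have "tensor x y (J @ K) = (\<Sum>k\<le>length (J @ K). if k = m then x J * y K else 0)"
    unfolding word_conv_def using assms by (intro sum.cong) auto
  also have "\<dots> = x J * y K"
    using assms by simp
  finally show ?thesis .
qed

fun tensor_power :: "(nat list \<Rightarrow> complex) \<Rightarrow> nat \<Rightarrow> nat list \<Rightarrow> complex" where
  "tensor_power x 0 = word_delta []"
| "tensor_power x (Suc p) = tensor x (tensor_power x p)"

definition nonperiodic :: "nat \<Rightarrow> (nat list \<Rightarrow> complex) \<Rightarrow> bool" where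
  "nonperiodic n z \<longleftrightarrow> (\<forall>p\<ge>1. \<forall>x\<in>(\<Union>k\<in>{1..}. tensors n k). z = tensor_power x p \<longrightarrow> p = 1)"

definition indecomposable :: "nat \<Rightarrow> (nat list \<Rightarrow> complex) \<Rightarrow> bool" where
  "indecomposable n z \<longleftrightarrow>
     \<not> (\<exists>z1\<in>(\<Union>k\<in>{1..}. tensors n k). \<exists>z2\<in>(\<Union>k\<in>{1..}. tensors n k). z = tensor z1 z2)"

definition nonperiodic_units :: "nat \<Rightarrow> (nat list \<Rightarrow> complex) set" where
  "nonperiodic_units n = {z \<in> (\<Union>m\<in>{1..}. unit_tensors n m). nonperiodic n z}"

definition indecomposable_units :: "nat \<Rightarrow> (nat list \<Rightarrow> complex) set" where
  "indecomposable_units n = {z \<in> (\<Union>m\<in>{1..}. unit_tensors n m). indecomposable n z}"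

text \<open>The order \<open>m\<close> is determined by the unit vector \<open>z\<close>.\<close>

definition sub_cuntz_state :: "nat \<Rightarrow> (nat list \<Rightarrow> complex) \<Rightarrow> (cuntz_elem \<Rightarrow> complex) \<Rightarrow> bool" where
  "sub_cuntz_state n z \<omega> \<longleftrightarrow> \<omega> \<in> states (cuntz n) \<and>
     (\<exists>m\<ge>1. z \<in> unit_tensors n m \<and> (\<forall>J\<in>words n m. \<omega> (cuntz_word n J) = cnj (z J)))"

definition pure_sub_cuntz_states :: "nat \<Rightarrow> (cuntz_elem \<Rightarrow> complex) set" where
  "pure_sub_cuntz_states n = {\<omega> \<in> pure_states (cuntz n). \<exists>z. sub_cuntz_state n z \<omega>}"

definition omega_tilde :: "nat \<Rightarrow> (nat list \<Rightarrow> complex) \<Rightarrow> cuntz_elem \<Rightarrow> complex" where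
  "omega_tilde n z = (THE \<omega>. sub_cuntz_state n z \<omega>)"

definition gns_equiv_class ::
    "nat \<Rightarrow> (nat list \<Rightarrow> complex) \<Rightarrow> (cuntz_elem, (nat \<Rightarrow> cuntz_elem) set) rep set" where
  "gns_equiv_class n z = unitary_equiv (cuntz n) `` {gns_rep (cuntz n) (omega_tilde n z)}"

end

theory Submission
  imports
    Defs
    "HOL-Library.Diagonal_Subsequence"
    "HOL-Library.Countable_Set"
begin

text \<open>Write \<open>s(z) = \<Sum> z\<^sub>J s\<^sub>J\<close>.  A state \<open>\<omega>\<close> is sub-Cuntz by \<open>z\<close> iff \<open>\<omega> (s(z)) = 1\<close>, that is, iff
  \<open>s(z) \<Omega> = \<Omega>\<close> for its cyclic vector \<open>\<Omega>\<close>.  Everything rests on functionals \<open>g\<close> with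
  \<open>g (s(z)* a) = g a = g (a s(y))\<close>, such as \<open>a \<mapsto> \<langle>\<Omega>', a \<Omega>\<rangle>\<close> with \<open>s(z) \<Omega>' = \<Omega>'\<close> and
  \<open>s(y) \<Omega> = \<Omega>\<close>, or the difference of two sub-Cuntz states by \<open>z = y\<close>.  If \<open>z\<close> and \<open>y\<close> have the same
  order \<open>m\<close>, then \<open>g\<close> is determined by the tensors \<open>u\<close> of order \<open>d < m\<close> that represent it on the words
  of length \<open>d\<close>, and the equality case of the Cauchy-Schwarz inequality forces \<open>z \<otimes> u = u \<otimes> y\<close>.
  Homogeneous tensors are cancellative and equidivisible like words, so such equations can be
  solved: nonperiodicity yields uniqueness, purity and the one-dimensionality of the fixed space
  of \<open>s(z)\<close>, hence irreducibility, and indecomposability yields the inequivalence of the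
  representations for \<open>z \<noteq> y\<close>.

  Existence holds because \<open>s(z)\<close> is a proper isometry: \<open>1\<close> is an approximate eigenvalue of it, and
  a limit of vector states is sub-Cuntz by \<open>z\<close>.\<close>

section \<open>Completion of a seminormed space\<close>

text \<open>The two conditions on \<open>g\<close> act only at the ends of a word. The left one
  strips the first m letters off a word of generators; the right one appends generators until every
  adjoint letter has been cancelled. Hence generator words shorter than m control \<open>g\<close>,
  and no normal form for elements of the Cuntz algebra is required. The delicate point is the
  surjectivity of q. A pure state may be presented by a periodic vector x^p, and it must be shown to
  come from a scalar multiple of x. The equation is then x^p \<otimes> u = u \<otimes> x^p, solved
  only by multiples of powers of x, and purity is used again to make the cyclic vector an
  eigenvector of s(x). Nonperiodicity alone would not give (ii): for z = a \<otimes> b and y = b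
  \<otimes> a the tensor u = a solves z \<otimes> u = u \<otimes> y, and s(b) carries a vector fixed
  by s(z) to one fixed by s(y). Indecomposability rules out such conjugate pairs.\<close>

abbreviation scalars :: "complex ring" where
  "scalars \<equiv> ring_of_type_algebra"

lemma scalars_simps [simp]:
  "carrier scalars = UNIV" "a \<otimes>\<^bsub>scalars\<^esub> b = a * b" "a \<oplus>\<^bsub>scalars\<^esub> b = a + b"
  "\<one>\<^bsub>scalars\<^esub> = 1" "\<zero>\<^bsub>scalars\<^esub> = 0"
  by (simp_all add: ring_of_type_algebra_def)

text \<open>The free *-algebra, its completion, the GNS spaces and the finitely supported sequences
  all carry records extending \<open>module\<close>, so one locale of vector spaces serves them all.
  The laws below trade the record operations of \<open>scalars\<close> for those of the type
  \<open>complex\<close>, in which coefficients can be computed.\<close>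

locale cspace = Module.module scalars V for V :: "(complex, 'v, 'm) module_scheme" (structure)
begin

lemma sm_closed [simp, intro]: "x \<in> carrier V \<Longrightarrow> c \<odot> x \<in> carrier V"
  by (rule smult_closed) simp_all

lemma sm_add_left: "x \<in> carrier V \<Longrightarrow> (a + b) \<odot> x = a \<odot> x \<oplus> b \<odot> x"
  using smult_l_distr[of a b x] by simp

lemma sm_add_right: "x \<in> carrier V \<Longrightarrow> y \<in> carrier V \<Longrightarrow> a \<odot> (x \<oplus> y) = a \<odot> x \<oplus> a \<odot> y"
  using smult_r_distr[of a x y] by simp

lemma sm_sm: "x \<in> carrier V \<Longrightarrow> a \<odot> (b \<odot> x) = (a * b) \<odot> x"
  using smult_assoc1[of a b x] by simp

lemma sm_one [simp]: "x \<in> carrier V \<Longrightarrow> 1 \<odot> x = x"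
  using smult_one[of x] by simp

lemma sm_zero_left [simp]: "x \<in> carrier V \<Longrightarrow> 0 \<odot> x = \<zero>"
  using smult_l_null[of x] by simp

lemma sm_zero_right [simp]: "c \<odot> \<zero> = \<zero>"
  using smult_r_null[of c] by simp

lemma minus_eq_sm: "x \<in> carrier V \<Longrightarrow> \<ominus> x = (-1) \<odot> x"
proof -
  assume x: "x \<in> carrier V"
  have "x \<oplus> (-1) \<odot> x = \<zero>"
    using sm_add_left[OF x, of 1 "-1"] x by simp
  then show ?thesis
    using x by (metis M.add.inv_closed M.add.m_comm M.minus_equality sm_closed)
qed

lemma sm_minus_add: "x \<in> carrier V \<Longrightarrow> (-1) \<odot> x \<oplus> x = \<zero>"
  by (simp flip: minus_eq_sm add: M.l_neg)

lemma diff_eq_sm: "x \<in> carrier V \<Longrightarrow> y \<in> carrier V \<Longrightarrow> x \<ominus> y = x \<oplus> (-1) \<odot> y"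
  by (simp add: a_minus_def minus_eq_sm)

lemma diff_closed [simp, intro]: "x \<in> carrier V \<Longrightarrow> y \<in> carrier V \<Longrightarrow> x \<ominus> y \<in> carrier V"
  by (simp add: diff_eq_sm)

lemma diff_self [simp]: "x \<in> carrier V \<Longrightarrow> x \<ominus> x = \<zero>"
  by (simp add: M.r_neg a_minus_def)

lemma diff_zero [simp]: "x \<in> carrier V \<Longrightarrow> x \<ominus> \<zero> = x"
  by (simp add: diff_eq_sm)

lemma diff_add_cancel: "x \<in> carrier V \<Longrightarrow> y \<in> carrier V \<Longrightarrow> (x \<ominus> y) \<oplus> y = x"
  by (simp add: a_minus_def M.a_assoc M.l_neg)

lemma diff_eq_zero_iff: "x \<in> carrier V \<Longrightarrow> y \<in> carrier V \<Longrightarrow> x \<ominus> y = \<zero> \<longleftrightarrow> x = y"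
  by (metis M.add.l_one diff_add_cancel diff_self)

lemma diff_add_diff: "\<lbrakk>x \<in> carrier V; y \<in> carrier V; z \<in> carrier V\<rbrakk> \<Longrightarrow> (x \<ominus> y) \<oplus> (y \<ominus> z) = x \<ominus> z"
  by (simp add: a_minus_def M.a_assoc M.l_neg M.r_neg2 M.r_neg1)

lemma add_diff_add: "\<lbrakk>x \<in> carrier V; y \<in> carrier V; x' \<in> carrier V; y' \<in> carrier V\<rbrakk> \<Longrightarrow>
    (x \<oplus> y) \<ominus> (x' \<oplus> y') = (x \<ominus> x') \<oplus> (y \<ominus> y')"
  by (simp add: diff_eq_sm sm_add_right M.a_ac)

lemma sm_diff: "\<lbrakk>x \<in> carrier V; y \<in> carrier V\<rbrakk> \<Longrightarrow> c \<odot> (x \<ominus> y) = c \<odot> x \<ominus> c \<odot> y"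
  by (simp add: diff_eq_sm sm_add_right sm_sm)

lemma diff_diff_sm: "\<lbrakk>x \<in> carrier V; y \<in> carrier V\<rbrakk> \<Longrightarrow> y \<ominus> x = (-1) \<odot> (x \<ominus> y)"
  by (simp add: diff_eq_sm sm_add_right sm_sm M.a_comm)

end

lemma cspaceI:
  fixes V :: "(complex, 'v, 'm) module_scheme" (structure)
  assumes "abelian_group V"
    and "\<And>a x. x \<in> carrier V \<Longrightarrow> a \<odot> x \<in> carrier V"
    and "\<And>a b x. x \<in> carrier V \<Longrightarrow> (a + b) \<odot> x = a \<odot> x \<oplus> b \<odot> x"
    and "\<And>a x y. x \<in> carrier V \<Longrightarrow> y \<in> carrier V \<Longrightarrow> a \<odot> (x \<oplus> y) = a \<odot> x \<oplus> a \<odot> y"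
    and "\<And>a b x. x \<in> carrier V \<Longrightarrow> (a * b) \<odot> x = a \<odot> (b \<odot> x)"
    and "\<And>x. x \<in> carrier V \<Longrightarrow> 1 \<odot> x = x"
  shows "cspace V"
  unfolding cspace_def using assms by (intro moduleI cring_from_type_algebra) auto

text \<open>Covers C*-seminorms, the seminorm of a semi-inner product and the norms of the
  completions: the Cuntz algebra and the GNS spaces arise from one and the same completion
  argument.\<close>

locale seminormed_space = cspace V for V :: "(complex, 'v, 'm) module_scheme" (structure) +
  fixes p :: "'v \<Rightarrow> real"
  assumes p_nonneg: "x \<in> carrier V \<Longrightarrow> 0 \<le> p x"
    and p_add: "x \<in> carrier V \<Longrightarrow> y \<in> carrier V \<Longrightarrow> p (x \<oplus> y) \<le> p x + p y"
    and p_sm: "x \<in> carrier V \<Longrightarrow> p (c \<odot> x) = cmod c * p x"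
begin

lemma p_zero [simp]: "p \<zero> = 0"
  using p_sm[of \<zero> 0] by simp

lemma p_swap: "x \<in> carrier V \<Longrightarrow> y \<in> carrier V \<Longrightarrow> p (y \<ominus> x) = p (x \<ominus> y)"
  by (subst diff_diff_sm) (simp_all add: p_sm)

lemma p_triangle: "\<lbrakk>x \<in> carrier V; y \<in> carrier V; z \<in> carrier V\<rbrakk> \<Longrightarrow> p (x \<ominus> z) \<le> p (x \<ominus> y) + p (y \<ominus> z)"
  using p_add[of "x \<ominus> y" "y \<ominus> z"] by (simp add: diff_add_diff)

lemma p_diff_le: "\<lbrakk>x \<in> carrier V; y \<in> carrier V\<rbrakk> \<Longrightarrow> \<bar>p x - p y\<bar> \<le> p (x \<ominus> y)"
  using p_add[of "x \<ominus> y" y] p_add[of "y \<ominus> x" x] by (simp add: diff_add_cancel p_swap)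

definition CS where "CS = cauchy_seqs (carrier V) (\<lambda>x y. p (x \<ominus> y))"

definition cl where "cl u = null_rel (carrier V) (\<lambda>x y. p (x \<ominus> y)) `` {u}"

definition eqv where "eqv u v \<longleftrightarrow> (\<lambda>k. p (u k \<ominus> v k)) \<longlonglongrightarrow> 0"

lemma CS_iff: "u \<in> CS \<longleftrightarrow> (\<forall>k. u k \<in> carrier V) \<and> (\<forall>e>0. \<exists>N. \<forall>j\<ge>N. \<forall>k\<ge>N. p (u j \<ominus> u k) < e)"
  by (simp add: CS_def cauchy_seqs_def)

lemma CS_carrier [simp, intro]: "u \<in> CS \<Longrightarrow> u k \<in> carrier V"
  by (simp add: CS_iff)

lemma CS_Cauchy: "u \<in> CS \<Longrightarrow> e > 0 \<Longrightarrow> \<exists>N. \<forall>j\<ge>N. \<forall>k\<ge>N. p (u j \<ominus> u k) < e"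
  by (simp add: CS_iff)

lemma CS_const [simp, intro]: "x \<in> carrier V \<Longrightarrow> (\<lambda>k. x) \<in> CS"
  by (auto simp: CS_iff)

text \<open>Scalar multiplication, the adjoint and left multiplication act termwise and are
  Lipschitz; each preserves Cauchy sequences by this estimate.\<close>

lemma CS_dominated:
  assumes "u \<in> CS" and "\<And>k. w k \<in> carrier V" and B: "\<And>j k. p (w j \<ominus> w k) \<le> B * p (u j \<ominus> u k)"
  shows "w \<in> CS"
  unfolding CS_iff
proof (intro conjI allI impI)
  fix e :: real assume e: "e > 0"
  \<comment> \<open>\<open>B\<close> may be zero or negative, so a positive bound is fixed before
    dividing by it.\<close>
  define B' where "B' = max B 1"
  have B': "B' > 0" "B \<le> B'" by (auto simp: B'_def)
  obtain N where N: "\<And>j k. j \<ge> N \<Longrightarrow> k \<ge> N \<Longrightarrow> p (u j \<ominus> u k) < e / B'"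
    using CS_Cauchy[OF assms(1), of "e / B'"] e B' by auto
  have "p (w j \<ominus> w k) < e" if "j \<ge> N" "k \<ge> N" for j k
  proof -
    have "p (w j \<ominus> w k) \<le> B' * p (u j \<ominus> u k)"
      using B[of j k] B' p_nonneg[of "u j \<ominus> u k"] assms(1)
      by (meson CS_carrier diff_closed mult_right_mono order_trans)
    also have "\<dots> < e"
      using N[OF that] B' by (simp add: field_simps)
    finally show ?thesis .
  qed
  then show "\<exists>N. \<forall>j\<ge>N. \<forall>k\<ge>N. p (w j \<ominus> w k) < e" by blast
qed (use assms in auto)

lemma CS_add [simp, intro]:
  assumes "u \<in> CS" "v \<in> CS" shows "(\<lambda>k. u k \<oplus> v k) \<in> CS"
  unfolding CS_iff
proof (intro conjI allI impI)
  fix e :: real assume e: "e > 0"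
  obtain N where N: "\<And>j k. j \<ge> N \<Longrightarrow> k \<ge> N \<Longrightarrow> p (u j \<ominus> u k) < e / 2"
    using CS_Cauchy[OF assms(1), of "e / 2"] e by auto
  obtain M where M: "\<And>j k. j \<ge> M \<Longrightarrow> k \<ge> M \<Longrightarrow> p (v j \<ominus> v k) < e / 2"
    using CS_Cauchy[OF assms(2), of "e / 2"] e by auto
  have "p ((u j \<oplus> v j) \<ominus> (u k \<oplus> v k)) < e" if "j \<ge> max M N" "k \<ge> max M N" for j k
    using N[of j k] M[of j k] that p_add[of "u j \<ominus> u k" "v j \<ominus> v k"] assms
    by (simp add: add_diff_add)
  then show "\<exists>N. \<forall>j\<ge>N. \<forall>k\<ge>N. p ((u j \<oplus> v j) \<ominus> (u k \<oplus> v k)) < e" by blast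
qed (use assms in auto)

lemma CS_sm [simp, intro]: "u \<in> CS \<Longrightarrow> (\<lambda>k. c \<odot> u k) \<in> CS"
  by (rule CS_dominated[where u = u and B = "cmod c"]) (auto simp flip: sm_diff simp: p_sm)

lemma CS_diff [simp, intro]: "u \<in> CS \<Longrightarrow> v \<in> CS \<Longrightarrow> (\<lambda>k. u k \<ominus> v k) \<in> CS"
  using CS_add[of u "\<lambda>k. (-1) \<odot> v k"] by (simp add: diff_eq_sm)

lemma CS_convergent: assumes "u \<in> CS" shows "convergent (\<lambda>k. p (u k))"
proof -
  have "Cauchy (\<lambda>k. p (u k))"
  proof (rule metric_CauchyI)
    fix e :: real assume "e > 0"
    then obtain N where N: "\<And>j k. j \<ge> N \<Longrightarrow> k \<ge> N \<Longrightarrow> p (u j \<ominus> u k) < e"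
      using CS_Cauchy[OF assms] by blast
    have "dist (p (u j)) (p (u k)) < e" if "j \<ge> N" "k \<ge> N" for j k
      using N[OF that] p_diff_le[of "u j" "u k"] assms by (simp add: dist_real_def)
    then show "\<exists>N. \<forall>j\<ge>N. \<forall>k\<ge>N. dist (p (u j)) (p (u k)) < e" by blast
  qed
  then show ?thesis by (simp add: Cauchy_convergent_iff)
qed

lemma CS_bounded: assumes "u \<in> CS" obtains B where "B > 0" "\<And>k. p (u k) \<le> B"
proof -
  have "Bseq (\<lambda>k. p (u k))"
    using CS_convergent[OF assms] by (simp add: Bseq_eq_bounded convergent_imp_Bseq)
  then obtain B where "B > 0" "\<And>k. norm (p (u k)) \<le> B"
    by (auto simp: Bseq_def)
  then show ?thesis by (intro that) (auto simp: abs_le_iff)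
qed

lemma eqv_refl [simp]: "u \<in> CS \<Longrightarrow> eqv u u"
  by (simp add: eqv_def)

lemma eqv_sym: "u \<in> CS \<Longrightarrow> v \<in> CS \<Longrightarrow> eqv u v \<Longrightarrow> eqv v u"
  by (simp add: eqv_def p_swap)

lemma tendsto_zero_le: "(g \<longlonglongrightarrow> (0::real)) \<Longrightarrow> (\<And>k. 0 \<le> f k) \<Longrightarrow> (\<And>k. f k \<le> g k) \<Longrightarrow> f \<longlonglongrightarrow> 0"
  by (rule real_tendsto_sandwich[of "\<lambda>_. 0"]) auto

lemma eqv_trans: assumes "u \<in> CS" "v \<in> CS" "w \<in> CS" "eqv u v" "eqv v w" shows "eqv u w"
  unfolding eqv_def
proof (rule tendsto_zero_le)
  show "(\<lambda>k. p (u k \<ominus> v k) + p (v k \<ominus> w k)) \<longlonglongrightarrow> 0"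
    using tendsto_add[OF assms(4,5)[unfolded eqv_def]] by simp
qed (use assms in \<open>auto intro!: p_nonneg p_triangle\<close>)

lemma null_rel_iff:
  "(u, v) \<in> null_rel (carrier V) (\<lambda>x y. p (x \<ominus> y)) \<longleftrightarrow> u \<in> CS \<and> v \<in> CS \<and> eqv u v"
  by (simp add: null_rel_def CS_def eqv_def)

lemma equiv_null_rel: "equiv CS (null_rel (carrier V) (\<lambda>x y. p (x \<ominus> y)))"
proof (rule equivI)
  show "sym (null_rel (carrier V) (\<lambda>x y. p (x \<ominus> y)))"
    unfolding sym_def null_rel_iff by (meson eqv_sym)
  show "trans (null_rel (carrier V) (\<lambda>x y. p (x \<ominus> y)))"
    unfolding trans_def null_rel_iff by (meson eqv_trans)
qed (auto simp: refl_on_def null_rel_iff)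

lemma in_cl: "u \<in> CS \<Longrightarrow> v \<in> cl u \<longleftrightarrow> v \<in> CS \<and> eqv u v"
  by (simp add: cl_def null_rel_iff)

lemma cl_eq_iff: "u \<in> CS \<Longrightarrow> v \<in> CS \<Longrightarrow> cl u = cl v \<longleftrightarrow> eqv u v"
  unfolding cl_def by (subst eq_equiv_class_iff[OF equiv_null_rel]) (auto simp: null_rel_iff)

lemma completion_eq: "hausdorff_completion (carrier V) (\<lambda>x y. p (x \<ominus> y)) = cl ` CS"
  by (auto simp: hausdorff_completion_def quotient_def cl_def CS_def)

text \<open>The operations of a completion are defined as unions over all representatives. Once the
  value is independent of the representative, the union collapses to a single term; every induced
  operation is computed through this fact.\<close>

lemma UN_cl:
  assumes "a \<in> CS" "\<And>u. u \<in> CS \<Longrightarrow> eqv a u \<Longrightarrow> eqv u a \<Longrightarrow> f u = f a"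
  shows "(\<Union>u\<in>cl a. f u) = f a"
proof -
  have "a \<in> cl a" using assms(1) by (simp add: in_cl)
  moreover have "f u = f a" if "u \<in> cl a" for u
    using that assms in_cl[OF assms(1)] eqv_sym[OF assms(1)] by blast
  ultimately show ?thesis by blast
qed

lemma eqv_add: assumes "u \<in> CS" "v \<in> CS" "u' \<in> CS" "v' \<in> CS" "eqv u u'" "eqv v v'"
  shows "eqv (\<lambda>k. u k \<oplus> v k) (\<lambda>k. u' k \<oplus> v' k)"
  unfolding eqv_def
proof (rule tendsto_zero_le)
  show "(\<lambda>k. p (u k \<ominus> u' k) + p (v k \<ominus> v' k)) \<longlonglongrightarrow> 0"
    using tendsto_add[OF assms(5,6)[unfolded eqv_def]] by simp
qed (use assms in \<open>auto simp: add_diff_add intro!: p_nonneg p_add\<close>)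

lemma eqv_dominated:
  assumes "eqv u u'" and "\<And>k. w k \<in> carrier V" "\<And>k. w' k \<in> carrier V"
    and "\<And>k. p (w k \<ominus> w' k) \<le> B * p (u k \<ominus> u' k)"
  shows "eqv w w'"
  unfolding eqv_def
proof (rule tendsto_zero_le)
  show "(\<lambda>k. B * p (u k \<ominus> u' k)) \<longlonglongrightarrow> 0"
    using tendsto_mult_left[OF assms(1)[unfolded eqv_def], of B] by simp
qed (use assms in \<open>auto intro!: p_nonneg\<close>)

lemma eqv_sm: "u \<in> CS \<Longrightarrow> u' \<in> CS \<Longrightarrow> eqv u u' \<Longrightarrow> eqv (\<lambda>k. c \<odot> u k) (\<lambda>k. c \<odot> u' k)"
  by (rule eqv_dominated[where u = u and u' = u' and B = "cmod c"])
     (auto simp flip: sm_diff simp: p_sm)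

lemma eqv_lim: assumes "u \<in> CS" "v \<in> CS" "eqv u v" shows "lim (\<lambda>k. p (v k)) = lim (\<lambda>k. p (u k))"
proof -
  have "(\<lambda>k. \<bar>p (v k) - p (u k)\<bar>) \<longlonglongrightarrow> 0"
  proof (rule tendsto_zero_le[OF assms(3)[unfolded eqv_def]])
    show "\<bar>p (v k) - p (u k)\<bar> \<le> p (u k \<ominus> v k)" for k
      using p_diff_le[of "u k" "v k"] assms by (simp add: abs_minus_commute)
  qed simp
  then have "(\<lambda>k. p (v k) - p (u k)) \<longlonglongrightarrow> 0"
    by (simp add: tendsto_rabs_zero_iff)
  moreover have "(\<lambda>k. p (u k)) \<longlonglongrightarrow> lim (\<lambda>k. p (u k))"
    using CS_convergent[OF assms(1)] by (simp add: convergent_LIMSEQ_iff)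
  ultimately have "(\<lambda>k. (p (v k) - p (u k)) + p (u k)) \<longlonglongrightarrow> 0 + lim (\<lambda>k. p (u k))"
    by (rule tendsto_add)
  then show ?thesis by (simp add: limI)
qed

definition cnorm where "cnorm P = the_elem (\<Union>u\<in>P. {lim (\<lambda>k. p (u k))})"

lemma cnorm_cl: "u \<in> CS \<Longrightarrow> cnorm (cl u) = lim (\<lambda>k. p (u k))"
  unfolding cnorm_def by (subst UN_cl) (auto intro!: eqv_lim)

lemma cnorm_tendsto: "u \<in> CS \<Longrightarrow> (\<lambda>k. p (u k)) \<longlonglongrightarrow> cnorm (cl u)"
  using CS_convergent[of u] by (simp add: cnorm_cl convergent_LIMSEQ_iff)

lemma cnorm_const [simp]: "x \<in> carrier V \<Longrightarrow> cnorm (cl (\<lambda>k. x)) = p x"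
  by (simp add: cnorm_cl)

end

text \<open>Only the carrier, zero, addition and scalar multiplication are fixed, so
  \<open>W\<close> may carry a product and an adjoint or an inner product on top. The relation is
  written out instead of using \<open>cl\<close>, to agree literally with the unfolded definitions
  of \<open>universal_cstar\<close> and \<open>gns_space\<close>.\<close>

locale seminormed_completion = seminormed_space V p
  for V :: "(complex, 'v, 'm) module_scheme" (structure) and p +
  fixes W :: "(complex, (nat \<Rightarrow> 'v) set, 'w) module_scheme"
  assumes carrier_W: "carrier W = hausdorff_completion (carrier V) (\<lambda>x y. p (x \<ominus> y))"
    and zero_W': "\<zero>\<^bsub>W\<^esub> = null_rel (carrier V) (\<lambda>x y. p (x \<ominus> y)) `` {\<lambda>k. \<zero>}"
    and add_W': "ring.add W = (\<lambda>P Q. \<Union>u\<in>P. \<Union>v\<in>Q. null_rel (carrier V) (\<lambda>x y. p (x \<ominus> y)) `` {\<lambda>k. u k \<oplus> v k})"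
    and sm_W': "module.smult W = (\<lambda>c P. \<Union>u\<in>P. null_rel (carrier V) (\<lambda>x y. p (x \<ominus> y)) `` {\<lambda>k. c \<odot> u k})"
begin

lemma zero_W: "\<zero>\<^bsub>W\<^esub> = cl (\<lambda>k. \<zero>)"
  by (simp add: zero_W' cl_def)

lemma carrier_W_cl: "carrier W = cl ` CS"
  by (simp add: carrier_W completion_eq)

lemma cl_closed [simp, intro]: "u \<in> CS \<Longrightarrow> cl u \<in> carrier W"
  by (simp add: carrier_W_cl)

lemma carrier_W_E: assumes "P \<in> carrier W" obtains u where "u \<in> CS" "P = cl u"
  using assms by (auto simp: carrier_W_cl)

lemma add_cl: assumes "u \<in> CS" "v \<in> CS" shows "cl u \<oplus>\<^bsub>W\<^esub> cl v = cl (\<lambda>k. u k \<oplus> v k)"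
proof -
  have "cl u \<oplus>\<^bsub>W\<^esub> cl v = (\<Union>u\<in>cl u. \<Union>v\<in>cl v. cl (\<lambda>k. u k \<oplus> v k))"
    by (simp add: add_W' cl_def)
  also have "\<dots> = (\<Union>u\<in>cl u. cl (\<lambda>k. u k \<oplus> v k))"
  proof (rule SUP_cong[OF refl])
    fix u' assume "u' \<in> cl u"
    then have "u' \<in> CS" using assms by (simp add: in_cl)
    then show "(\<Union>v\<in>cl v. cl (\<lambda>k. u' k \<oplus> v k)) = cl (\<lambda>k. u' k \<oplus> v k)"
      using assms by (subst UN_cl) (auto simp: cl_eq_iff intro!: eqv_add)
  qed
  also have "\<dots> = cl (\<lambda>k. u k \<oplus> v k)"
    using assms by (subst UN_cl) (auto simp: cl_eq_iff intro!: eqv_add)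
  finally show ?thesis .
qed

lemma sm_cl: assumes "u \<in> CS" shows "c \<odot>\<^bsub>W\<^esub> cl u = cl (\<lambda>k. c \<odot> u k)"
proof -
  have "c \<odot>\<^bsub>W\<^esub> cl u = (\<Union>u\<in>cl u. cl (\<lambda>k. c \<odot> u k))"
    by (simp add: sm_W' cl_def)
  also have "\<dots> = cl (\<lambda>k. c \<odot> u k)"
    using assms by (subst UN_cl) (auto simp: cl_eq_iff intro!: eqv_sm)
  finally show ?thesis .
qed

lemma abelian_group_W: "abelian_group W"
proof (rule abelian_groupI)
  show "\<zero>\<^bsub>W\<^esub> \<in> carrier W" by (simp add: zero_W cl_closed)
next
  fix x y assume "x \<in> carrier W" "y \<in> carrier W"
  then show "x \<oplus>\<^bsub>W\<^esub> y \<in> carrier W"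
    by (elim carrier_W_E) (simp add: add_cl)
next
  fix x y z assume "x \<in> carrier W" "y \<in> carrier W" "z \<in> carrier W"
  then show "x \<oplus>\<^bsub>W\<^esub> y \<oplus>\<^bsub>W\<^esub> z = x \<oplus>\<^bsub>W\<^esub> (y \<oplus>\<^bsub>W\<^esub> z)"
    by (elim carrier_W_E) (simp add: add_cl M.a_assoc)
next
  fix x y assume "x \<in> carrier W" "y \<in> carrier W"
  then show "x \<oplus>\<^bsub>W\<^esub> y = y \<oplus>\<^bsub>W\<^esub> x"
    by (elim carrier_W_E) (simp add: add_cl M.a_comm)
next
  fix x assume "x \<in> carrier W"
  then show "\<zero>\<^bsub>W\<^esub> \<oplus>\<^bsub>W\<^esub> x = x"
    by (elim carrier_W_E) (simp add: add_cl zero_W)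
next
  fix x assume "x \<in> carrier W"
  then obtain u where u: "u \<in> CS" "x = cl u" by (rule carrier_W_E)
  have "cl (\<lambda>k. (-1) \<odot> u k) \<oplus>\<^bsub>W\<^esub> x = \<zero>\<^bsub>W\<^esub>"
    using u by (simp add: add_cl zero_W sm_minus_add)
  then show "\<exists>y\<in>carrier W. y \<oplus>\<^bsub>W\<^esub> x = \<zero>\<^bsub>W\<^esub>"
    using u by blast
qed

lemma cspace_W: "cspace W"
proof (rule cspaceI[OF abelian_group_W])
  fix a x assume "x \<in> carrier W"
  then show "a \<odot>\<^bsub>W\<^esub> x \<in> carrier W" by (elim carrier_W_E) (simp add: sm_cl)
next
  fix a b x assume "x \<in> carrier W"
  then show "(a + b) \<odot>\<^bsub>W\<^esub> x = a \<odot>\<^bsub>W\<^esub> x \<oplus>\<^bsub>W\<^esub> b \<odot>\<^bsub>W\<^esub> x"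
    by (elim carrier_W_E) (simp add: sm_cl add_cl sm_add_left)
next
  fix a x y assume "x \<in> carrier W" "y \<in> carrier W"
  then show "a \<odot>\<^bsub>W\<^esub> (x \<oplus>\<^bsub>W\<^esub> y) = a \<odot>\<^bsub>W\<^esub> x \<oplus>\<^bsub>W\<^esub> a \<odot>\<^bsub>W\<^esub> y"
    by (elim carrier_W_E) (simp add: sm_cl add_cl sm_add_right)
next
  fix a b x assume "x \<in> carrier W"
  then show "(a * b) \<odot>\<^bsub>W\<^esub> x = a \<odot>\<^bsub>W\<^esub> (b \<odot>\<^bsub>W\<^esub> x)"
    by (elim carrier_W_E) (simp add: sm_cl sm_sm)
next
  fix x assume "x \<in> carrier W"
  then show "1 \<odot>\<^bsub>W\<^esub> x = x" by (elim carrier_W_E) (simp add: sm_cl)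
qed

sublocale W: cspace W by (rule cspace_W)

lemma diff_cl: "u \<in> CS \<Longrightarrow> v \<in> CS \<Longrightarrow> cl u \<ominus>\<^bsub>W\<^esub> cl v = cl (\<lambda>k. u k \<ominus> v k)"
  by (simp add: W.diff_eq_sm sm_cl add_cl diff_eq_sm)

lemma seminormed_W: "seminormed_space W cnorm"
proof (unfold_locales)
  fix x assume "x \<in> carrier W"
  then obtain u where u: "u \<in> CS" "x = cl u" by (rule carrier_W_E)
  show "0 \<le> cnorm x"
    unfolding u(2) by (rule LIMSEQ_le_const[OF cnorm_tendsto[OF u(1)]]) (use u(1) p_nonneg in auto)
  fix c
  have "(\<lambda>k. cmod c * p (u k)) \<longlonglongrightarrow> cmod c * cnorm (cl u)"
    by (intro tendsto_mult_left cnorm_tendsto u)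
  moreover have "(\<lambda>k. cmod c * p (u k)) \<longlonglongrightarrow> cnorm (cl (\<lambda>k. c \<odot> u k))"
    using cnorm_tendsto[OF CS_sm[OF u(1)], of c] u by (simp add: p_sm)
  ultimately show "cnorm (c \<odot>\<^bsub>W\<^esub> x) = cmod c * cnorm x"
    using u by (simp add: sm_cl LIMSEQ_unique)
next
  fix x y assume "x \<in> carrier W" "y \<in> carrier W"
  then obtain u v where u: "u \<in> CS" "x = cl u" and v: "v \<in> CS" "y = cl v" by (metis carrier_W_E)
  show "cnorm (x \<oplus>\<^bsub>W\<^esub> y) \<le> cnorm x + cnorm y"
    unfolding u v add_cl[OF u(1) v(1)]
  proof (rule LIMSEQ_le[OF cnorm_tendsto tendsto_add[OF cnorm_tendsto cnorm_tendsto]])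
    show "\<exists>N. \<forall>k\<ge>N. p (u k \<oplus> v k) \<le> p (u k) + p (v k)"
      using u v by (auto intro!: p_add)
  qed (use u v in auto)
qed

sublocale WN: seminormed_space W cnorm by (rule seminormed_W)

lemma cnorm_eq_0: assumes "x \<in> carrier W" "cnorm x = 0" shows "x = \<zero>\<^bsub>W\<^esub>"
proof -
  obtain u where u: "u \<in> CS" "x = cl u" using assms(1) by (rule carrier_W_E)
  have "eqv u (\<lambda>k. \<zero>)"
    using cnorm_tendsto[OF u(1)] assms(2) u by (simp add: eqv_def)
  then show ?thesis using u by (simp add: zero_W cl_eq_iff)
qed

lemma cl_approx: assumes "u \<in> CS"
  shows "(\<lambda>k. cnorm (cl (\<lambda>j. u k) \<ominus>\<^bsub>W\<^esub> cl u)) \<longlonglongrightarrow> 0"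
proof (rule LIMSEQ_I)
  fix e :: real assume e: "e > 0"
  obtain N where N: "\<And>j k. j \<ge> N \<Longrightarrow> k \<ge> N \<Longrightarrow> p (u j \<ominus> u k) < e / 2"
    using CS_Cauchy[OF assms, of "e / 2"] e by auto
  have "norm (cnorm (cl (\<lambda>j. u k) \<ominus>\<^bsub>W\<^esub> cl u) - 0) < e" if "k \<ge> N" for k
  proof -
    \<comment> \<open>Strict bounds become weak ones in the limit; the halved tolerance makes up for
      that.\<close>
    have "cnorm (cl (\<lambda>j. u k \<ominus> u j)) \<le> e / 2"
      by (rule LIMSEQ_le_const2[OF cnorm_tendsto]) (use assms N that in \<open>auto intro!: less_imp_le\<close>)
    moreover have "cnorm (cl (\<lambda>j. u k \<ominus> u j)) \<ge> 0"
      using assms by (intro WN.p_nonneg) auto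
    ultimately show ?thesis using e assms by (simp add: diff_cl)
  qed
  then show "\<exists>N. \<forall>k\<ge>N. norm (cnorm (cl (\<lambda>j. u k) \<ominus>\<^bsub>W\<^esub> cl u) - 0) < e" by blast
qed

lemma dense: assumes "x \<in> carrier W" "e > 0"
  obtains a where "a \<in> carrier V" "cnorm (cl (\<lambda>j. a) \<ominus>\<^bsub>W\<^esub> x) < e"
proof -
  obtain u where u: "u \<in> CS" "x = cl u" using assms(1) by (rule carrier_W_E)
  obtain k where "norm (cnorm (cl (\<lambda>j. u k) \<ominus>\<^bsub>W\<^esub> cl u) - 0) < e"
    using LIMSEQ_D[OF cl_approx[OF u(1)] assms(2)] by blast
  then show ?thesis using u by (intro that[of "u k"]) auto
qed

text \<open>The k-th term is replaced by the class of a constant at distance less than 1/(k+1). The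
  constants chosen form a Cauchy sequence in the original space, and its class is the limit.\<close>

lemma complete_W: assumes "h \<in> WN.CS"
  shows "\<exists>x\<in>carrier W. (\<lambda>k. cnorm (h k \<ominus>\<^bsub>W\<^esub> x)) \<longlonglongrightarrow> 0"
proof -
  have "\<exists>a\<in>carrier V. cnorm (cl (\<lambda>j. a) \<ominus>\<^bsub>W\<^esub> h k) < inverse (real (Suc k))" for k
    by (rule dense[of "h k" "inverse (real (Suc k))"]) (use assms in auto)
  then obtain a where a: "\<And>k. a k \<in> carrier V"
      "\<And>k. cnorm (cl (\<lambda>j. a k) \<ominus>\<^bsub>W\<^esub> h k) < inverse (real (Suc k))"
    by metis
  have h [simp]: "h k \<in> carrier W" for k using assms by auto
  have lim0: "(\<lambda>k. inverse (real (Suc k))) \<longlonglongrightarrow> 0" by (rule LIMSEQ_inverse_real_of_nat)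
  have "a \<in> CS"
    unfolding CS_iff
  proof (intro conjI allI impI a(1))
    fix e :: real assume e: "e > 0"
    obtain N where N: "\<And>j k. j \<ge> N \<Longrightarrow> k \<ge> N \<Longrightarrow> cnorm (h j \<ominus>\<^bsub>W\<^esub> h k) < e / 3"
      using WN.CS_Cauchy[OF assms, of "e / 3"] e by auto
    obtain M where M: "\<And>k. k \<ge> M \<Longrightarrow> inverse (real (Suc k)) < e / 3"
      using LIMSEQ_D[OF lim0, of "e / 3"] e by auto
    have "p (a j \<ominus> a k) < e" if jk: "j \<ge> max M N" "k \<ge> max M N" for j k
    proof -
      have "p (a j \<ominus> a k) = cnorm (cl (\<lambda>i. a j) \<ominus>\<^bsub>W\<^esub> cl (\<lambda>i. a k))"
        using a(1) by (simp add: diff_cl)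
      also have "\<dots> \<le> cnorm (cl (\<lambda>i. a j) \<ominus>\<^bsub>W\<^esub> h j) + cnorm (h j \<ominus>\<^bsub>W\<^esub> cl (\<lambda>i. a k))"
        using a(1) by (intro WN.p_triangle) auto
      also have "\<dots> \<le> cnorm (cl (\<lambda>i. a j) \<ominus>\<^bsub>W\<^esub> h j) + (cnorm (h j \<ominus>\<^bsub>W\<^esub> h k) + cnorm (h k \<ominus>\<^bsub>W\<^esub> cl (\<lambda>i. a k)))"
        using a(1) by (intro add_left_mono WN.p_triangle) auto
      also have "cnorm (h k \<ominus>\<^bsub>W\<^esub> cl (\<lambda>i. a k)) = cnorm (cl (\<lambda>i. a k) \<ominus>\<^bsub>W\<^esub> h k)"
        using a(1) by (intro WN.p_swap) auto
      finally show ?thesis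
        using a(2)[of j] a(2)[of k] M[of j] M[of k] N[of j k] jk by simp
    qed
    then show "\<exists>N. \<forall>j\<ge>N. \<forall>k\<ge>N. p (a j \<ominus> a k) < e" by blast
  qed
  then have "(\<lambda>k. inverse (real (Suc k)) + cnorm (cl (\<lambda>j. a k) \<ominus>\<^bsub>W\<^esub> cl a)) \<longlonglongrightarrow> 0"
    using tendsto_add[OF lim0 cl_approx[of a]] by simp
  then have "(\<lambda>k. cnorm (h k \<ominus>\<^bsub>W\<^esub> cl a)) \<longlonglongrightarrow> 0"
  proof (rule tendsto_zero_le)
    fix k
    have "cnorm (h k \<ominus>\<^bsub>W\<^esub> cl a) \<le> cnorm (h k \<ominus>\<^bsub>W\<^esub> cl (\<lambda>i. a k)) + cnorm (cl (\<lambda>j. a k) \<ominus>\<^bsub>W\<^esub> cl a)"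
      using a(1) \<open>a \<in> CS\<close> by (intro WN.p_triangle) auto
    also have "cnorm (h k \<ominus>\<^bsub>W\<^esub> cl (\<lambda>i. a k)) = cnorm (cl (\<lambda>i. a k) \<ominus>\<^bsub>W\<^esub> h k)"
      using a(1) by (intro WN.p_swap) auto
    finally show "cnorm (h k \<ominus>\<^bsub>W\<^esub> cl a) \<le> inverse (real (Suc k)) + cnorm (cl (\<lambda>j. a k) \<ominus>\<^bsub>W\<^esub> cl a)"
      using a(2)[of k] by simp
    show "0 \<le> cnorm (h k \<ominus>\<^bsub>W\<^esub> cl a)"
      using \<open>a \<in> CS\<close> by (intro WN.p_nonneg) auto
  qed
  then show ?thesis using \<open>a \<in> CS\<close> by blast
qed

end

section \<open>Semi-inner products and positive functionals\<close>

locale semi_inner_space = cspace V for V :: "(complex, 'v, 'm) module_scheme" (structure) +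
  fixes B :: "'v \<Rightarrow> 'v \<Rightarrow> complex"
  assumes B_add: "\<lbrakk>x \<in> carrier V; y \<in> carrier V; z \<in> carrier V\<rbrakk> \<Longrightarrow> B x (y \<oplus> z) = B x y + B x z"
    and B_sm: "\<lbrakk>x \<in> carrier V; y \<in> carrier V\<rbrakk> \<Longrightarrow> B x (c \<odot> y) = c * B x y"
    and B_commute: "\<lbrakk>x \<in> carrier V; y \<in> carrier V\<rbrakk> \<Longrightarrow> B y x = cnj (B x y)"
    and B_nonneg: "x \<in> carrier V \<Longrightarrow> B x x \<in> \<real>\<^sub>\<ge>\<^sub>0"
begin

lemma B_add_left: "\<lbrakk>x \<in> carrier V; y \<in> carrier V; z \<in> carrier V\<rbrakk> \<Longrightarrow> B (x \<oplus> y) z = B x z + B y z"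
  using B_commute[of z "x \<oplus> y"] B_commute[of z x] B_commute[of z y] B_add[of z x y] by simp

lemma B_sm_left: "\<lbrakk>x \<in> carrier V; y \<in> carrier V\<rbrakk> \<Longrightarrow> B (c \<odot> x) y = cnj c * B x y"
  using B_commute[of y "c \<odot> x"] B_commute[of y x] B_sm[of y x c] by simp

lemma B_diff: "\<lbrakk>x \<in> carrier V; y \<in> carrier V; z \<in> carrier V\<rbrakk> \<Longrightarrow> B x (y \<ominus> z) = B x y - B x z"
  by (simp add: diff_eq_sm B_add B_sm)

lemma B_diff_left: "\<lbrakk>x \<in> carrier V; y \<in> carrier V; z \<in> carrier V\<rbrakk> \<Longrightarrow> B (x \<ominus> y) z = B x z - B y z"
  by (simp add: diff_eq_sm B_add_left B_sm_left)

lemma B_zero [simp]: "x \<in> carrier V \<Longrightarrow> B x \<zero> = 0"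
  using B_sm[of x \<zero> 0] by simp

lemma B_zero_left [simp]: "x \<in> carrier V \<Longrightarrow> B \<zero> x = 0"
  using B_sm_left[of \<zero> x 0] by simp

definition nrm where "nrm x = sqrt (Re (B x x))"

lemma B_self_Re: "x \<in> carrier V \<Longrightarrow> 0 \<le> Re (B x x)"
  using B_nonneg[of x] by (simp add: complex_nonneg_Reals_iff)

lemma B_self: "x \<in> carrier V \<Longrightarrow> B x x = complex_of_real ((nrm x)\<^sup>2)"
  using B_nonneg[of x] by (auto simp: nrm_def complex_nonneg_Reals_iff complex_eq_iff)

lemma nrm_nonneg: "x \<in> carrier V \<Longrightarrow> 0 \<le> nrm x"
  by (simp add: nrm_def B_self_Re)

lemma nrm_sq: "x \<in> carrier V \<Longrightarrow> (nrm x)\<^sup>2 = Re (B x x)"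
  by (simp add: nrm_def B_self_Re)

lemma nrm_sm: "x \<in> carrier V \<Longrightarrow> nrm (c \<odot> x) = cmod c * nrm x"
proof -
  assume x: "x \<in> carrier V"
  have "B (c \<odot> x) (c \<odot> x) = (c * cnj c) * B x x"
    using x by (simp add: B_sm B_sm_left)
  also have "c * cnj c = complex_of_real ((cmod c)\<^sup>2)"
    by (rule complex_norm_square[symmetric])
  finally have "B (c \<odot> x) (c \<odot> x) = complex_of_real ((cmod c)\<^sup>2) * B x x" .
  then have "Re (B (c \<odot> x) (c \<odot> x)) = (cmod c)\<^sup>2 * Re (B x x)"
    by (simp only: times_complex.simps Re_complex_of_real Im_complex_of_real mult_zero_left diff_zero)
  then show ?thesis
    by (simp add: nrm_def real_sqrt_mult)
qed

lemma nrm_diff_sq: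
  assumes "x \<in> carrier V" "y \<in> carrier V"
  shows "(nrm (x \<ominus> y))\<^sup>2 = (nrm x)\<^sup>2 - 2 * Re (B x y) + (nrm y)\<^sup>2"
  using assms B_commute[of x y] by (simp add: nrm_sq B_diff B_diff_left)

lemma nrm_add_sq:
  assumes "x \<in> carrier V" "y \<in> carrier V"
  shows "(nrm (x \<oplus> y))\<^sup>2 = (nrm x)\<^sup>2 + 2 * Re (B x y) + (nrm y)\<^sup>2"
  using assms B_commute[of x y] by (simp add: nrm_sq B_add B_add_left)

text \<open>With b the value of the form, nonnegativity of the square of x - t conj(b) y for all
  real t gives \<open>main\<close>. The form may be degenerate, so a null vector y needs its own
  choice of t.\<close>

lemma Cauchy_Schwarz:
  assumes x: "x \<in> carrier V" and y: "y \<in> carrier V"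
  shows "cmod (B x y) \<le> nrm x * nrm y"
proof -
  define b where "b = B x y"
  have main: "2 * t * (cmod b)\<^sup>2 \<le> (nrm x)\<^sup>2 + t\<^sup>2 * (cmod b)\<^sup>2 * (nrm y)\<^sup>2" for t :: real
  proof -
    let ?c = "complex_of_real t * cnj b"
    have "0 \<le> (nrm (x \<ominus> ?c \<odot> y))\<^sup>2" by simp
    also have "\<dots> = (nrm x)\<^sup>2 - 2 * Re (?c * b) + (cmod ?c * nrm y)\<^sup>2"
      using x y by (simp add: nrm_diff_sq B_sm nrm_sm b_def)
    also have "?c * b = complex_of_real (t * (cmod b)\<^sup>2)"
      using complex_norm_square[of b] by (simp add: mult.commute mult.left_commute)
    also have "(cmod ?c * nrm y)\<^sup>2 = t\<^sup>2 * (cmod b)\<^sup>2 * (nrm y)\<^sup>2"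
      by (simp add: norm_mult power_mult_distrib)
    finally show ?thesis by simp
  qed
  have "(cmod b)\<^sup>2 \<le> (nrm x * nrm y)\<^sup>2"
  proof (cases "b = 0")
    case False
    then have b: "(cmod b)\<^sup>2 > 0" by simp
    show ?thesis
    proof (cases "nrm y = 0")
      case True
      \<comment> \<open>For a null vector y the right side of \<open>main\<close> is constant in t;
        this t makes the left side \<open>(nrm x)\<^sup>2 + 1\<close>, a contradiction.\<close>
      have "2 * (((nrm x)\<^sup>2 + 1) / (2 * (cmod b)\<^sup>2)) * (cmod b)\<^sup>2 \<le> (nrm x)\<^sup>2"
        using main[of "((nrm x)\<^sup>2 + 1) / (2 * (cmod b)\<^sup>2)"] True by simp
      then show ?thesis using b by (simp add: field_simps)
    next
      case False
      then have y0: "(nrm y)\<^sup>2 > 0" by simp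
      have "2 * (1 / (nrm y)\<^sup>2) * (cmod b)\<^sup>2 \<le> (nrm x)\<^sup>2 + (1 / (nrm y)\<^sup>2)\<^sup>2 * (cmod b)\<^sup>2 * (nrm y)\<^sup>2"
        by (rule main)
      also have "(1 / (nrm y)\<^sup>2)\<^sup>2 * (cmod b)\<^sup>2 * (nrm y)\<^sup>2 = (1 / (nrm y)\<^sup>2) * (cmod b)\<^sup>2"
        using y0 by (simp add: field_simps power2_eq_square)
      finally have "(1 / (nrm y)\<^sup>2) * (cmod b)\<^sup>2 \<le> (nrm x)\<^sup>2" by simp
      then show ?thesis
        using y0 by (simp add: field_simps power_mult_distrib)
    qed
  qed simp
  then show ?thesis
    unfolding b_def by (rule power2_le_imp_le) (simp add: nrm_nonneg x y)
qed

lemma nrm_add: assumes "x \<in> carrier V" "y \<in> carrier V" shows "nrm (x \<oplus> y) \<le> nrm x + nrm y"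
proof (rule power2_le_imp_le)
  have "Re (B x y) \<le> nrm x * nrm y"
    using Cauchy_Schwarz[OF assms] complex_Re_le_cmod order_trans by blast
  then show "(nrm (x \<oplus> y))\<^sup>2 \<le> (nrm x + nrm y)\<^sup>2"
    using assms by (simp add: nrm_add_sq power2_sum)
qed (use assms nrm_nonneg in simp)

sublocale seminormed_space V nrm
  by unfold_locales (auto simp: nrm_nonneg nrm_add nrm_sm)

lemma B_null: "\<lbrakk>x \<in> carrier V; y \<in> carrier V; nrm y = 0\<rbrakk> \<Longrightarrow> B x y = 0"
  using Cauchy_Schwarz[of x y] by simp

text \<open>The first part lets the inner product of two completed vectors exist as a limit, the
  second makes it independent of the representatives. Both come from \<open>est\<close>, the product
  rule for differences combined with Cauchy-Schwarz.\<close>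

lemma B_tendsto:
  assumes "u \<in> CS" "v \<in> CS" "eqv u u'" "eqv v v'" "u' \<in> CS" "v' \<in> CS"
  shows "convergent (\<lambda>k. B (u k) (v k))"
    and "(\<lambda>k. B (u k) (v k) - B (u' k) (v' k)) \<longlonglongrightarrow> 0"
proof -
  have est: "cmod (B x y - B x' y') \<le> nrm x * nrm (y \<ominus> y') + nrm (x \<ominus> x') * nrm y'"
    if "x \<in> carrier V" "y \<in> carrier V" "x' \<in> carrier V" "y' \<in> carrier V" for x y x' y'
  proof -
    have "B x y - B x' y' = B x (y \<ominus> y') + B (x \<ominus> x') y'"
      using that by (simp add: B_diff B_diff_left)
    also have "cmod \<dots> \<le> cmod (B x (y \<ominus> y')) + cmod (B (x \<ominus> x') y')" by (rule norm_triangle_ineq)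
    also have "\<dots> \<le> nrm x * nrm (y \<ominus> y') + nrm (x \<ominus> x') * nrm y'"
      using that by (intro add_mono Cauchy_Schwarz) auto
    finally show ?thesis .
  qed
  obtain C where C: "C > 0" "\<And>k. nrm (u k) \<le> C" using CS_bounded[OF assms(1)] by blast
  obtain D where D: "D > 0" "\<And>k. nrm (v k) \<le> D" using CS_bounded[OF assms(2)] by blast
  obtain D' where D': "D' > 0" "\<And>k. nrm (v' k) \<le> D'" using CS_bounded[OF assms(6)] by blast
  have "Cauchy (\<lambda>k. B (u k) (v k))"
  proof (rule metric_CauchyI)
    fix e :: real assume e: "e > 0"
    obtain N where N: "\<And>j k. j \<ge> N \<Longrightarrow> k \<ge> N \<Longrightarrow> nrm (u j \<ominus> u k) < e / (2 * D)"
      using CS_Cauchy[OF assms(1), of "e / (2 * D)"] e D by auto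
    obtain M where M: "\<And>j k. j \<ge> M \<Longrightarrow> k \<ge> M \<Longrightarrow> nrm (v j \<ominus> v k) < e / (2 * C)"
      using CS_Cauchy[OF assms(2), of "e / (2 * C)"] e C by auto
    have "dist (B (u j) (v j)) (B (u k) (v k)) < e" if jk: "j \<ge> max M N" "k \<ge> max M N" for j k
    proof -
      have "dist (B (u j) (v j)) (B (u k) (v k)) \<le> nrm (u j) * nrm (v j \<ominus> v k) + nrm (u j \<ominus> u k) * nrm (v k)"
        unfolding dist_norm by (rule est) (use assms in auto)
      also have "\<dots> \<le> C * nrm (v j \<ominus> v k) + nrm (u j \<ominus> u k) * D"
        using C D assms by (intro add_mono mult_right_mono mult_left_mono p_nonneg) auto
      also have "\<dots> < C * (e / (2 * C)) + e / (2 * D) * D"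
        using C D N[of j k] M[of j k] jk by (intro add_strict_mono mult_strict_left_mono mult_strict_right_mono) auto
      also have "\<dots> = e" using C D by simp
      finally show ?thesis .
    qed
    then show "\<exists>N. \<forall>j\<ge>N. \<forall>k\<ge>N. dist (B (u j) (v j)) (B (u k) (v k)) < e" by blast
  qed
  then show "convergent (\<lambda>k. B (u k) (v k))" by (simp add: Cauchy_convergent_iff)
  have "(\<lambda>k. cmod (B (u k) (v k) - B (u' k) (v' k))) \<longlonglongrightarrow> 0"
  proof (rule tendsto_zero_le)
    have "(\<lambda>k. C * nrm (v k \<ominus> v' k) + nrm (u k \<ominus> u' k) * D') \<longlonglongrightarrow> C * 0 + 0 * D'"
      by (intro tendsto_add tendsto_mult tendsto_const assms(3,4)[unfolded eqv_def])
    then show "(\<lambda>k. C * nrm (v k \<ominus> v' k) + nrm (u k \<ominus> u' k) * D') \<longlonglongrightarrow> 0" by simp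
    fix k
    have "cmod (B (u k) (v k) - B (u' k) (v' k)) \<le> nrm (u k) * nrm (v k \<ominus> v' k) + nrm (u k \<ominus> u' k) * nrm (v' k)"
      by (rule est) (use assms in auto)
    also have "\<dots> \<le> C * nrm (v k \<ominus> v' k) + nrm (u k \<ominus> u' k) * D'"
      using C D' assms by (intro add_mono mult_right_mono mult_left_mono p_nonneg) auto
    finally show "cmod (B (u k) (v k) - B (u' k) (v' k)) \<le> C * nrm (v k \<ominus> v' k) + nrm (u k \<ominus> u' k) * D'" .
  qed simp
  then show "(\<lambda>k. B (u k) (v k) - B (u' k) (v' k)) \<longlonglongrightarrow> 0"
    by (simp add: tendsto_norm_zero_iff)
qed

end

section \<open>Unital *-algebras and the semi-inner product of a positive functional\<close>

locale star_alg = cspace A for A :: "('a, 'm) star_algebra_scheme" (structure) +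
  assumes mult_closed [simp, intro]: "\<lbrakk>x \<in> carrier A; y \<in> carrier A\<rbrakk> \<Longrightarrow> x \<otimes> y \<in> carrier A"
    and one_closed [simp, intro]: "\<one> \<in> carrier A"
    and mult_assoc: "\<lbrakk>x \<in> carrier A; y \<in> carrier A; z \<in> carrier A\<rbrakk> \<Longrightarrow> (x \<otimes> y) \<otimes> z = x \<otimes> (y \<otimes> z)"
    and one_left [simp]: "x \<in> carrier A \<Longrightarrow> \<one> \<otimes> x = x"
    and one_right [simp]: "x \<in> carrier A \<Longrightarrow> x \<otimes> \<one> = x"
    and mult_add_left: "\<lbrakk>x \<in> carrier A; y \<in> carrier A; z \<in> carrier A\<rbrakk> \<Longrightarrow> (x \<oplus> y) \<otimes> z = x \<otimes> z \<oplus> y \<otimes> z"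
    and mult_add_right: "\<lbrakk>x \<in> carrier A; y \<in> carrier A; z \<in> carrier A\<rbrakk> \<Longrightarrow> x \<otimes> (y \<oplus> z) = x \<otimes> y \<oplus> x \<otimes> z"
    and sm_mult: "\<lbrakk>x \<in> carrier A; y \<in> carrier A\<rbrakk> \<Longrightarrow> (c \<odot> x) \<otimes> y = c \<odot> (x \<otimes> y)"
    and mult_sm: "\<lbrakk>x \<in> carrier A; y \<in> carrier A\<rbrakk> \<Longrightarrow> x \<otimes> (c \<odot> y) = c \<odot> (x \<otimes> y)"
    and star_closed [simp, intro]: "x \<in> carrier A \<Longrightarrow> star A x \<in> carrier A"
    and star_add: "\<lbrakk>x \<in> carrier A; y \<in> carrier A\<rbrakk> \<Longrightarrow> star A (x \<oplus> y) = star A x \<oplus> star A y"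
    and star_sm: "x \<in> carrier A \<Longrightarrow> star A (c \<odot> x) = cnj c \<odot> star A x"
    and star_mult: "\<lbrakk>x \<in> carrier A; y \<in> carrier A\<rbrakk> \<Longrightarrow> star A (x \<otimes> y) = star A y \<otimes> star A x"
    and star_star [simp]: "x \<in> carrier A \<Longrightarrow> star A (star A x) = x"
begin

lemma star_one [simp]: "star A \<one> = \<one>"
proof -
  have "star A \<one> = star A (star A \<one>) \<otimes> star A \<one>" by simp
  also have "\<dots> = star A (\<one> \<otimes> star A \<one>)" by (simp only: star_mult one_closed star_closed)
  also have "\<dots> = \<one>" by simp
  finally show ?thesis .
qed

lemma star_diff: "\<lbrakk>x \<in> carrier A; y \<in> carrier A\<rbrakk> \<Longrightarrow> star A (x \<ominus> y) = star A x \<ominus> star A y"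
  by (simp add: diff_eq_sm star_add star_sm)

lemma mult_diff: "\<lbrakk>x \<in> carrier A; y \<in> carrier A; z \<in> carrier A\<rbrakk> \<Longrightarrow> x \<otimes> (y \<ominus> z) = x \<otimes> y \<ominus> x \<otimes> z"
  by (simp add: diff_eq_sm mult_add_right mult_sm)

lemma diff_mult: "\<lbrakk>x \<in> carrier A; y \<in> carrier A; z \<in> carrier A\<rbrakk> \<Longrightarrow> (x \<ominus> y) \<otimes> z = x \<otimes> z \<ominus> y \<otimes> z"
  by (simp add: diff_eq_sm mult_add_left sm_mult)

lemma mult_zero [simp]: "x \<in> carrier A \<Longrightarrow> x \<otimes> \<zero> = \<zero>"
  using mult_sm[of x \<zero> 0] by simp

lemma zero_mult [simp]: "x \<in> carrier A \<Longrightarrow> \<zero> \<otimes> x = \<zero>"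
  using sm_mult[of \<zero> x 0] by simp

lemma star_zero [simp]: "star A \<zero> = \<zero>"
  using star_sm[of \<zero> 0] by simp

lemma mult_diff_mult: "\<lbrakk>x \<in> carrier A; y \<in> carrier A; x' \<in> carrier A; y' \<in> carrier A\<rbrakk> \<Longrightarrow>
    x \<otimes> y \<ominus> x' \<otimes> y' = x \<otimes> (y \<ominus> y') \<oplus> (x \<ominus> x') \<otimes> y'"
  by (simp add: mult_diff diff_mult diff_add_diff)

end

locale pos_functional = star_alg A for A :: "('a, 'm) star_algebra_scheme" (structure) +
  fixes \<omega> :: "'a \<Rightarrow> complex"
  assumes w_add: "\<lbrakk>x \<in> carrier A; y \<in> carrier A\<rbrakk> \<Longrightarrow> \<omega> (x \<oplus> y) = \<omega> x + \<omega> y"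
    and w_sm: "x \<in> carrier A \<Longrightarrow> \<omega> (c \<odot> x) = c * \<omega> x"
    and w_nonneg: "x \<in> carrier A \<Longrightarrow> \<omega> (star A x \<otimes> x) \<in> \<real>\<^sub>\<ge>\<^sub>0"
begin

definition form where "form x y = \<omega> (star A x \<otimes> y)"

lemma form_add_right: "\<lbrakk>x \<in> carrier A; y \<in> carrier A; z \<in> carrier A\<rbrakk> \<Longrightarrow> form x (y \<oplus> z) = form x y + form x z"
  by (simp add: form_def mult_add_right w_add)

lemma form_add_left: "\<lbrakk>x \<in> carrier A; y \<in> carrier A; z \<in> carrier A\<rbrakk> \<Longrightarrow> form (x \<oplus> y) z = form x z + form y z"
  by (simp add: form_def mult_add_left star_add w_add)

lemma form_sm_right: "\<lbrakk>x \<in> carrier A; y \<in> carrier A\<rbrakk> \<Longrightarrow> form x (c \<odot> y) = c * form x y"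
  by (simp add: form_def mult_sm w_sm)

lemma form_sm_left: "\<lbrakk>x \<in> carrier A; y \<in> carrier A\<rbrakk> \<Longrightarrow> form (c \<odot> x) y = cnj c * form x y"
  by (simp add: form_def sm_mult star_sm w_sm)

lemma form_Im: "x \<in> carrier A \<Longrightarrow> Im (form x x) = 0"
  using w_nonneg[of x] by (simp add: form_def complex_nonneg_Reals_iff)

text \<open>Polarization: the form is real on the diagonal, and evaluating it at x + y and at x + i
  y yields the imaginary and the real part of Hermitian symmetry. Positivity thus suffices.\<close>

lemma form_commute: assumes "x \<in> carrier A" "y \<in> carrier A" shows "form y x = cnj (form x y)"
proof -
  have "Im (form (x \<oplus> y) (x \<oplus> y)) = 0" "Im (form (x \<oplus> \<i> \<odot> y) (x \<oplus> \<i> \<odot> y)) = 0"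
    using assms by (auto intro!: form_Im)
  then show ?thesis
    using assms form_Im[of x] form_Im[of y]
    by (simp add: form_add_left form_add_right form_sm_right form_sm_left complex_eq_iff)
qed

sublocale S: semi_inner_space A form
proof unfold_locales
  fix x y assume "x \<in> carrier A" "y \<in> carrier A"
  then show "form y x = cnj (form x y)" by (rule form_commute)
  show "form x x \<in> \<real>\<^sub>\<ge>\<^sub>0" if "x \<in> carrier A" for x
    using that by (simp add: form_def w_nonneg)
qed (simp_all add: form_add_right form_sm_right)

lemma w_star: "x \<in> carrier A \<Longrightarrow> \<omega> (star A x) = cnj (\<omega> x)"
  using form_commute[of x \<one>] by (simp add: form_def)

lemma w_diff: "\<lbrakk>x \<in> carrier A; y \<in> carrier A\<rbrakk> \<Longrightarrow> \<omega> (x \<ominus> y) = \<omega> x - \<omega> y"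
  by (simp add: diff_eq_sm w_add w_sm)

lemma w_le: "x \<in> carrier A \<Longrightarrow> cmod (\<omega> x) \<le> S.nrm \<one> * S.nrm x"
  using S.Cauchy_Schwarz[of \<one> x] by (simp add: form_def)

end

lemma statesD:
  assumes "star_alg A" "\<omega> \<in> states A" shows "pos_functional A \<omega>" "\<omega> \<one>\<^bsub>A\<^esub> = 1" "\<omega> \<in> extensional (carrier A)"
  using assms unfolding states_def pos_functional_def pos_functional_axioms_def by auto

lemma statesI:
  assumes "pos_functional A \<omega>" "\<omega> \<one>\<^bsub>A\<^esub> = 1" "\<omega> \<in> extensional (carrier A)" shows "\<omega> \<in> states A"
  using assms unfolding states_def pos_functional_def pos_functional_axioms_def by auto


section \<open>C*-algebras\<close>

locale cstar_seminormed = star_alg A for A :: "('a, 'm) star_algebra_scheme" (structure) +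
  fixes p :: "'a \<Rightarrow> real"
  assumes p_cstar: "cstar_seminorm A p"
begin

sublocale seminormed_space A p
  using p_cstar by unfold_locales (auto simp: cstar_seminorm_def)

lemma p_mult: "\<lbrakk>x \<in> carrier A; y \<in> carrier A\<rbrakk> \<Longrightarrow> p (x \<otimes> y) \<le> p x * p y"
  using p_cstar by (auto simp: cstar_seminorm_def)

lemma p_star_mult: "x \<in> carrier A \<Longrightarrow> p (star A x \<otimes> x) = (p x)\<^sup>2"
  using p_cstar by (auto simp: cstar_seminorm_def)

text \<open>The C*-identity gives \<open>(p y)\<^sup>2 \<le> p (star A y) * p y\<close>; dividing by
  \<open>p y\<close> and applying the result to x and to its adjoint yields both
  inequalities.\<close>

lemma p_star: assumes "x \<in> carrier A" shows "p (star A x) = p x"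
proof -
  have le: "p y \<le> p (star A y)" if "y \<in> carrier A" for y
  proof (cases "p y = 0")
    case False
    then have "p y > 0" using p_nonneg[OF that] by simp
    moreover have "p y * p y \<le> p (star A y) * p y"
      using p_mult[of "star A y" y] p_star_mult[OF that] that by (simp add: power2_eq_square)
    ultimately show ?thesis by simp
  qed (use that p_nonneg in auto)
  show ?thesis using le[of x] le[of "star A x"] assms by simp
qed

lemma CS_star: "u \<in> CS \<Longrightarrow> (\<lambda>k. star A (u k)) \<in> CS"
  by (rule CS_dominated[where u = u and B = 1]) (auto simp: star_diff[symmetric] p_star)

lemma eqv_star: "u \<in> CS \<Longrightarrow> v \<in> CS \<Longrightarrow> eqv u v \<Longrightarrow> eqv (\<lambda>k. star A (u k)) (\<lambda>k. star A (v k))"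
  by (rule eqv_dominated[where u = u and u' = v and B = 1]) (auto simp: star_diff[symmetric] p_star)

lemma p_mult_diff:
  assumes "x \<in> carrier A" "y \<in> carrier A" "x' \<in> carrier A" "y' \<in> carrier A"
  shows "p (x \<otimes> y \<ominus> x' \<otimes> y') \<le> p x * p (y \<ominus> y') + p (x \<ominus> x') * p y'"
proof -
  have "p (x \<otimes> y \<ominus> x' \<otimes> y') \<le> p (x \<otimes> (y \<ominus> y')) + p ((x \<ominus> x') \<otimes> y')"
    using assms by (subst mult_diff_mult) (auto intro!: p_add)
  also have "\<dots> \<le> p x * p (y \<ominus> y') + p (x \<ominus> x') * p y'"
    using assms by (intro add_mono p_mult) auto
  finally show ?thesis .
qed

lemma CS_mult: assumes "u \<in> CS" "v \<in> CS" shows "(\<lambda>k. u k \<otimes> v k) \<in> CS"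
  unfolding CS_iff
proof (intro conjI allI impI)
  fix e :: real assume e: "e > 0"
  obtain C where C: "C > 0" "\<And>k. p (u k) \<le> C" using CS_bounded[OF assms(1)] by blast
  obtain D where D: "D > 0" "\<And>k. p (v k) \<le> D" using CS_bounded[OF assms(2)] by blast
  obtain N where N: "\<And>j k. j \<ge> N \<Longrightarrow> k \<ge> N \<Longrightarrow> p (u j \<ominus> u k) < e / (2 * D)"
    using CS_Cauchy[OF assms(1), of "e / (2 * D)"] e D by auto
  obtain M where M: "\<And>j k. j \<ge> M \<Longrightarrow> k \<ge> M \<Longrightarrow> p (v j \<ominus> v k) < e / (2 * C)"
    using CS_Cauchy[OF assms(2), of "e / (2 * C)"] e C by auto
  have "p (u j \<otimes> v j \<ominus> u k \<otimes> v k) < e" if jk: "j \<ge> max M N" "k \<ge> max M N" for j k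
  proof -
    have "p (u j \<otimes> v j \<ominus> u k \<otimes> v k) \<le> p (u j) * p (v j \<ominus> v k) + p (u j \<ominus> u k) * p (v k)"
      by (rule p_mult_diff) (use assms in auto)
    also have "\<dots> \<le> C * p (v j \<ominus> v k) + p (u j \<ominus> u k) * D"
      using C D assms by (intro add_mono mult_right_mono mult_left_mono p_nonneg) auto
    also have "\<dots> < C * (e / (2 * C)) + e / (2 * D) * D"
      using C D N[of j k] M[of j k] jk by (intro add_strict_mono mult_strict_left_mono mult_strict_right_mono) auto
    also have "\<dots> = e" using C D by simp
    finally show ?thesis .
  qed
  then show "\<exists>N. \<forall>j\<ge>N. \<forall>k\<ge>N. p (u j \<otimes> v j \<ominus> u k \<otimes> v k) < e" by blast
qed (use assms in auto)

lemma eqv_mult: assumes "u \<in> CS" "v \<in> CS" "u' \<in> CS" "v' \<in> CS" "eqv u u'" "eqv v v'"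
  shows "eqv (\<lambda>k. u k \<otimes> v k) (\<lambda>k. u' k \<otimes> v' k)"
proof -
  obtain C where C: "C > 0" "\<And>k. p (u k) \<le> C" using CS_bounded[OF assms(1)] by blast
  obtain D where D: "D > 0" "\<And>k. p (v' k) \<le> D" using CS_bounded[OF assms(4)] by blast
  show ?thesis
  unfolding eqv_def
proof (rule tendsto_zero_le)
  have "(\<lambda>k. C * p (v k \<ominus> v' k) + p (u k \<ominus> u' k) * D) \<longlonglongrightarrow> C * 0 + 0 * D"
    by (intro tendsto_add tendsto_mult tendsto_const assms(5,6)[unfolded eqv_def])
  then show "(\<lambda>k. C * p (v k \<ominus> v' k) + p (u k \<ominus> u' k) * D) \<longlonglongrightarrow> 0" by simp
  fix k
  have "p (u k \<otimes> v k \<ominus> u' k \<otimes> v' k) \<le> p (u k) * p (v k \<ominus> v' k) + p (u k \<ominus> u' k) * p (v' k)"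
    by (rule p_mult_diff) (use assms in auto)
  also have "\<dots> \<le> C * p (v k \<ominus> v' k) + p (u k \<ominus> u' k) * D"
    using C D assms by (intro add_mono mult_right_mono mult_left_mono p_nonneg) auto
  finally show "p (u k \<otimes> v k \<ominus> u' k \<otimes> v' k) \<le> C * p (v k \<ominus> v' k) + p (u k \<ominus> u' k) * D" .
qed (use assms in \<open>auto intro!: p_nonneg\<close>)
qed

end

locale cstar_completion = cstar_seminormed A p + seminormed_completion A p W
  for A :: "('a, 'm) star_algebra_scheme" (structure) and p
    and W :: "((nat \<Rightarrow> 'a) set, 'w) star_algebra_scheme" +
  assumes mult_W': "monoid.mult W = (\<lambda>P Q. \<Union>u\<in>P. \<Union>v\<in>Q. null_rel (carrier A) (\<lambda>x y. p (x \<ominus> y)) `` {\<lambda>k. u k \<otimes> v k})"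
    and one_W': "\<one>\<^bsub>W\<^esub> = null_rel (carrier A) (\<lambda>x y. p (x \<ominus> y)) `` {\<lambda>k. \<one>}"
    and star_W': "star W = (\<lambda>P. \<Union>u\<in>P. null_rel (carrier A) (\<lambda>x y. p (x \<ominus> y)) `` {\<lambda>k. star A (u k)})"
begin

lemma one_W: "\<one>\<^bsub>W\<^esub> = cl (\<lambda>k. \<one>)"
  by (simp add: one_W' cl_def)

lemma mult_cl: assumes "u \<in> CS" "v \<in> CS" shows "cl u \<otimes>\<^bsub>W\<^esub> cl v = cl (\<lambda>k. u k \<otimes> v k)"
proof -
  have "cl u \<otimes>\<^bsub>W\<^esub> cl v = (\<Union>u\<in>cl u. \<Union>v\<in>cl v. cl (\<lambda>k. u k \<otimes> v k))"
    by (simp add: mult_W' cl_def)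
  also have "\<dots> = (\<Union>u\<in>cl u. cl (\<lambda>k. u k \<otimes> v k))"
  proof (rule SUP_cong[OF refl])
    fix u' assume "u' \<in> cl u"
    then have "u' \<in> CS" using assms by (simp add: in_cl)
    then show "(\<Union>v\<in>cl v. cl (\<lambda>k. u' k \<otimes> v k)) = cl (\<lambda>k. u' k \<otimes> v k)"
      using assms by (subst UN_cl) (auto simp: cl_eq_iff CS_mult intro!: eqv_mult)
  qed
  also have "\<dots> = cl (\<lambda>k. u k \<otimes> v k)"
    using assms by (subst UN_cl) (auto simp: cl_eq_iff CS_mult intro!: eqv_mult)
  finally show ?thesis .
qed

lemma star_cl: assumes "u \<in> CS" shows "star W (cl u) = cl (\<lambda>k. star A (u k))"
proof -
  have "star W (cl u) = (\<Union>u\<in>cl u. cl (\<lambda>k. star A (u k)))"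
    by (simp add: star_W' cl_def)
  also have "\<dots> = cl (\<lambda>k. star A (u k))"
    using assms by (subst UN_cl) (auto simp: cl_eq_iff CS_star intro!: eqv_star)
  finally show ?thesis .
qed

lemma star_alg_W: "star_alg W"
  apply (unfold_locales; (elim carrier_W_E)?)
  apply (simp_all add: mult_cl add_cl sm_cl star_cl one_W CS_mult CS_star mult_assoc mult_add_left
      mult_add_right sm_mult mult_sm star_add star_sm star_mult)
  done

lemma cstar_seminorm_W: "cstar_seminorm W cnorm"
  unfolding cstar_seminorm_def
proof (intro conjI ballI allI)
  fix a b assume "a \<in> carrier W" "b \<in> carrier W"
  then obtain u v where u: "u \<in> CS" "a = cl u" and v: "v \<in> CS" "b = cl v" by (metis carrier_W_E)
  show "cnorm (a \<otimes>\<^bsub>W\<^esub> b) \<le> cnorm a * cnorm b"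
    unfolding u v mult_cl[OF u(1) v(1)]
  proof (rule LIMSEQ_le[OF cnorm_tendsto tendsto_mult[OF cnorm_tendsto cnorm_tendsto]])
    show "\<exists>N. \<forall>k\<ge>N. p (u k \<otimes> v k) \<le> p (u k) * p (v k)"
      using u v by (auto intro!: p_mult)
  qed (use u v in \<open>auto simp: CS_mult\<close>)
next
  fix a assume "a \<in> carrier W"
  then obtain u where u: "u \<in> CS" "a = cl u" by (rule carrier_W_E)
  have "(\<lambda>k. p (star A (u k) \<otimes> u k)) \<longlonglongrightarrow> cnorm (star W a \<otimes>\<^bsub>W\<^esub> a)"
    using u CS_star[OF u(1)] by (simp add: star_cl mult_cl CS_mult cnorm_tendsto)
  moreover have "(\<lambda>k. p (star A (u k) \<otimes> u k)) \<longlonglongrightarrow> (cnorm a)\<^sup>2"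
    using tendsto_power[OF cnorm_tendsto[OF u(1)], of 2] u by (simp add: p_star_mult)
  ultimately show "cnorm (star W a \<otimes>\<^bsub>W\<^esub> a) = (cnorm a)\<^sup>2" by (rule LIMSEQ_unique)
qed (auto simp: WN.p_nonneg WN.p_add WN.p_sm)

end

locale cstar_alg = cstar_seminormed A p for A :: "('a, 'm) star_algebra_scheme" (structure) and p +
  assumes p_eq_0: "x \<in> carrier A \<Longrightarrow> p x = 0 \<Longrightarrow> x = \<zero>"
    and complete: "u \<in> CS \<Longrightarrow> \<exists>x\<in>carrier A. (\<lambda>k. p (u k \<ominus> x)) \<longlonglongrightarrow> 0"
begin

lemma CS_geometric:
  assumes u: "\<And>k. u k \<in> carrier A" and le: "\<And>k. p (u (Suc k) \<ominus> u k) \<le> (1/2)^k"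
  shows "u \<in> CS"
  unfolding CS_iff
proof (intro conjI allI impI u)
  \<comment> \<open>The factor \<open>2 - 2 * (1/2)^i\<close> is the sum of the first i terms of the
    geometric series with ratio 1/2.\<close>
  have step: "p (u (k + i) \<ominus> u k) \<le> (1/2)^k * (2 - 2 * (1/2)^i)" for k i
  proof (induction i)
    case (Suc i)
    have "p (u (k + Suc i) \<ominus> u k) \<le> p (u (Suc (k + i)) \<ominus> u (k + i)) + p (u (k + i) \<ominus> u k)"
      using p_triangle[OF u u u, of "Suc (k + i)" k "k + i"] by simp
    also have "\<dots> \<le> (1/2)^(k + i) + (1/2)^k * (2 - 2 * (1/2)^i)"
      by (intro add_mono le Suc)
    also have "\<dots> = (1/2)^k * (2 - 2 * (1/2)^Suc i)"
      by (simp add: power_add algebra_simps)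
    finally show ?case .
  qed (simp add: u)
  have step': "p (u (k + i) \<ominus> u k) \<le> 2 * (1/2)^k" for k i
    using step[of k i] by (rule order_trans) (simp add: algebra_simps)
  fix e :: real assume e: "e > 0"
  have "(\<lambda>k. 2 * (1/2)^k :: real) \<longlonglongrightarrow> 2 * 0"
    by (intro tendsto_mult tendsto_const LIMSEQ_power_zero) simp
  then obtain N where "norm (2 * (1/2)^N - 0 :: real) < e / 2"
    using LIMSEQ_D[of "\<lambda>k. 2 * (1/2)^k :: real" 0 "e / 2"] e by auto
  then have N: "2 * (1/2)^N < e / 2" by simp
  have "p (u j \<ominus> u k) < e" if "j \<ge> N" "k \<ge> N" for j k
  proof -
    have "p (u j \<ominus> u k) \<le> p (u j \<ominus> u N) + p (u N \<ominus> u k)" by (intro p_triangle u)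
    also have "p (u N \<ominus> u k) = p (u k \<ominus> u N)" by (intro p_swap u)
    finally show ?thesis
      using step'[of N "j - N"] step'[of N "k - N"] that N by simp
  qed
  then show "\<exists>N. \<forall>j\<ge>N. \<forall>k\<ge>N. p (u j \<ominus> u k) < e" by blast
qed

text \<open>If \<open>y\<close> is the fixed point of the contraction \<open>y \<mapsto> (h + y\<^sup>2) / 2\<close>, then \<open>(1 - y)\<^sup>2 = 1 - h\<close>.\<close>

lemma sqrt_one_minus:
  assumes h: "h \<in> carrier A" "star A h = h" and small: "p h \<le> 1/2"
  obtains s where "s \<in> carrier A" "star A s = s" "s \<otimes> s = \<one> \<ominus> h"
proof -
  define f where "f y = (1/2) \<odot> (h \<oplus> y \<otimes> y)" for y
  define u where "u k = (f ^^ k) \<zero>" for k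
  have f: "f y \<in> carrier A" if "y \<in> carrier A" for y using that h by (simp add: f_def)
  have u0: "u 0 = \<zero>" and uS: "u (Suc k) = f (u k)" for k by (simp_all add: u_def)
  have u: "u k \<in> carrier A" for k by (induction k) (auto simp: u0 uS f)
  have star_u: "star A (u k) = u k" for k
    by (induction k) (simp_all add: u0 uS f_def star_sm star_add star_mult h u)
  \<comment> \<open>Because (1/2 + 1/4) / 2 < 1/2, the iterates stay in the ball of radius 1/2, and
    on that ball \<open>f_diff\<close> has contraction constant 1/2.\<close>
  have p_u: "p (u k) \<le> 1/2" for k
  proof (induction k)
    case (Suc k)
    have "p (u k \<otimes> u k) \<le> (1/2) * (1/2)"
      using p_mult[OF u u, of k k] mult_mono[OF Suc Suc] p_nonneg[OF u, of k] by simp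
    then have "p (h \<oplus> u k \<otimes> u k) \<le> 1/2 + (1/2) * (1/2)"
      using p_add[of h "u k \<otimes> u k"] small h u by force
    then show ?case using h u by (simp add: uS f_def p_sm)
  qed (simp add: u0)
  have f_diff: "p (f x \<ominus> f y) \<le> (1/2) * (p x * p (x \<ominus> y) + p (x \<ominus> y) * p y)"
    if "x \<in> carrier A" "y \<in> carrier A" for x y
  proof -
    have "f x \<ominus> f y = (1/2) \<odot> ((h \<oplus> x \<otimes> x) \<ominus> (h \<oplus> y \<otimes> y))"
      using that h by (simp add: f_def sm_diff)
    also have "(h \<oplus> x \<otimes> x) \<ominus> (h \<oplus> y \<otimes> y) = x \<otimes> x \<ominus> y \<otimes> y"
      using that h by (simp add: add_diff_add)
    finally show ?thesis using p_mult_diff[of x x y y] that by (simp add: p_sm)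
  qed
  have "p (u (Suc k) \<ominus> u k) \<le> (1/2)^k" for k
  proof (induction k)
    case 0
    then show ?case using p_u[of 1] u by (simp add: u0)
  next
    case (Suc k)
    have "p (u (Suc (Suc k)) \<ominus> u (Suc k)) \<le> (1/2) * (p (u (Suc k)) * p (u (Suc k) \<ominus> u k) + p (u (Suc k) \<ominus> u k) * p (u k))"
      using f_diff[OF u u, of "Suc k" k] by (simp add: uS)
    also have "\<dots> \<le> (1/2) * ((1/2) * p (u (Suc k) \<ominus> u k) + p (u (Suc k) \<ominus> u k) * (1/2))"
      using p_u u by (intro mult_left_mono add_mono mult_right_mono p_nonneg) auto
    also have "\<dots> \<le> (1/2)^Suc k" using Suc by simp
    finally show ?case .
  qed
  then have CSu: "u \<in> CS" by (intro CS_geometric u)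
  then obtain y where y: "y \<in> carrier A" and lim: "(\<lambda>k. p (u k \<ominus> y)) \<longlonglongrightarrow> 0"
    using complete by blast
  have "p (star A y \<ominus> y) \<le> 0"
  proof (rule LIMSEQ_le_const)
    show "(\<lambda>k. p (u k \<ominus> y) + p (u k \<ominus> y)) \<longlonglongrightarrow> 0" using tendsto_add[OF lim lim] by simp
    have "p (star A y \<ominus> y) \<le> p (u k \<ominus> y) + p (u k \<ominus> y)" for k
    proof -
      have "p (star A y \<ominus> y) \<le> p (star A y \<ominus> u k) + p (u k \<ominus> y)"
        using y u by (intro p_triangle) auto
      also have "star A y \<ominus> u k = star A (y \<ominus> u k)" using y u star_u by (simp add: star_diff)
      also have "p \<dots> = p (u k \<ominus> y)" using y u by (simp add: p_star p_swap)
      finally show ?thesis .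
    qed
    then show "\<exists>N. \<forall>n\<ge>N. p (star A y \<ominus> y) \<le> p (u n \<ominus> y) + p (u n \<ominus> y)" by blast
  qed
  then have star_y: "star A y = y"
    using p_eq_0[of "star A y \<ominus> y"] p_nonneg[of "star A y \<ominus> y"] y by (simp add: diff_eq_zero_iff)
  have "p (f y \<ominus> y) \<le> 0"
  proof (rule LIMSEQ_le_const)
    have "(\<lambda>k. (1/2) * (p y * p (u k \<ominus> y) + p (u k \<ominus> y) * (1/2)) + p (u (Suc k) \<ominus> y)) \<longlonglongrightarrow> (1/2) * (p y * 0 + 0 * (1/2)) + 0"
      by (intro tendsto_add tendsto_mult tendsto_const lim LIMSEQ_Suc)
    then show "(\<lambda>k. (1/2) * (p y * p (u k \<ominus> y) + p (u k \<ominus> y) * (1/2)) + p (u (Suc k) \<ominus> y)) \<longlonglongrightarrow> 0" by simp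
    have "p (f y \<ominus> y) \<le> (1/2) * (p y * p (u k \<ominus> y) + p (u k \<ominus> y) * (1/2)) + p (u (Suc k) \<ominus> y)" for k
    proof -
      have "p (f y \<ominus> y) \<le> p (f y \<ominus> u (Suc k)) + p (u (Suc k) \<ominus> y)"
        using y u f by (intro p_triangle) auto
      also have "p (f y \<ominus> u (Suc k)) \<le> (1/2) * (p y * p (y \<ominus> u k) + p (y \<ominus> u k) * p (u k))"
        unfolding uS by (intro f_diff y u)
      also have "p (y \<ominus> u k) = p (u k \<ominus> y)" by (intro p_swap y u)
      also have "(1/2) * (p y * p (u k \<ominus> y) + p (u k \<ominus> y) * p (u k)) \<le> (1/2) * (p y * p (u k \<ominus> y) + p (u k \<ominus> y) * (1/2))"
        using y u p_u by (intro mult_left_mono add_mono p_nonneg) auto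
      finally show ?thesis by simp
    qed
    then show "\<exists>N. \<forall>n\<ge>N. p (f y \<ominus> y) \<le> (1/2) * (p y * p (u n \<ominus> y) + p (u n \<ominus> y) * (1/2)) + p (u (Suc n) \<ominus> y)" by blast
  qed
  then have fy: "f y = y"
    using p_eq_0[of "f y \<ominus> y"] p_nonneg[of "f y \<ominus> y"] y f by (simp add: diff_eq_zero_iff)
  have "2 \<odot> y = 2 \<odot> f y" by (simp add: fy)
  also have "\<dots> = h \<oplus> y \<otimes> y" using h y by (simp add: f_def sm_sm)
  finally have yy: "y \<otimes> y = 2 \<odot> y \<ominus> h"
    using h y by (simp add: diff_eq_sm M.a_ac) (simp add: minus_eq_sm[symmetric] M.r_neg M.a_assoc[symmetric] M.a_comm)
  have "(\<one> \<ominus> y) \<otimes> (\<one> \<ominus> y) = (\<one> \<ominus> y) \<ominus> (y \<ominus> y \<otimes> y)"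
    using y by (simp add: diff_mult mult_diff)
  also have "\<dots> = (\<one> \<ominus> h) \<oplus> ((-1) \<odot> y \<oplus> ((-1) \<odot> y \<oplus> 2 \<odot> y))"
    using y h by (simp add: yy diff_eq_sm sm_add_right sm_sm M.a_ac)
  also have "(-1) \<odot> y \<oplus> ((-1) \<odot> y \<oplus> 2 \<odot> y) = \<zero>"
    using sm_add_left[OF y, of "-1" 2] sm_add_left[OF y, of "-1" 1] y by simp
  finally show ?thesis
    using that[of "\<one> \<ominus> y"] y h star_y by (simp add: star_diff)
qed

end

locale cstar_functional = cstar_alg A p + pos_functional A \<omega>
  for A :: "('a, 'm) star_algebra_scheme" (structure) and p and \<omega>
begin

text \<open>With t = 1 / (2 |a|^2) the element t a* a has norm 1/2, so 1 - t a* a is the square of a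
  self-adjoint s, and \<omega>(b* (1 - t a* a) b) is the squared length of s b, hence nonnegative.
  The factor 2 is the price of staying within reach of \<open>sqrt_one_minus\<close>; later
  arguments use only that states and left multiplications are bounded.\<close>

lemma w_sandwich:
  assumes a: "a \<in> carrier A" and b: "b \<in> carrier A"
  shows "(S.nrm (a \<otimes> b))\<^sup>2 \<le> 2 * (p a)\<^sup>2 * (S.nrm b)\<^sup>2"
proof (cases "p a = 0")
  case True
  then have "a = \<zero>" using a p_eq_0 by simp
  then show ?thesis using b by simp
next
  case False
  then have pa: "p a > 0" using p_nonneg[OF a] by simp
  define t where "t = 1 / (2 * (p a)\<^sup>2)"
  have t: "t > 0" using pa by (simp add: t_def)
  define h where "h = complex_of_real t \<odot> (star A a \<otimes> a)"
  have h: "h \<in> carrier A" "star A h = h" using a by (simp_all add: h_def star_sm star_mult)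
  have "p h = t * (p a)\<^sup>2" using a t by (simp add: h_def p_sm p_star_mult)
  then have "p h = 1/2" using pa by (simp add: t_def)
  then obtain s where s: "s \<in> carrier A" "star A s = s" "s \<otimes> s = \<one> \<ominus> h"
    using sqrt_one_minus[OF h] by auto
  have "0 \<le> (S.nrm (s \<otimes> b))\<^sup>2" by simp
  also have "\<dots> = Re (\<omega> (star A b \<otimes> ((s \<otimes> s) \<otimes> b)))"
    using s(1,2) b by (simp add: S.nrm_sq form_def star_mult mult_assoc)
  also have "star A b \<otimes> ((s \<otimes> s) \<otimes> b) = (star A b \<otimes> b) \<ominus> complex_of_real t \<odot> (star A (a \<otimes> b) \<otimes> (a \<otimes> b))"
    using a b s by (simp add: h_def diff_mult mult_diff sm_mult mult_sm star_mult mult_assoc)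
  also have "Re (\<omega> \<dots>) = (S.nrm b)\<^sup>2 - t * (S.nrm (a \<otimes> b))\<^sup>2"
    using a b by (simp add: w_diff w_sm S.nrm_sq form_def)
  finally show ?thesis using pa by (simp add: t_def field_simps)
qed

lemma nrm_mult_le:
  assumes a: "a \<in> carrier A" and b: "b \<in> carrier A"
  shows "S.nrm (a \<otimes> b) \<le> sqrt 2 * p a * S.nrm b"
  by (rule power2_le_imp_le)
     (use w_sandwich[OF a b] p_nonneg[OF a] S.nrm_nonneg[OF b] in \<open>auto simp: power_mult_distrib\<close>)

lemma nrm_le: "a \<in> carrier A \<Longrightarrow> S.nrm a \<le> sqrt 2 * S.nrm \<one> * p a"
  using nrm_mult_le[of a \<one>] by (simp add: mult_ac)

lemma w_bounded: assumes "a \<in> carrier A" shows "cmod (\<omega> a) \<le> (S.nrm \<one> * (sqrt 2 * S.nrm \<one>)) * p a"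
proof -
  have "cmod (\<omega> a) \<le> S.nrm \<one> * S.nrm a" by (rule w_le[OF assms])
  also have "\<dots> \<le> S.nrm \<one> * (sqrt 2 * S.nrm \<one> * p a)"
    using assms by (intro mult_left_mono nrm_le S.nrm_nonneg) auto
  finally show ?thesis by (simp add: mult_ac)
qed

end

section \<open>Hilbert spaces and irreducibility\<close>

sublocale complex_hilbert_space \<subseteq> semi_inner_space H "hinner H"
  by unfold_locales (auto simp: inner_add_right inner_smult_right inner_self_nonneg intro: inner_commute)

context complex_hilbert_space
begin

lemma hnorm_eq: "hnorm H = nrm"
  by (simp add: hnorm_def nrm_def fun_eq_iff)

lemma hdist_eq: "hdist H x y = nrm (x \<ominus> y)"
  by (simp add: hdist_def hnorm_eq)

lemma CS_complete: "u \<in> CS \<Longrightarrow> \<exists>x\<in>carrier H. (\<lambda>k. nrm (u k \<ominus> x)) \<longlonglongrightarrow> 0"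
  using complete[of u] by (simp add: hdist_eq[abs_def] CS_def)

lemma parallelogram:
  assumes "a \<in> carrier H" "b \<in> carrier H"
  shows "(nrm (a \<oplus> b))\<^sup>2 + (nrm (a \<ominus> b))\<^sup>2 = 2 * (nrm a)\<^sup>2 + 2 * (nrm b)\<^sup>2"
  using assms by (simp add: nrm_add_sq nrm_diff_sq)

lemma closed_subspaceD:
  assumes "closed_subspace H K"
  shows "K \<subseteq> carrier H" "\<zero> \<in> K" "x \<in> K \<Longrightarrow> y \<in> K \<Longrightarrow> x \<oplus> y \<in> K" "x \<in> K \<Longrightarrow> c \<odot> x \<in> K"
    "\<lbrakk>\<And>k. u k \<in> K; l \<in> carrier H; (\<lambda>k. nrm (u k \<ominus> l)) \<longlonglongrightarrow> 0\<rbrakk> \<Longrightarrow> l \<in> K"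
proof -
  have sub: "submodule K scalars H" using assms by (simp add: closed_subspace_def)
  show K: "K \<subseteq> carrier H" using submoduleE(1)[OF sub] .
  show sm: "c \<odot> x \<in> K" if "x \<in> K" for c x using submoduleE(4)[OF sub] that by simp
  show "x \<oplus> y \<in> K" if "x \<in> K" "y \<in> K" using submoduleE(5)[OF sub that] .
  obtain x where "x \<in> K" using submoduleE(2)[OF sub] by blast
  then show "\<zero> \<in> K" using sm[of x 0] K by auto
  show "\<lbrakk>\<And>k. u k \<in> K; l \<in> carrier H; (\<lambda>k. nrm (u k \<ominus> l)) \<longlonglongrightarrow> 0\<rbrakk> \<Longrightarrow> l \<in> K"
    using assms unfolding closed_subspace_def hdist_eq by blast
qed

text \<open>The nearest point of K: by the parallelogram law a minimizing sequence is Cauchy, since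
  midpoints stay in K, and comparing its limit k with k + c y for y in K forces
  orthogonality.\<close>

lemma projection:
  assumes K: "closed_subspace H K" and x: "x \<in> carrier H"
  obtains k where "k \<in> K" "\<And>y. y \<in> K \<Longrightarrow> hinner H y (x \<ominus> k) = 0"
proof -
  note KD = closed_subspaceD[OF K]
  have KH: "y \<in> carrier H" if "y \<in> K" for y using KD(1) that by blast
  define D where "D = (\<lambda>y. (nrm (x \<ominus> y))\<^sup>2) ` K"
  define \<delta> where "\<delta> = Inf D"
  have bdd: "bdd_below D" unfolding D_def by (rule bdd_belowI[of _ 0]) auto
  have ne: "D \<noteq> {}" using KD(2) by (auto simp: D_def)
  have low: "\<delta> \<le> (nrm (x \<ominus> y))\<^sup>2" if "y \<in> K" for y
    unfolding \<delta>_def using that by (intro cInf_lower bdd) (auto simp: D_def)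
  have "\<exists>y\<in>K. (nrm (x \<ominus> y))\<^sup>2 < \<delta> + inverse (real (Suc k))" for k
    using cInf_lessD[OF ne, of "\<delta> + inverse (real (Suc k))"] by (auto simp: \<delta>_def D_def)
  then obtain w where w: "\<And>k. w k \<in> K" "\<And>k. (nrm (x \<ominus> w k))\<^sup>2 < \<delta> + inverse (real (Suc k))"
    by metis
  have wH: "w k \<in> carrier H" for k using w KH by blast
  have close: "(nrm (w j \<ominus> w k))\<^sup>2 \<le> 2 * inverse (real (Suc j)) + 2 * inverse (real (Suc k))" for j k
  proof -
    define mid where "mid = (1/2) \<odot> (w j \<oplus> w k)"
    have mid: "mid \<in> K" by (auto simp: mid_def intro!: KD(3,4) w)
    have e1: "(x \<ominus> w k) \<ominus> (x \<ominus> w j) = w j \<ominus> w k"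
      using x wH[of j] wH[of k] diff_add_diff[of "w j" x "w k"]
      by (simp add: diff_eq_sm sm_add_right sm_sm M.a_ac)
    have two: "2 \<odot> y = y \<oplus> y" if "y \<in> carrier H" for y
      using sm_add_left[OF that, of 1 1] that by simp
    have e2: "(x \<ominus> w k) \<oplus> (x \<ominus> w j) = 2 \<odot> (x \<ominus> mid)"
      using x wH[of j] wH[of k] by (simp add: mid_def diff_eq_sm sm_add_right sm_sm two M.a_ac)
    have "(nrm (2 \<odot> (x \<ominus> mid)))\<^sup>2 + (nrm (w j \<ominus> w k))\<^sup>2 = 2 * (nrm (x \<ominus> w k))\<^sup>2 + 2 * (nrm (x \<ominus> w j))\<^sup>2"
      using parallelogram[of "x \<ominus> w k" "x \<ominus> w j"] x wH by (simp add: e1 e2)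
    moreover have "(nrm (2 \<odot> (x \<ominus> mid)))\<^sup>2 = 4 * (nrm (x \<ominus> mid))\<^sup>2"
      using x KH[OF mid] by (simp add: nrm_sm power_mult_distrib)
    ultimately show ?thesis using low[OF mid] w(2)[of j] w(2)[of k] by linarith
  qed
  have lim0: "(\<lambda>k. inverse (real (Suc k))) \<longlonglongrightarrow> 0" by (rule LIMSEQ_inverse_real_of_nat)
  have "w \<in> CS"
    unfolding CS_iff
  proof (intro conjI allI impI wH)
    fix e :: real assume e: "e > 0"
    obtain N where N: "\<And>k. k \<ge> N \<Longrightarrow> norm (inverse (real (Suc k)) - 0) < e\<^sup>2 / 4"
      using LIMSEQ_D[OF lim0, of "e\<^sup>2 / 4"] e by auto
    have "nrm (w j \<ominus> w k) < e" if "j \<ge> N" "k \<ge> N" for j k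
    proof -
      have "inverse (real (Suc j)) < e\<^sup>2 / 4" "inverse (real (Suc k)) < e\<^sup>2 / 4"
        using N[OF that(1)] N[OF that(2)] by simp_all
      then have "(nrm (w j \<ominus> w k))\<^sup>2 < e\<^sup>2" using close[of j k] by linarith
      then show ?thesis using e by (simp add: power_less_imp_less_base)
    qed
    then show "\<exists>N. \<forall>j\<ge>N. \<forall>k\<ge>N. nrm (w j \<ominus> w k) < e" by blast
  qed
  then obtain k where k: "k \<in> carrier H" and lim: "(\<lambda>i. nrm (w i \<ominus> k)) \<longlonglongrightarrow> 0"
    using CS_complete by blast
  have kK: "k \<in> K" using KD(5)[OF w(1) k lim] .
  have opt: "nrm (x \<ominus> k) \<le> nrm (x \<ominus> y)" if y: "y \<in> K" for y
  proof (rule LIMSEQ_le_const)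
    have "(\<lambda>i. sqrt ((nrm (x \<ominus> y))\<^sup>2 + inverse (real (Suc i))) + nrm (w i \<ominus> k)) \<longlonglongrightarrow> sqrt ((nrm (x \<ominus> y))\<^sup>2 + 0) + 0"
      by (intro tendsto_add tendsto_const tendsto_real_sqrt lim0 lim)
    then show "(\<lambda>i. sqrt ((nrm (x \<ominus> y))\<^sup>2 + inverse (real (Suc i))) + nrm (w i \<ominus> k)) \<longlonglongrightarrow> nrm (x \<ominus> y)"
      using x KH[OF y] nrm_nonneg[of "x \<ominus> y"] by simp
    have "nrm (x \<ominus> k) \<le> sqrt ((nrm (x \<ominus> y))\<^sup>2 + inverse (real (Suc i))) + nrm (w i \<ominus> k)" for i
    proof -
      have "nrm (x \<ominus> k) \<le> nrm (x \<ominus> w i) + nrm (w i \<ominus> k)" by (intro p_triangle x wH k)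
      moreover have "nrm (x \<ominus> w i) \<le> sqrt ((nrm (x \<ominus> y))\<^sup>2 + inverse (real (Suc i)))"
        by (rule real_le_rsqrt) (use w(2)[of i] low[OF y] in linarith)
      ultimately show ?thesis by linarith
    qed
    then show "\<exists>N. \<forall>i\<ge>N. nrm (x \<ominus> k) \<le> sqrt ((nrm (x \<ominus> y))\<^sup>2 + inverse (real (Suc i))) + nrm (w i \<ominus> k)"
      by blast
  qed
  have "hinner H y (x \<ominus> k) = 0" if y: "y \<in> K" for y
  proof -
    define b where "b = hinner H (x \<ominus> k) y"
    have main: "2 * t * (cmod b)\<^sup>2 \<le> t\<^sup>2 * ((cmod b)\<^sup>2 * (nrm y)\<^sup>2)" for t :: real
    proof -
      let ?c = "complex_of_real t * cnj b"
      have kc: "k \<oplus> ?c \<odot> y \<in> K" by (intro KD(3,4) kK y)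
      have "(nrm (x \<ominus> k))\<^sup>2 \<le> (nrm (x \<ominus> (k \<oplus> ?c \<odot> y)))\<^sup>2"
        using opt[OF kc] nrm_nonneg[of "x \<ominus> k"] x k by (intro power_mono) auto
      also have "x \<ominus> (k \<oplus> ?c \<odot> y) = (x \<ominus> k) \<ominus> ?c \<odot> y"
        using x k KH[OF y] by (simp add: diff_eq_sm sm_add_right sm_sm M.a_ac)
      also have "(nrm \<dots>)\<^sup>2 = (nrm (x \<ominus> k))\<^sup>2 - 2 * Re (?c * b) + (cmod ?c * nrm y)\<^sup>2"
        using x k KH[OF y] by (simp add: nrm_diff_sq B_sm nrm_sm b_def)
      also have "?c * b = complex_of_real (t * (cmod b)\<^sup>2)"
        using complex_norm_square[of b] by (simp add: mult.commute mult.left_commute)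
      also have "(cmod ?c * nrm y)\<^sup>2 = t\<^sup>2 * ((cmod b)\<^sup>2 * (nrm y)\<^sup>2)"
        by (simp add: norm_mult power_mult_distrib)
      finally show ?thesis by simp
    qed
    have "(cmod b)\<^sup>2 = 0"
    proof (rule ccontr)
      assume "(cmod b)\<^sup>2 \<noteq> 0"
      then have b: "(cmod b)\<^sup>2 > 0" by simp
      \<comment> \<open>A nonzero b would force \<open>t * (nrm y)\<^sup>2 \<ge> 2\<close> for every
        positive t. This t violates that, and the summand 1 covers a y of norm zero.\<close>
      define t where "t = 1 / ((nrm y)\<^sup>2 + 1)"
      have t: "t > 0" "t * (nrm y)\<^sup>2 \<le> 1" by (auto simp: t_def field_simps add_pos_nonneg)
      have "2 * (t * (cmod b)\<^sup>2) \<le> (t * (nrm y)\<^sup>2) * (t * (cmod b)\<^sup>2)"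
        using main[of t] by (simp add: power2_eq_square mult_ac)
      also have "\<dots> \<le> 1 * (t * (cmod b)\<^sup>2)"
        using t b by (intro mult_right_mono) auto
      finally show False using t b by (simp add: mult_le_0_iff)
    qed
    then show ?thesis
      using B_commute[of "x \<ominus> k" y] x k KH[OF y] by (simp add: b_def)
  qed
  then show ?thesis using kK that by blast
qed

end

context star_alg
begin

lemma
  assumes rep: "representation A (H, \<pi>)" and a: "a \<in> carrier A" and x: "x \<in> carrier H"
  shows rep_closed: "\<pi> a x \<in> carrier H"
    and rep_add: "y \<in> carrier H \<Longrightarrow> \<pi> a (x \<oplus>\<^bsub>H\<^esub> y) = \<pi> a x \<oplus>\<^bsub>H\<^esub> \<pi> a y"
    and rep_mult: "b \<in> carrier A \<Longrightarrow> \<pi> (a \<otimes> b) x = \<pi> a (\<pi> b x)"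
    and rep_plus: "b \<in> carrier A \<Longrightarrow> \<pi> (a \<oplus> b) x = \<pi> a x \<oplus>\<^bsub>H\<^esub> \<pi> b x"
    and rep_scale: "\<pi> (c \<odot> a) x = c \<odot>\<^bsub>H\<^esub> \<pi> a x"
    and rep_one: "\<pi> \<one> x = x"
    and rep_star: "y \<in> carrier H \<Longrightarrow> hinner H (\<pi> (star A a) x) y = hinner H x (\<pi> a y)"
proof -
  have lin: "linear_op H H (\<pi> a)" using rep a by (simp add: bounded_op_def)
  show "\<pi> a x \<in> carrier H" using lin x by (auto simp: linear_op_def)
  show "y \<in> carrier H \<Longrightarrow> \<pi> a (x \<oplus>\<^bsub>H\<^esub> y) = \<pi> a x \<oplus>\<^bsub>H\<^esub> \<pi> a y" using lin x by (auto simp: linear_op_def)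
qed (use rep a x in auto)

text \<open>Project \<Omega> to a vector v of the invariant subspace K. Then \<pi>(s) fixes v, so v
  is a multiple of \<Omega>. If v = 0, the whole orbit of \<Omega> is orthogonal to K and K is zero;
  otherwise \<Omega> lies in K and cyclicity makes K everything. Cyclicity is stated through
  orthogonality, which is the form needed in both cases.\<close>

lemma irreducible_criterion:
  assumes rep: "representation A (H, \<pi>)"
    and \<Omega>: "\<Omega> \<in> carrier H" "\<Omega> \<noteq> \<zero>\<^bsub>H\<^esub>"
    and s: "s \<in> carrier A" "\<pi> s \<Omega> = \<Omega>"
    and cyclic: "\<And>v. v \<in> carrier H \<Longrightarrow> (\<And>a. a \<in> carrier A \<Longrightarrow> hinner H v (\<pi> a \<Omega>) = 0) \<Longrightarrow> v = \<zero>\<^bsub>H\<^esub>"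
    and fix_s: "\<And>v. v \<in> carrier H \<Longrightarrow> \<pi> s v = v \<Longrightarrow> \<exists>c. v = c \<odot>\<^bsub>H\<^esub> \<Omega>"
  shows "irreducible_rep A (H, \<pi>)"
proof -
  interpret H: complex_hilbert_space H using rep by simp
  have "K = {\<zero>\<^bsub>H\<^esub>} \<or> K = carrier H"
    if K: "closed_subspace H K" and inv: "\<And>a. a \<in> carrier A \<Longrightarrow> \<pi> a ` K \<subseteq> K" for K
  proof -
    note KD = H.closed_subspaceD[OF K]
    have KH: "y \<in> carrier H" if "y \<in> K" for y using KD(1) that by blast
    have invK: "\<pi> a y \<in> K" if "a \<in> carrier A" "y \<in> K" for a y using inv that by blast
    obtain v where v: "v \<in> K" "\<And>y. y \<in> K \<Longrightarrow> hinner H y (\<Omega> \<ominus>\<^bsub>H\<^esub> v) = 0"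
      using H.projection[OF K \<Omega>(1)] by blast
    have vH: "v \<in> carrier H" using KH v by blast
    define v' where "v' = \<Omega> \<ominus>\<^bsub>H\<^esub> v"
    have v'H: "v' \<in> carrier H" using \<Omega> vH by (simp add: v'_def)
    have sum: "v' \<oplus>\<^bsub>H\<^esub> v = \<Omega>" using \<Omega> vH by (simp add: v'_def H.diff_add_cancel)
    \<comment> \<open>This vector lies in K. Since \<pi>(s) fixes \<Omega>, it also equals v' -
      \<pi>(s) v', which is orthogonal to K because the adjoint of s preserves K. So it is
      orthogonal to itself.\<close>
    define e where "e = \<pi> s v \<ominus>\<^bsub>H\<^esub> v"
    have "e \<in> K"
      using invK[OF s(1) v(1)] v KH by (auto simp: e_def H.diff_eq_sm intro!: KD(3,4))
    have "\<pi> s v' \<oplus>\<^bsub>H\<^esub> \<pi> s v = v' \<oplus>\<^bsub>H\<^esub> v"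
      using s(2) rep_add[OF rep s(1) v'H vH] by (simp add: sum)
    then have "(\<pi> s v' \<oplus>\<^bsub>H\<^esub> \<pi> s v) \<ominus>\<^bsub>H\<^esub> (\<pi> s v' \<oplus>\<^bsub>H\<^esub> v) = (v' \<oplus>\<^bsub>H\<^esub> v) \<ominus>\<^bsub>H\<^esub> (\<pi> s v' \<oplus>\<^bsub>H\<^esub> v)" by simp
    then have e': "e = v' \<ominus>\<^bsub>H\<^esub> \<pi> s v'"
      using vH v'H rep_closed[OF rep s(1) vH] rep_closed[OF rep s(1) v'H] by (simp add: H.add_diff_add e_def)
    have perp: "hinner H y v' = 0" if "y \<in> K" for y using v that by (simp add: v'_def)
    have "hinner H y (\<pi> s v') = 0" if "y \<in> K" for y
    proof -
      have "hinner H (\<pi> (star A s) y) v' = hinner H y (\<pi> s v')"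
        using rep_star[OF rep s(1) KH[OF that] v'H] .
      then show ?thesis using perp[OF invK[OF star_closed[OF s(1)] that]] by simp
    qed
    then have "hinner H e e = 0"
      using \<open>e \<in> K\<close> perp KH v'H rep_closed[OF rep s(1) v'H] by (subst (2) e') (simp add: H.B_diff)
    then have "e = \<zero>\<^bsub>H\<^esub>" using KH[OF \<open>e \<in> K\<close>] by (simp add: H.inner_self_eq_0)
    then have "\<pi> s v = v"
      using vH rep_closed[OF rep s(1) vH] by (simp add: e_def H.diff_eq_zero_iff)
    then obtain c where c: "v = c \<odot>\<^bsub>H\<^esub> \<Omega>" using fix_s[OF vH] by blast
    show ?thesis
    proof (cases "c = 0")
      case True
      then have v0: "v = \<zero>\<^bsub>H\<^esub>" using c \<Omega> by simp
      have "y = \<zero>\<^bsub>H\<^esub>" if "y \<in> K" for y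
      proof (rule cyclic[OF KH[OF that]])
        fix a assume a: "a \<in> carrier A"
        have "hinner H y (\<pi> a \<Omega>) = hinner H (\<pi> (star A a) y) \<Omega>"
          using rep_star[OF rep a KH[OF that] \<Omega>(1)] by simp
        also have "\<dots> = 0"
          using perp[OF invK[OF star_closed[OF a] that]] \<Omega> by (simp add: v'_def v0)
        finally show "hinner H y (\<pi> a \<Omega>) = 0" .
      qed
      then show ?thesis using KD(2) by blast
    next
      case False
      then have "\<Omega> = inverse c \<odot>\<^bsub>H\<^esub> v" using c \<Omega> by (simp add: H.sm_sm)
      then have \<Omega>K: "\<Omega> \<in> K" using KD(4)[OF v(1)] by simp
      have "x \<in> K" if x: "x \<in> carrier H" for x
      proof -
        obtain k where k: "k \<in> K" "\<And>y. y \<in> K \<Longrightarrow> hinner H y (x \<ominus>\<^bsub>H\<^esub> k) = 0"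
          using H.projection[OF K x] by blast
        have d: "x \<ominus>\<^bsub>H\<^esub> k \<in> carrier H" using x KH[OF k(1)] by simp
        have "x \<ominus>\<^bsub>H\<^esub> k = \<zero>\<^bsub>H\<^esub>"
        proof (rule cyclic[OF d])
          fix a assume a: "a \<in> carrier A"
          have "hinner H (\<pi> a \<Omega>) (x \<ominus>\<^bsub>H\<^esub> k) = 0" using k(2)[OF invK[OF a \<Omega>K]] .
          then show "hinner H (x \<ominus>\<^bsub>H\<^esub> k) (\<pi> a \<Omega>) = 0"
            using H.B_commute[OF rep_closed[OF rep a \<Omega>(1)] d] by simp
        qed
        then show ?thesis using k(1) x KH[OF k(1)] by (simp add: H.diff_eq_zero_iff)
      qed
      then show ?thesis using KD(1) by blast
    qed
  qed
  then show ?thesis using rep \<Omega> by auto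
qed

lemma unitary_equiv_refl: assumes "representation A \<rho>" shows "(\<rho>, \<rho>) \<in> unitary_equiv A"
proof (cases \<rho>)
  case (Pair H \<pi>)
  have "intertwining_unitary A (H, \<pi>) (H, \<pi>) (\<lambda>x. x)"
    by (auto simp: linear_op_def bij_betw_def)
  then show ?thesis using assms Pair by (auto simp: unitary_equiv_def)
qed

end


section \<open>The GNS representation\<close>

context cstar_functional
begin

lemma gns_dist_eq: "gns_dist A \<omega> = (\<lambda>x y. S.nrm (x \<ominus> y))"
  by (simp add: gns_dist_def S.nrm_def form_def fun_eq_iff)

sublocale G: seminormed_completion A S.nrm "gns_space A \<omega>"
  by unfold_locales (simp_all add: gns_space_def gns_dist_eq)

lemma hinner_cl:
  assumes "u \<in> S.CS" "v \<in> S.CS"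
  shows "(\<lambda>k. form (u k) (v k)) \<longlonglongrightarrow> hinner (gns_space A \<omega>) (S.cl u) (S.cl v)"
proof -
  have eq: "lim (\<lambda>k. form (u' k) (v' k)) = lim (\<lambda>k. form (u'' k) (v'' k))"
    if "u' \<in> S.CS" "v' \<in> S.CS" "u'' \<in> S.CS" "v'' \<in> S.CS" "S.eqv u' u''" "S.eqv v' v''" for u' v' u'' v''
  proof -
    have "(\<lambda>k. form (u' k) (v' k)) \<longlonglongrightarrow> lim (\<lambda>k. form (u' k) (v' k))"
      using S.B_tendsto(1)[of u' v' u'' v''] that by (simp add: convergent_LIMSEQ_iff)
    moreover have "(\<lambda>k. form (u' k) (v' k) - form (u'' k) (v'' k)) \<longlonglongrightarrow> 0"
      using S.B_tendsto(2)[of u' v' u'' v''] that by simp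
    ultimately have "(\<lambda>k. form (u' k) (v' k) - (form (u' k) (v' k) - form (u'' k) (v'' k))) \<longlonglongrightarrow> lim (\<lambda>k. form (u' k) (v' k)) - 0"
      by (rule tendsto_diff)
    then show ?thesis by (simp add: limI)
  qed
  have "hinner (gns_space A \<omega>) (S.cl u) (S.cl v) = the_elem (\<Union>u\<in>S.cl u. \<Union>v\<in>S.cl v. {lim (\<lambda>k. form (u k) (v k))})"
    by (simp add: gns_space_def form_def)
  also have "(\<Union>u\<in>S.cl u. \<Union>v\<in>S.cl v. {lim (\<lambda>k. form (u k) (v k))}) = (\<Union>u\<in>S.cl u. {lim (\<lambda>k. form (u k) (v k))})"
  proof (rule SUP_cong[OF refl])
    fix u' assume "u' \<in> S.cl u"
    then have "u' \<in> S.CS" using assms by (simp add: S.in_cl)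
    then show "(\<Union>v\<in>S.cl v. {lim (\<lambda>k. form (u' k) (v k))}) = {lim (\<lambda>k. form (u' k) (v k))}"
      using assms by (subst S.UN_cl) (auto intro!: eq)
  qed
  also have "\<dots> = {lim (\<lambda>k. form (u k) (v k))}"
    using assms by (subst S.UN_cl) (auto intro!: eq)
  finally have "hinner (gns_space A \<omega>) (S.cl u) (S.cl v) = lim (\<lambda>k. form (u k) (v k))" by simp
  then show ?thesis
    using S.B_tendsto(1)[of u v u v] assms by (simp add: convergent_LIMSEQ_iff)
qed

lemma hinner_self: assumes "P \<in> carrier (gns_space A \<omega>)"
  shows "hinner (gns_space A \<omega>) P P = complex_of_real ((S.cnorm P)\<^sup>2)"
proof -
  obtain u where u: "u \<in> S.CS" "P = S.cl u" using assms by (rule G.carrier_W_E)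
  have "(\<lambda>k. complex_of_real ((S.nrm (u k))\<^sup>2)) \<longlonglongrightarrow> complex_of_real ((S.cnorm P)\<^sup>2)"
    unfolding u by (intro tendsto_of_real tendsto_power S.cnorm_tendsto u)
  then have "(\<lambda>k. form (u k) (u k)) \<longlonglongrightarrow> complex_of_real ((S.cnorm P)\<^sup>2)"
    using u by (simp add: S.B_self)
  with hinner_cl[OF u(1) u(1)] show ?thesis
    unfolding u(2) by (rule LIMSEQ_unique)
qed

lemma hnorm_gns: "P \<in> carrier (gns_space A \<omega>) \<Longrightarrow> hnorm (gns_space A \<omega>) P = S.cnorm P"
  using G.WN.p_nonneg[of P] by (simp add: hnorm_def hinner_self flip: of_real_power)

lemma gns_hilbert: "complex_hilbert_space (gns_space A \<omega>)"
proof -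
  let ?H = "gns_space A \<omega>"
  interpret I: semi_inner_space ?H "hinner ?H"
  proof (unfold_locales, goal_cases)
    case (1 x y z)
    then obtain u v w where u: "u \<in> S.CS" "x = S.cl u" and v: "v \<in> S.CS" "y = S.cl v" and w: "w \<in> S.CS" "z = S.cl w"
      by (metis G.carrier_W_E)
    have "(\<lambda>k. form (u k) (v k \<oplus> w k)) \<longlonglongrightarrow> hinner ?H x (y \<oplus>\<^bsub>?H\<^esub> z)"
      using u v w hinner_cl[of u "\<lambda>k. v k \<oplus> w k"] by (simp add: G.add_cl)
    moreover have "(\<lambda>k. form (u k) (v k) + form (u k) (w k)) \<longlonglongrightarrow> hinner ?H x y + hinner ?H x z"
      unfolding u v w by (intro tendsto_add hinner_cl u v w)
    ultimately show ?case
      using u v w by (simp add: form_add_right LIMSEQ_unique)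
  next
    case (2 x y c)
    then obtain u v where u: "u \<in> S.CS" "x = S.cl u" and v: "v \<in> S.CS" "y = S.cl v"
      by (metis G.carrier_W_E)
    have "(\<lambda>k. form (u k) (c \<odot> v k)) \<longlonglongrightarrow> hinner ?H x (c \<odot>\<^bsub>?H\<^esub> y)"
      using u v hinner_cl[of u "\<lambda>k. c \<odot> v k"] by (simp add: G.sm_cl)
    moreover have "(\<lambda>k. c * form (u k) (v k)) \<longlonglongrightarrow> c * hinner ?H x y"
      unfolding u v by (intro tendsto_mult tendsto_const hinner_cl u v)
    ultimately show ?case
      using u v by (simp add: form_sm_right LIMSEQ_unique)
  next
    case (3 x y)
    then obtain u v where u: "u \<in> S.CS" "x = S.cl u" and v: "v \<in> S.CS" "y = S.cl v"
      by (metis G.carrier_W_E)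
    have "(\<lambda>k. cnj (form (u k) (v k))) \<longlonglongrightarrow> cnj (hinner ?H x y)"
      unfolding u v by (intro tendsto_cnj hinner_cl u v)
    moreover have "form (v k) (u k) = cnj (form (u k) (v k))" for k
      using u v by (intro form_commute) auto
    ultimately have "(\<lambda>k. form (v k) (u k)) \<longlonglongrightarrow> cnj (hinner ?H x y)" by simp
    with hinner_cl[OF v(1) u(1)] show ?case unfolding u v by (rule LIMSEQ_unique)
  next
    case (4 x)
    then show ?case by (simp add: hinner_self complex_nonneg_Reals_iff)
  qed
  show ?thesis
  proof unfold_locales
    fix x assume "x \<in> carrier ?H" "hinner ?H x x = 0"
    then show "x = \<zero>\<^bsub>?H\<^esub>" by (simp add: hinner_self G.cnorm_eq_0)
  next
    fix u assume u: "u \<in> cauchy_seqs (carrier ?H) (hdist ?H)"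
    then have uc: "u k \<in> carrier ?H" for k by (simp add: cauchy_seqs_def)
    have "u \<in> G.WN.CS"
      using u uc by (simp add: G.WN.CS_iff cauchy_seqs_def hdist_def hnorm_gns)
    then obtain x where "x \<in> carrier ?H" "(\<lambda>k. S.cnorm (u k \<ominus>\<^bsub>?H\<^esub> x)) \<longlonglongrightarrow> 0"
      using G.complete_W by blast
    then show "\<exists>x\<in>carrier ?H. (\<lambda>k. hdist ?H (u k) x) \<longlonglongrightarrow> 0"
      using uc by (intro bexI[of _ x]) (simp_all add: hdist_def hnorm_gns)
  qed (simp_all add: I.B_add I.B_sm I.B_commute[symmetric] I.B_nonneg)
qed

text \<open>Left multiplication is Lipschitz for the GNS seminorm by \<open>nrm_mult_le\<close>;
  here the C*-norm of a makes the action extend to the completion.\<close>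

lemma S_CS_mult: "a \<in> carrier A \<Longrightarrow> u \<in> S.CS \<Longrightarrow> (\<lambda>k. a \<otimes> u k) \<in> S.CS"
  by (rule S.CS_dominated[where u = u and B = "sqrt 2 * p a"])
     (auto simp: mult_diff[symmetric] nrm_mult_le)

lemma S_eqv_mult: "a \<in> carrier A \<Longrightarrow> u \<in> S.CS \<Longrightarrow> v \<in> S.CS \<Longrightarrow> S.eqv u v \<Longrightarrow> S.eqv (\<lambda>k. a \<otimes> u k) (\<lambda>k. a \<otimes> v k)"
  by (rule S.eqv_dominated[where u = u and u' = v and B = "sqrt 2 * p a"])
     (auto simp: mult_diff[symmetric] nrm_mult_le)

definition act where "act = snd (gns_rep A \<omega>)"

lemma gns_rep_eq: "gns_rep A \<omega> = (gns_space A \<omega>, act)"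
  by (simp add: act_def gns_rep_def)

lemma act_cl: assumes "a \<in> carrier A" "u \<in> S.CS" shows "act a (S.cl u) = S.cl (\<lambda>k. a \<otimes> u k)"
proof -
  have "act a (S.cl u) = (\<Union>u\<in>S.cl u. S.cl (\<lambda>k. a \<otimes> u k))"
    by (simp add: act_def gns_rep_def S.cl_def gns_dist_eq)
  also have "\<dots> = S.cl (\<lambda>k. a \<otimes> u k)"
    using assms by (subst S.UN_cl) (auto simp: S.cl_eq_iff S_CS_mult intro!: S_eqv_mult)
  finally show ?thesis .
qed

lemma gns_representation: "representation A (gns_space A \<omega>, act)"
proof -
  let ?H = "gns_space A \<omega>"
  have lin: "linear_op ?H ?H (act a)" if a: "a \<in> carrier A" for a
    unfolding linear_op_def
  proof (intro conjI ballI allI)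
    show "act a \<in> carrier ?H \<rightarrow> carrier ?H"
    proof
      fix x assume "x \<in> carrier ?H"
      then show "act a x \<in> carrier ?H"
        using a by (elim G.carrier_W_E) (simp add: act_cl S_CS_mult G.cl_closed)
    qed
  next
    fix x y assume "x \<in> carrier ?H" "y \<in> carrier ?H"
    then show "act a (x \<oplus>\<^bsub>?H\<^esub> y) = act a x \<oplus>\<^bsub>?H\<^esub> act a y"
      using a by (elim G.carrier_W_E) (simp add: act_cl S_CS_mult G.add_cl mult_add_right)
  next
    fix c x assume "x \<in> carrier ?H"
    then show "act a (c \<odot>\<^bsub>?H\<^esub> x) = c \<odot>\<^bsub>?H\<^esub> act a x"
      using a by (elim G.carrier_W_E) (simp add: act_cl S_CS_mult G.sm_cl mult_sm)
  qed
  have cl: "act a x \<in> carrier ?H" if "a \<in> carrier A" "x \<in> carrier ?H" for a x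
    using lin[OF that(1)] that(2) by (auto simp: linear_op_def)
  have bd: "hnorm ?H (act a x) \<le> sqrt 2 * p a * hnorm ?H x" if a: "a \<in> carrier A" and x: "x \<in> carrier ?H" for a x
  proof -
    obtain u where u: "u \<in> S.CS" "x = S.cl u" using x by (rule G.carrier_W_E)
    have "S.cnorm (S.cl (\<lambda>k. a \<otimes> u k)) \<le> sqrt 2 * p a * S.cnorm (S.cl u)"
    proof (rule LIMSEQ_le[OF S.cnorm_tendsto tendsto_mult[OF tendsto_const S.cnorm_tendsto]])
      show "\<exists>N. \<forall>k\<ge>N. S.nrm (a \<otimes> u k) \<le> sqrt 2 * p a * S.nrm (u k)"
        using a u by (auto intro!: nrm_mult_le)
    qed (use a u S_CS_mult in auto)
    then show ?thesis using a u x cl[OF a x] by (simp add: hnorm_gns act_cl)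
  qed
  have adj: "hinner ?H (act (star A a) x) y = hinner ?H x (act a y)"
    if a: "a \<in> carrier A" and x: "x \<in> carrier ?H" and y: "y \<in> carrier ?H" for a x y
  proof -
    obtain u where u: "u \<in> S.CS" "x = S.cl u" using x by (rule G.carrier_W_E)
    obtain v where v: "v \<in> S.CS" "y = S.cl v" using y by (rule G.carrier_W_E)
    have "(\<lambda>k. form (star A a \<otimes> u k) (v k)) \<longlonglongrightarrow> hinner ?H (act (star A a) x) y"
      using a u v hinner_cl[of "\<lambda>k. star A a \<otimes> u k" v] by (simp add: act_cl S_CS_mult)
    moreover have "(\<lambda>k. form (u k) (a \<otimes> v k)) \<longlonglongrightarrow> hinner ?H x (act a y)"
      using a u v hinner_cl[of u "\<lambda>k. a \<otimes> v k"] by (simp add: act_cl S_CS_mult)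
    moreover have "form (star A a \<otimes> u k) (v k) = form (u k) (a \<otimes> v k)" for k
      using a u v by (simp add: form_def star_mult mult_assoc)
    ultimately show ?thesis by (simp add: LIMSEQ_unique)
  qed
  have alg: "act (a \<oplus> b) x = act a x \<oplus>\<^bsub>?H\<^esub> act b x" "act (a \<otimes> b) x = act a (act b x)"
     "act (c \<odot> a) x = c \<odot>\<^bsub>?H\<^esub> act a x" "act \<one> x = x"
    if "a \<in> carrier A" "b \<in> carrier A" and x: "x \<in> carrier ?H" for a b c x
  proof -
    obtain u where u: "u \<in> S.CS" "x = S.cl u" using x by (rule G.carrier_W_E)
    show "act (a \<oplus> b) x = act a x \<oplus>\<^bsub>?H\<^esub> act b x" "act (a \<otimes> b) x = act a (act b x)"
     "act (c \<odot> a) x = c \<odot>\<^bsub>?H\<^esub> act a x" "act \<one> x = x"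
      using that u by (simp_all add: act_cl S_CS_mult G.add_cl G.sm_cl mult_add_left mult_assoc sm_mult)
  qed
  show ?thesis
    unfolding representation.simps
    by (intro conjI ballI allI gns_hilbert adj alg(1,2) alg(3)[OF _ one_closed] alg(4)[OF one_closed one_closed])
       (use lin bd in \<open>auto simp: bounded_op_def\<close>)
qed

definition cyc where "cyc = S.cl (\<lambda>k. \<one>)"

lemma cyc_closed [simp]: "cyc \<in> carrier (gns_space A \<omega>)"
  by (simp add: cyc_def G.cl_closed)

lemma act_cyc: "a \<in> carrier A \<Longrightarrow> act a cyc = S.cl (\<lambda>k. a)"
  by (simp add: cyc_def act_cl)

lemma hinner_const: "a \<in> carrier A \<Longrightarrow> b \<in> carrier A \<Longrightarrow>
    hinner (gns_space A \<omega>) (S.cl (\<lambda>k. a)) (S.cl (\<lambda>k. b)) = form a b"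
  using hinner_cl[of "\<lambda>k. a" "\<lambda>k. b"] by (simp add: LIMSEQ_const_iff)

lemma hinner_cyc: "a \<in> carrier A \<Longrightarrow> hinner (gns_space A \<omega>) cyc (act a cyc) = \<omega> a"
  by (simp add: act_cyc) (simp add: cyc_def hinner_const form_def)

text \<open>The orbit of \<open>cyc\<close> consists of the classes of constant sequences, which are
  dense. So v is a limit of vectors orthogonal to v, and Cauchy-Schwarz makes its norm zero.\<close>

lemma cyc_cyclic:
  assumes v: "v \<in> carrier (gns_space A \<omega>)"
    and 0: "\<And>a. a \<in> carrier A \<Longrightarrow> hinner (gns_space A \<omega>) v (act a cyc) = 0"
  shows "v = \<zero>\<^bsub>gns_space A \<omega>\<^esub>"
proof -
  let ?H = "gns_space A \<omega>"
  interpret H: complex_hilbert_space ?H by (rule gns_hilbert)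
  obtain u where u: "u \<in> S.CS" "v = S.cl u" using v by (rule G.carrier_W_E)
  have "(\<lambda>k. S.cnorm v * S.cnorm (S.cl (\<lambda>j. u k) \<ominus>\<^bsub>?H\<^esub> v)) \<longlonglongrightarrow> S.cnorm v * 0"
    unfolding u by (intro tendsto_mult tendsto_const G.cl_approx u)
  then have "(S.cnorm v)\<^sup>2 \<le> S.cnorm v * 0"
  proof (rule LIMSEQ_le_const)
    have "(S.cnorm v)\<^sup>2 \<le> S.cnorm v * S.cnorm (S.cl (\<lambda>j. u k) \<ominus>\<^bsub>?H\<^esub> v)" for k
    proof -
      have uk: "S.cl (\<lambda>j. u k) \<in> carrier ?H" using u by auto
      have "hinner ?H v (S.cl (\<lambda>j. u k)) = 0" using 0[of "u k"] u by (simp add: act_cyc)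
      then have "hinner ?H v (S.cl (\<lambda>j. u k) \<ominus>\<^bsub>?H\<^esub> v) = - complex_of_real ((S.cnorm v)\<^sup>2)"
        using v uk by (simp add: H.B_diff hinner_self)
      then have "(S.cnorm v)\<^sup>2 = cmod (hinner ?H v (S.cl (\<lambda>j. u k) \<ominus>\<^bsub>?H\<^esub> v))"
        by (simp add: norm_power)
      also have "\<dots> \<le> S.cnorm v * S.cnorm (S.cl (\<lambda>j. u k) \<ominus>\<^bsub>?H\<^esub> v)"
        using H.Cauchy_Schwarz[OF v, of "S.cl (\<lambda>j. u k) \<ominus>\<^bsub>?H\<^esub> v"] v uk
        by (simp add: H.hnorm_eq[symmetric] hnorm_gns)
      finally show ?thesis .
    qed
    then show "\<exists>N. \<forall>k\<ge>N. (S.cnorm v)\<^sup>2 \<le> S.cnorm v * S.cnorm (S.cl (\<lambda>j. u k) \<ominus>\<^bsub>?H\<^esub> v)" by blast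
  qed
  then have "S.cnorm v = 0" by simp
  then show ?thesis using v by (simp add: G.cnorm_eq_0)
qed

end

section \<open>Homogeneous tensors\<close>

text \<open>Both sides sum over all ways of cutting the word into three consecutive pieces. The
  reindexing passes from the two cut positions (i, k) to the lengths i and k - i of the first two
  pieces.\<close>

lemma word_conv_assoc: "word_conv (word_conv f g) h = word_conv f (word_conv g h)"
proof
  fix w :: "'a list"
  let ?n = "length w"
  have "word_conv (word_conv f g) h w =
      (\<Sum>k\<le>?n. \<Sum>i\<le>k. f (take i w) * g (take (k - i) (drop i w)) * h (drop k w))"
    unfolding word_conv_def
    by (intro sum.cong refl) (auto simp: sum_distrib_right min_def drop_take intro!: sum.cong)
  also have "\<dots> = (\<Sum>(k, i)\<in>Sigma {..?n} (\<lambda>k. {..k}). f (take i w) * g (take (k - i) (drop i w)) * h (drop k w))"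
    by (simp add: sum.Sigma)
  also have "\<dots> = (\<Sum>(i, j)\<in>Sigma {..?n} (\<lambda>i. {..?n - i}). f (take i w) * (g (take j (drop i w)) * h (drop j (drop i w))))"
    by (rule sum.reindex_bij_witness[where i = "\<lambda>(i, j). (i + j, i)" and j = "\<lambda>(k, i). (i, k - i)"])
       (auto simp: add.commute)
  also have "\<dots> = word_conv f (word_conv g h) w"
    unfolding word_conv_def by (simp add: sum.Sigma sum_distrib_left)
  finally show "word_conv (word_conv f g) h w = word_conv f (word_conv g h) w" .
qed

lemma word_delta_mult: "word_conv (word_delta J) f w = (if \<exists>v. w = J @ v then f (drop (length J) w) else 0)"
proof -
  have "word_conv (word_delta J) f w = (\<Sum>k\<le>length w. if k = length J \<and> take k w = J then f (drop k w) else 0)"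
    unfolding word_conv_def word_delta_def by (intro sum.cong) auto
  also have "\<dots> = (if length J \<le> length w \<and> take (length J) w = J then f (drop (length J) w) else 0)"
  proof (cases "length J \<le> length w \<and> take (length J) w = J")
    case True
    then have "(\<Sum>k\<le>length w. if k = length J \<and> take k w = J then f (drop k w) else 0)
      = (\<Sum>k\<le>length w. if k = length J then f (drop k w) else 0)"
      by (intro sum.cong) auto
    then show ?thesis using True by simp
  qed (auto intro!: sum.neutral)
  also have "length J \<le> length w \<and> take (length J) w = J \<longleftrightarrow> (\<exists>v. w = J @ v)"
    by (metis append_eq_conv_conj append_take_drop_id length_append le_add1)
  finally show ?thesis .
qed

lemma word_delta_Nil_left [simp]: "word_conv (word_delta []) f = f"
  by (rule ext) (simp add: word_delta_mult)

lemma word_delta_Nil_right [simp]: "word_conv f (word_delta []) = f"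
proof
  fix w
  have "word_conv f (word_delta []) w = (\<Sum>k\<le>length w. if k = length w then f w else 0)"
    unfolding word_conv_def word_delta_def by (intro sum.cong) auto
  then show "word_conv f (word_delta []) w = f w" by simp
qed

lemma word_conv_scale_left: "word_conv (\<lambda>w. c * f w) g = (\<lambda>w. c * word_conv f g w)"
  by (simp add: word_conv_def fun_eq_iff sum_distrib_left mult.assoc)

lemma word_conv_scale_right: "word_conv f (\<lambda>w. c * g w) = (\<lambda>w. c * word_conv f g w)"
  by (simp add: word_conv_def fun_eq_iff sum_distrib_left mult.left_commute)

lemma words_iff: "J \<in> words n m \<longleftrightarrow> set J \<subseteq> {1..n} \<and> length J = m"
  by (auto simp: words_def)

lemma finite_words [simp]: "finite (words n m)"
  by (rule finite_subset[OF _ finite_lists_length_eq[of "{1..n}" m]]) (use words_iff in blast, simp)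

lemma words_append: "J \<in> words n m \<Longrightarrow> K \<in> words n d \<Longrightarrow> J @ K \<in> words n (m + d)"
  by (auto simp: words_iff)

lemma words_take_drop: "J \<in> words n (m + d) \<Longrightarrow> take m J \<in> words n m \<and> drop m J \<in> words n d"
  using set_take_subset[of m J] set_drop_subset[of m J] by (auto simp: words_iff)

lemma words_length: "J \<in> words n m \<Longrightarrow> length J = m"
  by (simp add: words_iff)

lemma words_0 [simp]: "words n 0 = {[]}"
  by (auto simp: words_iff)

lemma sum_words_append:
  "(\<Sum>w\<in>words n (m + d). F w) = (\<Sum>J\<in>words n m. \<Sum>K\<in>words n d. F (J @ K))"
proof -
  have "(\<Sum>J\<in>words n m. \<Sum>K\<in>words n d. F (J @ K)) = (\<Sum>(J, K)\<in>words n m \<times> words n d. F (J @ K))"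
    by (simp add: sum.cartesian_product)
  also have "\<dots> = (\<Sum>w\<in>words n (m + d). F w)"
    by (rule sum.reindex_bij_witness[where i = "\<lambda>w. (take m w, drop m w)" and j = "\<lambda>(J, K). J @ K"])
       (use words_take_drop in \<open>auto simp: words_append dest: words_length\<close>)
  finally show ?thesis by simp
qed

lemma tensors_eqI:
  assumes "x \<in> tensors n m" "y \<in> tensors n m" "\<And>J. J \<in> words n m \<Longrightarrow> x J = y J"
  shows "x = y"
proof
  fix J show "x J = y J"
    using assms by (cases "J \<in> words n m") (simp_all add: tensors_def)
qed

lemma tensors_outside: "x \<in> tensors n m \<Longrightarrow> J \<notin> words n m \<Longrightarrow> x J = 0"
  by (simp add: tensors_def)

lemma tensor_split:
  assumes "x \<in> tensors n m" "y \<in> tensors n l"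
  shows "tensor x y w = (if length w = m + l then x (take m w) * y (drop m w) else 0)"
proof (cases "length w = m + l")
  case True
  then show ?thesis using tensor_append[OF assms, of "take m w" "drop m w"] by simp
next
  case False
  have "x (take k w) * y (drop k w) = 0" if "k \<le> length w" for k
  proof (cases "k = m")
    case True
    then have "drop k w \<notin> words n l" using False that by (auto simp: words_iff)
    then show ?thesis using assms(2) by (simp add: tensors_outside)
  next
    case False
    then have "take k w \<notin> words n m" using that by (auto simp: words_iff)
    then show ?thesis using assms(1) by (simp add: tensors_outside)
  qed
  then have "tensor x y w = 0"
    unfolding word_conv_def by (intro sum.neutral) simp
  then show ?thesis using False by simp
qed

lemma tensor_in_tensors:
  assumes "x \<in> tensors n m" "y \<in> tensors n l" shows "tensor x y \<in> tensors n (m + l)"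
  unfolding tensors_def
proof (intro CollectI allI impI)
  fix w assume w: "w \<notin> words n (m + l)"
  show "tensor x y w = 0"
  proof (cases "length w = m + l")
    case True
    then have "take m w \<notin> words n m \<or> drop m w \<notin> words n l"
      using w words_append[of "take m w" n m "drop m w" l] by auto
    then show ?thesis using assms by (auto simp: tensor_split[OF assms] tensors_outside)
  qed (simp add: tensor_split[OF assms])
qed

lemma scale_in_tensors: "x \<in> tensors n m \<Longrightarrow> (\<lambda>w. c * x w) \<in> tensors n m"
  by (simp add: tensors_def)

lemma word_delta_in_tensors [simp]: "word_delta [] \<in> tensors n 0"
  by (simp add: tensors_def word_delta_def)

lemma tensors_0: assumes "x \<in> tensors n 0" shows "x = (\<lambda>w. x [] * word_delta [] w)"
  using assms by (intro ext) (auto simp: tensors_def word_delta_def)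

lemma nonzero_word: assumes "x \<in> tensors n m" "x \<noteq> (\<lambda>w. 0)" obtains J where "J \<in> words n m" "x J \<noteq> 0"
  using assms by (auto simp: tensors_def fun_eq_iff)

section \<open>Cancellation, equidivisibility and commutation of tensors\<close>

lemma tensor_nonzero:
  assumes x: "x \<in> tensors n m" "x \<noteq> (\<lambda>w. 0)" and y: "y \<in> tensors n l" "y \<noteq> (\<lambda>w. 0)"
  shows "tensor x y \<noteq> (\<lambda>w. 0)"
proof -
  obtain J where J: "J \<in> words n m" "x J \<noteq> 0" using nonzero_word[OF x] by blast
  obtain K where K: "K \<in> words n l" "y K \<noteq> 0" using nonzero_word[OF y] by blast
  have "tensor x y (J @ K) = x J * y K"
    using J K by (intro tensor_append[OF x(1) y(1)]) (auto simp: words_iff)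
  then have "tensor x y (J @ K) \<noteq> 0" using J K by simp
  then show ?thesis by auto
qed

text \<open>Fix a word L in the support of d. Reading off the values of b at the words ending in L
  and dividing by \<open>d L\<close> produces the middle factor e. This carries the equidivisibility
  of free monoids over to homogeneous tensors; in all equations below it is the means of splitting
  off a factor.\<close>

lemma equidivisible:
  assumes a: "a \<in> tensors n i" and b: "b \<in> tensors n k" and c: "c \<in> tensors n j" and d: "d \<in> tensors n l"
    and ij: "i \<le> j" "i + k = j + l" and eq: "tensor a b = tensor c d" and nz: "d \<noteq> (\<lambda>w. 0)"
  obtains e where "e \<in> tensors n (j - i)" "c = tensor a e"
proof -
  obtain L where L: "L \<in> words n l" "d L \<noteq> 0" using nonzero_word[OF d nz] by blast
  define e where "e w = (if w \<in> words n (j - i) then b (w @ L) / d L else 0)" for w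
  have e: "e \<in> tensors n (j - i)" by (simp add: e_def tensors_def)
  have "c = tensor a e"
  proof (rule tensors_eqI[OF c])
    show "tensor a e \<in> tensors n j" using tensor_in_tensors[OF a e] ij by simp
    fix W assume W: "W \<in> words n j"
    then have td: "take i W \<in> words n i" "drop i W \<in> words n (j - i)" and len: "length W = j"
      using words_take_drop[of W n i "j - i"] ij by (auto simp: words_iff)
    have "c W * d L = tensor c d (W @ L)"
      using W L by (intro tensor_append[OF c d, symmetric]) (auto simp: words_iff)
    also have "\<dots> = tensor a b (W @ L)" by (simp add: eq)
    also have "W @ L = take i W @ (drop i W @ L)"
      by (simp flip: append_assoc)
    also have "tensor a b \<dots> = a (take i W) * b (drop i W @ L)"
      by (rule tensor_append[OF a b]) (use td L len ij in \<open>simp_all add: words_iff\<close>)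
    finally have "c W = a (take i W) * e (drop i W)"
      using L td by (simp add: e_def field_simps)
    also have "\<dots> = tensor a e W"
      using tensor_append[OF a e, of "take i W" "drop i W"] td by (simp add: words_iff)
    finally show "c W = tensor a e W" .
  qed
  then show ?thesis using that e by blast
qed

text \<open>Comparing both products at J @ K for a single J in the support of a is enough.\<close>

lemma tensor_left_cancel:
  assumes a: "a \<in> tensors n i" "a \<noteq> (\<lambda>w. 0)" and b: "b \<in> tensors n k" "b' \<in> tensors n k"
    and eq: "tensor a b = tensor a b'"
  shows "b = b'"
proof (rule tensors_eqI[OF b])
  fix K assume K: "K \<in> words n k"
  obtain J where J: "J \<in> words n i" "a J \<noteq> 0" using nonzero_word[OF a] by blast
  have "a J * b K = a J * b' K"
    using tensor_append[OF a(1) b(1), of J K] tensor_append[OF a(1) b(2), of J K] J K eq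
    by (simp add: words_iff)
  then show "b K = b' K" using J by simp
qed

text \<open>The words of \<open>supp x\<close> and \<open>supp u\<close> that are lexicographically largest determine the largest word
  of the support of either product, and its coefficient is \<open>x\<^sub>A u\<^sub>B\<close> in both.\<close>

lemma commutation_scalar:
  assumes x: "x \<in> tensors n m" "x \<noteq> (\<lambda>w. 0)" and u: "u \<in> tensors n d" "u \<noteq> (\<lambda>w. 0)"
    and eq: "tensor x u = (\<lambda>w. c * tensor u x w)"
  shows "c = 1"
proof -
  \<comment> \<open>Words are read as numerals in base n + 1, whose digits include the letters 1,
    ..., n; on words of one length the order of the values is the lexicographic order.\<close>
  define N where "N = Suc n"
  define val where "val = foldl (\<lambda>a i. a * N + i) 0"
  have val_foldl: "foldl (\<lambda>a i. a * N + i) a w = a * N ^ length w + val w" for a w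
    unfolding val_def
  proof (induction w arbitrary: a)
    case (Cons i w)
    show ?case using Cons[of "a * N + i"] Cons[of i] by (simp add: algebra_simps)
  qed simp
  have val_append: "val (A @ B) = val A * N ^ length B + val B" for A B
    using val_foldl[of "val A" B] by (simp add: val_def)
  have val_Cons: "val (i # w) = i * N ^ length w + val w" for i w
    using val_append[of "[i]" w] by (simp add: val_def)
  have val_less: "val w < N ^ length w" if "set w \<subseteq> {1..n}" for w
    using that
  proof (induction w)
    case (Cons i w)
    then have "i * N ^ length w + val w < i * N ^ length w + N ^ length w" by simp
    also have "\<dots> = Suc i * N ^ length w" by simp
    also have "\<dots> \<le> N * N ^ length w" using Cons by (intro mult_right_mono) (auto simp: N_def)
    finally show ?case by (simp add: val_Cons)
  qed (simp add: val_def)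
  have val_inj: "w = w'" if "set w \<subseteq> {1..n}" "set w' \<subseteq> {1..n}" "length w = length w'" "val w = val w'" for w w'
    using that
  proof (induction w arbitrary: w')
    case (Cons i w)
    then obtain i' v where w': "w' = i' # v" by (cases w') auto
    have len: "length v = length w" using Cons w' by simp
    have lt: "val w < N ^ length w" "val v < N ^ length w"
      using val_less[of w] val_less[of v] Cons.prems w' len by auto
    have e: "i * N ^ length w + val w = i' * N ^ length w + val v"
      using Cons.prems(4) w' len by (simp add: val_Cons)
    have P: "N ^ length w \<noteq> 0" by (simp add: N_def)
    have "i = (i * N ^ length w + val w) div N ^ length w"
      using lt(1) div_mult_self3[OF P, of i "val w"] by simp
    also have "\<dots> = i'"
      unfolding e using lt(2) div_mult_self3[OF P, of i' "val v"] by simp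
    finally have "i = i'" .
    then show ?case using Cons w' e len by auto
  qed simp
  have ex_max: "\<exists>A. A \<in> words n k \<and> y A \<noteq> 0 \<and> (\<forall>B. B \<in> words n k \<longrightarrow> y B \<noteq> 0 \<longrightarrow> val B \<le> val A)"
    if "y \<in> tensors n k" "y \<noteq> (\<lambda>w. 0)" for y :: "nat list \<Rightarrow> complex" and k
  proof -
    let ?S = "{B \<in> words n k. y B \<noteq> 0}"
    have "finite ?S" "?S \<noteq> {}" using nonzero_word[OF that] by auto
    then have "Max (val ` ?S) \<in> val ` ?S" by (intro Max_in) auto
    then obtain A where A: "A \<in> ?S" "Max (val ` ?S) = val A" by (rule imageE) simp
    have "val B \<le> val A" if "B \<in> ?S" for B
      unfolding A(2)[symmetric] using that \<open>finite ?S\<close> by (intro Max_ge) auto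
    then show ?thesis using A(1) by auto
  qed
  obtain A where A: "A \<in> words n m" "x A \<noteq> 0" "\<And>B. B \<in> words n m \<Longrightarrow> x B \<noteq> 0 \<Longrightarrow> val B \<le> val A"
    using ex_max[OF x] by blast
  obtain B where B: "B \<in> words n d" "u B \<noteq> 0" "\<And>C. C \<in> words n d \<Longrightarrow> u C \<noteq> 0 \<Longrightarrow> val C \<le> val B"
    using ex_max[OF u] by blast
  have le_xu: "val w \<le> val (A @ B)" if "tensor x u w \<noteq> 0" for w
  proof -
    have len: "length w = m + d" and nz: "x (take m w) \<noteq> 0" "u (drop m w) \<noteq> 0"
      using that by (auto simp: tensor_split[OF x(1) u(1)] split: if_splits)
    then have wd: "take m w \<in> words n m" "drop m w \<in> words n d"
      using tensors_outside x(1) u(1) by blast+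
    have "val w = val (take m w) * N ^ d + val (drop m w)"
      using val_append[of "take m w" "drop m w"] len by simp
    also have "\<dots> \<le> val A * N ^ d + val B"
      using A(3)[OF wd(1) nz(1)] B(3)[OF wd(2) nz(2)] by (intro add_mono mult_right_mono) auto
    also have "\<dots> = val (A @ B)" using B by (simp add: val_append words_iff)
    finally show ?thesis .
  qed
  have le_ux: "val w \<le> val (B @ A)" if "tensor u x w \<noteq> 0" for w
  proof -
    have len: "length w = d + m" and nz: "u (take d w) \<noteq> 0" "x (drop d w) \<noteq> 0"
      using that by (auto simp: tensor_split[OF u(1) x(1)] split: if_splits)
    then have wd: "take d w \<in> words n d" "drop d w \<in> words n m"
      using tensors_outside x(1) u(1) by blast+
    have "val w = val (take d w) * N ^ m + val (drop d w)"
      using val_append[of "take d w" "drop d w"] len by simp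
    also have "\<dots> \<le> val B * N ^ m + val A"
      using A(3)[OF wd(2) nz(2)] B(3)[OF wd(1) nz(1)] by (intro add_mono mult_right_mono) auto
    also have "\<dots> = val (B @ A)" using A by (simp add: val_append words_iff)
    finally show ?thesis .
  qed
  have xu: "tensor x u (A @ B) = x A * u B" and ux: "tensor u x (B @ A) = u B * x A"
    using A B by (auto intro!: tensor_append[OF x(1) u(1)] tensor_append[OF u(1) x(1)] simp: words_iff)
  \<comment> \<open>As c is nonzero, both products have the same support, with largest word A @ B
    and also B @ A. Since \<open>val\<close> is injective on words of one length, these words
    coincide.\<close>
  have "tensor x u (A @ B) \<noteq> 0" "tensor u x (B @ A) \<noteq> 0" using A B by (simp_all add: xu ux)
  moreover have "c \<noteq> 0" using eq \<open>tensor x u (A @ B) \<noteq> 0\<close> by auto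
  ultimately have "tensor u x (A @ B) \<noteq> 0" "tensor x u (B @ A) \<noteq> 0" by (auto simp: eq)
  then have "val (A @ B) = val (B @ A)" using le_xu le_ux by (simp add: le_antisym)
  then have "A @ B = B @ A" using A B by (intro val_inj) (auto simp: words_iff)
  then have "x A * u B = c * (u B * x A)" using xu ux eq by metis
  then show ?thesis using A B by (simp add: mult_ac)
qed

section \<open>Powers, norms and roots of tensors\<close>

lemma tensor_power_in: "x \<in> tensors n m \<Longrightarrow> tensor_power x p \<in> tensors n (p * m)"
  by (induction p) (simp_all add: tensor_in_tensors)

lemma tensor_power_add: "tensor_power x (p + q) = tensor (tensor_power x p) (tensor_power x q)"
  by (induction p) (simp_all add: word_conv_assoc)

lemma tensor_power_1 [simp]: "tensor_power x (Suc 0) = x"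
  by simp

lemma tensor_power_Suc_right: "tensor_power x (Suc p) = tensor (tensor_power x p) x"
  using tensor_power_add[of x p 1] by simp

lemma tensor_power_mult: "tensor_power x (q * p) = tensor_power (tensor_power x q) p"
  by (induction p) (simp_all add: tensor_power_add)

lemma tensor_power_scale: "tensor_power (\<lambda>w. a * x w) p = (\<lambda>w. a ^ p * tensor_power x p w)"
  by (induction p) (simp_all add: word_conv_scale_left word_conv_scale_right mult_ac)

lemma tensor_power_nonzero:
  assumes "x \<in> tensors n m" "x \<noteq> (\<lambda>w. 0)" shows "tensor_power x p \<noteq> (\<lambda>w. 0)"
proof (induction p)
  case 0
  then show ?case by (auto simp: word_delta_def fun_eq_iff)
next
  case (Suc p)
  then show ?case using tensor_nonzero[OF assms tensor_power_in[OF assms(1)]] by simp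
qed

definition sqnorm :: "nat \<Rightarrow> nat \<Rightarrow> (nat list \<Rightarrow> complex) \<Rightarrow> real" where
  "sqnorm n m x = (\<Sum>J\<in>words n m. (cmod (x J))\<^sup>2)"

lemma sqnorm_tensor:
  assumes "x \<in> tensors n m" "y \<in> tensors n l"
  shows "sqnorm n (m + l) (tensor x y) = sqnorm n m x * sqnorm n l y"
proof -
  have "sqnorm n (m + l) (tensor x y) = (\<Sum>J\<in>words n m. \<Sum>K\<in>words n l. (cmod (tensor x y (J @ K)))\<^sup>2)"
    by (simp add: sqnorm_def sum_words_append)
  also have "\<dots> = (\<Sum>J\<in>words n m. \<Sum>K\<in>words n l. (cmod (x J))\<^sup>2 * (cmod (y K))\<^sup>2)"
    by (intro sum.cong refl)
       (simp add: tensor_append[OF assms] words_iff norm_mult power_mult_distrib)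
  finally show ?thesis by (simp add: sqnorm_def sum_product)
qed

lemma unit_tensors_iff: "x \<in> unit_tensors n m \<longleftrightarrow> x \<in> tensors n m \<and> sqnorm n m x = 1"
  by (simp add: unit_tensors_def sqnorm_def)

lemma sqnorm_power: "x \<in> tensors n m \<Longrightarrow> sqnorm n (p * m) (tensor_power x p) = sqnorm n m x ^ p"
  by (induction p) (simp_all add: sqnorm_tensor tensor_power_in, simp add: sqnorm_def word_delta_def)

lemma unit_power: "x \<in> unit_tensors n m \<Longrightarrow> tensor_power x p \<in> unit_tensors n (p * m)"
  by (simp add: unit_tensors_iff sqnorm_power tensor_power_in)

lemma unit_nonzero: "x \<in> unit_tensors n m \<Longrightarrow> x \<noteq> (\<lambda>w. 0)"
  by (auto simp: unit_tensors_iff sqnorm_def)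

lemma sqnorm_nonneg: "sqnorm n m x \<ge> 0"
  by (simp add: sqnorm_def sum_nonneg)

text \<open>Descent on the order: a periodic vector is a proper power of a shorter one, which is
  again a unit vector because the norm is multiplicative.\<close>

lemma nonperiodic_root:
  assumes "z \<in> unit_tensors n m" "m \<ge> 1"
  shows "\<exists>x k p. x \<in> unit_tensors n k \<and> k \<ge> 1 \<and> p \<ge> 1 \<and> nonperiodic n x \<and> z = tensor_power x p"
  using assms
proof (induction m arbitrary: z rule: less_induct)
  case (less m z)
  show ?case
  proof (cases "nonperiodic n z")
    case True
    then show ?thesis using less.prems by (intro exI[of _ z] exI[of _ m] exI[of _ 1]) simp
  next
    case False
    then obtain p x k where px: "p \<ge> 1" "p \<noteq> 1" "k \<ge> 1" "x \<in> tensors n k" "z = tensor_power x p"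
      unfolding nonperiodic_def by auto
    obtain J where J: "J \<in> words n m" "z J \<noteq> 0"
      using less.prems(1) nonzero_word unit_nonzero unfolding unit_tensors_iff by metis
    \<comment> \<open>The order of a nonzero tensor can be read off from any word of its support;
      this identifies m with p * k.\<close>
    have "J \<in> words n (p * k)"
      using J(2) tensor_power_in[OF px(4), of p] px(5) tensors_outside by metis
    then have m: "m = p * k" using J(1) by (simp add: words_iff)
    have "sqnorm n k x ^ p = 1"
      using less.prems(1) sqnorm_power[OF px(4), of p] px(5) m by (simp add: unit_tensors_iff)
    then have "sqnorm n k x = 1"
      using power_eq_imp_eq_base[of "sqnorm n k x" p 1] sqnorm_nonneg[of n k x] px(1) by simp
    then have x: "x \<in> unit_tensors n k" using px by (simp add: unit_tensors_iff)
    have "k < m" using px m by (cases p) auto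
    then obtain y l q where "y \<in> unit_tensors n l" "l \<ge> 1" "q \<ge> 1" "nonperiodic n y" "x = tensor_power y q"
      using less.IH[OF _ x px(3)] by blast
    then show ?thesis
      using px by (intro exI[of _ y] exI[of _ l] exI[of _ "q * p"]) (simp add: tensor_power_mult)
  qed
qed

text \<open>The Euclidean algorithm for commuting words: the shorter tensor divides the longer one
  on the left, and the quotient commutes with the shorter again. The scalars a and b appear because
  a quotient of order 0 is only a number.\<close>

lemma commuting_common_root:
  assumes "x \<in> tensors n m" "x \<noteq> (\<lambda>w. 0)" "u \<in> tensors n d" "u \<noteq> (\<lambda>w. 0)" "m \<ge> 1" "d \<ge> 1"
    and "tensor x u = tensor u x"
  shows "\<exists>w k i j a b. w \<in> tensors n k \<and> k \<ge> 1 \<and> i \<ge> 1 \<and> j \<ge> 1 \<and> m = i * k \<and> d = j * k \<and>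
    x = (\<lambda>v. a * tensor_power w i v) \<and> u = (\<lambda>v. b * tensor_power w j v)"
  using assms
proof (induction "m + d" arbitrary: m d x u rule: less_induct)
  case less
  show ?case
  proof (cases "m \<le> d")
    case True
    obtain e where e: "e \<in> tensors n (d - m)" "u = tensor x e"
      by (rule equidivisible[OF less.prems(1,3,3,1) True _ less.prems(7,2)]) auto
    show ?thesis
    proof (cases "d = m")
      case True
      \<comment> \<open>At equal orders the quotient is a scalar, so u is a multiple of x and x
        serves as the common root.\<close>
      then have "e = (\<lambda>w. e [] * word_delta [] w)" using tensors_0 e(1) by simp
      then have "tensor x e = tensor x (\<lambda>w. e [] * word_delta [] w)" by (rule arg_cong)
      then have "u = (\<lambda>w. e [] * x w)" using e(2) by (simp add: word_conv_scale_right)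
      then show ?thesis
        using less.prems True
        by (intro exI[of _ x] exI[of _ m] exI[of _ 1] exI[of _ "e []"]) auto
    next
      case False
      have "tensor x (tensor x e) = tensor x (tensor e x)"
        using less.prems(7) by (simp add: e(2) word_conv_assoc)
      then have "tensor x e = tensor e x"
        using tensor_left_cancel[OF less.prems(1,2)] tensor_in_tensors[OF less.prems(1) e(1)]
          tensor_in_tensors[OF e(1) less.prems(1)] by (simp add: add.commute)
      moreover have enz: "e \<noteq> (\<lambda>w. 0)" using less.prems(4) e(2) by (auto simp: word_conv_def)
      moreover have "m + (d - m) < m + d" "1 \<le> d - m" using True False less.prems by auto
      ultimately obtain w k i j a b where w: "w \<in> tensors n k" "k \<ge> 1" "i \<ge> 1" "j \<ge> 1" "m = i * k" "d - m = j * k"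
          "x = (\<lambda>v. a * tensor_power w i v)" "e = (\<lambda>v. b * tensor_power w j v)"
        using less.hyps[OF _ less.prems(1,2) e(1) enz less.prems(5)] by blast
      have "u = (\<lambda>v. (a * b) * tensor_power w (i + j) v)"
        unfolding e(2) w(7,8) by (simp add: word_conv_scale_left word_conv_scale_right tensor_power_add mult_ac)
      moreover have "d = (i + j) * k" using w True by (simp add: algebra_simps)
      ultimately show ?thesis using w by (intro exI[of _ w] exI[of _ k] exI[of _ i] exI[of _ "i + j"] exI[of _ a] exI[of _ "a * b"]) auto
    qed
  next
    case False
    then have dm: "d \<le> m" by simp
    obtain e where e: "e \<in> tensors n (m - d)" "x = tensor u e"
      by (rule equidivisible[OF less.prems(3,1,1,3) dm _ less.prems(7)[symmetric] less.prems(4)]) auto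
    have "tensor u (tensor u e) = tensor u (tensor e u)"
      using less.prems(7) by (simp add: e(2) word_conv_assoc)
    then have "tensor u e = tensor e u"
      using tensor_left_cancel[OF less.prems(3,4)] tensor_in_tensors[OF less.prems(3) e(1)]
        tensor_in_tensors[OF e(1) less.prems(3)] by (simp add: add.commute)
    moreover have enz: "e \<noteq> (\<lambda>w. 0)" using less.prems(2) e(2) by (auto simp: word_conv_def)
    moreover have "d + (m - d) < m + d" "1 \<le> m - d" using False less.prems by auto
    ultimately obtain w k i j a b where w: "w \<in> tensors n k" "k \<ge> 1" "i \<ge> 1" "j \<ge> 1" "d = i * k" "m - d = j * k"
        "u = (\<lambda>v. a * tensor_power w i v)" "e = (\<lambda>v. b * tensor_power w j v)"
      using less.hyps[OF _ less.prems(3,4) e(1) enz less.prems(6)] by blast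
    have "x = (\<lambda>v. (a * b) * tensor_power w (i + j) v)"
      unfolding e(2) w(7,8) by (simp add: word_conv_scale_left word_conv_scale_right tensor_power_add mult_ac)
    moreover have "m = (i + j) * k" using w False by (simp add: algebra_simps)
    ultimately show ?thesis using w by (intro exI[of _ w] exI[of _ k] exI[of _ "i + j"] exI[of _ i] exI[of _ "a * b"] exI[of _ a]) auto
  qed
qed

lemma complex_root_exists: "p \<ge> 1 \<Longrightarrow> \<exists>\<alpha>::complex. \<alpha> ^ p = a"
proof -
  assume p: "p \<ge> 1"
  show ?thesis
  proof (cases "a = 0")
    case False
    have "(cis (Arg a / p) * complex_of_real (root p (cmod a))) ^ p = cis (Arg a) * complex_of_real (cmod a)"
      using p by (simp add: power_mult_distrib DeMoivre flip: of_real_power)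
    also have "\<dots> = a" using rcis_cmod_Arg[of a] by (simp add: rcis_def mult.commute)
    finally show ?thesis by blast
  qed (use p in auto)
qed

text \<open>A common root w would give x = a w^i. An i-th root of a can be absorbed into w, so
  nonperiodicity forces i = 1; then d is a positive multiple of m, against d < m.\<close>

lemma nonperiodic_no_commuting:
  assumes x: "x \<in> tensors n m" "x \<noteq> (\<lambda>w. 0)" "nonperiodic n x" and u: "u \<in> tensors n d" "u \<noteq> (\<lambda>w. 0)"
    and d: "0 < d" "d < m"
  shows "tensor x u \<noteq> tensor u x"
proof
  assume comm: "tensor x u = tensor u x"
  have md: "m \<ge> 1" "d \<ge> 1" using d by auto
  obtain w k i j a b where w: "w \<in> tensors n k" "k \<ge> 1" "i \<ge> 1" "j \<ge> 1" "m = i * k" "d = j * k"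
    "x = (\<lambda>v. a * tensor_power w i v)"
    using commuting_common_root[OF x(1,2) u md comm] by blast
  obtain \<alpha> where \<alpha>: "\<alpha> ^ i = a" using complex_root_exists[OF w(3)] by blast
  have "x = tensor_power (\<lambda>v. \<alpha> * w v) i" using w(7) by (simp add: tensor_power_scale \<alpha>)
  moreover have "(\<lambda>v. \<alpha> * w v) \<in> (\<Union>k\<in>{1..}. tensors n k)" using w scale_in_tensors by blast
  ultimately have "i = 1" using x(3) w(3) unfolding nonperiodic_def by blast
  then show False using d w by (cases j) auto
qed

text \<open>As long as u has order at least m, a factor x splits off on the left and the quotient
  still commutes with x^p. A remainder of order strictly between 0 and m would commute with x
  itself, which \<open>nonperiodic_no_commuting\<close> excludes, so the remainder is a
  scalar.\<close>

lemma commuting_with_power: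
  assumes x: "x \<in> tensors n m" "x \<noteq> (\<lambda>w. 0)" "nonperiodic n x" "m \<ge> 1" and p: "p \<ge> 1"
    and u: "u \<in> tensors n d" "u \<noteq> (\<lambda>w. 0)" and comm: "tensor (tensor_power x p) u = tensor u (tensor_power x p)"
  shows "\<exists>j c. u = (\<lambda>w. c * tensor_power x j w) \<and> d = j * m"
  using u comm
proof (induction d arbitrary: u rule: less_induct)
  case (less d u)
  obtain q where q: "p = Suc q" using p by (cases p) auto
  let ?X = "tensor_power x p" and ?Y = "tensor_power x q"
  have XY: "?X = tensor x ?Y" "?X = tensor ?Y x" by (simp_all add: q tensor_power_Suc_right[symmetric])
  note X = tensor_power_in[OF x(1), of p] and Y = tensor_power_in[OF x(1), of q]
  note Xnz = tensor_power_nonzero[OF x(1,2), of p]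
  have Yu: "tensor ?Y u \<in> tensors n (q * m + d)" using tensor_in_tensors[OF Y less.prems(1)] .
  have Yunz: "tensor ?Y u \<noteq> (\<lambda>w. 0)"
    using tensor_nonzero[OF Y tensor_power_nonzero[OF x(1,2)] less.prems(1,2)] .
  have eq: "tensor x (tensor ?Y u) = tensor u ?X"
    using less.prems(3) by (simp add: XY(1) word_conv_assoc)
  consider "d = 0" | "d \<ge> m" | "0 < d" "d < m" by linarith
  then show ?case
  proof cases
    case 1
    then have "u = (\<lambda>w. u [] * tensor_power x 0 w)" using tensors_0 less.prems(1) by auto
    then show ?thesis using 1 by (intro exI[of _ 0] exI[of _ "u []"]) auto
  next
    case 2
    obtain e where e: "e \<in> tensors n (d - m)" "u = tensor x e"
      by (rule equidivisible[OF x(1) Yu less.prems(1) X 2 _ eq Xnz]) (simp add: q)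
    have "tensor x (tensor ?X e) = tensor x (tensor e ?X)"
    proof -
      have "tensor x (tensor ?X e) = tensor (tensor x (tensor ?Y x)) e"
        by (simp add: XY(2) word_conv_assoc)
      also have "\<dots> = tensor ?X u" by (simp add: XY(1) e(2) word_conv_assoc)
      also have "\<dots> = tensor x (tensor e ?X)" using less.prems(3) by (simp add: e(2) word_conv_assoc)
      finally show ?thesis .
    qed
    then have "tensor ?X e = tensor e ?X"
      using tensor_left_cancel[OF x(1,2)] tensor_in_tensors[OF X e(1)] tensor_in_tensors[OF e(1) X]
      by (simp add: add.commute)
    moreover have "e \<noteq> (\<lambda>w. 0)" using less.prems(2) e(2) by (auto simp: word_conv_def)
    ultimately obtain j c where jc: "e = (\<lambda>w. c * tensor_power x j w)" "d - m = j * m"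
      using less.IH[of "d - m" e] e x(4) 2 by auto
    have "u = (\<lambda>w. c * tensor_power x (Suc j) w)"
      unfolding e(2) by (simp add: jc(1) word_conv_scale_right)
    then show ?thesis using jc 2 by (intro exI[of _ "Suc j"] exI[of _ c]) auto
  next
    case 3
    \<comment> \<open>Now x = u f, and cancelling u in u x^p = x^p u gives x^p = f x^q u. The aim is
      u f = f u.\<close>
    obtain f where f: "f \<in> tensors n (m - d)" "x = tensor u f"
      by (rule equidivisible[OF less.prems(1) X x(1) Yu _ _ eq[symmetric] Yunz]) (use 3 in \<open>auto simp: q\<close>)
    have fnz: "f \<noteq> (\<lambda>w. 0)" using x(2) f(2) by (auto simp: word_conv_def)
    note uf = tensor_in_tensors[OF less.prems(1) f(1)] and fu = tensor_in_tensors[OF f(1) less.prems(1)]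
    have "tensor u (tensor f (tensor ?Y u)) = tensor u ?X"
      using eq by (simp add: f(2) word_conv_assoc)
    then have fYu: "tensor f (tensor ?Y u) = ?X"
      using tensor_left_cancel[OF less.prems(1,2)] tensor_in_tensors[OF f(1) Yu] X 3
      by (simp add: q algebra_simps)
    have "tensor u f = tensor f u"
    proof (cases q)
      case 0
      then show ?thesis using fYu f(2) XY(1) by simp
    next
      case (Suc r)
      let ?R = "tensor_power x r"
      note R = tensor_power_in[OF x(1), of r]
      note RU = tensor_in_tensors[OF R less.prems(1)]
      note fRu = tensor_in_tensors[OF f(1) RU]
      \<comment> \<open>With one more factor x = u f available, x^p begins with f u as well as with
        u f. Both have order m, so they are proportional, and \<open>commutation_scalar\<close>
        shows that the factor is 1.\<close>
      have "?Y = tensor (tensor u f) ?R" using Suc f(2) by simp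
      then have "tensor (tensor f u) (tensor f (tensor ?R u)) = tensor (tensor u f) ?Y"
        using fYu XY(1) f(2) by (simp add: word_conv_assoc)
      then obtain e where e: "e \<in> tensors n (d + (m - d) - (m - d + d))" "tensor u f = tensor (tensor f u) e"
        by (rule equidivisible[OF fu fRu uf Y, rotated 2])
           (use 3 Suc tensor_power_nonzero[OF x(1,2), of q] in \<open>auto simp: algebra_simps\<close>)
      have "e = (\<lambda>w. e [] * word_delta [] w)" using tensors_0 e(1) by simp
      then have "tensor (tensor f u) e = tensor (tensor f u) (\<lambda>w. e [] * word_delta [] w)" by (rule arg_cong)
      then have "tensor u f = (\<lambda>w. e [] * tensor f u w)" using e(2) by (simp add: word_conv_scale_right)
      moreover from this have "e [] = 1" by (rule commutation_scalar[OF less.prems(1,2) f(1) fnz])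
      ultimately show ?thesis by simp
    qed
    then have "tensor x u = tensor u x"
      unfolding f(2) word_conv_assoc by (simp only:)
    then show ?thesis using nonperiodic_no_commuting[OF x(1,2,3) less.prems(1,2) 3] by simp
  qed
qed

lemma indecomposableD:
  assumes "indecomposable n z" "x \<in> tensors n k" "y \<in> tensors n l" "k \<ge> 1" "l \<ge> 1"
  shows "z \<noteq> tensor x y"
  using assms unfolding indecomposable_def by (metis UN_I atLeast_iff)

text \<open>Factors z are stripped off u until its order drops below m. A remainder of positive
  order would be a proper left factor of z, so the remainder is a scalar and z^a = y^b. Of z and y
  the shorter one would then divide the longer one, hence m = l. The clause for a = 1 matches the
  exponents chosen when both orders agree from the start.\<close>

lemma indecomposable_conjugate:
  assumes z: "z \<in> tensors n m" "indecomposable n z" "m \<ge> 1" "z \<noteq> (\<lambda>w. 0)"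
    and y: "y \<in> tensors n l" "indecomposable n y" "l \<ge> 1" "y \<noteq> (\<lambda>w. 0)"
    and ab: "a \<ge> 1" "b \<ge> 1" "a * m = b * l"
    and u: "u \<in> tensors n d" "u \<noteq> (\<lambda>w. 0)"
    and eq: "tensor (tensor_power z a) u = tensor u (tensor_power y b)"
  shows "m = l \<and> (a = 1 \<longrightarrow> z = y)"
  using u eq
proof (induction d arbitrary: u rule: less_induct)
  case (less d u)
  obtain a' where a': "a = Suc a'" using ab by (cases a) auto
  obtain b' where b': "b = Suc b'" using ab by (cases b) auto
  let ?Z = "tensor_power z a" and ?Y = "tensor_power y b"
  let ?Z' = "tensor_power z a'" and ?Y' = "tensor_power y b'"
  note Z = tensor_power_in[OF z(1), of a] and Y = tensor_power_in[OF y(1), of b]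
  note Z' = tensor_power_in[OF z(1), of a'] and Y' = tensor_power_in[OF y(1), of b']
  note nz = tensor_power_nonzero[OF z(1,4)] tensor_power_nonzero[OF y(1,4)]
  have Z'u: "tensor ?Z' u \<in> tensors n (a' * m + d)" using tensor_in_tensors[OF Z' less.prems(1)] .
  have Z'unz: "tensor ?Z' u \<noteq> (\<lambda>w. 0)" using tensor_nonzero[OF Z' nz(1) less.prems(1,2)] .
  have eq: "tensor z (tensor ?Z' u) = tensor u ?Y"
    using less.prems(3) by (simp add: a' word_conv_assoc)
  consider "d = 0" | "d \<ge> m" | "0 < d" "d < m" by linarith
  then show ?case
  proof cases
    case 1
    then have u0: "u = (\<lambda>w. u [] * word_delta [] w)" using tensors_0 less.prems(1) by auto
    then have c: "u [] \<noteq> 0" using less.prems(2) by (metis mult_zero_left)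
    have "(\<lambda>w. u [] * ?Z w) = (\<lambda>w. u [] * ?Y w)"
      using less.prems(3) by (subst (asm) (1 2) u0) (simp add: word_conv_scale_left word_conv_scale_right)
    then have ZY: "?Z = ?Y" using c by (simp add: fun_eq_iff)
    have zy: "tensor z ?Z' = tensor y ?Y'" using ZY by (simp add: a' b')
    have "\<not> m < l"
    proof
      assume "m < l"
      then obtain e where "e \<in> tensors n (l - m)" "y = tensor z e"
        by (rule equidivisible[OF z(1) Z' y(1) Y' less_imp_le _ zy nz(2)]) (use ab in \<open>auto simp: a' b'\<close>)
      then show False using indecomposableD[OF y(2) z(1), of e "l - m"] z(3) \<open>m < l\<close> by auto
    qed
    moreover have "\<not> l < m"
    proof
      assume "l < m"
      then obtain e where "e \<in> tensors n (m - l)" "z = tensor y e"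
        by (rule equidivisible[OF y(1) Y' z(1) Z' less_imp_le _ zy[symmetric] nz(1)]) (use ab in \<open>auto simp: a' b'\<close>)
      then show False using indecomposableD[OF z(2) y(1), of e "m - l"] y(3) \<open>l < m\<close> by auto
    qed
    ultimately have ml: "m = l" by simp
    have "z = y" if "a = 1"
    proof -
      have "b = 1" using that ab ml z(3) by simp
      then show ?thesis using ZY that by simp
    qed
    then show ?thesis using ml by simp
  next
    case 2
    obtain e where e: "e \<in> tensors n (d - m)" "u = tensor z e"
      by (rule equidivisible[OF z(1) Z'u less.prems(1) Y 2 _ eq nz(2)]) (use ab in \<open>simp add: a'\<close>)
    have "tensor z (tensor ?Z e) = tensor (tensor_power z (Suc a)) e" by (simp add: word_conv_assoc)
    also have "\<dots> = tensor ?Z u" by (simp only: tensor_power_Suc_right) (simp add: e(2) word_conv_assoc)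
    also have "\<dots> = tensor z (tensor e ?Y)" using less.prems(3) by (simp add: e(2) word_conv_assoc)
    finally have "tensor ?Z e = tensor e ?Y"
      using tensor_left_cancel[OF z(1,4)] tensor_in_tensors[OF Z e(1)] tensor_in_tensors[OF e(1) Y] ab
      by (simp add: add.commute)
    moreover have "e \<noteq> (\<lambda>w. 0)" using less.prems(2) e(2) by (auto simp: word_conv_def)
    ultimately show ?thesis using less.IH[of "d - m" e] e z(3) 2 by auto
  next
    case 3
    then obtain f where "f \<in> tensors n (m - d)" "z = tensor u f"
      by (rule_tac equidivisible[OF less.prems(1) Y z(1) Z'u _ _ eq[symmetric] Z'unz]) (use ab in \<open>auto simp: a'\<close>)
    then show ?thesis using indecomposableD[OF z(2) less.prems(1), of f "m - d"] 3 by auto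
  qed
qed

lemma indecomposable_nonperiodic:
  assumes "indecomposable n z" shows "nonperiodic n z"
  unfolding nonperiodic_def
proof (intro allI impI ballI)
  fix p x assume p: "1 \<le> p" and "x \<in> (\<Union>k\<in>{1..}. tensors n k)" and z: "z = tensor_power x p"
  then obtain k where x: "k \<ge> 1" "x \<in> tensors n k" by auto
  show "p = 1"
  proof (rule ccontr)
    assume "p \<noteq> 1"
    then obtain q where q: "p = Suc q" "q \<ge> 1" using p by (cases p) auto
    then show False
      using indecomposableD[OF assms x(2) tensor_power_in[OF x(2), of q]] x z by simp
  qed
qed

section \<open>Functionals on words\<close>

definition letters :: "nat \<Rightarrow> nat letter set" where
  "letters n = Gen ` {1..n} \<union> Adj ` {1..n}"

definition gens :: "nat list \<Rightarrow> nat letter list" where "gens J = map Gen J"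

text \<open>The reversal makes \<open>adjs J\<close> the formal adjoint of the word
  \<open>gens J\<close>.\<close>

definition adjs :: "nat list \<Rightarrow> nat letter list" where "adjs J = map Adj (rev J)"

lemma gens_simps [simp]: "gens [] = []" "gens (j # J) = Gen j # gens J" "gens (J @ K) = gens J @ gens K"
  by (simp_all add: gens_def)

lemma adjs_simps [simp]: "adjs [] = []" "adjs (j # J) = adjs J @ [Adj j]" "adjs (J @ K) = adjs K @ adjs J"
  by (simp_all add: adjs_def)

lemma gens_in [simp]: "gens J \<in> lists (letters n) \<longleftrightarrow> set J \<subseteq> {1..n}"
  by (auto simp: gens_def letters_def in_lists_conv_set)

lemma adjs_in [simp]: "adjs J \<in> lists (letters n) \<longleftrightarrow> set J \<subseteq> {1..n}"
  by (auto simp: adjs_def letters_def in_lists_conv_set)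

text \<open>For a functional \<open>g\<close> on the Cuntz algebra, \<open>\<gamma> w\<close> stands for the value of \<open>g\<close> at the word \<open>w\<close>, and
  the last two assumptions say \<open>g (s(z)* a) = g a = g (a s(y))\<close>.\<close>

locale word_functional =
  fixes n :: nat and \<gamma> :: "nat letter list \<Rightarrow> complex" and z y :: "nat list \<Rightarrow> complex" and N :: nat
  assumes cuntz_rel: "\<lbrakk>u \<in> lists (letters n); v \<in> lists (letters n); i \<in> {1..n}; j \<in> {1..n}\<rbrakk> \<Longrightarrow>
      \<gamma> (u @ Adj i # Gen j # v) = (if i = j then \<gamma> (u @ v) else 0)"
    and z: "z \<in> unit_tensors n N" and y: "y \<in> unit_tensors n N" and N: "N \<ge> 1"
    and left_fixed: "w \<in> lists (letters n) \<Longrightarrow> (\<Sum>J\<in>words n N. cnj (z J) * \<gamma> (adjs J @ w)) = \<gamma> w"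
    and right_fixed: "w \<in> lists (letters n) \<Longrightarrow> (\<Sum>J\<in>words n N. y J * \<gamma> (w @ gens J)) = \<gamma> w"
begin

lemma absorb:
  assumes "w \<in> lists (letters n)" "set K \<subseteq> {1..n}" "length w \<le> length K"
  shows "\<exists>c L. set L \<subseteq> {1..n} \<and> \<gamma> (w @ gens K) = c * \<gamma> (gens L)"
  using assms
proof (induction w arbitrary: K rule: rev_induct)
  case Nil
  then show ?case by (intro exI[of _ 1] exI[of _ K]) simp
next
  case (snoc l w)
  have w: "w \<in> lists (letters n)" using snoc.prems by simp
  show ?case
  proof (cases l)
    case (Gen i)
    then have "set (i # K) \<subseteq> {1..n}" using snoc.prems by (auto simp: letters_def)
    then show ?thesis using snoc.IH[OF w, of "i # K"] snoc.prems Gen by auto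
  next
    case (Adj i)
    then have i: "i \<in> {1..n}" using snoc.prems by (auto simp: letters_def)
    obtain k K' where K: "K = k # K'" using snoc.prems by (cases K) auto
    have k: "k \<in> {1..n}" "set K' \<subseteq> {1..n}" using snoc.prems K by auto
    have "\<gamma> ((w @ [l]) @ gens K) = (if i = k then \<gamma> (w @ gens K') else 0)"
      using cuntz_rel[OF w _ i k(1), of "gens K'"] k by (simp add: K Adj)
    moreover obtain c L where "set L \<subseteq> {1..n}" "\<gamma> (w @ gens K') = c * \<gamma> (gens L)"
      using snoc.IH[OF w k(2)] snoc.prems K by auto
    ultimately have "set L \<subseteq> {1..n} \<and> \<gamma> ((w @ [l]) @ gens K) = (if i = k then c else 0) * \<gamma> (gens L)" by simp
    then show ?thesis by blast
  qed
qed

lemma cancel_prefix: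
  assumes "set J \<subseteq> {1..n}" "set K \<subseteq> {1..n}" "length J \<le> length K"
  shows "\<gamma> (adjs J @ gens K) = (if J = take (length J) K then \<gamma> (gens (drop (length J) K)) else 0)"
  using assms
proof (induction J arbitrary: K)
  case (Cons j J)
  obtain k K' where K: "K = k # K'" using Cons.prems by (cases K) auto
  have jk: "j \<in> {1..n}" "k \<in> {1..n}" "set J \<subseteq> {1..n}" "set K' \<subseteq> {1..n}" "length J \<le> length K'"
    using Cons.prems K by auto
  have "\<gamma> (adjs (j # J) @ gens K) = (if j = k then \<gamma> (adjs J @ gens K') else 0)"
    using cuntz_rel[of "adjs J" "gens K'" j k] jk by (simp add: K)
  then show ?case using Cons.IH[OF jk(3-5)] by (simp add: K)
qed simp

text \<open>\<open>left_fixed\<close> puts s(z)* in front of the word, and of its terms only the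
  adjoint of the first N letters of L survives.\<close>

lemma reduce:
  assumes "set L \<subseteq> {1..n}" "length L \<ge> N"
  shows "\<gamma> (gens L) = cnj (z (take N L)) * \<gamma> (gens (drop N L))"
proof -
  have tk: "take N L \<in> words n N"
    using assms set_take_subset[of N L] by (auto simp: words_iff simp del: atLeastAtMost_iff)
  have "\<gamma> (gens L) = (\<Sum>J\<in>words n N. cnj (z J) * \<gamma> (adjs J @ gens L))"
    using assms by (simp add: left_fixed)
  also have "\<dots> = (\<Sum>J\<in>words n N. if J = take N L then cnj (z (take N L)) * \<gamma> (gens (drop N L)) else 0)"
  proof (intro sum.cong refl)
    fix J assume "J \<in> words n N"
    then have "set J \<subseteq> {1..n}" "length J = N" by (simp_all only: words_iff)
    then show "cnj (z J) * \<gamma> (adjs J @ gens L) = (if J = take N L then cnj (z (take N L)) * \<gamma> (gens (drop N L)) else 0)"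
      using cancel_prefix[of J L] assms by simp
  qed
  also have "\<dots> = cnj (z (take N L)) * \<gamma> (gens (drop N L))" using tk by simp
  finally show ?thesis .
qed

text \<open>\<open>reduce\<close> extends the hypothesis to generator words of every length. For a
  general word, \<open>right_fixed\<close> appends generators until \<open>absorb\<close> can remove
  all adjoint letters.\<close>

lemma vanish:
  assumes short: "\<And>L. set L \<subseteq> {1..n} \<Longrightarrow> length L < N \<Longrightarrow> \<gamma> (gens L) = 0" and w: "w \<in> lists (letters n)"
  shows "\<gamma> w = 0"
proof -
  have gens0: "\<gamma> (gens L) = 0" if "set L \<subseteq> {1..n}" for L
    using that
  proof (induction "length L" arbitrary: L rule: less_induct)
    case less
    show ?case
    proof (cases "length L < N")
      case False
      have "set (drop N L) \<subseteq> {1..n}" using less.prems set_drop_subset[of N L] by blast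
      then have "\<gamma> (gens (drop N L)) = 0" using less.hyps[of "drop N L"] False N by simp
      then show ?thesis using reduce[OF less.prems] False by simp
    qed (use short less.prems in blast)
  qed
  \<comment> \<open>Each use of \<open>right_fixed\<close> lengthens the tail by N; r counts the
    uses still required before the tail is as long as w.\<close>
  have long: "\<gamma> (w @ gens K) = 0" if "set K \<subseteq> {1..n}" "length w \<le> length K + r * N" for K r
    using that
  proof (induction r arbitrary: K)
    case 0
    then show ?case using absorb[OF w, of K] gens0 by auto
  next
    case (Suc r)
    have "\<gamma> (w @ gens K) = (\<Sum>J\<in>words n N. y J * \<gamma> ((w @ gens K) @ gens J))"
      using w Suc.prems by (intro right_fixed[symmetric]) simp
    also have "\<dots> = 0"
    proof (intro sum.neutral ballI)
      fix J assume "J \<in> words n N"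
      then have "set J \<subseteq> {1..n}" "length J = N" by (simp_all only: words_iff)
      then have "\<gamma> (w @ gens (K @ J)) = 0" using Suc.prems by (intro Suc.IH) auto
      then show "y J * \<gamma> ((w @ gens K) @ gens J) = 0" by simp
    qed
    finally show ?case .
  qed
  show ?thesis using long[of "[]" "length w"] N by simp
qed

text \<open>The conjugate makes this the tensor u that represents the functional on words of length
  d: the value belonging to s(x) becomes the inner product (u, x) for x of order d, and for x = u it
  is the squared norm of u.\<close>

definition coeffs :: "nat \<Rightarrow> nat list \<Rightarrow> complex" where
  "coeffs d L = (if L \<in> words n d then cnj (\<gamma> (gens L)) else 0)"

lemma coeffs_in: "coeffs d \<in> tensors n d"
  by (simp add: coeffs_def tensors_def)

text \<open>With \<open>u = coeffs d\<close> and \<open>(z \<otimes> u, u \<otimes> y) = g (s(z)* s(u) s(y)) = g (s(u)) = (u, u)\<close>, the equality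
  case of the Cauchy-Schwarz inequality applies.\<close>

lemma coeffs_intertwine: "tensor z (coeffs d) = tensor (coeffs d) y"
proof -
  let ?u = "coeffs d"
  have zt: "z \<in> tensors n N" "y \<in> tensors n N" "sqnorm n N z = 1" "sqnorm n N y = 1"
    using z y by (auto simp: unit_tensors_iff)
  have zu: "tensor z ?u \<in> tensors n (d + N)" and uy: "tensor ?u y \<in> tensors n (d + N)"
    using tensor_in_tensors[OF zt(1) coeffs_in[of d]] tensor_in_tensors[OF coeffs_in[of d] zt(2)]
    by (simp_all only: add.commute)
  have nzu: "sqnorm n (d + N) (tensor z ?u) = sqnorm n d ?u"
    using sqnorm_tensor[OF zt(1) coeffs_in[of d]] zt by (simp add: add.commute)
  have nuy: "sqnorm n (d + N) (tensor ?u y) = sqnorm n d ?u"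
    using sqnorm_tensor[OF coeffs_in[of d] zt(2)] zt by simp
  have ip: "(\<Sum>W\<in>words n (d + N). cnj (tensor z ?u W) * tensor ?u y W) = complex_of_real (sqnorm n d ?u)"
  proof -
    \<comment> \<open>This is \<open>reduce\<close> at a word of length d + N, with its first N
      letters split off.\<close>
    have "cnj (tensor z ?u W) = \<gamma> (gens W)" if W: "W \<in> words n (d + N)" for W
    proof -
      have W': "set W \<subseteq> {1..n}" "length W = d + N" using W by (simp_all only: words_iff)
      have "drop N W \<in> words n d" using words_take_drop[of W n N d] W by (simp add: add.commute)
      then show ?thesis
        using W' reduce[OF W'(1)] by (simp add: tensor_split[OF zt(1) coeffs_in] coeffs_def)
    qed
    then have "(\<Sum>W\<in>words n (d + N). cnj (tensor z ?u W) * tensor ?u y W) =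
        (\<Sum>W\<in>words n (d + N). \<gamma> (gens W) * tensor ?u y W)" by simp
    also have "\<dots> = (\<Sum>L\<in>words n d. \<Sum>K\<in>words n N. \<gamma> (gens (L @ K)) * tensor ?u y (L @ K))"
      by (rule sum_words_append)
    also have "\<dots> = (\<Sum>L\<in>words n d. ?u L * (\<Sum>K\<in>words n N. y K * \<gamma> (gens L @ gens K)))"
      by (auto simp: tensor_append[OF coeffs_in zt(2)] sum_distrib_left mult_ac dest!: words_length intro!: sum.cong)
    also have "\<dots> = (\<Sum>L\<in>words n d. ?u L * \<gamma> (gens L))"
      by (intro sum.cong refl arg_cong2[where f = "(*)"] right_fixed) (simp_all add: words_iff)
    also have "\<dots> = (\<Sum>L\<in>words n d. complex_of_real ((cmod (?u L))\<^sup>2))"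
      by (intro sum.cong refl) (simp add: coeffs_def complex_norm_square mult.commute flip: of_real_power)
    finally show ?thesis by (simp add: sqnorm_def)
  qed
  have "(\<Sum>W\<in>words n (d + N). (cmod (tensor z ?u W - tensor ?u y W))\<^sup>2) =
      (\<Sum>W\<in>words n (d + N). (cmod (tensor z ?u W))\<^sup>2 + (cmod (tensor ?u y W))\<^sup>2 - 2 * Re (cnj (tensor z ?u W) * tensor ?u y W))"
    by (intro sum.cong refl) (simp only: cmod_power2 minus_complex.simps times_complex.simps cnj.simps, simp add: power2_eq_square algebra_simps)
  also have "\<dots> = sqnorm n (d + N) (tensor z ?u) + sqnorm n (d + N) (tensor ?u y)
      - 2 * Re (\<Sum>W\<in>words n (d + N). cnj (tensor z ?u W) * tensor ?u y W)"
    by (simp add: sqnorm_def sum.distrib sum_subtractf sum_distrib_left)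
  also have "\<dots> = 0" by (simp add: ip nzu nuy)
  finally have "\<forall>W\<in>words n (d + N). (cmod (tensor z ?u W - tensor ?u y W))\<^sup>2 = 0"
    by (subst (asm) sum_nonneg_eq_0_iff) auto
  then show ?thesis by (intro tensors_eqI[OF zu uy]) simp
qed

text \<open>Applied to u = \<open>coeffs d\<close>, the hypothesis says that the sum of the squared
  moduli of all values on generator words of length d is zero. The sum in it is g(s(u)), so each
  application consists in solving z \<otimes> u = u \<otimes> y and evaluating g at s(u).\<close>

lemma vanish_criterion:
  assumes "\<And>d u. \<lbrakk>d < N; u \<in> tensors n d; u \<noteq> (\<lambda>w. 0); tensor z u = tensor u y\<rbrakk> \<Longrightarrow>
      (\<Sum>L\<in>words n d. u L * \<gamma> (gens L)) = 0"
    and w: "w \<in> lists (letters n)"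
  shows "\<gamma> w = 0"
proof (rule vanish[OF _ w])
  fix L assume L: "set L \<subseteq> {1..n}" "length L < N"
  let ?d = "length L"
  have Ld: "L \<in> words n ?d" using L by (simp add: words_iff)
  have "(\<Sum>L\<in>words n ?d. coeffs ?d L * \<gamma> (gens L)) = 0"
  proof (cases "coeffs ?d = (\<lambda>w. 0)")
    case False
    then show ?thesis using assms(1)[OF L(2) coeffs_in False coeffs_intertwine] by simp
  qed simp
  also have "(\<Sum>L\<in>words n ?d. coeffs ?d L * \<gamma> (gens L)) = complex_of_real (\<Sum>L\<in>words n ?d. (cmod (\<gamma> (gens L)))\<^sup>2)"
    unfolding of_real_sum
    by (intro sum.cong refl) (simp add: coeffs_def complex_norm_square mult.commute flip: of_real_power)
  finally have "(\<Sum>L\<in>words n ?d. (cmod (\<gamma> (gens L)))\<^sup>2) = 0" by (simp only: of_real_eq_0_iff)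
  then have "\<forall>L\<in>words n ?d. (cmod (\<gamma> (gens L)))\<^sup>2 = 0" by (subst (asm) sum_nonneg_eq_0_iff) auto
  then show "\<gamma> (gens L) = 0" using Ld by simp
qed

end


section \<open>The free star algebra\<close>

lemma adj_letter_invol [simp]: "adj_letter (adj_letter l) = l"
  by (cases l) auto

definition adj_word :: "'g letter list \<Rightarrow> 'g letter list" where "adj_word w = rev (map adj_letter w)"

lemma adj_word_invol [simp]: "adj_word (adj_word w) = w"
  by (simp add: adj_word_def rev_map o_def)

lemma length_adj_word [simp]: "length (adj_word w) = length w"
  by (simp add: adj_word_def)

lemma adj_word_in: "w \<in> lists (Gen ` G \<union> Adj ` G) \<Longrightarrow> adj_word w \<in> lists (Gen ` G \<union> Adj ` G)"
  by (auto simp: adj_word_def in_lists_conv_set)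

lemma free_carrier: "carrier (free_star_algebra G) = {f. finite {w. f w \<noteq> 0} \<and> {w. f w \<noteq> 0} \<subseteq> lists (Gen ` G \<union> Adj ` G)}"
  by (simp add: free_star_algebra_def)

lemma free_ops [simp]:
  "f \<oplus>\<^bsub>free_star_algebra G\<^esub> g = (\<lambda>w. f w + g w)"
  "f \<otimes>\<^bsub>free_star_algebra G\<^esub> g = word_conv f g"
  "c \<odot>\<^bsub>free_star_algebra G\<^esub> f = (\<lambda>w. c * f w)"
  "\<zero>\<^bsub>free_star_algebra G\<^esub> = (\<lambda>w. 0)"
  "\<one>\<^bsub>free_star_algebra G\<^esub> = word_delta []"
  "star (free_star_algebra G) f = (\<lambda>w. cnj (f (adj_word w)))"
  by (simp_all add: free_star_algebra_def adj_word_def)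

lemma free_add_closed: "f \<in> carrier (free_star_algebra G) \<Longrightarrow> g \<in> carrier (free_star_algebra G) \<Longrightarrow>
    (\<lambda>w. f w + g w) \<in> carrier (free_star_algebra G)"
  unfolding free_carrier mem_Collect_eq
proof
  assume f: "finite {w. f w \<noteq> 0} \<and> {w. f w \<noteq> 0} \<subseteq> lists (Gen ` G \<union> Adj ` G)"
    and g: "finite {w. g w \<noteq> 0} \<and> {w. g w \<noteq> 0} \<subseteq> lists (Gen ` G \<union> Adj ` G)"
  have sub: "{w. f w + g w \<noteq> 0} \<subseteq> {w. f w \<noteq> 0} \<union> {w. g w \<noteq> 0}" by auto
  show "finite {w. f w + g w \<noteq> 0}" using f g finite_subset[OF sub] by simp
  show "{w. f w + g w \<noteq> 0} \<subseteq> lists (Gen ` G \<union> Adj ` G)" using sub f g by blast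
qed

lemma free_scale_closed: "f \<in> carrier (free_star_algebra G) \<Longrightarrow> (\<lambda>w. c * f w) \<in> carrier (free_star_algebra G)"
  unfolding free_carrier mem_Collect_eq
proof
  assume f: "finite {w. f w \<noteq> 0} \<and> {w. f w \<noteq> 0} \<subseteq> lists (Gen ` G \<union> Adj ` G)"
  have sub: "{w. c * f w \<noteq> 0} \<subseteq> {w. f w \<noteq> 0}" by auto
  show "finite {w. c * f w \<noteq> 0}" using f finite_subset[OF sub] by simp
  show "{w. c * f w \<noteq> 0} \<subseteq> lists (Gen ` G \<union> Adj ` G)" using sub f by blast
qed

lemma free_mult_closed: assumes "f \<in> carrier (free_star_algebra G)" "g \<in> carrier (free_star_algebra G)"
  shows "word_conv f g \<in> carrier (free_star_algebra G)"
proof -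
  have f: "finite {w. f w \<noteq> 0}" "{w. f w \<noteq> 0} \<subseteq> lists (Gen ` G \<union> Adj ` G)"
    and g: "finite {w. g w \<noteq> 0}" "{w. g w \<noteq> 0} \<subseteq> lists (Gen ` G \<union> Adj ` G)"
    using assms by (simp_all add: free_carrier)
  have sub: "{w. word_conv f g w \<noteq> 0} \<subseteq> (\<lambda>(u, v). u @ v) ` ({w. f w \<noteq> 0} \<times> {w. g w \<noteq> 0})"
  proof
    fix w assume "w \<in> {w. word_conv f g w \<noteq> 0}"
    then obtain k where "f (take k w) * g (drop k w) \<noteq> 0"
      unfolding word_conv_def mem_Collect_eq by (meson sum.not_neutral_contains_not_neutral)
    then show "w \<in> (\<lambda>(u, v). u @ v) ` ({w. f w \<noteq> 0} \<times> {w. g w \<noteq> 0})"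
      by (intro image_eqI[of _ _ "(take k w, drop k w)"]) auto
  qed
  have "finite {w. word_conv f g w \<noteq> 0}" using finite_subset[OF sub] f g by simp
  moreover have "{w. word_conv f g w \<noteq> 0} \<subseteq> lists (Gen ` G \<union> Adj ` G)"
  proof
    fix w assume "w \<in> {w. word_conv f g w \<noteq> 0}"
    then obtain u v where "w = u @ v" "f u \<noteq> 0" "g v \<noteq> 0" using sub by auto
    then show "w \<in> lists (Gen ` G \<union> Adj ` G)" using f(2) g(2) by auto
  qed
  ultimately show ?thesis by (simp add: free_carrier)
qed

lemma free_star_closed: assumes "f \<in> carrier (free_star_algebra G)"
  shows "(\<lambda>w. cnj (f (adj_word w))) \<in> carrier (free_star_algebra G)"
proof -
  have f: "finite {w. f w \<noteq> 0}" "{w. f w \<noteq> 0} \<subseteq> lists (Gen ` G \<union> Adj ` G)"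
    using assms by (simp_all add: free_carrier)
  have eq: "{w. cnj (f (adj_word w)) \<noteq> 0} = adj_word ` {w. f w \<noteq> 0}"
  proof
    show "{w. cnj (f (adj_word w)) \<noteq> 0} \<subseteq> adj_word ` {w. f w \<noteq> 0}"
    proof
      fix w assume "w \<in> {w. cnj (f (adj_word w)) \<noteq> 0}"
      then show "w \<in> adj_word ` {w. f w \<noteq> 0}" by (intro image_eqI[of _ _ "adj_word w"]) auto
    qed
  qed auto
  have "adj_word ` {w. f w \<noteq> 0} \<subseteq> lists (Gen ` G \<union> Adj ` G)"
  proof
    fix w assume "w \<in> adj_word ` {w. f w \<noteq> 0}"
    then obtain v where w: "w = adj_word v" and v: "v \<in> {w. f w \<noteq> 0}" by auto
    show "w \<in> lists (Gen ` G \<union> Adj ` G)" unfolding w by (rule adj_word_in[OF subsetD[OF f(2) v]])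
  qed
  then show ?thesis unfolding free_carrier mem_Collect_eq eq using f(1) by simp
qed

lemma free_delta_in: "w \<in> lists (Gen ` G \<union> Adj ` G) \<Longrightarrow> word_delta w \<in> carrier (free_star_algebra G)"
proof -
  assume "w \<in> lists (Gen ` G \<union> Adj ` G)"
  moreover have "{v. word_delta w v \<noteq> 0} = {w}" by (auto simp: word_delta_def)
  ultimately show ?thesis by (simp add: free_carrier)
qed

lemma star_conv: "cnj (word_conv f g (adj_word w)) =
    word_conv (\<lambda>w. cnj (g (adj_word w))) (\<lambda>w. cnj (f (adj_word w))) w"
proof -
  have td: "take k (adj_word w) = adj_word (drop (length w - k) w)" "drop k (adj_word w) = adj_word (take (length w - k) w)" for k
    by (simp_all add: adj_word_def take_rev drop_rev drop_map take_map)
  have "cnj (word_conv f g (adj_word w)) = (\<Sum>k\<le>length w. cnj (g (adj_word (take (length w - k) w))) * cnj (f (adj_word (drop (length w - k) w))))"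
    by (simp add: word_conv_def td mult.commute)
  also have "\<dots> = word_conv (\<lambda>w. cnj (g (adj_word w))) (\<lambda>w. cnj (f (adj_word w))) w"
    unfolding word_conv_def
    by (rule sum.reindex_bij_witness[where i = "\<lambda>k. length w - k" and j = "\<lambda>k. length w - k"]) auto
  finally show ?thesis .
qed

lemma star_alg_free: "star_alg (free_star_algebra G)"
proof -
  let ?F = "free_star_algebra G"
  have "abelian_group ?F"
  proof (rule abelian_groupI)
    fix f assume "f \<in> carrier ?F"
    then show "\<exists>g\<in>carrier ?F. g \<oplus>\<^bsub>?F\<^esub> f = \<zero>\<^bsub>?F\<^esub>"
      using free_scale_closed[of f G "-1"] by (intro bexI[of _ "\<lambda>w. -1 * f w"]) auto
  qed (auto simp: free_add_closed add_ac, simp add: free_carrier)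
  then interpret cspace ?F
    by (rule cspaceI) (auto simp: free_scale_closed algebra_simps)
  show ?thesis
    by unfold_locales
       (auto simp: free_mult_closed free_star_closed free_delta_in word_conv_assoc
         word_conv_scale_left word_conv_scale_right star_conv,
        auto simp: word_conv_def fun_eq_iff sum.distrib algebra_simps)
qed

text \<open>Induction over the finite support; the step adds a single monomial, so linear statements
  reduce to words.\<close>

lemma free_induct [consumes 1, case_names zero add]:
  assumes f: "f \<in> carrier (free_star_algebra G)"
    and zero: "P (\<lambda>w. 0)"
    and add: "\<And>f c w. f \<in> carrier (free_star_algebra G) \<Longrightarrow> w \<in> lists (Gen ` G \<union> Adj ` G) \<Longrightarrow> P f \<Longrightarrow>
      P (\<lambda>v. f v + c * word_delta w v)"
  shows "P f"
proof -
  have "finite {w. f w \<noteq> 0}" using f by (simp add: free_carrier)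
  then show ?thesis using f
  proof (induction "{w. f w \<noteq> 0}" arbitrary: f rule: finite_induct)
    case empty
    then have "f = (\<lambda>w. 0)" by auto
    then show ?case using zero by simp
  next
    case (insert w S f)
    define g where "g = f(w := 0)"
    have S: "S = {v. g v \<noteq> 0}" using insert.hyps(2,4) by (auto simp: g_def)
    have w: "w \<in> lists (Gen ` G \<union> Adj ` G)" using insert.prems insert.hyps(4) by (auto simp: free_carrier)
    have g: "g \<in> carrier (free_star_algebra G)"
      using insert.prems insert.hyps(1,4) S by (auto simp: free_carrier)
    have "P (\<lambda>v. g v + f w * word_delta w v)"
      by (rule add[OF g w insert.hyps(3)[OF S g]])
    moreover have "(\<lambda>v. g v + f w * word_delta w v) = f" by (auto simp: g_def word_delta_def)
    ultimately show ?case by simp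
  qed
qed


section \<open>The universal seminorm\<close>

locale universal_algebra = star_alg F for F :: "('a, 'm) star_algebra_scheme" (structure) +
  fixes R :: "'a set"
  assumes R_carrier: "R \<subseteq> carrier F"
    and bounded: "a \<in> carrier F \<Longrightarrow> \<exists>B. \<forall>p. cstar_seminorm F p \<and> (\<forall>r\<in>R. p r = 0) \<longrightarrow> p a \<le> B"
begin

abbreviation U where "U \<equiv> universal_seminorm F R"

definition adm where "adm = {p. cstar_seminorm F p \<and> (\<forall>r\<in>R. p r = 0)}"

lemma U_eq: "U a = (SUP p\<in>adm. p a)"
  by (simp add: universal_seminorm_def adm_def)

text \<open>The family of admissible seminorms is nonempty, so least upper bound arguments
  apply.\<close>

lemma zero_adm: "(\<lambda>a. 0) \<in> adm"
  by (simp add: adm_def cstar_seminorm_def)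

lemma adm_le: assumes "p \<in> adm" "a \<in> carrier F" shows "p a \<le> U a"
  unfolding U_eq
proof (rule cSUP_upper[OF assms(1)])
  show "bdd_above ((\<lambda>p. p a) ` adm)"
    using bounded[OF assms(2)] by (auto simp: bdd_above_def adm_def)
qed

lemma U_le: "(\<And>p. p \<in> adm \<Longrightarrow> p a \<le> B) \<Longrightarrow> U a \<le> B"
  unfolding U_eq using zero_adm by (intro cSUP_least) auto

lemma U_nonneg: "a \<in> carrier F \<Longrightarrow> 0 \<le> U a"
  using adm_le[OF zero_adm] by simp

lemma admD: assumes "p \<in> adm"
  shows "a \<in> carrier F \<Longrightarrow> 0 \<le> p a"
    and "a \<in> carrier F \<Longrightarrow> b \<in> carrier F \<Longrightarrow> p (a \<oplus> b) \<le> p a + p b"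
    and "a \<in> carrier F \<Longrightarrow> p (c \<odot> a) = cmod c * p a"
    and "a \<in> carrier F \<Longrightarrow> b \<in> carrier F \<Longrightarrow> p (a \<otimes> b) \<le> p a * p b"
    and "a \<in> carrier F \<Longrightarrow> p (star F a \<otimes> a) = (p a)\<^sup>2"
  using assms by (auto simp: adm_def cstar_seminorm_def)

lemma U_rel: "r \<in> R \<Longrightarrow> U r = 0"
  using U_nonneg[of r] R_carrier U_le[of r 0] by (auto simp: adm_def)

text \<open>Upper estimates pass to the supremum directly. The reverse inequality for scalars comes
  from the inverse scalar, and that for the C*-identity from bounding each p a by the square root of
  the supremum at a* a.\<close>

lemma cstar_seminorm_U: "cstar_seminorm F U"
  unfolding cstar_seminorm_def
proof (intro conjI ballI allI)
  fix a assume a: "a \<in> carrier F"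
  show "0 \<le> U a" by (rule U_nonneg[OF a])
  have sm_le: "U (c \<odot> b) \<le> cmod c * U b" if "b \<in> carrier F" for c b
  proof (rule U_le)
    fix p assume p: "p \<in> adm"
    show "p (c \<odot> b) \<le> cmod c * U b"
      using adm_le[OF p that] by (simp add: admD(3)[OF p that] mult_left_mono)
  qed
  show "U (c \<odot> a) = cmod c * U a" for c
  proof (cases "c = 0")
    case True
    then show ?thesis using sm_le[OF a, of 0] U_nonneg[of \<zero>] a by simp
  next
    case False
    have "cmod c * U a = cmod c * U (inverse c \<odot> (c \<odot> a))" using a False by (simp add: sm_sm)
    also have "\<dots> \<le> cmod c * (cmod (inverse c) * U (c \<odot> a))"
      using a by (intro mult_left_mono sm_le) auto
    also have "\<dots> = U (c \<odot> a)" using False by (simp add: norm_inverse)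
    finally show ?thesis using sm_le[OF a, of c] by simp
  qed
  show "U (star F a \<otimes> a) = (U a)\<^sup>2"
  proof (rule antisym)
    show "U (star F a \<otimes> a) \<le> (U a)\<^sup>2"
    proof (rule U_le)
      fix p assume p: "p \<in> adm"
      show "p (star F a \<otimes> a) \<le> (U a)\<^sup>2"
        using adm_le[OF p a] admD(1)[OF p a] by (simp add: admD(5)[OF p a] power_mono)
    qed
    have "p a \<le> sqrt (U (star F a \<otimes> a))" if "p \<in> adm" for p
      using adm_le[OF that, of "star F a \<otimes> a"] admD(5)[OF that a] a by (intro real_le_rsqrt) simp
    then have "U a \<le> sqrt (U (star F a \<otimes> a))" by (rule U_le)
    then have "(U a)\<^sup>2 \<le> (sqrt (U (star F a \<otimes> a)))\<^sup>2" using U_nonneg[OF a] by (rule power_mono)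
    then show "(U a)\<^sup>2 \<le> U (star F a \<otimes> a)" using U_nonneg[of "star F a \<otimes> a"] a by simp
  qed
  fix b assume b: "b \<in> carrier F"
  show "U (a \<oplus> b) \<le> U a + U b"
  proof (rule U_le)
    fix p assume p: "p \<in> adm"
    show "p (a \<oplus> b) \<le> U a + U b"
      using admD(2)[OF p a b] adm_le[OF p a] adm_le[OF p b] by linarith
  qed
  show "U (a \<otimes> b) \<le> U a * U b"
  proof (rule U_le)
    fix p assume p: "p \<in> adm"
    have "p (a \<otimes> b) \<le> p a * p b" by (rule admD(4)[OF p a b])
    also have "\<dots> \<le> U a * U b"
      by (intro mult_mono adm_le p a b U_nonneg admD(1)[OF p])
    finally show "p (a \<otimes> b) \<le> U a * U b" .
  qed
qed

lemma universal_dist_eq: "universal_dist F R = (\<lambda>x y. U (x \<ominus> y))"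
  by (simp add: universal_dist_def fun_eq_iff)

lemma cstar_seminormed_U: "cstar_seminormed F U"
  by unfold_locales (rule cstar_seminorm_U)

sublocale SU: cstar_seminormed F U by (rule cstar_seminormed_U)

sublocale C: cstar_completion F U "universal_cstar F R"
  by unfold_locales (simp_all add: universal_cstar_def universal_dist_eq)

lemma cstar_alg_universal: "cstar_alg (universal_cstar F R) SU.cnorm"
proof -
  interpret star_alg "universal_cstar F R" by (rule C.star_alg_W)
  interpret W: cstar_seminormed "universal_cstar F R" SU.cnorm
    by unfold_locales (rule C.cstar_seminorm_W)
  show ?thesis
    by unfold_locales (use C.cnorm_eq_0 C.complete_W in auto)
qed

end

section \<open>The Cuntz algebra\<close>

declare One_nat_def [simp del]

lemma cuntz_relations_carrier: "cuntz_relations n \<subseteq> carrier (free_star_algebra {1..n})"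
proof
  let ?F = "free_star_algebra {1..n}"
  interpret star_alg ?F by (rule star_alg_free)
  fix r assume "r \<in> cuntz_relations n"
  then consider i j where "i \<in> {1..n}" "j \<in> {1..n}"
      "r = (\<lambda>w. word_delta [Adj i, Gen j] w - (if i = j then word_delta [] w else 0))"
    | "r = (\<lambda>w. (\<Sum>i=1..n. word_delta [Gen i, Adj i] w) - word_delta [] w)"
    unfolding cuntz_relations_def by blast
  then show "r \<in> carrier ?F"
  proof cases
    case 1
    have "word_delta [Adj i, Gen j] \<in> carrier ?F" "word_delta [] \<in> carrier ?F"
      using 1 by (auto intro!: free_delta_in)
    moreover have "r = (\<lambda>w. word_delta [Adj i, Gen j] w + (if i = j then -1 else 0) * word_delta [] w)"
      using 1(3) by auto
    ultimately show ?thesis by (simp only: free_add_closed free_scale_closed)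
  next
    case 2
    have "(\<lambda>w. \<Sum>i\<in>S. word_delta [Gen i, Adj i] w) \<in> carrier ?F" if "finite S" "S \<subseteq> {1..n}" for S
      using that
    proof (induction S rule: finite_induct)
      case empty
      then show ?case using M.zero_closed by simp
    next
      case (insert i S)
      then have "word_delta [Gen i, Adj i] \<in> carrier ?F" by (auto intro!: free_delta_in)
      then show ?case using insert by (simp add: free_add_closed)
    qed
    from free_add_closed[OF this[of "{1..n}"] free_scale_closed[OF one_closed, of "-1"]]
    show ?thesis by (simp add: 2)
  qed
qed

lemma relation_isometry:
  "i \<in> {1..n} \<Longrightarrow> j \<in> {1..n} \<Longrightarrow>
    (\<lambda>w. word_delta [Adj i, Gen j] w + (if i = j then -1 else 0) * word_delta [] w) \<in> cuntz_relations n"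
  unfolding cuntz_relations_def by (intro UnI1 CollectI exI[of _ i] exI[of _ j]) auto

lemma word_delta_conv: "word_conv (word_delta u) (word_delta v) = word_delta (u @ v)"
  by (rule ext) (auto simp: word_delta_mult word_delta_def)

lemma star_word_delta: "(\<lambda>w. cnj (word_delta u (adj_word w))) = word_delta (adj_word u)"
  by (rule ext) (auto simp: word_delta_def)

text \<open>The C*-identity gives p(1) = p(1)^2, so p(1) is at most 1, and then p(s_i)^2 = p(s_i*
  s_i) = p(1) bounds the generators. Adjoints have the same seminorm, and words follow by
  submultiplicativity. This is what makes the universal seminorm finite.\<close>

lemma admissible_delta_le:
  assumes p: "cstar_seminorm (free_star_algebra {1..n}) p" and rel: "\<And>r. r \<in> cuntz_relations n \<Longrightarrow> p r = 0"
    and w: "w \<in> lists (Gen ` {1..n} \<union> Adj ` {1..n})"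
  shows "p (word_delta w) \<le> 1"
proof -
  let ?F = "free_star_algebra {1..n}"
  interpret star_alg ?F by (rule star_alg_free)
  interpret cstar_seminormed ?F p by unfold_locales (rule p)
  have one: "p (word_delta []) \<le> 1"
  proof -
    have "p (word_delta []) = (p (word_delta []))\<^sup>2"
      using p_star_mult[of "word_delta []"] one_closed star_one by simp
    then have "p (word_delta []) = 0 \<or> p (word_delta []) = 1" by (auto simp: power2_eq_square)
    then show ?thesis by auto
  qed
  have gen: "p (word_delta [Gen i]) \<le> 1" if i: "i \<in> {1..n}" for i
  proof -
    have gi: "word_delta [Gen i] \<in> carrier ?F" using i by (intro free_delta_in) auto
    let ?r = "\<lambda>w. word_delta [Adj i, Gen i] w + (-1) * word_delta [] w"
    have "?r \<in> cuntz_relations n" using relation_isometry[OF i i] by simp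
    then have "p ?r = 0" "?r \<in> carrier ?F" using rel cuntz_relations_carrier by auto
    moreover have "word_delta [Adj i, Gen i] = ?r \<oplus>\<^bsub>?F\<^esub> \<one>\<^bsub>?F\<^esub>" by simp
    ultimately have "p (word_delta [Adj i, Gen i]) \<le> 1"
      using p_add[of ?r "\<one>\<^bsub>?F\<^esub>"] one one_closed by simp
    moreover have "p (word_delta [Adj i, Gen i]) = (p (word_delta [Gen i]))\<^sup>2"
      using p_star_mult[OF gi] by (simp add: star_word_delta word_delta_conv) (simp add: adj_word_def)
    ultimately have "(p (word_delta [Gen i]))\<^sup>2 \<le> 1\<^sup>2" by simp
    then show ?thesis by (rule power2_le_imp_le) simp
  qed
  have adj: "p (word_delta [Adj i]) \<le> 1" if i: "i \<in> {1..n}" for i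
  proof -
    have gi: "word_delta [Gen i] \<in> carrier ?F" using i by (intro free_delta_in) auto
    have "p (word_delta [Adj i]) = p (word_delta [Gen i])"
      using p_star[OF gi] by (simp add: star_word_delta) (simp add: adj_word_def)
    then show ?thesis using gen[OF i] by simp
  qed
  show ?thesis using w
  proof (induction w)
    case (Cons l w)
    have l: "p (word_delta [l]) \<le> 1" using Cons.hyps(1) gen adj by auto
    have in_F: "word_delta [l] \<in> carrier ?F" "word_delta w \<in> carrier ?F"
      using Cons.hyps by (auto intro!: free_delta_in)
    have "p (word_delta (l # w)) \<le> p (word_delta [l]) * p (word_delta w)"
      using p_mult[OF in_F] by (simp add: word_delta_conv)
    also have "\<dots> \<le> 1 * 1" using l Cons.IH p_nonneg[OF in_F(2)] by (intro mult_mono) auto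
    finally show ?case by simp
  qed (rule one)
qed

lemma universal_algebra_cuntz: "universal_algebra (free_star_algebra {1..n}) (cuntz_relations n)"
proof -
  let ?F = "free_star_algebra {1..n}"
  interpret star_alg ?F by (rule star_alg_free)
  show ?thesis
  proof unfold_locales
    fix a assume "a \<in> carrier ?F"
    then show "\<exists>B. \<forall>p. cstar_seminorm ?F p \<and> (\<forall>r\<in>cuntz_relations n. p r = 0) \<longrightarrow> p a \<le> B"
    proof (induction rule: free_induct)
      case zero
      have "p (\<lambda>w. 0) = 0" if "cstar_seminorm ?F p" for p
      proof -
        interpret cstar_seminormed ?F p by unfold_locales (rule that)
        show ?thesis using p_zero by simp
      qed
      note p0 = this
      show ?case
      proof (intro exI allI impI)
        fix p assume "cstar_seminorm ?F p \<and> (\<forall>r\<in>cuntz_relations n. p r = 0)"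
        then have "p (\<lambda>w. 0) = 0" using p0 by blast
        then show "p (\<lambda>w. 0) \<le> 0" by simp
      qed
    next
      case (add f c w)
      then obtain B where B: "\<And>p. cstar_seminorm ?F p \<Longrightarrow> (\<forall>r\<in>cuntz_relations n. p r = 0) \<Longrightarrow> p f \<le> B" by blast
      have "p (\<lambda>v. f v + c * word_delta w v) \<le> B + cmod c"
        if p: "cstar_seminorm ?F p" "\<forall>r\<in>cuntz_relations n. p r = 0" for p
      proof -
        interpret cstar_seminormed ?F p by unfold_locales (rule p)
        have w: "word_delta w \<in> carrier ?F" using add.hyps by (intro free_delta_in)
        have "p (\<lambda>v. f v + c * word_delta w v) \<le> p f + cmod c * p (word_delta w)"
          using p_add[OF add.hyps(1) sm_closed[OF w, of c]] p_sm[OF w, of c] by simp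
        moreover have "cmod c * p (word_delta w) \<le> cmod c * 1"
          using admissible_delta_le[OF p(1) _ add.hyps(2)] p(2) by (intro mult_left_mono) auto
        ultimately show ?thesis using B[OF p] by simp
      qed
      then show ?case by blast
    qed
  qed (rule cuntz_relations_carrier)
qed

fun ungen :: "nat letter \<Rightarrow> nat" where "ungen (Gen i) = i" | "ungen (Adj i) = i"

text \<open>The polynomial without adjoint letters whose coefficients are given by x; the test
  \<open>w = gens (map ungen w)\<close> singles out the words without adjoint letters.\<close>

definition lift :: "(nat list \<Rightarrow> complex) \<Rightarrow> nat letter list \<Rightarrow> complex" where
  "lift x w = (if w = gens (map ungen w) then x (map ungen w) else 0)"

lemma map_ungen_gens [simp]: "map ungen (gens J) = J"
  by (induction J) auto

lemma gens_inj [simp]: "gens J = gens K \<longleftrightarrow> J = K"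
  by (metis map_ungen_gens)

lemma lift_gens [simp]: "lift x (gens J) = x J"
  by (simp add: lift_def)

text \<open>Two pieces of a word are both free of adjoint letters exactly when the word is, so
  \<open>lift\<close> is multiplicative.\<close>

lemma lift_conv: "word_conv (lift x) (lift y) = lift (word_conv x y)"
proof
  fix w :: "nat letter list"
  show "word_conv (lift x) (lift y) w = lift (word_conv x y) w"
  proof (cases "w = gens (map ungen w)")
    case True
    then obtain J where w: "w = gens J" by blast
    have "take k w = gens (take k J)" "drop k w = gens (drop k J)" for k
      by (simp_all add: w gens_def take_map drop_map)
    then show ?thesis by (simp add: word_conv_def w) (simp add: gens_def)
  next
    case False
    have zero: "lift x (take k w) * lift y (drop k w) = 0" for k
    proof (rule ccontr)
      assume "lift x (take k w) * lift y (drop k w) \<noteq> 0"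
      then have "take k w = gens (map ungen (take k w))" "drop k w = gens (map ungen (drop k w))"
        by (auto simp: lift_def split: if_splits)
      then have "take k w @ drop k w = gens (map ungen (take k w @ drop k w))"
        by (simp only: map_append gens_simps)
      then show False using False by simp
    qed
    have "word_conv (lift x) (lift y) w = 0"
      unfolding word_conv_def by (simp only: zero sum.neutral_const)
    then show ?thesis using False by (simp add: lift_def[of "word_conv x y"])
  qed
qed

lemma lift_sum: assumes "x \<in> tensors n m"
  shows "lift x = (\<lambda>w. \<Sum>J\<in>words n m. x J * word_delta (gens J) w)"
proof
  fix w
  show "lift x w = (\<Sum>J\<in>words n m. x J * word_delta (gens J) w)"
  proof (cases "\<exists>J\<in>words n m. w = gens J")
    case True
    then obtain J where J: "J \<in> words n m" "w = gens J" by blast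
    have "(\<Sum>K\<in>words n m. x K * word_delta (gens K) w) = (\<Sum>K\<in>words n m. if K = J then x J else 0)"
    proof (intro sum.cong refl)
      fix K show "x K * word_delta (gens K) w = (if K = J then x J else 0)"
        using J(2) map_ungen_gens[of J] map_ungen_gens[of K] by (auto simp: word_delta_def)
    qed
    then show ?thesis using J by simp
  next
    case False
    then have "(\<Sum>J\<in>words n m. x J * word_delta (gens J) w) = 0"
      by (intro sum.neutral) (auto simp: word_delta_def)
    moreover have "lift x w = 0"
      using False tensors_outside[OF assms, of "map ungen w"] by (auto simp: lift_def)
    ultimately show ?thesis by simp
  qed
qed

lemma adj_word_gens: "adj_word (gens J) = adjs J"
  by (induction J) (simp_all add: adj_word_def)

locale cuntz_algebra =
  fixes n :: nat
  assumes n_ge_2: "2 \<le> n"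
begin

abbreviation F where "F \<equiv> free_star_algebra {1..n}"
abbreviation A where "A \<equiv> cuntz n"

sublocale UA: universal_algebra F "cuntz_relations n"
  by (rule universal_algebra_cuntz)

abbreviation anorm where "anorm \<equiv> UA.SU.cnorm"

sublocale A: cstar_alg A anorm
  unfolding cuntz_def by (rule UA.cstar_alg_universal)

definition emb where "emb f = UA.SU.cl (\<lambda>k. f)"

lemma emb_closed [simp, intro]: "f \<in> carrier F \<Longrightarrow> emb f \<in> carrier A"
  by (simp add: emb_def cuntz_def UA.C.cl_closed)

lemma emb_add: "f \<in> carrier F \<Longrightarrow> h \<in> carrier F \<Longrightarrow> emb (f \<oplus>\<^bsub>F\<^esub> h) = emb f \<oplus>\<^bsub>A\<^esub> emb h"
  by (simp add: emb_def cuntz_def UA.C.add_cl)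

lemma emb_sm: "f \<in> carrier F \<Longrightarrow> emb (c \<odot>\<^bsub>F\<^esub> f) = c \<odot>\<^bsub>A\<^esub> emb f"
  by (simp add: emb_def cuntz_def UA.C.sm_cl)

lemma emb_mult: "f \<in> carrier F \<Longrightarrow> h \<in> carrier F \<Longrightarrow> emb (f \<otimes>\<^bsub>F\<^esub> h) = emb f \<otimes>\<^bsub>A\<^esub> emb h"
  by (simp add: emb_def cuntz_def UA.C.mult_cl)

lemma emb_star: "f \<in> carrier F \<Longrightarrow> emb (star F f) = star A (emb f)"
  by (simp add: emb_def cuntz_def UA.C.star_cl)

lemma emb_one: "emb \<one>\<^bsub>F\<^esub> = \<one>\<^bsub>A\<^esub>"
  by (simp add: emb_def cuntz_def UA.C.one_W)

lemma emb_zero: "emb \<zero>\<^bsub>F\<^esub> = \<zero>\<^bsub>A\<^esub>"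
  by (simp add: emb_def cuntz_def UA.C.zero_W)

lemma emb_eq_zero: "r \<in> cuntz_relations n \<Longrightarrow> emb r = \<zero>\<^bsub>A\<^esub>"
  using UA.U_rel[of r] UA.R_carrier UA.C.cnorm_eq_0[of "emb r"]
  by (auto simp: emb_def cuntz_def UA.C.cl_closed)

lemma emb_dense: assumes "a \<in> carrier A" "e > 0"
  obtains f where "f \<in> carrier F" "anorm (emb f \<ominus>\<^bsub>A\<^esub> a) < e"
  using UA.C.dense[of a e] assms unfolding emb_def cuntz_def by blast

definition wd where "wd w = emb (word_delta w)"

lemma delta_in [simp, intro]: "w \<in> lists (letters n) \<Longrightarrow> word_delta w \<in> carrier F"
  by (rule free_delta_in) (simp add: letters_def)

lemma wd_closed [simp, intro]: "w \<in> lists (letters n) \<Longrightarrow> wd w \<in> carrier A"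
  by (simp add: wd_def)

lemma wd_append: "u \<in> lists (letters n) \<Longrightarrow> v \<in> lists (letters n) \<Longrightarrow> wd (u @ v) = wd u \<otimes>\<^bsub>A\<^esub> wd v"
  using emb_mult[of "word_delta u" "word_delta v"] by (simp add: wd_def word_delta_conv)

lemma wd_Nil [simp]: "wd [] = \<one>\<^bsub>A\<^esub>"
  using emb_one by (simp add: wd_def)

lemma wd_star: "w \<in> lists (letters n) \<Longrightarrow> star A (wd w) = wd (adj_word w)"
  using emb_star[of "word_delta w"] by (simp add: wd_def star_word_delta)

lemma wd_rel: assumes "i \<in> {1..n}" "j \<in> {1..n}" shows "wd [Adj i, Gen j] = (if i = j then \<one>\<^bsub>A\<^esub> else \<zero>\<^bsub>A\<^esub>)"
proof -
  let ?c = "if i = j then -1 else 0 :: complex"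
  have d: "word_delta [Adj i, Gen j] \<in> carrier F" using assms by (intro delta_in) (auto simp: letters_def)
  have "\<zero>\<^bsub>A\<^esub> = emb (word_delta [Adj i, Gen j] \<oplus>\<^bsub>F\<^esub> ?c \<odot>\<^bsub>F\<^esub> \<one>\<^bsub>F\<^esub>)"
    using emb_eq_zero[OF relation_isometry[OF assms]] by simp
  also have "\<dots> = wd [Adj i, Gen j] \<oplus>\<^bsub>A\<^esub> ?c \<odot>\<^bsub>A\<^esub> \<one>\<^bsub>A\<^esub>"
    using d emb_one by (subst emb_add) (auto simp del: free_ops simp: emb_sm wd_def intro!: UA.one_closed)
  finally have sum: "wd [Adj i, Gen j] \<oplus>\<^bsub>A\<^esub> ?c \<odot>\<^bsub>A\<^esub> \<one>\<^bsub>A\<^esub> = \<zero>\<^bsub>A\<^esub>" ..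
  have wdA: "wd [Adj i, Gen j] \<in> carrier A" using d by (simp add: wd_def)
  show ?thesis
  proof (cases "i = j")
    case True
    have "wd [Adj i, Gen j] \<ominus>\<^bsub>A\<^esub> \<one>\<^bsub>A\<^esub> = \<zero>\<^bsub>A\<^esub>"
      using sum wdA True by (simp only: A.diff_eq_sm A.one_closed if_True refl)
    then show ?thesis using wdA True A.diff_eq_zero_iff[OF wdA A.one_closed] by simp
  next
    case False
    then show ?thesis using sum wdA by simp
  qed
qed

lemma wd_cancel:
  assumes "set J \<subseteq> {1..n}" "set K \<subseteq> {1..n}" "length J = length K"
  shows "wd (adjs J) \<otimes>\<^bsub>A\<^esub> wd (gens K) = (if J = K then \<one>\<^bsub>A\<^esub> else \<zero>\<^bsub>A\<^esub>)"
  using assms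
proof (induction J arbitrary: K)
  case (Cons j J)
  obtain k K' where K: "K = k # K'" using Cons.prems by (cases K) auto
  have j: "j \<in> {1..n}" "k \<in> {1..n}" "set J \<subseteq> {1..n}" "set K' \<subseteq> {1..n}" using Cons.prems K by auto
  have l: "[Adj j, Gen k] \<in> lists (letters n)" using j by (auto simp: letters_def)
  have "wd (adjs (j # J)) \<otimes>\<^bsub>A\<^esub> wd (gens K) = wd ((adjs J @ [Adj j, Gen k]) @ gens K')"
  proof -
    have "adjs (j # J) \<in> lists (letters n)" "gens K \<in> lists (letters n)"
      using Cons.prems by (simp_all only: adjs_in gens_in)
    then have "wd (adjs (j # J)) \<otimes>\<^bsub>A\<^esub> wd (gens K) = wd (adjs (j # J) @ gens K)"
      by (simp only: wd_append)
    then show ?thesis by (simp add: K)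
  qed
  also have "\<dots> = (wd (adjs J) \<otimes>\<^bsub>A\<^esub> wd [Adj j, Gen k]) \<otimes>\<^bsub>A\<^esub> wd (gens K')"
    using j l by (simp add: wd_append del: lists.simps append_assoc Cons_in_lists_iff)
  also have "\<dots> = (if j = k then wd (adjs J) \<otimes>\<^bsub>A\<^esub> wd (gens K') else \<zero>\<^bsub>A\<^esub>)"
    using j by (simp add: wd_rel)
  also have "\<dots> = (if j # J = K then \<one>\<^bsub>A\<^esub> else \<zero>\<^bsub>A\<^esub>)"
    using Cons.IH[OF j(3,4)] Cons.prems(3) K by (cases "J = K'") simp_all
  finally show ?case .
qed simp

lemma cuntz_gen_eq: "cuntz_gen n i = wd [Gen i]"
  by (simp add: cuntz_gen_def wd_def emb_def UA.SU.cl_def UA.universal_dist_eq)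

lemma cuntz_word_eq: "set J \<subseteq> {1..n} \<Longrightarrow> cuntz_word n J = wd (gens J)"
proof (induction J)
  case (Cons j J)
  have j: "[Gen j] \<in> lists (letters n)" using Cons.prems by (auto simp: letters_def)
  have "wd ([Gen j] @ gens J) = wd [Gen j] \<otimes>\<^bsub>A\<^esub> wd (gens J)"
    using j Cons.prems by (intro wd_append) simp_all
  then show ?case using Cons by (simp add: cuntz_word_def cuntz_gen_eq)
qed (simp add: cuntz_word_def)

text \<open>Linearity only, because the identities below are algebraic; a bound is asked for
  separately in \<open>functional_eq_zero\<close>.\<close>

definition linear_functional :: "(cuntz_elem \<Rightarrow> complex) \<Rightarrow> bool" where
  "linear_functional g \<longleftrightarrow> (\<forall>a\<in>carrier A. \<forall>b\<in>carrier A. g (a \<oplus>\<^bsub>A\<^esub> b) = g a + g b) \<and>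
     (\<forall>c. \<forall>a\<in>carrier A. g (c \<odot>\<^bsub>A\<^esub> a) = c * g a)"

lemma linear_functionalD:
  assumes "linear_functional g"
  shows "a \<in> carrier A \<Longrightarrow> b \<in> carrier A \<Longrightarrow> g (a \<oplus>\<^bsub>A\<^esub> b) = g a + g b"
    and "a \<in> carrier A \<Longrightarrow> g (c \<odot>\<^bsub>A\<^esub> a) = c * g a"
    and "a \<in> carrier A \<Longrightarrow> b \<in> carrier A \<Longrightarrow> g (a \<ominus>\<^bsub>A\<^esub> b) = g a - g b"
    and "g \<zero>\<^bsub>A\<^esub> = 0"
  using assms unfolding linear_functional_def
  by (auto simp: A.diff_eq_sm) (metis A.sm_zero_right A.M.zero_closed mult_zero_left)

text \<open>Allows \<open>s_sum\<close> and \<open>star_s_sum\<close> to expand a factor in the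
  middle of a product.\<close>

lemma functional_sandwich:
  assumes "linear_functional g" "a \<in> carrier A" "b \<in> carrier A"
  shows "linear_functional (\<lambda>x. g (a \<otimes>\<^bsub>A\<^esub> (x \<otimes>\<^bsub>A\<^esub> b)))"
  using assms linear_functionalD[OF assms(1)]
  by (auto simp: linear_functional_def A.mult_add_left A.mult_add_right A.sm_mult A.mult_sm)

text \<open>The words span a dense subspace, and the bound makes g continuous. This step returns
  from word functionals to the algebra.\<close>

lemma functional_eq_zero:
  assumes g: "linear_functional g" and bd: "\<And>a. a \<in> carrier A \<Longrightarrow> cmod (g a) \<le> C * anorm a"
    and wd0: "\<And>w. w \<in> lists (letters n) \<Longrightarrow> g (wd w) = 0" and a: "a \<in> carrier A"
  shows "g a = 0"
proof -
  have embF: "g (emb f) = 0" if "f \<in> carrier F" for f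
    using that
  proof (induction rule: free_induct)
    case zero
    then show ?case using emb_zero linear_functionalD(4)[OF g] by simp
  next
    case (add f c w)
    then have w: "w \<in> lists (letters n)" by (simp add: letters_def)
    have "emb (f \<oplus>\<^bsub>F\<^esub> c \<odot>\<^bsub>F\<^esub> word_delta w) = emb f \<oplus>\<^bsub>A\<^esub> c \<odot>\<^bsub>A\<^esub> wd w"
      using add.hyps(1) w by (simp only: emb_add emb_sm UA.sm_closed delta_in wd_def)
    then show ?case
      using add w linear_functionalD(1,2)[OF g] wd0[OF w] by simp
  qed
  have "cmod (g a) \<le> (\<bar>C\<bar> + 1) * e" if e: "e > 0" for e
  proof -
    obtain f where f: "f \<in> carrier F" "anorm (emb f \<ominus>\<^bsub>A\<^esub> a) < e" using emb_dense[OF a e] by blast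
    have d: "emb f \<ominus>\<^bsub>A\<^esub> a \<in> carrier A" using f a by simp
    have "cmod (g a) = cmod (g (emb f \<ominus>\<^bsub>A\<^esub> a))"
      using linear_functionalD(3)[OF g, of "emb f" a] f a embF by simp
    also have "\<dots> \<le> C * anorm (emb f \<ominus>\<^bsub>A\<^esub> a)" by (rule bd[OF d])
    also have "\<dots> \<le> (\<bar>C\<bar> + 1) * anorm (emb f \<ominus>\<^bsub>A\<^esub> a)"
      using A.p_nonneg[OF d] by (intro mult_right_mono) auto
    also have "\<dots> \<le> (\<bar>C\<bar> + 1) * e" using f by (intro mult_left_mono) auto
    finally show ?thesis .
  qed
  note le = this
  show ?thesis
  proof (rule ccontr)
    assume "g a \<noteq> 0"
    \<comment> \<open>The tolerance is chosen so that the bound becomes half of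
      \<open>cmod (g a)\<close>.\<close>
    then have "cmod (g a) \<le> (\<bar>C\<bar> + 1) * (cmod (g a) / (2 * (\<bar>C\<bar> + 1)))" by (intro le) auto
    also have "\<dots> = cmod (g a) / 2" by (simp add: field_simps)
    finally show False using \<open>g a \<noteq> 0\<close> by simp
  qed
qed

definition s where "s x = emb (lift x)"

text \<open>Membership and evaluation share one induction, since evaluating the next sum requires
  the partial sum to lie in the free algebra.\<close>

lemma emb_sum:
  assumes "finite S" "\<And>J. J \<in> S \<Longrightarrow> h J \<in> lists (letters n)"
  shows "(\<lambda>w. \<Sum>J\<in>S. c J * word_delta (h J) w) \<in> carrier F \<and>
    (linear_functional g \<longrightarrow> g (emb (\<lambda>w. \<Sum>J\<in>S. c J * word_delta (h J) w)) = (\<Sum>J\<in>S. c J * g (wd (h J))))"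
  using assms
proof (induction S rule: finite_induct)
  case empty
  then show ?case using emb_zero UA.M.zero_closed linear_functionalD(4) by simp
next
  case (insert K S)
  let ?f = "\<lambda>w. \<Sum>J\<in>S. c J * word_delta (h J) w"
  have f: "?f \<in> carrier F" and K: "h K \<in> lists (letters n)" using insert by auto
  have eq: "(\<lambda>w. \<Sum>J\<in>insert K S. c J * word_delta (h J) w) = c K \<odot>\<^bsub>F\<^esub> word_delta (h K) \<oplus>\<^bsub>F\<^esub> ?f"
    using insert.hyps by simp
  have "emb \<dots> = c K \<odot>\<^bsub>A\<^esub> wd (h K) \<oplus>\<^bsub>A\<^esub> emb ?f"
    using f K by (simp only: emb_add emb_sm UA.sm_closed delta_in wd_def)
  moreover have "\<dots> \<in> carrier A" "c K \<odot>\<^bsub>F\<^esub> word_delta (h K) \<oplus>\<^bsub>F\<^esub> ?f \<in> carrier F"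
    using f K by (auto simp del: free_ops)
  ultimately show ?case
    unfolding eq using insert K f linear_functionalD(1,2)[of g] by auto
qed

lemma gens_words: "J \<in> words n m \<Longrightarrow> gens J \<in> lists (letters n)" "J \<in> words n m \<Longrightarrow> adjs J \<in> lists (letters n)"
  by (simp_all only: gens_in adjs_in words_iff)

lemma lift_in: "x \<in> tensors n m \<Longrightarrow> lift x \<in> carrier F"
  using emb_sum[of "words n m" gens x] gens_words by (simp add: lift_sum)

lemma s_closed: "x \<in> tensors n m \<Longrightarrow> s x \<in> carrier A"
  by (simp add: s_def lift_in)

text \<open>The sum is formed in the complex numbers, after applying a functional. This is why
  identities in the algebra such as \<open>isometry\<close> are stated as equations between values
  of g.\<close>

lemma s_sum: assumes "linear_functional g" "x \<in> tensors n m"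
  shows "g (s x) = (\<Sum>J\<in>words n m. x J * g (wd (gens J)))"
  using emb_sum[of "words n m" gens x g] assms gens_words by (simp add: s_def lift_sum)

lemma star_s_sum: assumes g: "linear_functional g" and x: "x \<in> tensors n m"
  shows "g (star A (s x)) = (\<Sum>J\<in>words n m. cnj (x J) * g (wd (adjs J)))"
proof -
  have "star A (s x) = emb (star F (lift x))" using lift_in[OF x] by (simp only: s_def emb_star)
  also have "star F (lift x) = (\<lambda>w. \<Sum>J\<in>words n m. cnj (x J) * word_delta (adjs J) w)"
  proof -
    have "word_delta (gens J) (adj_word w) = word_delta (adjs J) w" for J w
      unfolding adj_word_gens[symmetric] word_delta_def by (metis adj_word_invol)
    moreover have "cnj (word_delta v w) = word_delta v w" for v w :: "nat letter list" by (simp add: word_delta_def)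
    ultimately show ?thesis by (simp add: lift_sum[OF x])
  qed
  finally show ?thesis
    using emb_sum[of "words n m" adjs "\<lambda>J. cnj (x J)" g] g gens_words by simp
qed

lemma s_mult: assumes "x \<in> tensors n m" "y \<in> tensors n l" shows "s (tensor x y) = s x \<otimes>\<^bsub>A\<^esub> s y"
  using emb_mult[OF lift_in[OF assms(1)] lift_in[OF assms(2)]] by (simp add: s_def lift_conv)

lemma lift_delta: "lift (word_delta J) = word_delta (gens J)"
proof
  fix w show "lift (word_delta J) w = word_delta (gens J) w"
    using map_ungen_gens[of J] by (auto simp: lift_def word_delta_def)
qed

lemma s_delta: "s (word_delta J) = wd (gens J)"
  by (simp add: s_def wd_def lift_delta)

lemma s_scale: "x \<in> tensors n m \<Longrightarrow> s (\<lambda>w. c * x w) = c \<odot>\<^bsub>A\<^esub> s x"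
proof -
  assume "x \<in> tensors n m"
  moreover have "lift (\<lambda>w. c * x w) = c \<odot>\<^bsub>F\<^esub> lift x" by (auto simp: lift_def)
  ultimately show ?thesis using emb_sm[OF lift_in] by (simp only: s_def)
qed

text \<open>Words of equal length m satisfy s_J* s_K = 1 if J = K and 0 otherwise, so s(z)* s(z) is
  the squared norm of z, which is 1.\<close>

lemma isometry:
  assumes g: "linear_functional g" and z: "z \<in> unit_tensors n m" and a: "a \<in> carrier A" "b \<in> carrier A"
  shows "g (a \<otimes>\<^bsub>A\<^esub> (star A (s z) \<otimes>\<^bsub>A\<^esub> (s z \<otimes>\<^bsub>A\<^esub> b))) = g (a \<otimes>\<^bsub>A\<^esub> b)"
proof -
  have zt: "z \<in> tensors n m" and nz: "(\<Sum>J\<in>words n m. (cmod (z J))\<^sup>2) = 1"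
    using z by (auto simp: unit_tensors_def)
  note sz = s_closed[OF zt]
  have wdc: "wd (gens J) \<in> carrier A" "wd (adjs J) \<in> carrier A" if "J \<in> words n m" for J
    using gens_words that by auto
  have "g (a \<otimes>\<^bsub>A\<^esub> (star A (s z) \<otimes>\<^bsub>A\<^esub> (s z \<otimes>\<^bsub>A\<^esub> b))) =
      (\<Sum>J\<in>words n m. cnj (z J) * g (a \<otimes>\<^bsub>A\<^esub> (wd (adjs J) \<otimes>\<^bsub>A\<^esub> (s z \<otimes>\<^bsub>A\<^esub> b))))"
    using star_s_sum[OF functional_sandwich[OF g a(1), of "s z \<otimes>\<^bsub>A\<^esub> b"] zt] sz a by simp
  also have "\<dots> = (\<Sum>J\<in>words n m. cnj (z J) * (z J * g (a \<otimes>\<^bsub>A\<^esub> b)))"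
  proof (intro sum.cong refl arg_cong2[where f = "(*)"])
    fix J assume J: "J \<in> words n m"
    have "g (a \<otimes>\<^bsub>A\<^esub> (wd (adjs J) \<otimes>\<^bsub>A\<^esub> (s z \<otimes>\<^bsub>A\<^esub> b))) =
        (\<Sum>K\<in>words n m. z K * g (a \<otimes>\<^bsub>A\<^esub> (wd (adjs J) \<otimes>\<^bsub>A\<^esub> (wd (gens K) \<otimes>\<^bsub>A\<^esub> b))))"
      using s_sum[OF functional_sandwich[OF g, of "a \<otimes>\<^bsub>A\<^esub> wd (adjs J)" b] zt] sz a wdc J
      by (simp add: A.mult_assoc)
    also have "\<dots> = (\<Sum>K\<in>words n m. if K = J then z J * g (a \<otimes>\<^bsub>A\<^esub> b) else 0)"
    proof (intro sum.cong refl)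
      fix K assume K: "K \<in> words n m"
      have "wd (adjs J) \<otimes>\<^bsub>A\<^esub> (wd (gens K) \<otimes>\<^bsub>A\<^esub> b) = (wd (adjs J) \<otimes>\<^bsub>A\<^esub> wd (gens K)) \<otimes>\<^bsub>A\<^esub> b"
        using wdc J K a by (simp add: A.mult_assoc)
      also have "\<dots> = (if J = K then b else \<zero>\<^bsub>A\<^esub>)"
        using wd_cancel[of J K] J K a by (simp only: words_iff) simp
      finally show "z K * g (a \<otimes>\<^bsub>A\<^esub> (wd (adjs J) \<otimes>\<^bsub>A\<^esub> (wd (gens K) \<otimes>\<^bsub>A\<^esub> b))) = (if K = J then z J * g (a \<otimes>\<^bsub>A\<^esub> b) else 0)"
        using a linear_functionalD(4)[OF g] by simp
    qed
    also have "\<dots> = z J * g (a \<otimes>\<^bsub>A\<^esub> b)" using J by simp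
    finally show "g (a \<otimes>\<^bsub>A\<^esub> (wd (adjs J) \<otimes>\<^bsub>A\<^esub> (s z \<otimes>\<^bsub>A\<^esub> b))) = z J * g (a \<otimes>\<^bsub>A\<^esub> b)" .
  qed
  also have "\<dots> = (\<Sum>J\<in>words n m. complex_of_real ((cmod (z J))\<^sup>2)) * g (a \<otimes>\<^bsub>A\<^esub> b)"
    unfolding sum_distrib_right
    by (intro sum.cong refl) (simp only: complex_norm_square mult_ac)
  also have "(\<Sum>J\<in>words n m. complex_of_real ((cmod (z J))\<^sup>2)) = 1"
    using nz by (simp only: of_real_sum[symmetric] of_real_1)
  finally show ?thesis by simp
qed

text \<open>Only the term of s(z)* belonging to K survives against s_K; this recovers the
  coefficients of z from a fixed-point condition.\<close>

lemma star_s_word: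
  assumes g: "linear_functional g" and z: "z \<in> tensors n m" and K: "K \<in> words n m"
  shows "g (star A (s z) \<otimes>\<^bsub>A\<^esub> wd (gens K)) = cnj (z K) * g \<one>\<^bsub>A\<^esub>"
proof -
  have "g (star A (s z) \<otimes>\<^bsub>A\<^esub> wd (gens K)) = (\<Sum>J\<in>words n m. cnj (z J) * g (wd (adjs J) \<otimes>\<^bsub>A\<^esub> wd (gens K)))"
    using star_s_sum[OF functional_sandwich[OF g A.one_closed, of "wd (gens K)"] z] gens_words K s_closed[OF z] by simp
  also have "\<dots> = (\<Sum>J\<in>words n m. if J = K then cnj (z K) * g \<one>\<^bsub>A\<^esub> else 0)"
  proof (intro sum.cong refl)
    fix J assume J: "J \<in> words n m"
    have "wd (adjs J) \<otimes>\<^bsub>A\<^esub> wd (gens K) = (if J = K then \<one>\<^bsub>A\<^esub> else \<zero>\<^bsub>A\<^esub>)"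
      using J K by (intro wd_cancel) (simp_all only: words_iff)
    then show "cnj (z J) * g (wd (adjs J) \<otimes>\<^bsub>A\<^esub> wd (gens K)) = (if J = K then cnj (z K) * g \<one>\<^bsub>A\<^esub> else 0)"
      using linear_functionalD(4)[OF g] by simp
  qed
  finally show ?thesis using K by simp
qed

text \<open>The bridge from the algebra to words: fixed-point conditions on elements become those of
  the locale, after which \<open>vanish_criterion\<close> applies.\<close>

lemma word_functionalI:
  assumes g: "linear_functional g" and z: "z \<in> unit_tensors n N" "y \<in> unit_tensors n N" "N \<ge> 1"
    and left: "\<And>a. a \<in> carrier A \<Longrightarrow> g (star A (s z) \<otimes>\<^bsub>A\<^esub> a) = g a"
    and right: "\<And>a. a \<in> carrier A \<Longrightarrow> g (a \<otimes>\<^bsub>A\<^esub> s y) = g a"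
  shows "word_functional n (\<lambda>w. g (wd w)) z y N"
proof
  have zt: "z \<in> tensors n N" "y \<in> tensors n N" using z by (auto simp: unit_tensors_def)
  fix u v i j assume uv: "u \<in> lists (letters n)" "v \<in> lists (letters n)" and ij: "i \<in> {1..n}" "j \<in> {1..n}"
  have l: "[Adj i, Gen j] \<in> lists (letters n)" using ij by (auto simp: letters_def)
  have "wd (u @ [Adj i, Gen j] @ v) = wd u \<otimes>\<^bsub>A\<^esub> (wd [Adj i, Gen j] \<otimes>\<^bsub>A\<^esub> wd v)"
    using uv l by (simp only: wd_append append_in_lists_conv)
  also have "\<dots> = (if i = j then wd (u @ v) else \<zero>\<^bsub>A\<^esub>)"
    using uv ij by (simp add: wd_rel wd_append)
  finally show "g (wd (u @ Adj i # Gen j # v)) = (if i = j then g (wd (u @ v)) else 0)"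
    using linear_functionalD(4)[OF g] by simp
next
  have zt: "z \<in> tensors n N" "y \<in> tensors n N" using z by (auto simp: unit_tensors_def)
  fix w assume w: "w \<in> lists (letters n)"
  have "g (wd w) = (\<Sum>J\<in>words n N. cnj (z J) * g (wd (adjs J) \<otimes>\<^bsub>A\<^esub> wd w))"
    using star_s_sum[OF functional_sandwich[OF g A.one_closed wd_closed[OF w]] zt(1)] left[OF wd_closed[OF w]]
      s_closed[OF zt(1)] w gens_words by simp
  then show "(\<Sum>J\<in>words n N. cnj (z J) * g (wd (adjs J @ w))) = g (wd w)"
    using w gens_words by (simp add: wd_append)
  have "g (wd w) = (\<Sum>J\<in>words n N. y J * g (wd w \<otimes>\<^bsub>A\<^esub> wd (gens J)))"
    using s_sum[OF functional_sandwich[OF g wd_closed[OF w] A.one_closed] zt(2)] right[OF wd_closed[OF w]]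
      s_closed[OF zt(2)] w gens_words by simp
  then show "(\<Sum>J\<in>words n N. y J * g (wd (w @ gens J))) = g (wd w)"
    using w gens_words by (simp add: wd_append)
qed (use z in auto)

end

section \<open>Sub-Cuntz states\<close>

lemma unit_scale: "x \<in> unit_tensors n m \<Longrightarrow> cmod c = 1 \<Longrightarrow> (\<lambda>w. c * x w) \<in> unit_tensors n m"
  by (simp add: unit_tensors_def scale_in_tensors norm_mult)

text \<open>A p-th root of the inverse scalar can be moved into the factor y.\<close>

lemma nonperiodic_scale:
  assumes "nonperiodic n x" "c \<noteq> 0" shows "nonperiodic n (\<lambda>w. c * x w)"
  unfolding nonperiodic_def
proof (intro allI impI ballI)
  fix p y assume p: "1 \<le> p" and y: "y \<in> (\<Union>k\<in>{1..}. tensors n k)" and eq: "(\<lambda>w. c * x w) = tensor_power y p"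
  obtain \<beta> where \<beta>: "\<beta> ^ p = inverse c" using complex_root_exists[OF p] by blast
  have "x = (\<lambda>w. inverse c * tensor_power y p w)" using assms(2) by (simp add: eq[symmetric] mult.assoc[symmetric])
  also have "\<dots> = tensor_power (\<lambda>w. \<beta> * y w) p" by (simp add: tensor_power_scale \<beta>)
  finally have "x = tensor_power (\<lambda>w. \<beta> * y w) p" .
  moreover have "(\<lambda>w. \<beta> * y w) \<in> (\<Union>k\<in>{1..}. tensors n k)" using y scale_in_tensors by blast
  ultimately show "p = 1" using assms(1) p unfolding nonperiodic_def by blast
qed

lemma state_normalize:
  assumes "pos_functional A f" "f \<one>\<^bsub>A\<^esub> = complex_of_real k" "k > 0"
  shows "restrict (\<lambda>a. f a / complex_of_real k) (carrier A) \<in> states A"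
proof (rule statesI)
  interpret f: pos_functional A f by (rule assms)
  have "f (star A x \<otimes>\<^bsub>A\<^esub> x) / complex_of_real k \<in> \<real>\<^sub>\<ge>\<^sub>0" if "x \<in> carrier A" for x
    using f.w_nonneg[OF that] assms(3) by (auto simp: complex_nonneg_Reals_iff)
  then show "pos_functional A (restrict (\<lambda>a. f a / complex_of_real k) (carrier A))"
    by unfold_locales (auto simp: f.w_add f.w_sm add_divide_distrib)
  show "restrict (\<lambda>a. f a / complex_of_real k) (carrier A) \<one>\<^bsub>A\<^esub> = 1" using assms by simp
qed simp

text \<open>The vector functional of the class of b in the GNS space. It supplies the summands of
  the averaging argument for pure states and the approximating states in the existence
  proof.\<close>

lemma (in pos_functional) pos_functional_sandwich:
  assumes b: "b \<in> carrier A" shows "pos_functional A (\<lambda>a. \<omega> (star A b \<otimes> (a \<otimes> b)))"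
proof unfold_locales
  fix a assume a: "a \<in> carrier A"
  have "star A b \<otimes> ((star A a \<otimes> a) \<otimes> b) = star A (a \<otimes> b) \<otimes> (a \<otimes> b)"
    using b a by (simp add: star_mult mult_assoc)
  then show "\<omega> (star A b \<otimes> ((star A a \<otimes> a) \<otimes> b)) \<in> \<real>\<^sub>\<ge>\<^sub>0"
    using w_nonneg[of "a \<otimes> b"] a b by simp
qed (use b in \<open>auto simp: mult_add_left mult_add_right sm_mult mult_sm w_add w_sm\<close>)

text \<open>After normalization, P and Q write \<omega> as a convex combination with weights P(1)/c
  and Q(1)/c, and purity identifies the normalized P with \<omega>. A summand that vanishes at 1
  cannot be normalized, but it is zero by Cauchy-Schwarz.\<close>

lemma pure_dominated:
  assumes A: "star_alg A" and \<omega>: "\<omega> \<in> pure_states A" and P: "pos_functional A P" and Q: "pos_functional A Q"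
    and c: "c > 0" and sum: "\<And>a. a \<in> carrier A \<Longrightarrow> P a + Q a = complex_of_real c * \<omega> a"
    and a: "a \<in> carrier A"
  shows "P a = P \<one>\<^bsub>A\<^esub> * \<omega> a"
proof -
  interpret P: pos_functional A P by (rule P)
  interpret Q: pos_functional A Q by (rule Q)
  have \<omega>s: "\<omega> \<in> states A" using \<omega> by (simp add: pure_states_def)
  have pos_one: "\<exists>r\<ge>0. f \<one>\<^bsub>A\<^esub> = complex_of_real r" if "pos_functional A f" for f
  proof -
    interpret f: pos_functional A f by (rule that)
    have "f \<one>\<^bsub>A\<^esub> \<in> \<real>\<^sub>\<ge>\<^sub>0" using f.w_nonneg[of "\<one>\<^bsub>A\<^esub>"] by simp
    then show ?thesis by (auto simp: nonneg_Reals_def)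
  qed
  obtain r where r: "r \<ge> 0" "P \<one>\<^bsub>A\<^esub> = complex_of_real r" using pos_one[OF P] by blast
  obtain q where q: "q \<ge> 0" "Q \<one>\<^bsub>A\<^esub> = complex_of_real q" using pos_one[OF Q] by blast
  have "complex_of_real (r + q) = complex_of_real c"
    using sum[OF P.one_closed] statesD(2)[OF A \<omega>s] r q by simp
  then have rq: "r + q = c" by (simp only: of_real_eq_iff)
  have zero: "f a = 0" if "pos_functional A f" "f \<one>\<^bsub>A\<^esub> = 0" for f
  proof -
    interpret f: pos_functional A f by (rule that)
    have "f.S.nrm \<one>\<^bsub>A\<^esub> = 0" using that(2) by (simp add: f.S.nrm_def f.form_def)
    then show ?thesis using f.w_le[OF a] by simp
  qed
  consider "r = 0" | "q = 0" | "r > 0" "q > 0" using r q by fastforce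
  then show ?thesis
  proof cases
    case 1
    then show ?thesis using zero[OF P] r by simp
  next
    case 2
    then show ?thesis using zero[OF Q] sum[OF a] r q rq by simp
  next
    case 3
    define \<phi> where "\<phi> = restrict (\<lambda>a. P a / complex_of_real r) (carrier A)"
    define \<psi> where "\<psi> = restrict (\<lambda>a. Q a / complex_of_real q) (carrier A)"
    have "\<phi> \<in> states A" "\<psi> \<in> states A" unfolding \<phi>_def \<psi>_def using state_normalize P Q r q 3 by blast+
    moreover have "0 < r / c" "r / c < 1" using 3 c rq by auto
    moreover have "\<omega> x = complex_of_real (r / c) * \<phi> x + complex_of_real (1 - r / c) * \<psi> x" if x: "x \<in> carrier A" for x
    proof -
      have "1 - r / c = q / c" using c rq by (simp add: field_simps)
      then have "complex_of_real (r / c) * \<phi> x + complex_of_real (1 - r / c) * \<psi> x = (P x + Q x) / complex_of_real c"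
        using 3 x by (simp add: \<phi>_def \<psi>_def add_divide_distrib)
      then show ?thesis using sum[OF x] c by simp
    qed
    ultimately have "\<phi> = \<omega>" using \<omega> unfolding pure_states_def by blast
    then have "\<phi> a = \<omega> a" by simp
    then show ?thesis using a 3 r by (simp add: \<phi>_def field_simps)
  qed
qed

context cuntz_algebra
begin

lemma state_functional: assumes "\<omega> \<in> states A" shows "cstar_functional A anorm \<omega>"
proof -
  interpret pos_functional A \<omega> using statesD[OF _ assms] A.star_alg_axioms by blast
  show ?thesis by unfold_locales
qed

lemma state_one: "\<omega> \<in> states A \<Longrightarrow> \<omega> \<one>\<^bsub>A\<^esub> = 1"
  using statesD(2) A.star_alg_axioms by blast

lemma state_linear: assumes "\<omega> \<in> states A" shows "linear_functional \<omega>"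
proof -
  interpret cstar_functional A anorm \<omega> by (rule state_functional[OF assms])
  show ?thesis by (simp add: linear_functional_def w_add w_sm)
qed

lemma state_bounded: assumes "\<omega> \<in> states A" obtains C where "C \<ge> 0" "\<And>a. a \<in> carrier A \<Longrightarrow> cmod (\<omega> a) \<le> C * anorm a"
proof -
  interpret cstar_functional A anorm \<omega> by (rule state_functional[OF assms])
  show ?thesis by (rule that[OF _ w_bounded]) (auto intro!: mult_nonneg_nonneg S.nrm_nonneg)
qed

text \<open>In the form of \<omega> the squared length of s(z) - 1 is 1 - 1 - 1 + 1 = 0, because
  s(z) is an isometry and \<omega>(s(z)) = 1. A null vector drops out on either side of the
  form.\<close>

lemma state_fixed:
  assumes \<omega>: "\<omega> \<in> states A" and z: "z \<in> unit_tensors n m" and one: "\<omega> (s z) = 1" and a: "a \<in> carrier A"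
  shows "\<omega> (star A (s z) \<otimes>\<^bsub>A\<^esub> a) = \<omega> a" and "\<omega> (a \<otimes>\<^bsub>A\<^esub> s z) = \<omega> a"
proof -
  interpret cstar_functional A anorm \<omega> by (rule state_functional[OF \<omega>])
  have sz: "s z \<in> carrier A" using z s_closed by (auto simp: unit_tensors_def)
  define d where "d = s z \<ominus>\<^bsub>A\<^esub> \<one>\<^bsub>A\<^esub>"
  have d: "d \<in> carrier A" using sz by (simp add: d_def)
  have "form (s z) (s z) = 1"
    using isometry[OF state_linear[OF \<omega>] z A.one_closed A.one_closed] sz state_one[OF \<omega>] by (simp add: form_def)
  moreover have "form \<one>\<^bsub>A\<^esub> (s z) = 1" "form (s z) \<one>\<^bsub>A\<^esub> = 1" "form \<one>\<^bsub>A\<^esub> \<one>\<^bsub>A\<^esub> = 1"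
    using sz one w_star[OF sz] state_one[OF \<omega>] by (simp_all add: form_def)
  ultimately have "form d d = 0"
    using sz by (simp add: d_def S.B_diff S.B_diff_left)
  then have "S.nrm d = 0" by (simp add: S.nrm_def)
  then have null: "form b d = 0" if "b \<in> carrier A" for b using S.B_null[OF that d] by simp
  have "\<omega> (star A (star A a) \<otimes>\<^bsub>A\<^esub> d) = 0" using null[of "star A a"] a by (simp add: form_def)
  then show "\<omega> (a \<otimes>\<^bsub>A\<^esub> s z) = \<omega> a"
    using a sz by (simp add: d_def A.mult_diff w_diff)
  have "form d a = 0" using null[OF a] S.B_commute[OF a d] by simp
  then show "\<omega> (star A (s z) \<otimes>\<^bsub>A\<^esub> a) = \<omega> a"
    using a sz by (simp add: form_def d_def A.star_diff A.diff_mult w_diff)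
qed

text \<open>The prescribed values give \<omega>(s(z)) as the squared norm of z. Conversely
  \<omega>(s_J) = \<omega>(s(z)* s_J) by \<open>state_fixed\<close>, and s(z)* s_J is the scalar
  conj(z_J).\<close>

lemma sub_cuntz_iff:
  "sub_cuntz_state n z \<omega> \<longleftrightarrow> \<omega> \<in> states A \<and> (\<exists>m\<ge>1. z \<in> unit_tensors n m) \<and> \<omega> (s z) = 1"
proof
  assume "sub_cuntz_state n z \<omega>"
  then obtain m where \<omega>: "\<omega> \<in> states A" and m: "m \<ge> 1" and z: "z \<in> unit_tensors n m"
    and val: "\<And>J. J \<in> words n m \<Longrightarrow> \<omega> (cuntz_word n J) = cnj (z J)"
    unfolding sub_cuntz_state_def by blast
  have zt: "z \<in> tensors n m" "(\<Sum>J\<in>words n m. (cmod (z J))\<^sup>2) = 1" using z by (auto simp: unit_tensors_def)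
  have "\<omega> (s z) = (\<Sum>J\<in>words n m. z J * \<omega> (wd (gens J)))" by (rule s_sum[OF state_linear[OF \<omega>] zt(1)])
  also have "\<dots> = (\<Sum>J\<in>words n m. complex_of_real ((cmod (z J))\<^sup>2))"
  proof (intro sum.cong refl)
    fix J assume J: "J \<in> words n m"
    then have "cuntz_word n J = wd (gens J)" by (intro cuntz_word_eq) (simp only: words_iff)
    then show "z J * \<omega> (wd (gens J)) = complex_of_real ((cmod (z J))\<^sup>2)"
      using val[OF J] by (simp only: complex_norm_square)
  qed
  also have "\<dots> = 1" using zt(2) by (simp only: of_real_sum[symmetric] of_real_1)
  finally show "\<omega> \<in> states A \<and> (\<exists>m\<ge>1. z \<in> unit_tensors n m) \<and> \<omega> (s z) = 1" using \<omega> m z by blast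
next
  assume "\<omega> \<in> states A \<and> (\<exists>m\<ge>1. z \<in> unit_tensors n m) \<and> \<omega> (s z) = 1"
  then obtain m where \<omega>: "\<omega> \<in> states A" and m: "m \<ge> 1" and z: "z \<in> unit_tensors n m" and one: "\<omega> (s z) = 1" by blast
  have zt: "z \<in> tensors n m" using z by (auto simp: unit_tensors_def)
  have "\<omega> (cuntz_word n J) = cnj (z J)" if J: "J \<in> words n m" for J
  proof -
    have "cuntz_word n J = wd (gens J)" using J by (intro cuntz_word_eq) (simp only: words_iff)
    moreover have "\<omega> (star A (s z) \<otimes>\<^bsub>A\<^esub> wd (gens J)) = \<omega> (wd (gens J))"
      using state_fixed(1)[OF \<omega> z one] gens_words J by blast
    ultimately show ?thesis
      using star_s_word[OF state_linear[OF \<omega>] zt J] state_one[OF \<omega>] by simp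
  qed
  then show "sub_cuntz_state n z \<omega>" unfolding sub_cuntz_state_def using \<omega> m z by blast
qed

lemma state_word_functional:
  assumes "\<omega> \<in> states A" "z \<in> unit_tensors n m" "m \<ge> 1" "\<omega> (s z) = 1"
  shows "word_functional n (\<lambda>w. \<omega> (wd w)) z z m"
  using assms by (intro word_functionalI state_linear) (auto intro: state_fixed)

text \<open>For the difference g of the two states, the equation z \<otimes> u = u \<otimes> z with
  u of order below m has only scalar solutions by nonperiodicity, and g vanishes at 1.\<close>

lemma sub_cuntz_unique:
  assumes z: "z \<in> unit_tensors n m" "m \<ge> 1" "nonperiodic n z"
    and \<omega>: "\<omega> \<in> states A" "\<omega> (s z) = 1" and \<omega>': "\<omega>' \<in> states A" "\<omega>' (s z) = 1"
  shows "\<omega> = \<omega>'"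
proof -
  have zt: "z \<in> tensors n m" "z \<noteq> (\<lambda>w. 0)" using z unit_nonzero by (auto simp: unit_tensors_def)
  define g where "g a = \<omega> a - \<omega>' a" for a
  have sz: "s z \<in> carrier A" using s_closed[OF zt(1)] .
  have g: "linear_functional g"
    using linear_functionalD[OF state_linear[OF \<omega>(1)]] linear_functionalD[OF state_linear[OF \<omega>'(1)]]
    by (simp add: linear_functional_def g_def algebra_simps)
  interpret W: word_functional n "\<lambda>w. g (wd w)" z z m
    by (rule word_functionalI[OF g z(1,1,2)])
       (simp_all add: g_def state_fixed[OF \<omega>(1) z(1) \<omega>(2)] state_fixed[OF \<omega>'(1) z(1) \<omega>'(2)])
  have wd0: "g (wd w) = 0" if "w \<in> lists (letters n)" for w
  proof (rule W.vanish_criterion[OF _ that])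
    fix d u assume d: "d < m" and u: "u \<in> tensors n d" "u \<noteq> (\<lambda>w. 0)" "tensor z u = tensor u z"
    then have "d = 0" using nonperiodic_no_commuting[OF zt z(3) u(1,2)] by blast
    then show "(\<Sum>L\<in>words n d. u L * g (wd (gens L))) = 0"
      using state_one[OF \<omega>(1)] state_one[OF \<omega>'(1)] by (simp add: g_def)
  qed
  obtain C where C: "\<And>a. a \<in> carrier A \<Longrightarrow> cmod (\<omega> a) \<le> C * anorm a" using state_bounded[OF \<omega>(1)] by blast
  obtain C' where C': "\<And>a. a \<in> carrier A \<Longrightarrow> cmod (\<omega>' a) \<le> C' * anorm a" using state_bounded[OF \<omega>'(1)] by blast
  have "cmod (g a) \<le> (C + C') * anorm a" if "a \<in> carrier A" for a
    using C[OF that] C'[OF that] norm_triangle_ineq4[of "\<omega> a" "\<omega>' a"] by (simp add: g_def algebra_simps)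
  then have "g a = 0" if "a \<in> carrier A" for a by (rule functional_eq_zero[OF g _ wd0 that])
  then have "\<omega> a = \<omega>' a" if "a \<in> carrier A" for a using that by (simp add: g_def)
  moreover have "\<omega> \<in> extensional (carrier A)" "\<omega>' \<in> extensional (carrier A)"
    using \<omega>(1) \<omega>'(1) by (auto simp: states_def)
  ultimately show ?thesis by (intro extensionalityI)
qed

lemma state_s_le: assumes \<omega>: "\<omega> \<in> states A" and z: "z \<in> unit_tensors n m" shows "cmod (\<omega> (s z)) \<le> 1"
proof -
  interpret cstar_functional A anorm \<omega> by (rule state_functional[OF \<omega>])
  have sz: "s z \<in> carrier A" using z s_closed by (auto simp: unit_tensors_def)
  have "form (s z) (s z) = 1" "form \<one>\<^bsub>A\<^esub> \<one>\<^bsub>A\<^esub> = 1"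
    using isometry[OF state_linear[OF \<omega>] z A.one_closed A.one_closed] sz state_one[OF \<omega>] by (simp_all add: form_def)
  then show ?thesis using w_le[OF sz] by (simp add: S.nrm_def)
qed

text \<open>The number 1 is an extreme point of the closed unit disc, where
  \<open>state_s_le\<close> confines the values at s(z). Both components of a convex combination
  therefore take the value 1 at s(z), and uniqueness identifies them with \<omega>.\<close>

lemma sub_cuntz_pure:
  assumes z: "z \<in> unit_tensors n m" "m \<ge> 1" "nonperiodic n z" and \<omega>: "\<omega> \<in> states A" "\<omega> (s z) = 1"
  shows "\<omega> \<in> pure_states A"
proof -
  have "\<phi> = \<omega> \<and> \<psi> = \<omega>" if \<phi>: "\<phi> \<in> states A" and \<psi>: "\<psi> \<in> states A" and t: "0 < t" "t < (1::real)"
    and eq: "\<forall>a\<in>carrier A. \<omega> a = complex_of_real t * \<phi> a + complex_of_real (1 - t) * \<psi> a" for \<phi> \<psi> t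
  proof -
  have sz: "s z \<in> carrier A" using z s_closed by (auto simp: unit_tensors_def)
  have le: "Re (\<phi> (s z)) \<le> 1" "Re (\<psi> (s z)) \<le> 1"
    using state_s_le[OF \<phi> z(1)] state_s_le[OF \<psi> z(1)] complex_Re_le_cmod order_trans by blast+
  have sum: "1 = t * Re (\<phi> (s z)) + (1 - t) * Re (\<psi> (s z))"
    using arg_cong[OF eq[rule_format, OF sz], of Re] \<omega>(2) by simp
  have "t * Re (\<phi> (s z)) \<le> t * 1" "(1 - t) * Re (\<psi> (s z)) \<le> (1 - t) * 1"
    using le t by (intro mult_left_mono; simp)+
  moreover define p q where "p = t * Re (\<phi> (s z))" and "q = (1 - t) * Re (\<psi> (s z))"
  ultimately have "1 = p + q" "p \<le> t" "q \<le> 1 - t" using sum by simp_all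
  then have "p = t" "q = 1 - t" by simp_all
  then have Re1: "Re (\<phi> (s z)) = 1" "Re (\<psi> (s z)) = 1" using t by (simp_all add: p_def q_def)
  have Re_one: "v = 1" if "Re v = 1" "cmod v \<le> 1" for v
  proof -
    have "(Re v)\<^sup>2 + (Im v)\<^sup>2 \<le> 1" using that(2) power_mono[of "cmod v" 1 2] by (simp add: cmod_power2)
    then have "Im v = 0" using that(1) by simp
    then show ?thesis using that(1) by (simp add: complex_eq_iff)
  qed
  have "\<phi> (s z) = 1" "\<psi> (s z) = 1"
    using Re_one Re1 state_s_le[OF \<phi> z(1)] state_s_le[OF \<psi> z(1)] by blast+
    then show ?thesis using sub_cuntz_unique[OF z] \<phi> \<psi> \<omega> by blast
  qed
  then show ?thesis unfolding pure_states_def using \<omega> by blast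
qed

text \<open>At equal orders both vectors are read off from the values of \<omega> on words. If z
  were shorter than y, then z, being the tensor of those values, would commute with y, which
  nonperiodicity of y forbids. Used in both directions for the injectivity of q.\<close>

lemma nonperiodic_eq:
  assumes z: "z \<in> unit_tensors n m" "m \<ge> 1" and y: "y \<in> unit_tensors n l" "nonperiodic n y" "l \<ge> 1"
    and \<omega>: "\<omega> \<in> states A" "\<omega> (s z) = 1" "\<omega> (s y) = 1"
  shows "l \<le> m \<and> (l = m \<longrightarrow> z = y)"
proof -
  have zt: "z \<in> tensors n m" "z \<noteq> (\<lambda>w. 0)" and yt: "y \<in> tensors n l" "y \<noteq> (\<lambda>w. 0)"
    using z y unit_nonzero by (auto simp: unit_tensors_def)
  have val: "\<omega> (wd (gens J)) = cnj (x J)" if "x \<in> unit_tensors n k" "\<omega> (s x) = 1" "J \<in> words n k" for x k J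
  proof -
    have "\<omega> (star A (s x) \<otimes>\<^bsub>A\<^esub> wd (gens J)) = \<omega> (wd (gens J))"
      using state_fixed(1)[OF \<omega>(1) that(1,2)] gens_words that(3) by blast
    then show ?thesis
      using star_s_word[OF state_linear[OF \<omega>(1)] _ that(3), of x] that(1) state_one[OF \<omega>(1)] by (simp add: unit_tensors_def)
  qed
  interpret W: word_functional n "\<lambda>w. \<omega> (wd w)" y y l
    using y \<omega> by (intro state_word_functional) auto
  have "l \<le> m"
  proof (rule ccontr)
    assume "\<not> l \<le> m"
    then have m: "0 < m" "m < l" using z(2) by (auto simp: One_nat_def Suc_le_eq)
    have "W.coeffs m = (\<lambda>w. 0)"
      using nonperiodic_no_commuting[OF yt y(2) W.coeffs_in _ m] W.coeffs_intertwine by blast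
    moreover obtain J where J: "J \<in> words n m" "z J \<noteq> 0" using nonzero_word[OF zt] by blast
    moreover have "W.coeffs m J = z J" using J val[OF z(1) \<omega>(2)] by (simp add: W.coeffs_def)
    ultimately show False by simp
  qed
  moreover have "z = y" if lm: "l = m"
  proof (rule tensors_eqI[OF zt(1)])
    show "y \<in> tensors n m" using yt lm by simp
    fix J assume J: "J \<in> words n m"
    have "cnj (z J) = cnj (y J)" using val[OF z(1) \<omega>(2) J] val[OF y(1) \<omega>(3)] J lm by simp
    then show "z J = y J" by simp
  qed
  ultimately show ?thesis by blast
qed

lemma s_power_mult: assumes "x \<in> tensors n m"
  shows "s (tensor_power x (Suc p)) = s x \<otimes>\<^bsub>A\<^esub> s (tensor_power x p)"
    and "s (tensor_power x (Suc p)) = s (tensor_power x p) \<otimes>\<^bsub>A\<^esub> s x"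
  using s_mult[OF assms tensor_power_in[OF assms]] s_mult[OF tensor_power_in[OF assms] assms]
  by (simp, simp only: tensor_power_Suc_right)

text \<open>Let \<open>V = s(x)\<close>, so that \<open>V\<^sup>p \<Omega> = \<Omega>\<close> in the GNS representation.  Then \<open>\<omega>\<close> and \<open>\<omega> (V* \<cdot> V)\<close>
  agree, hence \<open>4 \<omega>\<close> is the sum of the positive functionals \<open>\<omega> ((1 \<plusminus> \<alpha> V)* \<cdot> (1 \<plusminus> \<alpha> V))\<close> for
  \<open>\<bar>\<alpha>\<bar> = 1\<close>.  By purity these are multiples of \<open>\<omega>\<close>, which makes \<open>\<Omega>\<close> an eigenvector of \<open>V\<close>.\<close>

lemma pure_sub_cuntz_nonperiodic:
  assumes x: "x \<in> unit_tensors n m" "m \<ge> 1" "nonperiodic n x" and p: "p \<ge> 1"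
    and pure: "\<omega> \<in> pure_states A" and one: "\<omega> (s (tensor_power x p)) = 1"
  shows "\<exists>c. cmod c = 1 \<and> \<omega> (s (\<lambda>w. c * x w)) = 1"
proof -
  have \<omega>: "\<omega> \<in> states A" using pure by (simp add: pure_states_def)
  interpret cstar_functional A anorm \<omega> by (rule state_functional[OF \<omega>])
  note lin = state_linear[OF \<omega>]
  have xt: "x \<in> tensors n m" "x \<noteq> (\<lambda>w. 0)" using x unit_nonzero by (auto simp: unit_tensors_def)
  define V where "V = s x"
  define Y where "Y j = s (tensor_power x j)" for j
  have V: "V \<in> carrier A" using s_closed[OF xt(1)] by (simp add: V_def)
  have Y: "Y j \<in> carrier A" for j using s_closed[OF tensor_power_in[OF xt(1)]] by (simp add: Y_def)
  have VY: "V \<otimes>\<^bsub>A\<^esub> Y j = Y j \<otimes>\<^bsub>A\<^esub> V" for j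
    using s_power_mult[OF xt(1), of j] by (simp add: V_def Y_def)
  have pu: "tensor_power x p \<in> unit_tensors n (p * m)" by (rule unit_power[OF x(1)])
  note fx = state_fixed[OF \<omega> pu one, folded Y_def]
  define g where "g a = \<omega> (star A V \<otimes>\<^bsub>A\<^esub> (a \<otimes>\<^bsub>A\<^esub> V)) - \<omega> a" for a
  have g: "linear_functional g"
    using linear_functionalD[OF functional_sandwich[OF lin A.star_closed[OF V] V]] linear_functionalD[OF lin]
    by (simp add: linear_functional_def g_def algebra_simps)
  have g_left: "g (star A (Y p) \<otimes>\<^bsub>A\<^esub> a) = g a" if a: "a \<in> carrier A" for a
  proof -
    have "star A V \<otimes>\<^bsub>A\<^esub> star A (Y p) = star A (Y p) \<otimes>\<^bsub>A\<^esub> star A V"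
      using VY[of p] V Y by (simp flip: A.star_mult)
    then have "star A V \<otimes>\<^bsub>A\<^esub> ((star A (Y p) \<otimes>\<^bsub>A\<^esub> a) \<otimes>\<^bsub>A\<^esub> V) = star A (Y p) \<otimes>\<^bsub>A\<^esub> (star A V \<otimes>\<^bsub>A\<^esub> (a \<otimes>\<^bsub>A\<^esub> V))"
      using V Y a by (simp flip: A.mult_assoc)
    then show ?thesis using fx(1) V a by (simp add: g_def)
  qed
  have g_right: "g (a \<otimes>\<^bsub>A\<^esub> Y p) = g a" if a: "a \<in> carrier A" for a
  proof -
    have "star A V \<otimes>\<^bsub>A\<^esub> ((a \<otimes>\<^bsub>A\<^esub> Y p) \<otimes>\<^bsub>A\<^esub> V) = (star A V \<otimes>\<^bsub>A\<^esub> (a \<otimes>\<^bsub>A\<^esub> V)) \<otimes>\<^bsub>A\<^esub> Y p"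
      using V Y a by (simp add: A.mult_assoc VY)
    then show ?thesis using fx(2) V a by (simp add: g_def)
  qed
  \<comment> \<open>V commutes with its powers and V* V = 1, so sandwiching between V* and V leaves
    the value at each power unchanged.\<close>
  have gY: "g (Y j) = 0" for j
  proof -
    have "star A V \<otimes>\<^bsub>A\<^esub> (Y j \<otimes>\<^bsub>A\<^esub> V) = \<one>\<^bsub>A\<^esub> \<otimes>\<^bsub>A\<^esub> (star A V \<otimes>\<^bsub>A\<^esub> (V \<otimes>\<^bsub>A\<^esub> Y j))"
      using V Y by (simp add: VY)
    then have "\<omega> (star A V \<otimes>\<^bsub>A\<^esub> (Y j \<otimes>\<^bsub>A\<^esub> V)) = \<omega> (\<one>\<^bsub>A\<^esub> \<otimes>\<^bsub>A\<^esub> Y j)"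
      using isometry[OF lin x(1) A.one_closed Y] by (simp only: V_def)
    then show ?thesis using Y by (simp add: g_def)
  qed
  have pm: "p * m \<ge> 1" using p x(2) by (simp add: Suc_le_eq One_nat_def)
  interpret W: word_functional n "\<lambda>w. g (wd w)" "tensor_power x p" "tensor_power x p" "p * m"
    by (rule word_functionalI[OF g pu pu pm]) (simp_all add: g_left g_right flip: Y_def)
  have wd0: "g (wd w) = 0" if "w \<in> lists (letters n)" for w
  proof (rule W.vanish_criterion[OF _ that])
    fix d u assume "d < p * m" and u: "u \<in> tensors n d" "u \<noteq> (\<lambda>w. 0)"
      "tensor (tensor_power x p) u = tensor u (tensor_power x p)"
    \<comment> \<open>The order p * m admits nonscalar solutions here, but only multiples of powers
      of x, and these are settled by \<open>gY\<close>.\<close>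
    obtain j c where u_eq: "u = (\<lambda>w. c * tensor_power x j w)"
      using commuting_with_power[OF xt x(3,2) p u] by blast
    have "(\<Sum>L\<in>words n d. u L * g (wd (gens L))) = g (s u)" by (rule s_sum[OF g u(1), symmetric])
    also have "s u = c \<odot>\<^bsub>A\<^esub> Y j" unfolding u_eq Y_def by (rule s_scale[OF tensor_power_in[OF xt(1)]])
    also have "g \<dots> = 0" using linear_functionalD(2)[OF g Y] gY by simp
    finally show "(\<Sum>L\<in>words n d. u L * g (wd (gens L))) = 0" .
  qed
  obtain C where C: "C \<ge> 0" "\<And>a. a \<in> carrier A \<Longrightarrow> cmod (\<omega> a) \<le> C * anorm a" using state_bounded[OF \<omega>] by blast
  have "cmod (g a) \<le> (C * anorm V * anorm V + C) * anorm a" if a: "a \<in> carrier A" for a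
  proof -
    have "anorm (star A V \<otimes>\<^bsub>A\<^esub> (a \<otimes>\<^bsub>A\<^esub> V)) \<le> anorm (star A V) * anorm (a \<otimes>\<^bsub>A\<^esub> V)"
      using V a by (intro A.p_mult) auto
    also have "\<dots> \<le> anorm V * (anorm a * anorm V)"
      using V a A.p_star[OF V] by (auto intro!: mult_left_mono A.p_mult A.p_nonneg)
    finally have "C * anorm (star A V \<otimes>\<^bsub>A\<^esub> (a \<otimes>\<^bsub>A\<^esub> V)) \<le> C * (anorm V * (anorm a * anorm V))"
      using C(1) by (rule mult_left_mono)
    moreover have "cmod (\<omega> (star A V \<otimes>\<^bsub>A\<^esub> (a \<otimes>\<^bsub>A\<^esub> V))) \<le> C * anorm (star A V \<otimes>\<^bsub>A\<^esub> (a \<otimes>\<^bsub>A\<^esub> V))"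
      using V a by (intro C) auto
    ultimately show ?thesis
      using C(2)[OF a] norm_triangle_ineq4[of "\<omega> (star A V \<otimes>\<^bsub>A\<^esub> (a \<otimes>\<^bsub>A\<^esub> V))" "\<omega> a"]
      by (simp add: g_def algebra_simps)
  qed
  then have "g a = 0" if "a \<in> carrier A" for a by (rule functional_eq_zero[OF g _ wd0 that])
  then have inv: "\<omega> (star A V \<otimes>\<^bsub>A\<^esub> (a \<otimes>\<^bsub>A\<^esub> V)) = \<omega> a" if "a \<in> carrier A" for a
    using that by (simp add: g_def)
  define E where "E \<alpha> = \<one>\<^bsub>A\<^esub> \<oplus>\<^bsub>A\<^esub> \<alpha> \<odot>\<^bsub>A\<^esub> V" for \<alpha>
  have E: "E \<alpha> \<in> carrier A" for \<alpha> using V by (simp add: E_def)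
  define P where "P \<alpha> a = \<omega> (star A (E \<alpha>) \<otimes>\<^bsub>A\<^esub> (a \<otimes>\<^bsub>A\<^esub> E \<alpha>))" for \<alpha> a
  \<comment> \<open>Both diagonal terms contribute \<omega>(a), the second one by
    \<open>inv\<close>; the cross terms change sign with \<alpha>.\<close>
  have P_eq: "P \<alpha> a = 2 * \<omega> a + cnj \<alpha> * \<omega> (star A V \<otimes>\<^bsub>A\<^esub> a) + \<alpha> * \<omega> (a \<otimes>\<^bsub>A\<^esub> V)"
    if "cmod \<alpha> = 1" and a: "a \<in> carrier A" for \<alpha> a
  proof -
    have "cnj \<alpha> * \<alpha> = 1" using that(1) complex_norm_square[of \<alpha>] by (simp add: mult.commute)
    then have "cnj \<alpha> * (\<alpha> * \<omega> a) = \<omega> a" by (simp flip: mult.assoc)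
    then show ?thesis
      using V a inv[OF a]
      by (simp add: P_def E_def A.star_add A.star_sm A.mult_add_left A.mult_add_right A.sm_mult A.mult_sm w_add w_sm algebra_simps)
  qed
  have P_pos: "pos_functional A (P \<alpha>)" for \<alpha>
    unfolding P_def by (rule pos_functional_sandwich[OF E])
  define v where "v = \<omega> V"
  have key: "cnj \<alpha> * \<omega> (star A V \<otimes>\<^bsub>A\<^esub> a) + \<alpha> * \<omega> (a \<otimes>\<^bsub>A\<^esub> V) = (cnj \<alpha> * cnj v + \<alpha> * v) * \<omega> a"
    if \<alpha>: "cmod \<alpha> = 1" and a: "a \<in> carrier A" for \<alpha> a
  proof -
    have "P \<alpha> a = P \<alpha> \<one>\<^bsub>A\<^esub> * \<omega> a"
    proof (rule pure_dominated[OF A.star_alg_axioms pure P_pos P_pos _ _ a])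
      show "P \<alpha> b + P (- \<alpha>) b = complex_of_real 4 * \<omega> b" if "b \<in> carrier A" for b
        using P_eq[of \<alpha> b] P_eq[of "- \<alpha>" b] \<alpha> that by simp
    qed simp
    then show ?thesis
      using P_eq[OF \<alpha> a] P_eq[OF \<alpha> A.one_closed] V state_one[OF \<omega>] w_star[OF V]
      by (simp add: v_def algebra_simps)
  qed
  \<comment> \<open>The choices \<alpha> = 1 and \<alpha> = i in \<open>key\<close> give the sum and
    the difference of the two cross terms, so each of them is determined.\<close>
  have mult_V: "\<omega> (a \<otimes>\<^bsub>A\<^esub> V) = v * \<omega> a" if a: "a \<in> carrier A" for a
  proof -
    let ?R = "\<omega> (a \<otimes>\<^bsub>A\<^esub> V)" and ?Z = "\<omega> (star A V \<otimes>\<^bsub>A\<^esub> a)"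
    have 1: "?Z + ?R = cnj v * \<omega> a + v * \<omega> a" using key[of 1 a] a by (simp add: algebra_simps)
    have "\<i> * (?R - ?Z) = \<i> * (v * \<omega> a - cnj v * \<omega> a)" using key[of \<i> a] a by (simp add: algebra_simps)
    then have 2: "?R - ?Z = v * \<omega> a - cnj v * \<omega> a" by (simp only: mult_cancel_left complex_i_not_zero simp_thms)
    have "2 * ?R = (?Z + ?R) + (?R - ?Z)" by simp
    also have "\<dots> = 2 * (v * \<omega> a)" unfolding 1 2 by simp
    finally show ?thesis by simp
  qed
  \<comment> \<open>Iterating the eigenvalue equation turns the value 1 at s(x^p) into v^p = 1.
    Hence v has modulus 1, and conj(v) x is the vector sought.\<close>
  have "\<omega> (Y j) = v ^ j" for j
  proof (induction j)
    case 0
    have "Y 0 = \<one>\<^bsub>A\<^esub>" by (simp add: Y_def s_delta)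
    then show ?case using state_one[OF \<omega>] by simp
  next
    case (Suc j)
    have "Y (Suc j) = Y j \<otimes>\<^bsub>A\<^esub> V" unfolding Y_def V_def by (rule s_power_mult(2)[OF xt(1)])
    then show ?case using mult_V[OF Y] Suc by simp
  qed
  then have "v ^ p = 1" using one by (simp add: Y_def)
  then have "cmod v ^ p = 1 ^ p" by (metis norm_power norm_one power_one)
  then have v1: "cmod v = 1" using p by (intro power_eq_imp_eq_base[of "cmod v" p 1]) auto
  have "\<omega> (s (\<lambda>w. cnj v * x w)) = cnj v * v"
    unfolding s_scale[OF xt(1)] using w_sm[OF V] by (simp add: V_def v_def)
  also have "\<dots> = 1" using v1 complex_norm_square[of v] by (simp add: mult.commute)
  finally show ?thesis using v1 by (intro exI[of _ "cnj v"]) simp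
qed

end

section \<open>Existence of sub-Cuntz states\<close>

text \<open>Bounded operators on a space with a semi-inner product already define a C*-seminorm, so
  finitely supported sequences can serve without passing to a completion.\<close>

locale pre_representation = star_alg A + E: semi_inner_space E B
  for A :: "('a, 'm) star_algebra_scheme" (structure)
    and E :: "(complex, 'e, 'k) module_scheme" and B +
  fixes \<pi> :: "'a \<Rightarrow> 'e \<Rightarrow> 'e"
  assumes pi_closed: "a \<in> carrier A \<Longrightarrow> f \<in> carrier E \<Longrightarrow> \<pi> a f \<in> carrier E"
    and pi_sm_vec: "a \<in> carrier A \<Longrightarrow> f \<in> carrier E \<Longrightarrow> \<pi> a (c \<odot>\<^bsub>E\<^esub> f) = c \<odot>\<^bsub>E\<^esub> \<pi> a f"
    and pi_add: "a \<in> carrier A \<Longrightarrow> b \<in> carrier A \<Longrightarrow> f \<in> carrier E \<Longrightarrow> \<pi> (a \<oplus> b) f = \<pi> a f \<oplus>\<^bsub>E\<^esub> \<pi> b f"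
    and pi_sm: "a \<in> carrier A \<Longrightarrow> f \<in> carrier E \<Longrightarrow> \<pi> (c \<odot> a) f = c \<odot>\<^bsub>E\<^esub> \<pi> a f"
    and pi_mult: "a \<in> carrier A \<Longrightarrow> b \<in> carrier A \<Longrightarrow> f \<in> carrier E \<Longrightarrow> \<pi> (a \<otimes> b) f = \<pi> a (\<pi> b f)"
    and pi_star: "a \<in> carrier A \<Longrightarrow> f \<in> carrier E \<Longrightarrow> g \<in> carrier E \<Longrightarrow> B (\<pi> (star A a) f) g = B f (\<pi> a g)"
    and pi_bounded: "a \<in> carrier A \<Longrightarrow> \<exists>C. \<forall>f\<in>carrier E. E.nrm (\<pi> a f) \<le> C * E.nrm f"
begin

definition opnorm where "opnorm a = (SUP f\<in>{f \<in> carrier E. E.nrm f \<le> 1}. E.nrm (\<pi> a f))"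

lemma opnorm_bdd:
  assumes a: "a \<in> carrier A" shows "bdd_above ((\<lambda>f. E.nrm (\<pi> a f)) ` {f \<in> carrier E. E.nrm f \<le> 1})"
proof -
  obtain C where C: "\<And>f. f \<in> carrier E \<Longrightarrow> E.nrm (\<pi> a f) \<le> C * E.nrm f" using pi_bounded[OF a] by blast
  show ?thesis
  proof (rule bdd_aboveI2)
    fix f assume f: "f \<in> {f \<in> carrier E. E.nrm f \<le> 1}"
    have "E.nrm (\<pi> a f) \<le> C * E.nrm f" using C f by simp
    also have "\<dots> \<le> \<bar>C\<bar> * 1" using f E.nrm_nonneg[of f] by (intro mult_mono) auto
    finally show "E.nrm (\<pi> a f) \<le> \<bar>C\<bar>" by simp
  qed
qed

lemma opnorm_bound: assumes a: "a \<in> carrier A" and f: "f \<in> carrier E"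
  shows "E.nrm (\<pi> a f) \<le> opnorm a * E.nrm f"
proof -
  obtain C where C: "\<And>f. f \<in> carrier E \<Longrightarrow> E.nrm (\<pi> a f) \<le> C * E.nrm f" using pi_bounded[OF a] by blast
  show ?thesis
  proof (cases "E.nrm f = 0")
    case True
    then show ?thesis using C[OF f] by simp
  next
    case False
    then have nf: "E.nrm f > 0" using E.nrm_nonneg[OF f] by simp
    define g where "g = complex_of_real (inverse (E.nrm f)) \<odot>\<^bsub>E\<^esub> f"
    have g: "g \<in> carrier E" "E.nrm g = 1" using f nf by (simp_all add: g_def E.nrm_sm norm_inverse)
    have "E.nrm (\<pi> a g) \<le> opnorm a"
      unfolding opnorm_def using g by (intro cSUP_upper opnorm_bdd a) simp
    moreover have "E.nrm (\<pi> a g) = inverse (E.nrm f) * E.nrm (\<pi> a f)"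
      using a f nf by (simp add: g_def pi_sm_vec E.nrm_sm pi_closed norm_inverse)
    ultimately show ?thesis using nf by (simp add: field_simps)
  qed
qed

lemma opnorm_least:
  assumes "C \<ge> 0" "\<And>f. f \<in> carrier E \<Longrightarrow> E.nrm (\<pi> a f) \<le> C * E.nrm f" shows "opnorm a \<le> C"
  unfolding opnorm_def
proof (rule cSUP_least)
  have "\<zero>\<^bsub>E\<^esub> \<in> {f \<in> carrier E. E.nrm f \<le> 1}" by simp
  then show "{f \<in> carrier E. E.nrm f \<le> 1} \<noteq> {}" by blast
  fix f assume f: "f \<in> {f \<in> carrier E. E.nrm f \<le> 1}"
  then have "E.nrm (\<pi> a f) \<le> C * E.nrm f" using assms by simp
  also have "\<dots> \<le> C * 1" using f assms(1) by (intro mult_left_mono) auto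
  finally show "E.nrm (\<pi> a f) \<le> C" by simp
qed

lemma opnorm_nonneg: assumes a: "a \<in> carrier A" shows "0 \<le> opnorm a"
proof -
  have "E.nrm (\<pi> a \<zero>\<^bsub>E\<^esub>) \<le> opnorm a" unfolding opnorm_def by (intro cSUP_upper opnorm_bdd a) auto
  then show ?thesis using E.nrm_nonneg[OF pi_closed[OF a E.M.zero_closed]] by linarith
qed

lemma opnorm_star_le: assumes a: "a \<in> carrier A" shows "opnorm (star A a) \<le> opnorm a"
proof (rule opnorm_least[OF opnorm_nonneg[OF a]])
  fix f assume f: "f \<in> carrier E"
  let ?h = "\<pi> (star A a) f"
  have h: "?h \<in> carrier E" using a f by (simp add: pi_closed)
  have "(E.nrm ?h)\<^sup>2 = Re (B f (\<pi> a ?h))" using pi_star[OF a f h] h by (simp add: E.nrm_sq)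
  also have "\<dots> \<le> E.nrm f * E.nrm (\<pi> a ?h)"
    using E.Cauchy_Schwarz[OF f pi_closed[OF a h]] complex_Re_le_cmod order_trans by blast
  also have "\<dots> \<le> E.nrm f * (opnorm a * E.nrm ?h)"
    by (intro mult_left_mono opnorm_bound a h E.nrm_nonneg f)
  finally have "E.nrm ?h * E.nrm ?h \<le> (opnorm a * E.nrm f) * E.nrm ?h" by (simp add: power2_eq_square mult_ac)
  moreover have "opnorm a * E.nrm f \<ge> 0" using opnorm_nonneg[OF a] E.nrm_nonneg[OF f] by simp
  ultimately show "E.nrm ?h \<le> opnorm a * E.nrm f"
    using E.nrm_nonneg[OF h] by (cases "E.nrm ?h = 0") auto
qed

text \<open>The lower bound in the C*-identity comes from writing the squared length of \<pi>(a) f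
  as the inner product of f with \<pi>(a* a) f; the upper bound from submultiplicativity and
  \<open>opnorm_star_le\<close>.\<close>

lemma cstar_seminorm_opnorm: "cstar_seminorm A opnorm"
  unfolding cstar_seminorm_def
proof (intro conjI ballI allI)
  fix a assume a: "a \<in> carrier A"
  show "0 \<le> opnorm a" by (rule opnorm_nonneg[OF a])
  have sm_le: "opnorm (c \<odot> b) \<le> cmod c * opnorm b" if b: "b \<in> carrier A" for c b
  proof (rule opnorm_least)
    show "E.nrm (\<pi> (c \<odot> b) f) \<le> cmod c * opnorm b * E.nrm f" if "f \<in> carrier E" for f
      using opnorm_bound[OF b that] b that
      by (simp add: pi_sm E.nrm_sm pi_closed mult.assoc mult_left_mono)
  qed (use opnorm_nonneg[OF b] in simp)
  show "opnorm (c \<odot> a) = cmod c * opnorm a" for c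
  proof (cases "c = 0")
    case True
    then show ?thesis using sm_le[OF a, of 0] opnorm_nonneg[of \<zero>] a by simp
  next
    case False
    have "cmod c * opnorm a = cmod c * opnorm (inverse c \<odot> (c \<odot> a))" using a False by (simp add: sm_sm)
    also have "\<dots> \<le> cmod c * (cmod (inverse c) * opnorm (c \<odot> a))"
      using a by (intro mult_left_mono sm_le) auto
    also have "\<dots> = opnorm (c \<odot> a)" using False by (simp add: norm_inverse)
    finally show ?thesis using sm_le[OF a, of c] by simp
  qed
  have mult_le: "opnorm (b \<otimes> c) \<le> opnorm b * opnorm c" if b: "b \<in> carrier A" and c: "c \<in> carrier A" for b c
  proof (rule opnorm_least)
    fix f assume f: "f \<in> carrier E"
    have "E.nrm (\<pi> b (\<pi> c f)) \<le> opnorm b * E.nrm (\<pi> c f)" by (intro opnorm_bound pi_closed b c f)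
    also have "\<dots> \<le> opnorm b * (opnorm c * E.nrm f)"
      by (intro mult_left_mono opnorm_bound b c f opnorm_nonneg)
    finally show "E.nrm (\<pi> (b \<otimes> c) f) \<le> opnorm b * opnorm c * E.nrm f" using b c f by (simp add: pi_mult mult_ac)
  qed (use opnorm_nonneg b c in simp)
  show "opnorm (star A a \<otimes> a) = (opnorm a)\<^sup>2"
  proof (rule antisym)
    have "opnorm (star A a \<otimes> a) \<le> opnorm (star A a) * opnorm a" using a by (intro mult_le) auto
    also have "\<dots> \<le> opnorm a * opnorm a" by (intro mult_right_mono opnorm_star_le opnorm_nonneg a)
    finally show "opnorm (star A a \<otimes> a) \<le> (opnorm a)\<^sup>2" by (simp add: power2_eq_square)
    let ?q = "opnorm (star A a \<otimes> a)"
    have q: "?q \<ge> 0" using a by (intro opnorm_nonneg) auto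
    have "opnorm a \<le> sqrt ?q"
    proof (rule opnorm_least)
      fix f assume f: "f \<in> carrier E"
      have af: "\<pi> a f \<in> carrier E" using a f by (rule pi_closed)
      have "(E.nrm (\<pi> a f))\<^sup>2 = Re (B f (\<pi> (star A a \<otimes> a) f))"
        using pi_star[OF star_closed[OF a] f af] a f af by (simp add: E.nrm_sq pi_mult)
      also have "\<dots> \<le> E.nrm f * E.nrm (\<pi> (star A a \<otimes> a) f)"
        using E.Cauchy_Schwarz[OF f pi_closed[OF _ f], of "star A a \<otimes> a"] a complex_Re_le_cmod order_trans by blast
      also have "\<dots> \<le> E.nrm f * (?q * E.nrm f)"
        using a by (intro mult_left_mono opnorm_bound f E.nrm_nonneg) auto
      also have "\<dots> = (sqrt ?q * E.nrm f)\<^sup>2" using q by (simp add: power_mult_distrib power2_eq_square)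
      finally show "E.nrm (\<pi> a f) \<le> sqrt ?q * E.nrm f"
        by (rule power2_le_imp_le) (use q E.nrm_nonneg[OF f] in simp)
    qed (use q in simp)
    then have "(opnorm a)\<^sup>2 \<le> (sqrt ?q)\<^sup>2" using opnorm_nonneg[OF a] by (rule power_mono)
    then show "(opnorm a)\<^sup>2 \<le> ?q" using q by simp
  qed
  fix b assume b: "b \<in> carrier A"
  show "opnorm (a \<otimes> b) \<le> opnorm a * opnorm b" by (rule mult_le[OF a b])
  show "opnorm (a \<oplus> b) \<le> opnorm a + opnorm b"
  proof (rule opnorm_least)
    fix f assume f: "f \<in> carrier E"
    have "E.nrm (\<pi> (a \<oplus> b) f) \<le> E.nrm (\<pi> a f) + E.nrm (\<pi> b f)"
      using a b f by (simp add: pi_add E.nrm_add pi_closed)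
    then show "E.nrm (\<pi> (a \<oplus> b) f) \<le> (opnorm a + opnorm b) * E.nrm f"
      using opnorm_bound[OF a f] opnorm_bound[OF b f] by (simp add: algebra_simps)
  qed (use opnorm_nonneg a b in simp)
qed

end

section \<open>A concrete representation on finitely supported sequences\<close>

definition fin_seqs :: "(complex, nat \<Rightarrow> complex) module" where
  "fin_seqs = \<lparr> carrier = {f. finite {k. f k \<noteq> 0}}, monoid.mult = undefined, monoid.one = undefined,
     ring.zero = (\<lambda>k. 0), ring.add = (\<lambda>f g k. f k + g k), module.smult = (\<lambda>c f k. c * f k) \<rparr>"

definition fin_inner :: "(nat \<Rightarrow> complex) \<Rightarrow> (nat \<Rightarrow> complex) \<Rightarrow> complex" where
  "fin_inner f g = (\<Sum>k | f k \<noteq> 0. cnj (f k) * g k)"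

lemma fin_seqs_simps [simp]:
  "f \<in> carrier fin_seqs \<longleftrightarrow> finite {k. f k \<noteq> 0}"
  "\<zero>\<^bsub>fin_seqs\<^esub> = (\<lambda>k. 0)" "f \<oplus>\<^bsub>fin_seqs\<^esub> g = (\<lambda>k. f k + g k)" "c \<odot>\<^bsub>fin_seqs\<^esub> f = (\<lambda>k. c * f k)"
  by (simp_all add: fin_seqs_def)

text \<open>\<open>fin_inner\<close> sums over the support of its first argument; to exchange the
  arguments, both sums are moved to a common finite index set.\<close>

lemma fin_inner_superset: "finite S \<Longrightarrow> {k. f k \<noteq> 0} \<subseteq> S \<Longrightarrow> fin_inner f g = (\<Sum>k\<in>S. cnj (f k) * g k)"
  unfolding fin_inner_def by (rule sum.mono_neutral_left) auto

lemma fin_add: "finite {k. f k \<noteq> 0} \<Longrightarrow> finite {k. g k \<noteq> 0} \<Longrightarrow> finite {k. f k + g k \<noteq> (0::complex)}"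
  by (rule finite_subset[of _ "{k. f k \<noteq> 0} \<union> {k. g k \<noteq> 0}"]) auto

lemma fin_scale: "finite {k. f k \<noteq> 0} \<Longrightarrow> finite {k. c * f k \<noteq> (0::complex)}"
  by (rule finite_subset[of _ "{k. f k \<noteq> 0}"]) auto

lemma semi_inner_fin_seqs: "semi_inner_space fin_seqs fin_inner"
proof -
  have "abelian_group fin_seqs"
  proof (rule abelian_groupI)
    fix f assume "f \<in> carrier fin_seqs"
    then show "\<exists>g\<in>carrier fin_seqs. g \<oplus>\<^bsub>fin_seqs\<^esub> f = \<zero>\<^bsub>fin_seqs\<^esub>"
      by (intro bexI[of _ "\<lambda>k. - f k"]) auto
  qed (auto simp: fin_add add_ac)
  then interpret cspace fin_seqs by (rule cspaceI) (auto simp: fin_scale algebra_simps)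
  show ?thesis
  proof unfold_locales
    fix f g :: "nat \<Rightarrow> complex" assume "f \<in> carrier fin_seqs" "g \<in> carrier fin_seqs"
    then have fin: "finite ({k. f k \<noteq> 0} \<union> {k. g k \<noteq> 0})" by simp
    show "fin_inner g f = cnj (fin_inner f g)"
      by (subst (1 2) fin_inner_superset[OF fin]) (auto simp: mult.commute)
  next
    fix f :: "nat \<Rightarrow> complex"
    have "fin_inner f f = complex_of_real (\<Sum>k | f k \<noteq> 0. (cmod (f k))\<^sup>2)"
      unfolding fin_inner_def of_real_sum
      by (intro sum.cong refl) (simp only: complex_norm_square mult.commute)
    moreover have "(\<Sum>k | f k \<noteq> 0. (cmod (f k))\<^sup>2) \<ge> 0" by (simp add: sum_nonneg)
    ultimately show "fin_inner f f \<in> \<real>\<^sub>\<ge>\<^sub>0"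
      by (simp only: complex_nonneg_Reals_iff Re_complex_of_real Im_complex_of_real)
  qed (simp_all add: fin_inner_def algebra_simps sum.distrib sum_distrib_left)
qed

text \<open>A permutative representation: s_i maps the basis vector e_k to e_(n k + i - 1), that is,
  it appends the digit i - 1 to k in base n. The adjoint removes the last digit if it equals i - 1
  and annihilates e_k otherwise.\<close>

fun act_letter :: "nat \<Rightarrow> nat letter \<Rightarrow> (nat \<Rightarrow> complex) \<Rightarrow> nat \<Rightarrow> complex" where
  "act_letter n (Gen i) f = (\<lambda>k. if k mod n = i - 1 then f (k div n) else 0)"
| "act_letter n (Adj i) f = (\<lambda>k. f (n * k + (i - 1)))"

definition act_word :: "nat \<Rightarrow> nat letter list \<Rightarrow> (nat \<Rightarrow> complex) \<Rightarrow> nat \<Rightarrow> complex" where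
  "act_word n w f = foldr (act_letter n) w f"

definition act_poly :: "nat \<Rightarrow> (nat letter list \<Rightarrow> complex) \<Rightarrow> (nat \<Rightarrow> complex) \<Rightarrow> nat \<Rightarrow> complex" where
  "act_poly n a f = (\<lambda>k. \<Sum>w | a w \<noteq> 0. a w * act_word n w f k)"

context cuntz_algebra
begin

interpretation E: semi_inner_space fin_seqs fin_inner by (rule semi_inner_fin_seqs)

lemma index_div_mod:
  assumes "i \<in> {1..n}" shows "(n * k + (i - 1)) div n = k" "(n * k + (i - 1)) mod n = i - 1"
proof -
  have "i - 1 < n" using assms by auto
  then show "(n * k + (i - 1)) div n = k" "(n * k + (i - 1)) mod n = i - 1"
    using n_ge_2 by (simp_all only: div_mult_self4 mod_mult_self4 div_less mod_less)
qed

lemma act_letter_closed: assumes "l \<in> letters n" "f \<in> carrier fin_seqs" shows "act_letter n l f \<in> carrier fin_seqs"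
proof (cases l)
  case (Gen i)
  have "{k. act_letter n l f k \<noteq> 0} \<subseteq> (\<lambda>k. n * k + (i - 1)) ` {k. f k \<noteq> 0}"
  proof
    fix k assume "k \<in> {k. act_letter n l f k \<noteq> 0}"
    then have "k mod n = i - 1" "f (k div n) \<noteq> 0" using Gen by (auto split: if_splits)
    then show "k \<in> (\<lambda>k. n * k + (i - 1)) ` {k. f k \<noteq> 0}"
      using mult_div_mod_eq[of n k] by (intro image_eqI[of _ _ "k div n"]) auto
  qed
  then show ?thesis using assms by (simp add: finite_subset)
next
  case (Adj i)
  have "finite ((\<lambda>k. n * k + (i - 1)) -` {k. f k \<noteq> 0})"
    using assms n_ge_2 by (intro finite_vimageI) (auto simp: inj_on_def)
  then show ?thesis using Adj by (simp add: vimage_def)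
qed

lemma act_letter_adjoint:
  assumes i: "i \<in> {1..n}" and f: "f \<in> carrier fin_seqs" and g: "g \<in> carrier fin_seqs"
  shows "fin_inner (act_letter n (Adj i) f) g = fin_inner f (act_letter n (Gen i) g)"
proof -
  obtain K where K: "{k. f k \<noteq> 0} \<subseteq> {..<K}" using f finite_nat_bounded by auto
  \<comment> \<open>Indices never decrease, so one bound K on the support of f also bounds that of
    its image under the adjoint, and all sums may run below K.\<close>
  have ge: "n * k + (i - 1) \<ge> k" for k using n_ge_2 by (simp add: trans_le_add1)
  have sub: "{k. act_letter n (Adj i) f k \<noteq> 0} \<subseteq> {..<K}"
  proof
    fix k assume "k \<in> {k. act_letter n (Adj i) f k \<noteq> 0}"
    then have "n * k + (i - 1) \<in> {..<K}" using K by auto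
    then show "k \<in> {..<K}" using ge[of k] by simp
  qed
  have "fin_inner (act_letter n (Adj i) f) g = (\<Sum>k\<in>{..<K}. cnj (f (n * k + (i - 1))) * g k)"
    by (subst fin_inner_superset[OF _ sub]) simp_all
  also have "\<dots> = (\<Sum>k\<in>{k\<in>{..<K}. n * k + (i - 1) < K}. cnj (f (n * k + (i - 1))) * g k)"
    using K by (intro sum.mono_neutral_right) auto
  also have "\<dots> = (\<Sum>k\<in>{k\<in>{..<K}. k mod n = i - 1}. cnj (f k) * g (k div n))"
  proof (rule sum.reindex_bij_witness[where j = "\<lambda>k. n * k + (i - 1)" and i = "\<lambda>k. k div n"])
    fix k assume "k \<in> {k\<in>{..<K}. n * k + (i - 1) < K}"
    then show "(n * k + (i - 1)) div n = k" "n * k + (i - 1) \<in> {k\<in>{..<K}. k mod n = i - 1}"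
      "cnj (f (n * k + (i - 1))) * g ((n * k + (i - 1)) div n) = cnj (f (n * k + (i - 1))) * g k"
      using index_div_mod[OF i, of k] by (simp_all del: add_diff_assoc diff_add_assoc)
  next
    fix k assume k: "k \<in> {k\<in>{..<K}. k mod n = i - 1}"
    then show eq: "n * (k div n) + (i - 1) = k" using mult_div_mod_eq[of n k] by simp
    show "k div n \<in> {k\<in>{..<K}. n * k + (i - 1) < K}" using k eq le_less_trans[OF div_le_dividend[of k n], of K] by simp
  qed
  also have "\<dots> = (\<Sum>k\<in>{..<K}. cnj (f k) * act_letter n (Gen i) g k)"
    by (subst sum.inter_filter) (auto intro!: sum.cong)
  also have "\<dots> = fin_inner f (act_letter n (Gen i) g)"
    by (rule fin_inner_superset[OF _ K, symmetric]) simp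
  finally show ?thesis .
qed

lemma act_letter_star:
  assumes "l \<in> letters n" "f \<in> carrier fin_seqs" "g \<in> carrier fin_seqs"
  shows "fin_inner (act_letter n (adj_letter l) f) g = fin_inner f (act_letter n l g)"
proof (cases l)
  case (Gen i)
  then show ?thesis using act_letter_adjoint[of i f g] assms by (auto simp: letters_def)
next
  case (Adj i)
  then have i: "i \<in> {1..n}" and li: "Gen i \<in> letters n" using assms by (auto simp: letters_def)
  have "fin_inner (act_letter n (Gen i) f) g = cnj (fin_inner g (act_letter n (Gen i) f))"
    using act_letter_closed[OF li assms(2)] assms(3) by (intro E.B_commute)
  also have "\<dots> = cnj (fin_inner (act_letter n (Adj i) g) f)"
    using act_letter_adjoint[OF i assms(3,2)] by simp
  also have "\<dots> = fin_inner f (act_letter n (Adj i) g)"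
    using act_letter_closed[OF assms(1,3)] assms(2) Adj by (intro E.B_commute[symmetric]) auto
  finally show ?thesis using Adj by simp
qed

lemma act_rel: assumes "i \<in> {1..n}" "j \<in> {1..n}"
  shows "act_letter n (Adj i) (act_letter n (Gen j) f) = (if i = j then f else (\<lambda>k. 0))"
proof
  fix k
  have "i - 1 = j - 1 \<longleftrightarrow> i = j" using assms by auto
  then show "act_letter n (Adj i) (act_letter n (Gen j) f) k = (if i = j then f else (\<lambda>k. 0)) k"
    unfolding act_letter.simps index_div_mod[OF assms(1)] by simp
qed

lemma act_sum: "(\<Sum>i=1..n. act_letter n (Gen i) (act_letter n (Adj i) f) k) = f k"
proof -
  have k: "Suc (k mod n) \<in> {1..n}" using n_ge_2 mod_less_divisor[of n k] by (auto simp: Suc_le_eq One_nat_def)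
  have "(\<Sum>i=1..n. act_letter n (Gen i) (act_letter n (Adj i) f) k) =
      (\<Sum>i=1..n. if i = Suc (k mod n) then f k else 0)"
  proof (intro sum.cong refl)
    fix i assume i: "i \<in> {1..n}"
    then have "k mod n = i - 1 \<longleftrightarrow> i = Suc (k mod n)" by auto
    moreover have "n * (k div n) + k mod n = k" by simp
    ultimately show "act_letter n (Gen i) (act_letter n (Adj i) f) k = (if i = Suc (k mod n) then f k else 0)"
      by (auto simp del: mult_div_mod_eq)
  qed
  then show ?thesis using k by simp
qed

text \<open>Generators act isometrically by \<open>act_rel\<close>. For an adjoint letter with image
  h, the squared length of h is the inner product of f with s_i h, so Cauchy-Schwarz gives the
  contraction.\<close>

lemma act_letter_le: assumes l: "l \<in> letters n" and f: "f \<in> carrier fin_seqs"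
  shows "E.nrm (act_letter n l f) \<le> E.nrm f"
proof -
  have gen: "E.nrm (act_letter n (Gen i) h) = E.nrm h" if i: "i \<in> {1..n}" and h: "h \<in> carrier fin_seqs" for i h
  proof -
    have li: "Gen i \<in> letters n" using i by (simp add: letters_def)
    have "fin_inner (act_letter n (Gen i) h) (act_letter n (Gen i) h) = fin_inner (act_letter n (Adj i) (act_letter n (Gen i) h)) h"
      using act_letter_adjoint[OF i act_letter_closed[OF li h] h] by simp
    also have "\<dots> = fin_inner h h" by (subst act_rel[OF i i]) simp
    finally show ?thesis by (simp add: E.nrm_def)
  qed
  show ?thesis
  proof (cases l)
    case (Gen i)
    then have "i \<in> {1..n}" using l by (auto simp: letters_def)
    then show ?thesis using gen f Gen by simp
  next
    case (Adj i)
    then have i: "i \<in> {1..n}" and li: "Gen i \<in> letters n" using l by (auto simp: letters_def)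
    let ?h = "act_letter n l f"
    have h: "?h \<in> carrier fin_seqs" using act_letter_closed[OF l f] .
    have "(E.nrm ?h)\<^sup>2 = Re (fin_inner f (act_letter n (Gen i) ?h))"
      using act_letter_adjoint[OF i f h] h Adj by (simp only: E.nrm_sq)
    also have "\<dots> \<le> E.nrm f * E.nrm (act_letter n (Gen i) ?h)"
      using E.Cauchy_Schwarz[OF f act_letter_closed[OF li h]] complex_Re_le_cmod order_trans by blast
    also have "E.nrm (act_letter n (Gen i) ?h) = E.nrm ?h" by (rule gen[OF i h])
    finally have "E.nrm ?h * E.nrm ?h \<le> E.nrm f * E.nrm ?h" by (simp only: power2_eq_square)
    then show ?thesis
      using E.nrm_nonneg[OF h] E.nrm_nonneg[OF f] by (cases "E.nrm ?h = 0") auto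
  qed
qed

lemma act_word_simps: "act_word n [] f = f" "act_word n (l # w) f = act_letter n l (act_word n w f)"
  "act_word n (u @ v) f = act_word n u (act_word n v f)"
  by (simp_all add: act_word_def)

lemma act_letter_linear:
  "act_letter n l (\<lambda>k. f k + c * g k) = (\<lambda>k. act_letter n l f k + c * act_letter n l g k)"
  by (cases l) (auto simp: fun_eq_iff)

lemma act_word_linear:
  "act_word n w (\<lambda>k. f k + c * g k) = (\<lambda>k. act_word n w f k + c * act_word n w g k)"
  by (induction w) (simp_all add: act_word_simps act_letter_linear)

lemma act_word_zero: "act_word n w (\<lambda>k. 0) = (\<lambda>k. 0)"
  using act_word_linear[of w "\<lambda>k. 0" "-1" "\<lambda>k. 0"] by simp

lemma act_word_scale: "act_word n w (\<lambda>k. c * f k) = (\<lambda>k. c * act_word n w f k)"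
  using act_word_linear[of w "\<lambda>k. 0" c f] by (simp add: act_word_zero)

lemma act_word_closed: "w \<in> lists (letters n) \<Longrightarrow> f \<in> carrier fin_seqs \<Longrightarrow> act_word n w f \<in> carrier fin_seqs"
proof (induction w)
  case (Cons l w)
  then show ?case unfolding act_word_simps by (intro act_letter_closed) auto
qed (simp add: act_word_simps)

lemma act_word_le: "w \<in> lists (letters n) \<Longrightarrow> f \<in> carrier fin_seqs \<Longrightarrow> E.nrm (act_word n w f) \<le> E.nrm f"
proof (induction w)
  case (Cons l w)
  then have "E.nrm (act_letter n l (act_word n w f)) \<le> E.nrm (act_word n w f)"
    by (intro act_letter_le act_word_closed) auto
  then show ?case using Cons by (simp add: act_word_simps)
qed (simp add: act_word_simps)

lemma act_word_star:
  "w \<in> lists (letters n) \<Longrightarrow> f \<in> carrier fin_seqs \<Longrightarrow> g \<in> carrier fin_seqs \<Longrightarrow>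
    fin_inner (act_word n (adj_word w) f) g = fin_inner f (act_word n w g)"
proof (induction w arbitrary: f)
  case (Cons l w)
  have l: "l \<in> letters n" "adj_letter l \<in> letters n" using Cons.prems by (auto simp: letters_def)
  have "adj_word (l # w) = adj_word w @ [adj_letter l]" by (simp add: adj_word_def)
  then have "fin_inner (act_word n (adj_word (l # w)) f) g = fin_inner (act_letter n (adj_letter l) f) (act_word n w g)"
    using Cons.IH[OF _ act_letter_closed[OF l(2)]] Cons.prems by (simp add: act_word_simps)
  also have "\<dots> = fin_inner f (act_letter n l (act_word n w g))"
    using Cons.prems l by (intro act_letter_star act_word_closed) auto
  finally show ?case by (simp add: act_word_simps)
qed (simp add: act_word_simps adj_word_def)

lemma act_poly_superset:
  "finite S \<Longrightarrow> {w. a w \<noteq> 0} \<subseteq> S \<Longrightarrow> act_poly n a f = (\<lambda>k. \<Sum>w\<in>S. a w * act_word n w f k)"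
  unfolding act_poly_def by (intro ext sum.mono_neutral_left) auto

lemma act_poly_add:
  assumes "a \<in> carrier F" "b \<in> carrier F"
  shows "act_poly n (\<lambda>w. a w + b w) f = (\<lambda>k. act_poly n a f k + act_poly n b f k)"
proof -
  let ?S = "{w. a w \<noteq> 0} \<union> {w. b w \<noteq> 0}"
  have S: "finite ?S" using assms by (simp add: free_carrier)
  have "{w. a w + b w \<noteq> 0} \<subseteq> ?S" by auto
  then show ?thesis
    using act_poly_superset[OF S, of "\<lambda>w. a w + b w"] act_poly_superset[OF S, of a] act_poly_superset[OF S, of b]
    by (simp add: algebra_simps sum.distrib)
qed

lemma act_poly_scale: assumes "a \<in> carrier F"
  shows "act_poly n (\<lambda>w. c * a w) f = (\<lambda>k. c * act_poly n a f k)"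
proof -
  have S: "finite {w. a w \<noteq> 0}" using assms by (simp add: free_carrier)
  have "{w. c * a w \<noteq> 0} \<subseteq> {w. a w \<noteq> 0}" by auto
  then show ?thesis
    using act_poly_superset[OF S, of "\<lambda>w. c * a w"] act_poly_superset[OF S, of a]
    by (simp add: sum_distrib_left mult.assoc)
qed

lemma act_poly_delta: "act_poly n (word_delta w) f = act_word n w f"
proof -
  have "{v. word_delta w v \<noteq> 0} \<subseteq> {w}" by (auto simp: word_delta_def)
  then show ?thesis using act_poly_superset[of "{w}" "word_delta w" f] by (simp add: word_delta_def)
qed

lemma act_poly_zero: "act_poly n (\<lambda>w. 0) f = (\<lambda>k. 0)"
  by (simp add: act_poly_def)

lemma act_poly_step: assumes "a \<in> carrier F" "w \<in> lists (Gen ` {1..n} \<union> Adj ` {1..n})"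
  shows "act_poly n (\<lambda>v. a v + c * word_delta w v) f = (\<lambda>k. act_poly n a f k + c * act_word n w f k)"
  using act_poly_add[OF assms(1) free_scale_closed[OF free_delta_in[OF assms(2)], of c]]
    act_poly_scale[OF free_delta_in[OF assms(2)], of c]
  by (simp add: act_poly_delta)

lemma act_poly_closed: "a \<in> carrier F \<Longrightarrow> f \<in> carrier fin_seqs \<Longrightarrow> act_poly n a f \<in> carrier fin_seqs"
proof (induction rule: free_induct)
  case (add a c w)
  then have "w \<in> lists (letters n)" by (simp add: letters_def)
  then show ?case using add act_word_closed[of w f] by (simp add: act_poly_step fin_add fin_scale)
qed (simp add: act_poly_zero)

lemma act_poly_mult:
  assumes a: "a \<in> carrier F" and b: "b \<in> carrier F"
  shows "act_poly n (word_conv a b) f = act_poly n a (act_poly n b f)"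
  using a
proof (induction rule: free_induct)
  case zero
  have "word_conv (\<lambda>w. 0) b = (\<lambda>w. 0)" by (simp add: word_conv_def fun_eq_iff)
  then show ?case by (simp add: act_poly_zero)
next
  case (add a c w)
  have w: "word_delta w \<in> carrier F" using add.hyps by (intro free_delta_in)
  have delta: "act_poly n (word_conv (word_delta w) b) f = act_word n w (act_poly n b f)"
    using b
  proof (induction rule: free_induct)
    case zero
    have "word_conv (word_delta w) (\<lambda>w. 0) = (\<lambda>w. 0)" by (simp add: word_conv_def fun_eq_iff)
    then show ?case by (simp add: act_poly_zero act_word_zero)
  next
    case (add b d v)
    have "word_conv (word_delta w) (\<lambda>u. b u + d * word_delta v u) = (\<lambda>u. word_conv (word_delta w) b u + d * word_delta (w @ v) u)"
      unfolding word_delta_conv[symmetric]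
      by (rule ext) (simp add: word_conv_def sum.distrib sum_distrib_left algebra_simps)
    moreover have "w @ v \<in> lists (Gen ` {1..n} \<union> Adj ` {1..n})"
      using add.hyps \<open>w \<in> lists (Gen ` {1..n} \<union> Adj ` {1..n})\<close> by simp
    ultimately show ?case
      using add free_mult_closed[OF w add.hyps(1)]
      by (simp only: act_poly_step act_word_linear act_word_simps)
  qed
  have "word_conv (\<lambda>v. a v + c * word_delta w v) b = (\<lambda>u. word_conv a b u + c * word_conv (word_delta w) b u)"
    by (rule ext) (simp add: word_conv_def sum.distrib sum_distrib_left algebra_simps)
  moreover have "act_poly n (\<lambda>u. word_conv a b u + c * word_conv (word_delta w) b u) f =
      (\<lambda>k. act_poly n (word_conv a b) f k + c * act_poly n (word_conv (word_delta w) b) f k)"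
    using act_poly_add[OF free_mult_closed[OF add.hyps(1) b] free_scale_closed[OF free_mult_closed[OF w b], of c]]
      act_poly_scale[OF free_mult_closed[OF w b], of c] by simp
  ultimately show ?case using add by (simp add: act_poly_step delta)
qed

lemma pre_representation_fin: "pre_representation F fin_seqs fin_inner (act_poly n)"
proof unfold_locales
  fix a f g assume a: "a \<in> carrier F" and f: "f \<in> carrier fin_seqs" and g: "g \<in> carrier fin_seqs"
  show "fin_inner (act_poly n (star F a) f) g = fin_inner f (act_poly n a g)"
    using a
  proof (induction rule: free_induct)
    case zero
    then show ?case using E.B_zero[OF f] E.B_zero_left[OF g] by (simp add: act_poly_zero)
  next
    case (add a c w)
    have w: "w \<in> lists (letters n)" "adj_word w \<in> lists (letters n)"
      and w': "adj_word w \<in> lists (Gen ` {1..n} \<union> Adj ` {1..n})"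
      using add.hyps adj_word_in[of w "{1..n}"] by (simp_all add: letters_def)
    have sa: "star F a \<in> carrier F" using add.hyps by (intro UA.star_closed)
    have "star F (\<lambda>v. a v + c * word_delta w v) = (\<lambda>v. star F a v + cnj c * word_delta (adj_word w) v)"
      by (simp add: star_word_delta[symmetric])
    then have eq: "act_poly n (star F (\<lambda>v. a v + c * word_delta w v)) f =
        (\<lambda>k. act_poly n (star F a) f k + cnj c * act_word n (adj_word w) f k)"
      using act_poly_step[OF sa w'] by simp
    have l: "fin_inner (\<lambda>k. p k + cnj c * q k) g = fin_inner p g + c * fin_inner q g"
      if "p \<in> carrier fin_seqs" "q \<in> carrier fin_seqs" for p q
      using E.B_add_left[OF that(1) E.sm_closed[OF that(2), of "cnj c"] g] E.B_sm_left[OF that(2) g, of "cnj c"] by simp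
    have r: "fin_inner f (\<lambda>k. p k + c * q k) = fin_inner f p + c * fin_inner f q"
      if "p \<in> carrier fin_seqs" "q \<in> carrier fin_seqs" for p q
      using E.B_add[OF f that(1) E.sm_closed[OF that(2), of c]] E.B_sm[OF f that(2), of c] by simp
    show ?case
      unfolding eq act_poly_step[OF add.hyps]
      using l[OF act_poly_closed[OF sa f] act_word_closed[OF w(2) f]]
        r[OF act_poly_closed[OF add.hyps(1) g] act_word_closed[OF w(1) g]] add.IH act_word_star[OF w(1) f g] by simp
  qed
next
  fix a assume "a \<in> carrier F"
  then show "\<exists>C. \<forall>f\<in>carrier fin_seqs. E.nrm (act_poly n a f) \<le> C * E.nrm f"
  proof (induction rule: free_induct)
    case zero
    then show ?case using E.p_zero by (intro exI[of _ 0]) (simp add: act_poly_zero)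
  next
    case (add a c w)
    then obtain C where C: "\<And>f. f \<in> carrier fin_seqs \<Longrightarrow> E.nrm (act_poly n a f) \<le> C * E.nrm f" by blast
    have w: "w \<in> lists (letters n)" using add.hyps by (simp add: letters_def)
    have "E.nrm (act_poly n (\<lambda>v. a v + c * word_delta w v) f) \<le> (C + cmod c) * E.nrm f" if f: "f \<in> carrier fin_seqs" for f
    proof -
      have "E.nrm (act_poly n (\<lambda>v. a v + c * word_delta w v) f) \<le> E.nrm (act_poly n a f) + cmod c * E.nrm (act_word n w f)"
        using E.nrm_add[OF act_poly_closed[OF add.hyps(1) f] E.sm_closed[OF act_word_closed[OF w f], of c]]
          E.nrm_sm[OF act_word_closed[OF w f], of c]
        by (simp only: fin_seqs_simps act_poly_step[OF add.hyps])
      moreover have "cmod c * E.nrm (act_word n w f) \<le> cmod c * E.nrm f"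
        using act_word_le[OF w f] by (intro mult_left_mono) auto
      ultimately show ?thesis using C[OF f] by (simp add: algebra_simps)
    qed
    then show ?case by blast
  qed
next
  fix a b c f assume a: "a \<in> carrier F" and f: "f \<in> carrier fin_seqs"
  show "act_poly n a f \<in> carrier fin_seqs" using a f by (rule act_poly_closed)
  show "act_poly n a (c \<odot>\<^bsub>fin_seqs\<^esub> f) = c \<odot>\<^bsub>fin_seqs\<^esub> act_poly n a f"
    by (simp add: act_poly_def act_word_scale sum_distrib_left mult.left_commute)
  show "act_poly n (c \<odot>\<^bsub>F\<^esub> a) f = c \<odot>\<^bsub>fin_seqs\<^esub> act_poly n a f" using act_poly_scale[OF a] by simp
  assume b: "b \<in> carrier F"
  show "act_poly n (a \<oplus>\<^bsub>F\<^esub> b) f = act_poly n a f \<oplus>\<^bsub>fin_seqs\<^esub> act_poly n b f" using act_poly_add[OF a b] by simp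
  show "act_poly n (a \<otimes>\<^bsub>F\<^esub> b) f = act_poly n a (act_poly n b f)" using act_poly_mult[OF a b] by simp
qed

interpretation P: pre_representation F fin_seqs fin_inner "act_poly n" by (rule pre_representation_fin)

lemma act_poly_relation: assumes "r \<in> cuntz_relations n" shows "act_poly n r f = (\<lambda>k. 0)"
proof -
  consider i j where "i \<in> {1..n}" "j \<in> {1..n}"
      "r = (\<lambda>w. word_delta [Adj i, Gen j] w - (if i = j then word_delta [] w else 0))"
    | "r = (\<lambda>w. (\<Sum>i=1..n. word_delta [Gen i, Adj i] w) - word_delta [] w)"
    using assms unfolding cuntz_relations_def by blast
  then show ?thesis
  proof cases
    case 1
    let ?c = "if i = j then -1 else 0 :: complex"
    have r: "r = (\<lambda>w. word_delta [Adj i, Gen j] w + ?c * word_delta [] w)" using 1(3) by auto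
    have "word_delta [Adj i, Gen j] \<in> carrier F" using 1 by (intro free_delta_in) auto
    then have "act_poly n r f = (\<lambda>k. act_word n [Adj i, Gen j] f k + ?c * f k)"
      unfolding r by (subst act_poly_step) (simp_all add: act_poly_delta act_word_simps)
    also have "act_word n [Adj i, Gen j] f = (if i = j then f else (\<lambda>k. 0))"
      using act_rel[OF 1(1,2)] by (simp only: act_word_simps)
    finally show ?thesis by auto
  next
    case 2
    have S: "(\<lambda>w. \<Sum>i\<in>S. word_delta [Gen i, Adj i] w) \<in> carrier F \<and>
        act_poly n (\<lambda>w. \<Sum>i\<in>S. word_delta [Gen i, Adj i] w) f = (\<lambda>k. \<Sum>i\<in>S. act_word n [Gen i, Adj i] f k)"
      if "finite S" "S \<subseteq> {1..n}" for S
      using that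
    proof (induction S rule: finite_induct)
      case empty
      then show ?case using UA.M.zero_closed by (simp add: act_poly_zero)
    next
      case (insert i S)
      then have d: "word_delta [Gen i, Adj i] \<in> carrier F" by (intro free_delta_in) auto
      show ?case
        using insert free_add_closed[OF d, of "\<lambda>w. \<Sum>i\<in>S. word_delta [Gen i, Adj i] w"]
          act_poly_add[OF d, of "\<lambda>w. \<Sum>i\<in>S. word_delta [Gen i, Adj i] w" f] by (simp add: act_poly_delta)
    qed
    have r: "r = (\<lambda>w. (\<Sum>i=1..n. word_delta [Gen i, Adj i] w) + (-1) * word_delta [] w)" using 2 by simp
    have "act_poly n r f = (\<lambda>k. (\<Sum>i=1..n. act_word n [Gen i, Adj i] f k) + (-1) * f k)"
      unfolding r using S[of "{1..n}"] by (subst act_poly_step) (simp_all add: act_word_simps)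
    then show ?thesis using act_sum[of f] by (simp only: act_word_simps) simp
  qed
qed

text \<open>The operator norm annihilates the Cuntz relations, so it is one of the seminorms in the
  supremum. This is what keeps the universal algebra from collapsing to zero.\<close>

lemma opnorm_le_U: "a \<in> carrier F \<Longrightarrow> P.opnorm a \<le> UA.U a"
proof (rule UA.adm_le)
  have "P.opnorm r = 0" if r: "r \<in> cuntz_relations n" for r
  proof -
    have "E.nrm (\<lambda>k. 0) = 0" using E.p_zero by simp
    then have "P.opnorm r \<le> 0" by (intro P.opnorm_least) (simp_all add: act_poly_relation[OF r])
    then show ?thesis using P.opnorm_nonneg[of r] UA.R_carrier r by force
  qed
  then show "P.opnorm \<in> UA.adm" using P.cstar_seminorm_opnorm by (simp add: UA.adm_def)
qed

end

section \<open>Existence of states and sequential compactness of the state space\<close>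

lemma bounded_complex_subseq:
  fixes f :: "nat \<Rightarrow> complex"
  assumes "\<And>k. cmod (f k) \<le> C"
  shows "\<exists>r. strict_mono r \<and> convergent (\<lambda>k. f (r k))"
proof -
  have real: "\<exists>r. strict_mono r \<and> convergent (\<lambda>k. g (r k))" if "\<And>k. \<bar>g k\<bar> \<le> C" for g :: "nat \<Rightarrow> real"
  proof -
    obtain r where r: "strict_mono r" "monoseq (\<lambda>k. g (r k))" using seq_monosub by blast
    have "Bseq (\<lambda>k. g (r k))" by (rule BseqI'[of _ C]) (simp add: that)
    then show ?thesis using Bseq_monoseq_convergent r by blast
  qed
  obtain r1 where r1: "strict_mono r1" "convergent (\<lambda>k. Re (f (r1 k)))"
    using real[of "\<lambda>k. Re (f k)"] assms abs_Re_le_cmod order_trans by metis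
  obtain r2 where r2: "strict_mono r2" "convergent (\<lambda>k. Im (f (r1 (r2 k))))"
    using real[of "\<lambda>k. Im (f (r1 k))"] assms abs_Im_le_cmod order_trans by metis
  have "convergent (\<lambda>k. Re (f (r1 (r2 k))))"
    using convergent_subseq_convergent[OF r1(2) r2(1)] by (simp add: o_def)
  then obtain a b where "(\<lambda>k. Re (f (r1 (r2 k)))) \<longlonglongrightarrow> a" "(\<lambda>k. Im (f (r1 (r2 k)))) \<longlonglongrightarrow> b"
    using r2(2) by (auto simp: convergent_def)
  then have "(\<lambda>k. f (r1 (r2 k))) \<longlonglongrightarrow> Complex a b" by (simp add: tendsto_complex_iff)
  then show ?thesis
    using strict_mono_o[OF r1(1) r2(1)] by (intro exI[of _ "r1 \<circ> r2"]) (auto simp: convergent_def)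
qed

lemma tendsto_nonneg_Reals:
  assumes "f \<longlonglongrightarrow> l" "\<And>k. f k \<in> \<real>\<^sub>\<ge>\<^sub>0" shows "l \<in> (\<real>\<^sub>\<ge>\<^sub>0 :: complex set)"
proof -
  have "(\<lambda>k. Re (f k)) \<longlonglongrightarrow> Re l" "(\<lambda>k. Im (f k)) \<longlonglongrightarrow> Im l"
    using assms(1) by (auto intro: tendsto_Re tendsto_Im)
  moreover have "0 \<le> Re (f k)" "Im (f k) = 0" for k using assms(2)[of k] by (auto simp: complex_nonneg_Reals_iff)
  ultimately show ?thesis
    by (auto simp: complex_nonneg_Reals_iff LIMSEQ_const_iff intro: LIMSEQ_le_const)
qed

context cuntz_algebra
begin

interpretation E: semi_inner_space fin_seqs fin_inner by (rule semi_inner_fin_seqs)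
interpretation P: pre_representation F fin_seqs fin_inner "act_poly n" by (rule pre_representation_fin)

text \<open>The vector state of e_0 on polynomials is dominated by the operator norm, hence by the
  universal seminorm, and extends by continuity to the completion.\<close>

lemma states_nonempty: "\<exists>\<omega>. \<omega> \<in> states A"
proof -
  define e :: "nat \<Rightarrow> complex" where "e k = (if k = 0 then 1 else 0)" for k
  have supp: "{k. e k \<noteq> 0} = {0}" by (auto simp: e_def)
  have e: "e \<in> carrier fin_seqs" by (simp add: supp)
  have ee: "fin_inner e e = 1" by (simp add: fin_inner_def supp) (simp add: e_def)
  then have ne: "E.nrm e = 1" by (simp add: E.nrm_def)
  define \<phi> where "\<phi> a = fin_inner e (act_poly n a e)" for a
  have \<phi>_add: "\<phi> (a \<oplus>\<^bsub>F\<^esub> b) = \<phi> a + \<phi> b" if "a \<in> carrier F" "b \<in> carrier F" for a b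
    using that e by (simp only: \<phi>_def P.pi_add E.B_add P.pi_closed)
  have \<phi>_sm: "\<phi> (c \<odot>\<^bsub>F\<^esub> a) = c * \<phi> a" if "a \<in> carrier F" for a c
    using that e by (simp only: \<phi>_def P.pi_sm E.B_sm P.pi_closed)
  have \<phi>_diff: "\<phi> (a \<ominus>\<^bsub>F\<^esub> b) = \<phi> a - \<phi> b" if "a \<in> carrier F" "b \<in> carrier F" for a b
    using that \<phi>_add[OF that(1) UA.sm_closed[OF that(2), of "-1"]] \<phi>_sm[OF that(2), of "-1"]
    by (simp only: UA.diff_eq_sm) simp
  have \<phi>_le: "cmod (\<phi> a) \<le> UA.U a" if a: "a \<in> carrier F" for a
  proof -
    have "cmod (\<phi> a) \<le> E.nrm e * E.nrm (act_poly n a e)"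
      unfolding \<phi>_def by (rule E.Cauchy_Schwarz[OF e P.pi_closed[OF a e]])
    also have "\<dots> \<le> P.opnorm a" using P.opnorm_bound[OF a e] by (simp add: ne)
    also have "\<dots> \<le> UA.U a" by (rule opnorm_le_U[OF a])
    finally show ?thesis .
  qed
  have \<phi>_nonneg: "\<phi> (star F a \<otimes>\<^bsub>F\<^esub> a) \<in> \<real>\<^sub>\<ge>\<^sub>0" if a: "a \<in> carrier F" for a
  proof -
    have "\<phi> (star F a \<otimes>\<^bsub>F\<^esub> a) = fin_inner (act_poly n a e) (act_poly n a e)"
      using P.pi_star[OF UA.star_closed[OF a] e P.pi_closed[OF a e]] P.pi_mult[OF UA.star_closed[OF a] a e] a
      by (simp only: \<phi>_def UA.star_star)
    then show ?thesis using E.B_nonneg[OF P.pi_closed[OF a e]] by simp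
  qed
  have \<phi>_one: "\<phi> \<one>\<^bsub>F\<^esub> = 1" by (simp add: \<phi>_def act_poly_delta act_word_simps ee)
  have conv: "convergent (\<lambda>k. \<phi> (u k))" if u: "u \<in> UA.SU.CS" for u
  proof -
    have "Cauchy (\<lambda>k. \<phi> (u k))"
    proof (rule metric_CauchyI)
      fix d :: real assume "d > 0"
      then obtain N where N: "\<And>j k. j \<ge> N \<Longrightarrow> k \<ge> N \<Longrightarrow> UA.U (u j \<ominus>\<^bsub>F\<^esub> u k) < d"
        using UA.SU.CS_Cauchy[OF u] by blast
      have "dist (\<phi> (u j)) (\<phi> (u k)) < d" if "j \<ge> N" "k \<ge> N" for j k
        using N[OF that] \<phi>_le[of "u j \<ominus>\<^bsub>F\<^esub> u k"] UA.SU.CS_carrier[OF u] UA.diff_closed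
        by (simp only: dist_norm \<phi>_diff[symmetric]) (meson le_less_trans)
      then show "\<exists>N. \<forall>j\<ge>N. \<forall>k\<ge>N. dist (\<phi> (u j)) (\<phi> (u k)) < d" by blast
    qed
    then show ?thesis by (simp add: Cauchy_convergent_iff)
  qed
  \<comment> \<open>Extension by limits: equivalent Cauchy sequences have the same limit of values,
    so the union over a class is a singleton.\<close>
  define \<omega> where "\<omega> Q = the_elem (\<Union>u\<in>Q. {lim (\<lambda>k. \<phi> (u k))})" for Q
  have \<omega>_cl: "(\<lambda>k. \<phi> (u k)) \<longlonglongrightarrow> \<omega> (UA.SU.cl u)" if u: "u \<in> UA.SU.CS" for u
  proof -
    have "lim (\<lambda>k. \<phi> (v k)) = lim (\<lambda>k. \<phi> (u k))" if v: "v \<in> UA.SU.CS" "UA.SU.eqv v u" for v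
    proof -
      have "(\<lambda>k. cmod (\<phi> (v k) - \<phi> (u k))) \<longlonglongrightarrow> 0"
      proof (rule UA.SU.tendsto_zero_le)
        show "(\<lambda>k. UA.U (v k \<ominus>\<^bsub>F\<^esub> u k)) \<longlonglongrightarrow> 0" using v(2) by (simp only: UA.SU.eqv_def)
        show "cmod (\<phi> (v k) - \<phi> (u k)) \<le> UA.U (v k \<ominus>\<^bsub>F\<^esub> u k)" for k
          using \<phi>_le UA.SU.CS_carrier[OF u] UA.SU.CS_carrier[OF v(1)]
          by (simp only: \<phi>_diff[symmetric] UA.diff_closed)
      qed simp
      then have "(\<lambda>k. \<phi> (v k) - \<phi> (u k)) \<longlonglongrightarrow> 0" by (rule tendsto_norm_zero_cancel)
      moreover have "(\<lambda>k. \<phi> (u k)) \<longlonglongrightarrow> lim (\<lambda>k. \<phi> (u k))"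
        using conv[OF u] by (simp only: convergent_LIMSEQ_iff)
      ultimately have "(\<lambda>k. (\<phi> (v k) - \<phi> (u k)) + \<phi> (u k)) \<longlonglongrightarrow> 0 + lim (\<lambda>k. \<phi> (u k))"
        by (rule tendsto_add)
      then show ?thesis by (simp add: limI)
    qed
    then have "\<omega> (UA.SU.cl u) = lim (\<lambda>k. \<phi> (u k))"
      unfolding \<omega>_def by (subst UA.SU.UN_cl[OF u]) auto
    then show ?thesis using conv[OF u] by (simp only: convergent_LIMSEQ_iff)
  qed
  have elim: "\<exists>u. u \<in> UA.SU.CS \<and> x = UA.SU.cl u" if "x \<in> carrier A" for x
    using that UA.C.carrier_W_E unfolding cuntz_def by metis
  have "pos_functional A (restrict \<omega> (carrier A))"
  proof unfold_locales
    fix x y assume x: "x \<in> carrier A" and y: "y \<in> carrier A"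
    obtain u v where u: "u \<in> UA.SU.CS" "x = UA.SU.cl u" and v: "v \<in> UA.SU.CS" "y = UA.SU.cl v"
      using elim[OF x] elim[OF y] by blast
    have "x \<oplus>\<^bsub>A\<^esub> y = UA.SU.cl (\<lambda>k. u k \<oplus>\<^bsub>F\<^esub> v k)"
      unfolding u v cuntz_def by (rule UA.C.add_cl[OF u(1) v(1)])
    then have "(\<lambda>k. \<phi> (u k \<oplus>\<^bsub>F\<^esub> v k)) \<longlonglongrightarrow> \<omega> (x \<oplus>\<^bsub>A\<^esub> y)"
      using \<omega>_cl[OF UA.SU.CS_add[OF u(1) v(1)]] by (simp only:)
    moreover have "(\<lambda>k. \<phi> (u k) + \<phi> (v k)) \<longlonglongrightarrow> \<omega> x + \<omega> y"
      unfolding u v by (intro tendsto_add \<omega>_cl u v)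
    moreover have "\<phi> (u k \<oplus>\<^bsub>F\<^esub> v k) = \<phi> (u k) + \<phi> (v k)" for k
      by (intro \<phi>_add UA.SU.CS_carrier u v)
    ultimately have "\<omega> (x \<oplus>\<^bsub>A\<^esub> y) = \<omega> x + \<omega> y" by (simp only: LIMSEQ_unique)
    then show "restrict \<omega> (carrier A) (x \<oplus>\<^bsub>A\<^esub> y) = restrict \<omega> (carrier A) x + restrict \<omega> (carrier A) y"
      using x y by simp
  next
    fix x c assume x: "x \<in> carrier A"
    obtain u where u: "u \<in> UA.SU.CS" "x = UA.SU.cl u" using elim[OF x] by blast
    have "c \<odot>\<^bsub>A\<^esub> x = UA.SU.cl (\<lambda>k. c \<odot>\<^bsub>F\<^esub> u k)"
      unfolding u cuntz_def by (rule UA.C.sm_cl[OF u(1)])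
    then have "(\<lambda>k. \<phi> (c \<odot>\<^bsub>F\<^esub> u k)) \<longlonglongrightarrow> \<omega> (c \<odot>\<^bsub>A\<^esub> x)"
      using \<omega>_cl[OF UA.SU.CS_sm[OF u(1)]] by (simp only:)
    moreover have "(\<lambda>k. c * \<phi> (u k)) \<longlonglongrightarrow> c * \<omega> x"
      unfolding u by (intro tendsto_mult tendsto_const \<omega>_cl u)
    moreover have "\<phi> (c \<odot>\<^bsub>F\<^esub> u k) = c * \<phi> (u k)" for k by (intro \<phi>_sm UA.SU.CS_carrier u)
    ultimately have "\<omega> (c \<odot>\<^bsub>A\<^esub> x) = c * \<omega> x" by (simp only: LIMSEQ_unique)
    then show "restrict \<omega> (carrier A) (c \<odot>\<^bsub>A\<^esub> x) = c * restrict \<omega> (carrier A) x" using x by simp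
  next
    fix x assume x: "x \<in> carrier A"
    obtain u where u: "u \<in> UA.SU.CS" "x = UA.SU.cl u" using elim[OF x] by blast
    have su: "(\<lambda>k. star F (u k)) \<in> UA.SU.CS" by (rule UA.SU.CS_star[OF u(1)])
    have "star A x = UA.SU.cl (\<lambda>k. star F (u k))" unfolding u cuntz_def by (rule UA.C.star_cl[OF u(1)])
    moreover have "UA.SU.cl (\<lambda>k. star F (u k)) \<otimes>\<^bsub>A\<^esub> UA.SU.cl u = UA.SU.cl (\<lambda>k. star F (u k) \<otimes>\<^bsub>F\<^esub> u k)"
      unfolding cuntz_def by (rule UA.C.mult_cl[OF su u(1)])
    ultimately have "star A x \<otimes>\<^bsub>A\<^esub> x = UA.SU.cl (\<lambda>k. star F (u k) \<otimes>\<^bsub>F\<^esub> u k)" by (simp only: u(2))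
    then have "(\<lambda>k. \<phi> (star F (u k) \<otimes>\<^bsub>F\<^esub> u k)) \<longlonglongrightarrow> \<omega> (star A x \<otimes>\<^bsub>A\<^esub> x)"
      using \<omega>_cl[OF UA.SU.CS_mult[OF su u(1)]] by (simp only:)
    then have "\<omega> (star A x \<otimes>\<^bsub>A\<^esub> x) \<in> \<real>\<^sub>\<ge>\<^sub>0"
      by (rule tendsto_nonneg_Reals) (intro \<phi>_nonneg UA.SU.CS_carrier u)
    then show "restrict \<omega> (carrier A) (star A x \<otimes>\<^bsub>A\<^esub> x) \<in> \<real>\<^sub>\<ge>\<^sub>0" using x by simp
  qed
  moreover have "restrict \<omega> (carrier A) \<one>\<^bsub>A\<^esub> = 1"
  proof -
    have "\<one>\<^bsub>A\<^esub> = UA.SU.cl (\<lambda>k. \<one>\<^bsub>F\<^esub>)" unfolding cuntz_def by (rule UA.C.one_W)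
    then have "(\<lambda>k. \<phi> \<one>\<^bsub>F\<^esub>) \<longlonglongrightarrow> \<omega> \<one>\<^bsub>A\<^esub>"
      using \<omega>_cl[OF UA.SU.CS_const[OF UA.one_closed]] by (simp only:)
    then have "\<omega> \<one>\<^bsub>A\<^esub> = 1" by (simp only: \<phi>_one LIMSEQ_const_iff)
    then show ?thesis by simp
  qed
  ultimately have "restrict \<omega> (carrier A) \<in> states A" by (rule statesI) (rule restrict_extensional)
  then show ?thesis by blast
qed

lemma state_le: assumes "\<omega> \<in> states A" "a \<in> carrier A" shows "cmod (\<omega> a) \<le> sqrt 2 * anorm a"
proof -
  interpret cstar_functional A anorm \<omega> by (rule state_functional[OF assms(1)])
  have "S.nrm \<one>\<^bsub>A\<^esub> = 1" using state_one[OF assms(1)] by (simp add: S.nrm_def form_def)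
  then show ?thesis using w_bounded[OF assms(2)] by simp
qed

text \<open>Weak* compactness by a diagonal argument: there are countably many words, so some
  subsequence converges on all of them. The bound of \<open>state_le\<close>, uniform over all
  states, carries convergence over to the whole algebra.\<close>

lemma states_subsequence:
  fixes \<omega> :: "nat \<Rightarrow> cuntz_elem \<Rightarrow> complex"
  assumes \<omega>: "\<And>k. \<omega> k \<in> states A"
  obtains r \<psi> where "strict_mono r" "\<psi> \<in> states A" "\<And>a. a \<in> carrier A \<Longrightarrow> (\<lambda>k. \<omega> (r k) a) \<longlonglongrightarrow> \<psi> a"
proof -
  have "finite (letters n)" by (simp add: letters_def)
  then have cnt: "countable (lists (letters n))" by (intro countable_lists countable_finite)
  define w where "w = from_nat_into (lists (letters n))"
  have ne: "lists (letters n) \<noteq> {}" by blast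
  have w: "w i \<in> lists (letters n)" for i unfolding w_def by (rule from_nat_into[OF ne])
  \<comment> \<open>Stage i thins out the sequence so that the values at the i-th word converge; the
    diagonal sequence is, from some point on, a subsequence of every stage.\<close>
  interpret subseqs "\<lambda>i s. convergent (\<lambda>k. \<omega> (s k) (wd (w i)))"
  proof
    fix i and s :: "nat \<Rightarrow> nat"
    show "\<exists>r'. strict_mono r' \<and> convergent (\<lambda>k. \<omega> ((s \<circ> r') k) (wd (w i)))"
      using bounded_complex_subseq[of "\<lambda>k. \<omega> (s k) (wd (w i))"] state_le[OF \<omega> wd_closed[OF w]] by (auto simp: o_def)
  qed
  have conv_wd: "convergent (\<lambda>k. \<omega> (diagseq k) (wd v))" if v: "v \<in> lists (letters n)" for v
  proof -
    obtain i where i: "v = w i" unfolding w_def using from_nat_into_surj[OF cnt v] by metis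
    have "convergent (\<lambda>k. \<omega> ((diagseq \<circ> ((+) (Suc i))) k) (wd (w i)))"
    proof (rule diagseq_holds)
      fix r s :: "nat \<Rightarrow> nat" and i assume "strict_mono r" "convergent (\<lambda>k. \<omega> (s k) (wd (w i)))"
      then show "convergent (\<lambda>k. \<omega> ((s \<circ> r) k) (wd (w i)))"
        using convergent_subseq_convergent[of "\<lambda>k. \<omega> (s k) (wd (w i))" r] by (simp add: o_def)
    qed
    then have "convergent (\<lambda>k. \<omega> (diagseq (k + Suc i)) (wd (w i)))" by (simp add: o_def add.commute)
    then show ?thesis unfolding i
      using convergent_ignore_initial_segment[of "\<lambda>k. \<omega> (diagseq k) (wd (w i))" "Suc i"] by simp
  qed
  have conv_emb: "convergent (\<lambda>k. \<omega> (diagseq k) (emb f))" if "f \<in> carrier F" for f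
    using that
  proof (induction rule: free_induct)
    case zero
    have "\<omega> k (emb (\<lambda>w. 0)) = 0" for k
      using emb_zero linear_functionalD(4)[OF state_linear[OF \<omega>]] by simp
    then show ?case by (simp add: convergent_const)
  next
    case (add f c v)
    then have v: "v \<in> lists (letters n)" by (simp add: letters_def)
    have "emb (f \<oplus>\<^bsub>F\<^esub> c \<odot>\<^bsub>F\<^esub> word_delta v) = emb f \<oplus>\<^bsub>A\<^esub> c \<odot>\<^bsub>A\<^esub> wd v"
      using add.hyps(1) v by (simp only: emb_add emb_sm UA.sm_closed delta_in wd_def)
    then have "\<omega> k (emb (\<lambda>u. f u + c * word_delta v u)) = \<omega> k (emb f) + c * \<omega> k (wd v)" for k
      using linear_functionalD(1,2)[OF state_linear[OF \<omega>]] add.hyps(1) v by simp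
    then show ?case
      using convergent_add[OF add.IH convergent_mult[OF convergent_const conv_wd[OF v]], of c] by simp
  qed
  have conv: "convergent (\<lambda>k. \<omega> (diagseq k) a)" if a: "a \<in> carrier A" for a
  proof -
    have "Cauchy (\<lambda>k. \<omega> (diagseq k) a)"
    proof (rule metric_CauchyI)
      fix e :: real assume e: "e > 0"
      \<comment> \<open>The constant of \<open>state_le\<close> is below 2, so e / 6 becomes e / 3,
        one of the three terms of the triangle inequality.\<close>
      obtain f where f: "f \<in> carrier F" "anorm (emb f \<ominus>\<^bsub>A\<^esub> a) < e / 6" using emb_dense[OF a, of "e / 6"] e by auto
      have close: "dist (\<omega> k (emb f)) (\<omega> k a) < e / 3" for k
      proof -
        have "dist (\<omega> k (emb f)) (\<omega> k a) = cmod (\<omega> k (emb f \<ominus>\<^bsub>A\<^esub> a))"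
          using linear_functionalD(3)[OF state_linear[OF \<omega>]] f a by (simp add: dist_norm)
        also have "\<dots> \<le> sqrt 2 * anorm (emb f \<ominus>\<^bsub>A\<^esub> a)" using f a by (intro state_le \<omega>) auto
        also have "\<dots> \<le> 2 * anorm (emb f \<ominus>\<^bsub>A\<^esub> a)"
          using f a sqrt2_less_2 by (intro mult_right_mono A.p_nonneg) auto
        also have "\<dots> < e / 3" using f by simp
        finally show ?thesis .
      qed
      have "Cauchy (\<lambda>k. \<omega> (diagseq k) (emb f))" using conv_emb[OF f(1)] by (simp add: Cauchy_convergent_iff)
      then obtain N where N: "\<And>j k. j \<ge> N \<Longrightarrow> k \<ge> N \<Longrightarrow> dist (\<omega> (diagseq j) (emb f)) (\<omega> (diagseq k) (emb f)) < e / 3"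
        using metric_CauchyD[of _ "e / 3"] e by (metis divide_pos_pos zero_less_numeral)
      have "dist (\<omega> (diagseq j) a) (\<omega> (diagseq k) a) < e" if "j \<ge> N" "k \<ge> N" for j k
      proof -
        have "dist (\<omega> (diagseq j) a) (\<omega> (diagseq k) a) \<le> dist (\<omega> (diagseq j) a) (\<omega> (diagseq j) (emb f))
           + dist (\<omega> (diagseq j) (emb f)) (\<omega> (diagseq k) a)"
          by (rule dist_triangle)
        moreover have "dist (\<omega> (diagseq j) (emb f)) (\<omega> (diagseq k) a) \<le>
            dist (\<omega> (diagseq j) (emb f)) (\<omega> (diagseq k) (emb f)) + dist (\<omega> (diagseq k) (emb f)) (\<omega> (diagseq k) a)"
          by (rule dist_triangle)
        moreover have "dist (\<omega> (diagseq j) a) (\<omega> (diagseq j) (emb f)) < e / 3"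
          using close[of "diagseq j"] by (simp only: dist_commute)
        ultimately show ?thesis using N[OF that] close[of "diagseq k"] by linarith
      qed
      then show "\<exists>N. \<forall>j\<ge>N. \<forall>k\<ge>N. dist (\<omega> (diagseq j) a) (\<omega> (diagseq k) a) < e" by blast
    qed
    then show ?thesis by (simp add: Cauchy_convergent_iff)
  qed
  define \<psi> where "\<psi> = restrict (\<lambda>a. lim (\<lambda>k. \<omega> (diagseq k) a)) (carrier A)"
  have lim: "(\<lambda>k. \<omega> (diagseq k) a) \<longlonglongrightarrow> \<psi> a" if "a \<in> carrier A" for a
    using conv[OF that] that by (simp add: \<psi>_def convergent_LIMSEQ_iff)
  have "\<psi> \<in> states A"
  proof (rule statesI)
    show "pos_functional A \<psi>"
    proof unfold_locales
      fix x y assume x: "x \<in> carrier A" and y: "y \<in> carrier A"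
      have "(\<lambda>k. \<omega> (diagseq k) (x \<oplus>\<^bsub>A\<^esub> y)) \<longlonglongrightarrow> \<psi> x + \<psi> y"
        using tendsto_add[OF lim[OF x] lim[OF y]] linear_functionalD(1)[OF state_linear[OF \<omega>] x y] by simp
      then show "\<psi> (x \<oplus>\<^bsub>A\<^esub> y) = \<psi> x + \<psi> y" using lim[of "x \<oplus>\<^bsub>A\<^esub> y"] x y by (simp add: LIMSEQ_unique)
    next
      fix x c assume x: "x \<in> carrier A"
      have "(\<lambda>k. \<omega> (diagseq k) (c \<odot>\<^bsub>A\<^esub> x)) \<longlonglongrightarrow> c * \<psi> x"
        using tendsto_mult[OF tendsto_const lim[OF x], of c] linear_functionalD(2)[OF state_linear[OF \<omega>] x] by simp
      then show "\<psi> (c \<odot>\<^bsub>A\<^esub> x) = c * \<psi> x" using lim[of "c \<odot>\<^bsub>A\<^esub> x"] x by (simp add: LIMSEQ_unique)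
    next
      fix x assume x: "x \<in> carrier A"
      show "\<psi> (star A x \<otimes>\<^bsub>A\<^esub> x) \<in> \<real>\<^sub>\<ge>\<^sub>0"
      proof (rule tendsto_nonneg_Reals[OF lim])
        show "\<omega> (diagseq k) (star A x \<otimes>\<^bsub>A\<^esub> x) \<in> \<real>\<^sub>\<ge>\<^sub>0" for k
          using \<omega>[of "diagseq k"] x by (simp add: states_def)
      qed (use x in auto)
    qed
    have "(\<lambda>k. 1) \<longlonglongrightarrow> \<psi> \<one>\<^bsub>A\<^esub>" using lim[OF A.one_closed] state_one[OF \<omega>] by simp
    then show "\<psi> \<one>\<^bsub>A\<^esub> = 1" by (simp add: LIMSEQ_const_iff)
  qed (simp add: \<psi>_def)
  then show ?thesis using that[OF subseq_diagseq _ lim] by blast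
qed

text \<open>For \<open>V = s(z)\<close> and a vector \<open>d\<close> with \<open>V* d = 0\<close>, the vectors \<open>V\<^sup>j d\<close> are orthogonal of equal length,
  and the normalised sum of the first \<open>N\<close> of them is almost fixed by \<open>V\<close>.\<close>

lemma sub_cuntz_exists:
  assumes z: "z \<in> unit_tensors n m" "m \<ge> 1"
  shows "\<exists>\<omega>. \<omega> \<in> states A \<and> \<omega> (s z) = 1"
proof -
  obtain \<omega>0 where \<omega>0: "\<omega>0 \<in> states A" using states_nonempty by blast
  interpret cstar_functional A anorm \<omega>0 by (rule state_functional[OF \<omega>0])
  note lin = state_linear[OF \<omega>0]
  have zt: "z \<in> tensors n m" and nz: "(\<Sum>J\<in>words n m. (cmod (z J))\<^sup>2) = 1" using z by (auto simp: unit_tensors_def)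
  \<comment> \<open>As n is at least 2 and m at least 1, there are two different words, and a unit
    vector cannot have modulus 1 at both. This makes s(z) a proper isometry.\<close>
  have "\<exists>J\<in>words n m. (cmod (z J))\<^sup>2 < 1"
  proof (rule ccontr)
    assume no: "\<not> ?thesis"
    let ?J1 = "replicate m (1::nat)" and ?J2 = "replicate m (2::nat)"
    have J: "?J1 \<in> words n m" "?J2 \<in> words n m" using n_ge_2 by (auto simp: words_iff)
    have neq: "?J1 \<noteq> ?J2" using z(2) by (cases m) auto
    have "(\<Sum>J\<in>{?J1, ?J2}. (cmod (z J))\<^sup>2) \<le> (\<Sum>J\<in>words n m. (cmod (z J))\<^sup>2)"
      using J by (intro sum_mono2) auto
    moreover have "(cmod (z ?J1))\<^sup>2 \<ge> 1" "(cmod (z ?J2))\<^sup>2 \<ge> 1" using no J by (auto simp: not_less)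
    ultimately show False using neq nz by simp
  qed
  then obtain J where J: "J \<in> words n m" "(cmod (z J))\<^sup>2 < 1" by blast
  define V where "V = s z"
  define W where "W = wd (gens J)"
  define d where "d = W \<ominus>\<^bsub>A\<^esub> cnj (z J) \<odot>\<^bsub>A\<^esub> V"
  define \<kappa> where "\<kappa> = 1 - (cmod (z J))\<^sup>2"
  have \<kappa>: "\<kappa> > 0" using J(2) by (simp add: \<kappa>_def)
  have V: "V \<in> carrier A" using s_closed[OF zt] by (simp add: V_def)
  have W: "W \<in> carrier A" using gens_words J(1) by (auto simp: W_def)
  have d: "d \<in> carrier A" using V W by (simp add: d_def)
  have VV: "form (V \<otimes>\<^bsub>A\<^esub> x) (V \<otimes>\<^bsub>A\<^esub> y) = form x y" if "x \<in> carrier A" "y \<in> carrier A" for x y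
    using isometry[OF lin z(1) A.star_closed[OF that(1)] that(2), folded V_def] V that
    by (simp add: form_def A.star_mult A.mult_assoc)
  have VW: "form (V \<otimes>\<^bsub>A\<^esub> x) W = cnj (z J) * form x \<one>\<^bsub>A\<^esub>" if x: "x \<in> carrier A" for x
    using star_s_word[OF functional_sandwich[OF lin A.star_closed[OF x] A.one_closed] zt J(1), folded V_def W_def] V W x
    by (simp add: form_def A.star_mult A.mult_assoc)
  have Vd: "form (V \<otimes>\<^bsub>A\<^esub> x) d = 0" if x: "x \<in> carrier A" for x
    using VW[OF x] VV[OF x A.one_closed] V W x by (simp add: d_def S.B_diff S.B_sm)
  have dV: "form d (V \<otimes>\<^bsub>A\<^esub> x) = 0" if x: "x \<in> carrier A" for x
    using Vd[OF x] S.B_commute[of "V \<otimes>\<^bsub>A\<^esub> x" d] V d x by simp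
  have WW: "form W W = 1"
  proof -
    have "star A W = wd (adjs J)" using gens_words(1)[OF J(1)] by (simp add: W_def wd_star adj_word_gens)
    then have "star A W \<otimes>\<^bsub>A\<^esub> W = \<one>\<^bsub>A\<^esub>"
      using wd_cancel[of J J] J(1) by (simp add: W_def words_iff)
    then show ?thesis using state_one[OF \<omega>0] by (simp add: form_def)
  qed
  have form_one: "form \<one>\<^bsub>A\<^esub> \<one>\<^bsub>A\<^esub> = 1" using state_one[OF \<omega>0] by (simp add: form_def)
  have WV: "form W V = z J"
    using VW[OF A.one_closed] S.B_commute[of V W] V W form_one by simp
  have dd: "form d d = complex_of_real \<kappa>"
  proof -
    have "form d d = form W d - z J * form (V \<otimes>\<^bsub>A\<^esub> \<one>\<^bsub>A\<^esub>) d"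
      using V W d by (subst d_def) (simp add: S.B_diff_left S.B_sm_left)
    also have "\<dots> = form W d" using Vd[OF A.one_closed] by simp
    also have "\<dots> = 1 - cnj (z J) * z J"
      using V W by (simp add: d_def S.B_diff S.B_sm WW WV)
    also have "\<dots> = complex_of_real \<kappa>"
      by (simp only: \<kappa>_def of_real_diff of_real_1 complex_norm_square mult.commute)
    finally show ?thesis .
  qed
  \<comment> \<open>\<open>c N\<close> is the sum of V^j d over j < N, with squared length N
    \<kappa> by orthogonality.\<close>
  define c where "c = rec_nat \<zero>\<^bsub>A\<^esub> (\<lambda>_ x. d \<oplus>\<^bsub>A\<^esub> V \<otimes>\<^bsub>A\<^esub> x)"
  have c0: "c 0 = \<zero>\<^bsub>A\<^esub>" and cS: "c (Suc N) = d \<oplus>\<^bsub>A\<^esub> V \<otimes>\<^bsub>A\<^esub> c N" for N by (simp_all add: c_def)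
  have c: "c N \<in> carrier A" for N by (induction N) (use V d in \<open>simp_all add: c0 cS\<close>)
  have cc: "form (c N) (c N) = complex_of_real (real N * \<kappa>)" for N
  proof (induction N)
    case (Suc N)
    then show ?case
      using V d c[of N] by (simp add: cS S.B_add S.B_add_left dd Vd dV VV algebra_simps)
  qed (simp add: c0)
  \<comment> \<open>The sum of N + 1 terms and its image under V share exactly the N vectors V d,
    ..., V^N d.\<close>
  have cVc: "form (c (Suc N)) (V \<otimes>\<^bsub>A\<^esub> c (Suc N)) = complex_of_real (real N * \<kappa>)" for N
  proof (induction N)
    case 0
    show ?case using V d by (simp add: cS c0 dV)
  next
    case (Suc N)
    have "form (c (Suc (Suc N))) (V \<otimes>\<^bsub>A\<^esub> c (Suc (Suc N))) = form (V \<otimes>\<^bsub>A\<^esub> c (Suc N)) (V \<otimes>\<^bsub>A\<^esub> c (Suc (Suc N)))"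
      using V d c[of "Suc N"] c[of "Suc (Suc N)"] by (subst cS) (simp add: S.B_add_left dV)
    also have "\<dots> = form (c (Suc N)) (c (Suc (Suc N)))" by (intro VV c)
    also have "\<dots> = form (c (Suc N)) d + form (c (Suc N)) (V \<otimes>\<^bsub>A\<^esub> c (Suc N))"
      using V d c[of "Suc N"] by (subst (2) cS) (simp add: S.B_add)
    also have "form (c (Suc N)) d = complex_of_real \<kappa>"
      using V d c[of N] by (simp add: cS S.B_add_left dd Vd)
    finally show ?case using Suc by (simp add: algebra_simps)
  qed
  \<comment> \<open>The shifted index avoids normalizing the zero vector \<open>c 0\<close>; the
    value at V becomes N / (N + 1), which tends to 1.\<close>
  define \<omega> where "\<omega> N = restrict (\<lambda>a. \<omega>0 (star A (c (Suc N)) \<otimes>\<^bsub>A\<^esub> (a \<otimes>\<^bsub>A\<^esub> c (Suc N))) / complex_of_real (real (Suc N) * \<kappa>)) (carrier A)" for N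
  have \<omega>: "\<omega> N \<in> states A" for N
    unfolding \<omega>_def
  proof (rule state_normalize[OF pos_functional_sandwich[OF c]])
    show "\<omega>0 (star A (c (Suc N)) \<otimes>\<^bsub>A\<^esub> (\<one>\<^bsub>A\<^esub> \<otimes>\<^bsub>A\<^esub> c (Suc N))) = complex_of_real (real (Suc N) * \<kappa>)"
      using cc[of "Suc N"] c[of "Suc N"] by (simp add: form_def)
  qed (use \<kappa> in simp)
  have val: "\<omega> N V = complex_of_real (real N / real (Suc N))" for N
  proof -
    have "\<omega> N V = complex_of_real (real N * \<kappa>) / complex_of_real (real (Suc N) * \<kappa>)"
      using cVc[of N] V by (simp add: \<omega>_def form_def)
    also have "\<dots> = complex_of_real ((real N * \<kappa>) / (real (Suc N) * \<kappa>))" by (simp only: of_real_divide)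
    also have "(real N * \<kappa>) / (real (Suc N) * \<kappa>) = real N / real (Suc N)" using \<kappa> by simp
    finally show ?thesis .
  qed
  obtain r \<psi> where r: "strict_mono r" and \<psi>: "\<psi> \<in> states A" "\<And>a. a \<in> carrier A \<Longrightarrow> (\<lambda>k. \<omega> (r k) a) \<longlonglongrightarrow> \<psi> a"
    by (rule states_subsequence[of \<omega>, OF \<omega>]) blast
  have "(\<lambda>N. complex_of_real (real N / real (Suc N))) \<longlonglongrightarrow> complex_of_real 1"
    by (intro tendsto_of_real LIMSEQ_n_over_Suc_n)
  then have "(\<lambda>N. \<omega> N V) \<longlonglongrightarrow> 1" by (simp only: val of_real_1)
  then have "(\<lambda>k. \<omega> (r k) V) \<longlonglongrightarrow> 1" using LIMSEQ_subseq_LIMSEQ[OF _ r] by (simp add: o_def)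
  then have "\<psi> V = 1" using \<psi>(2)[OF V] LIMSEQ_unique by blast
  then show ?thesis using \<psi>(1) by (auto simp: V_def)
qed

end

section \<open>Classification\<close>

context cuntz_algebra
begin

lemma omega_tilde:
  assumes z: "z \<in> unit_tensors n m" "m \<ge> 1" "nonperiodic n z"
  shows "omega_tilde n z \<in> states A" "omega_tilde n z (s z) = 1"
    and "\<omega> \<in> states A \<Longrightarrow> \<omega> (s z) = 1 \<Longrightarrow> omega_tilde n z = \<omega>"
proof -
  have unique: "\<omega> = \<omega>'" if "sub_cuntz_state n z \<omega>" "sub_cuntz_state n z \<omega>'" for \<omega> \<omega>'
    using that sub_cuntz_unique[OF z] by (simp only: sub_cuntz_iff)
  obtain \<omega>1 where "\<omega>1 \<in> states A" "\<omega>1 (s z) = 1" using sub_cuntz_exists[OF z(1,2)] by blast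
  then have 1: "sub_cuntz_state n z \<omega>1" using z by (auto simp: sub_cuntz_iff)
  have "sub_cuntz_state n z (omega_tilde n z)"
    unfolding omega_tilde_def by (rule theI[of "sub_cuntz_state n z", OF 1]) (rule unique[OF _ 1])
  then show "omega_tilde n z \<in> states A" "omega_tilde n z (s z) = 1" by (simp_all only: sub_cuntz_iff)
  then show "\<omega> \<in> states A \<Longrightarrow> \<omega> (s z) = 1 \<Longrightarrow> omega_tilde n z = \<omega>" using sub_cuntz_unique[OF z] by blast
qed

text \<open>Injectivity is \<open>nonperiodic_eq\<close> with the two vectors in either role. For
  surjectivity, the vector presenting a pure state is replaced by its nonperiodic root, corrected by
  a phase.\<close>

lemma omega_tilde_bij: "bij_betw (omega_tilde n) (nonperiodic_units n) (pure_sub_cuntz_states n)"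
  unfolding bij_betw_def
proof (intro conjI inj_onI subset_antisym subsetI)
  fix z y assume z: "z \<in> nonperiodic_units n" and y: "y \<in> nonperiodic_units n" and eq: "omega_tilde n z = omega_tilde n y"
  obtain m where m: "m \<ge> 1" "z \<in> unit_tensors n m" "nonperiodic n z" using z by (auto simp: nonperiodic_units_def)
  obtain l where l: "l \<ge> 1" "y \<in> unit_tensors n l" "nonperiodic n y" using y by (auto simp: nonperiodic_units_def)
  note oz = omega_tilde(1,2)[OF m(2,1,3)] and oy = omega_tilde(1,2)[OF l(2,1,3)]
  have "l \<le> m \<and> (l = m \<longrightarrow> z = y)" using nonperiodic_eq[OF m(2,1) l(2,3,1) oz] oy eq by simp
  moreover have "m \<le> l \<and> (m = l \<longrightarrow> y = z)" using nonperiodic_eq[OF l(2,1) m(2,3,1) oy] oz eq by simp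
  ultimately show "z = y" by auto
next
  fix \<omega> assume "\<omega> \<in> omega_tilde n ` nonperiodic_units n"
  then obtain z m where z: "\<omega> = omega_tilde n z" "m \<ge> 1" "z \<in> unit_tensors n m" "nonperiodic n z"
    by (auto simp: nonperiodic_units_def)
  note oz = omega_tilde(1,2)[OF z(3,2,4)]
  have "\<omega> \<in> pure_states A" using sub_cuntz_pure[OF z(3,2,4) oz] z(1) by simp
  moreover have "sub_cuntz_state n z \<omega>" using oz z by (auto simp: sub_cuntz_iff)
  ultimately show "\<omega> \<in> pure_sub_cuntz_states n" by (auto simp: pure_sub_cuntz_states_def)
next
  fix \<omega> assume "\<omega> \<in> pure_sub_cuntz_states n"
  then obtain z where pure: "\<omega> \<in> pure_states A" and "sub_cuntz_state n z \<omega>"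
    by (auto simp: pure_sub_cuntz_states_def)
  then obtain m where \<omega>: "\<omega> \<in> states A" "m \<ge> 1" "z \<in> unit_tensors n m" "\<omega> (s z) = 1"
    unfolding sub_cuntz_iff by blast
  obtain x k p where x: "x \<in> unit_tensors n k" "k \<ge> 1" "p \<ge> 1" "nonperiodic n x" "z = tensor_power x p"
    using nonperiodic_root[OF \<omega>(3,2)] by blast
  \<comment> \<open>The root x need not itself give \<omega>: multiplying it by a suitable root of
    unity leaves x^p unchanged, so a phase has to be recovered from the state.\<close>
  obtain c where c: "cmod c = 1" "\<omega> (s (\<lambda>w. c * x w)) = 1"
    using pure_sub_cuntz_nonperiodic[OF x(1,2,4,3) pure] \<omega>(4) x(5) by blast
  define y where "y = (\<lambda>w. c * x w)"
  have y: "y \<in> unit_tensors n k" unfolding y_def by (rule unit_scale[OF x(1) c(1)])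
  have npy: "nonperiodic n y" unfolding y_def by (rule nonperiodic_scale[OF x(4)]) (use c in auto)
  have "omega_tilde n y = \<omega>" by (rule omega_tilde(3)[OF y x(2) npy \<omega>(1)]) (use c in \<open>simp add: y_def\<close>)
  moreover have "y \<in> nonperiodic_units n" using y npy x(2) by (auto simp: nonperiodic_units_def)
  ultimately show "\<omega> \<in> omega_tilde n ` nonperiodic_units n" by blast
qed

end

section \<open>GNS representations of sub-Cuntz states\<close>

locale cuntz_state = cuntz_algebra +
  fixes \<omega> :: "cuntz_elem \<Rightarrow> complex"
  assumes state: "\<omega> \<in> states (cuntz n)"
begin

sublocale T: cstar_functional A anorm \<omega> by (rule state_functional[OF state])

abbreviation H where "H \<equiv> gns_space A \<omega>"

sublocale H: complex_hilbert_space H by (rule T.gns_hilbert)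

lemma cyc_norm: "hinner H T.cyc T.cyc = 1"
  using T.hinner_cyc[OF A.one_closed] A.rep_one[OF T.gns_representation A.one_closed T.cyc_closed] state_one[OF state]
  by simp

lemma act_fixed: assumes z: "z \<in> unit_tensors n m" and one: "\<omega> (s z) = 1" shows "T.act (s z) T.cyc = T.cyc"
proof -
  have sz: "s z \<in> carrier A" using z s_closed by (auto simp: unit_tensors_def)
  have "T.form (s z) (s z) = 1" "T.form (s z) \<one>\<^bsub>A\<^esub> = 1" "T.form \<one>\<^bsub>A\<^esub> \<one>\<^bsub>A\<^esub> = 1"
    using state_fixed(1)[OF state z one sz] sz one T.w_star[OF sz] state_one[OF state] by (simp_all add: T.form_def)
  then have "(T.S.nrm (s z \<ominus>\<^bsub>A\<^esub> \<one>\<^bsub>A\<^esub>))\<^sup>2 = 0" using sz by (subst T.S.nrm_diff_sq) (simp_all add: T.S.nrm_sq)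
  then have "T.S.eqv (\<lambda>k. s z) (\<lambda>k. \<one>\<^bsub>A\<^esub>)" by (simp add: T.S.eqv_def)
  then show ?thesis
    using sz by (simp add: T.act_cyc) (simp add: T.cyc_def T.S.cl_eq_iff)
qed

lemma coefficient_functional: assumes v: "v \<in> carrier H"
  shows "linear_functional (\<lambda>a. hinner H v (T.act a T.cyc))"
    and "a \<in> carrier A \<Longrightarrow> cmod (hinner H v (T.act a T.cyc)) \<le> (H.nrm v * (sqrt 2 * T.S.nrm \<one>\<^bsub>A\<^esub>)) * anorm a"
proof -
  note R = T.gns_representation
  show "linear_functional (\<lambda>a. hinner H v (T.act a T.cyc))"
    using v by (auto simp: linear_functional_def A.rep_plus[OF R _ T.cyc_closed] A.rep_scale[OF R _ T.cyc_closed]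
      H.B_add H.B_sm A.rep_closed[OF R _ T.cyc_closed])
  assume a: "a \<in> carrier A"
  have "H.nrm (T.act a T.cyc) = T.S.nrm a"
    using T.hnorm_gns[OF A.rep_closed[OF R a T.cyc_closed]] a by (simp add: H.hnorm_eq T.act_cyc)
  also have "\<dots> \<le> sqrt 2 * T.S.nrm \<one>\<^bsub>A\<^esub> * anorm a" by (rule T.nrm_le[OF a])
  finally have "H.nrm v * H.nrm (T.act a T.cyc) \<le> H.nrm v * (sqrt 2 * T.S.nrm \<one>\<^bsub>A\<^esub> * anorm a)"
    using H.nrm_nonneg[OF v] by (rule mult_left_mono)
  then show "cmod (hinner H v (T.act a T.cyc)) \<le> (H.nrm v * (sqrt 2 * T.S.nrm \<one>\<^bsub>A\<^esub>)) * anorm a"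
    using H.Cauchy_Schwarz[OF v A.rep_closed[OF R a T.cyc_closed]] by (simp add: mult.assoc)
qed

text \<open>Moving b* to the other side of the inner product turns it into b, which fixes v.
  Together with \<open>coefficient_right\<close> this gives the two conditions on g for matrix
  coefficients.\<close>

lemma coefficient_left: assumes v: "v \<in> carrier H" "T.act b v = v" and a: "b \<in> carrier A" "a \<in> carrier A"
  shows "hinner H v (T.act (star A b \<otimes>\<^bsub>A\<^esub> a) T.cyc) = hinner H v (T.act a T.cyc)"
proof -
  note R = T.gns_representation
  have ac: "T.act a T.cyc \<in> carrier H" by (rule A.rep_closed[OF R a(2) T.cyc_closed])
  have "hinner H (T.act (star A (star A b)) v) (T.act a T.cyc) = hinner H v (T.act (star A b) (T.act a T.cyc))"
    by (rule A.rep_star[OF R A.star_closed[OF a(1)] v(1) ac])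
  then show ?thesis using A.rep_mult[OF R A.star_closed[OF a(1)] T.cyc_closed a(2)] v a by simp
qed

lemma coefficient_right: assumes "T.act b T.cyc = T.cyc" "b \<in> carrier A" "a \<in> carrier A"
  shows "T.act (a \<otimes>\<^bsub>A\<^esub> b) T.cyc = T.act a T.cyc"
  using A.rep_mult[OF T.gns_representation assms(3) T.cyc_closed assms(2)] assms(1) by simp

text \<open>From the matrix coefficient of v and the cyclic vector a multiple of \<omega> is
  subtracted, so that the difference vanishes at 1. Nonperiodicity leaves only scalar solutions u,
  hence the difference is zero and v minus a multiple of the cyclic vector is orthogonal to the
  whole orbit.\<close>

lemma fixed_vector:
  assumes z: "z \<in> unit_tensors n m" "m \<ge> 1" "nonperiodic n z" and one: "\<omega> (s z) = 1"
    and v: "v \<in> carrier H" "T.act (s z) v = v"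
  shows "\<exists>c. v = c \<odot>\<^bsub>H\<^esub> T.cyc"
proof -
  note R = T.gns_representation
  have zt: "z \<in> tensors n m" "z \<noteq> (\<lambda>w. 0)" using z unit_nonzero by (auto simp: unit_tensors_def)
  have sz: "s z \<in> carrier A" using s_closed[OF zt(1)] .
  note fixc = act_fixed[OF z(1) one]
  define b where "b = hinner H v T.cyc"
  define g where "g a = hinner H v (T.act a T.cyc) - b * \<omega> a" for a
  have g: "linear_functional g"
    using linear_functionalD(1,2)[OF coefficient_functional(1)[OF v(1)]] linear_functionalD(1,2)[OF state_linear[OF state]]
    by (simp add: linear_functional_def g_def algebra_simps)
  interpret W: word_functional n "\<lambda>w. g (wd w)" z z m
    by (rule word_functionalI[OF g z(1,1,2)])
       (simp_all add: g_def state_fixed[OF state z(1) one] coefficient_left[OF v sz] coefficient_right[OF fixc sz])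
  have g_one: "g \<one>\<^bsub>A\<^esub> = 0"
    using A.rep_one[OF R A.one_closed T.cyc_closed] state_one[OF state] by (simp add: g_def b_def)
  have wd0: "g (wd w) = 0" if "w \<in> lists (letters n)" for w
  proof (rule W.vanish_criterion[OF _ that])
    fix d u assume d: "d < m" and u: "u \<in> tensors n d" "u \<noteq> (\<lambda>w. 0)" "tensor z u = tensor u z"
    then have "d = 0" using nonperiodic_no_commuting[OF zt z(3) u(1,2)] by blast
    then show "(\<Sum>L\<in>words n d. u L * g (wd (gens L))) = 0" using g_one by simp
  qed
  obtain C where C: "C \<ge> 0" "\<And>a. a \<in> carrier A \<Longrightarrow> cmod (\<omega> a) \<le> C * anorm a" using state_bounded[OF state] by blast
  define D where "D = H.nrm v * (sqrt 2 * T.S.nrm \<one>\<^bsub>A\<^esub>)"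
  have "cmod (g a) \<le> (D + cmod b * C) * anorm a" if a: "a \<in> carrier A" for a
  proof -
    have "cmod (g a) \<le> cmod (hinner H v (T.act a T.cyc)) + cmod b * cmod (\<omega> a)"
      unfolding g_def using norm_triangle_ineq4 by (metis norm_mult)
    also have "\<dots> \<le> D * anorm a + cmod b * (C * anorm a)"
      unfolding D_def by (intro add_mono mult_left_mono C(2) a coefficient_functional(2)[OF v(1) a]) simp
    finally show ?thesis by (simp add: algebra_simps)
  qed
  then have g0: "g a = 0" if "a \<in> carrier A" for a by (rule functional_eq_zero[OF g _ wd0 that])
  \<comment> \<open>The conjugate appears because the inner product is conjugate linear in its first
    argument.\<close>
  define x where "x = v \<ominus>\<^bsub>H\<^esub> cnj b \<odot>\<^bsub>H\<^esub> T.cyc"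
  have x: "x \<in> carrier H" using v by (simp add: x_def)
  have "x = \<zero>\<^bsub>H\<^esub>"
  proof (rule T.cyc_cyclic[OF x])
    fix a assume a: "a \<in> carrier A"
    have "hinner H x (T.act a T.cyc) = hinner H v (T.act a T.cyc) - b * hinner H T.cyc (T.act a T.cyc)"
      using v A.rep_closed[OF R a T.cyc_closed] by (simp add: x_def H.B_diff_left H.B_sm_left)
    then show "hinner H x (T.act a T.cyc) = 0" using g0[OF a] T.hinner_cyc[OF a] by (simp add: g_def)
  qed
  then have "v = cnj b \<odot>\<^bsub>H\<^esub> T.cyc" using v by (simp add: x_def T.G.W.diff_eq_zero_iff)
  then show ?thesis by blast
qed

lemma gns_irreducible:
  assumes z: "z \<in> unit_tensors n m" "m \<ge> 1" "nonperiodic n z" and one: "\<omega> (s z) = 1"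
  shows "irreducible_rep A (gns_rep A \<omega>)"
  unfolding T.gns_rep_eq
proof (rule A.irreducible_criterion[OF T.gns_representation T.cyc_closed])
  show "T.cyc \<noteq> \<zero>\<^bsub>H\<^esub>" using cyc_norm H.B_zero[OF T.G.W.M.zero_closed] by auto
  show "s z \<in> carrier A" using z s_closed by (auto simp: unit_tensors_def)
  show "T.act (s z) T.cyc = T.cyc" by (rule act_fixed[OF z(1) one])
  show "\<And>v. v \<in> carrier H \<Longrightarrow> (\<And>a. a \<in> carrier A \<Longrightarrow> hinner H v (T.act a T.cyc) = 0) \<Longrightarrow> v = \<zero>\<^bsub>H\<^esub>"
    by (rule T.cyc_cyclic)
  show "\<And>v. v \<in> carrier H \<Longrightarrow> T.act (s z) v = v \<Longrightarrow> \<exists>c. v = c \<odot>\<^bsub>H\<^esub> T.cyc"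
    by (rule fixed_vector[OF z one])
qed

lemma act_power_fixed:
  assumes x: "x \<in> tensors n m" and v: "v \<in> carrier H" "T.act (s x) v = v"
  shows "T.act (s (tensor_power x p)) v = v"
proof (induction p)
  case 0
  then show ?case using A.rep_one[OF T.gns_representation A.one_closed v(1)] by (simp add: s_delta)
next
  case (Suc p)
  then show ?case
    using A.rep_mult[OF T.gns_representation s_closed[OF x] v(1) s_closed[OF tensor_power_in[OF x, of p]]] v
    by (simp only: s_power_mult(1)[OF x])
qed

text \<open>Powers bring \<open>z\<close> and \<open>y\<close> to the same order, so that the intertwining relation is available.\<close>

lemma no_fixed_vector:
  assumes z: "z \<in> unit_tensors n m" "m \<ge> 1" "indecomposable n z"
    and y: "y \<in> unit_tensors n l" "l \<ge> 1" "indecomposable n y" and one: "\<omega> (s y) = 1"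
    and v: "v \<in> carrier H" "T.act (s z) v = v" and neq: "z \<noteq> y"
  shows "v = \<zero>\<^bsub>H\<^esub>"
proof (rule T.cyc_cyclic[OF v(1)])
  have zt: "z \<in> tensors n m" "z \<noteq> (\<lambda>w. 0)" using z unit_nonzero by (auto simp: unit_tensors_def)
  have yt: "y \<in> tensors n l" "y \<noteq> (\<lambda>w. 0)" using y unit_nonzero by (auto simp: unit_tensors_def)
  \<comment> \<open>Exponent 1 at equal orders gives access to the clause z = y of
    \<open>indecomposable_conjugate\<close>; otherwise the crosswise exponents give the common order
    l m.\<close>
  define a b where "a = (if m = l then 1 else l)" and "b = (if m = l then 1 else m)"
  have ab: "a \<ge> 1" "b \<ge> 1" "a * m = b * l" using z y by (auto simp: a_def b_def)
  define N where "N = a * m"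
  have N: "N \<ge> 1" using ab(1) z(2) by (simp add: N_def Suc_le_eq One_nat_def)
  have za: "tensor_power z a \<in> unit_tensors n N" unfolding N_def by (rule unit_power[OF z(1)])
  have yb: "tensor_power y b \<in> unit_tensors n N" unfolding N_def ab(3) by (rule unit_power[OF y(1)])
  have cl: "s (tensor_power z a) \<in> carrier A" "s (tensor_power y b) \<in> carrier A"
    using za yb s_closed by (auto simp: unit_tensors_def)
  have fv: "T.act (s (tensor_power z a)) v = v" by (rule act_power_fixed[OF zt(1) v])
  have fc: "T.act (s (tensor_power y b)) T.cyc = T.cyc"
    by (rule act_power_fixed[OF yt(1) T.cyc_closed act_fixed[OF y(1) one]])
  let ?g = "\<lambda>x. hinner H v (T.act x T.cyc)"
  note g = coefficient_functional[OF v(1)]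
  interpret W: word_functional n "\<lambda>w. ?g (wd w)" "tensor_power z a" "tensor_power y b" N
    by (rule word_functionalI[OF g(1) za yb N])
       (simp_all add: coefficient_left[OF v(1) fv cl(1)] coefficient_right[OF fc cl(2)])
  have "?g (wd w) = 0" if "w \<in> lists (letters n)" for w
  proof (rule W.vanish_criterion[OF _ that])
    fix d u assume u: "u \<in> tensors n d" "u \<noteq> (\<lambda>w. 0)" "tensor (tensor_power z a) u = tensor u (tensor_power y b)"
    \<comment> \<open>No nonzero u solves the equation at all, so the condition of
      \<open>vanish_criterion\<close> holds vacuously.\<close>
    have "m = l \<and> (a = 1 \<longrightarrow> z = y)"
      by (rule indecomposable_conjugate[OF zt(1) z(3,2) zt(2) yt(1) y(3,2) yt(2) ab u])
    then have False using neq by (auto simp: a_def)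
    then show "(\<Sum>L\<in>words n d. u L * ?g (wd (gens L))) = 0" ..
  qed
  then show "?g x = 0" if "x \<in> carrier A" for x
    using functional_eq_zero[OF g(1) g(2) _ that] by blast
qed

end

section \<open>The map into the spectrum and its injectivity\<close>

context cuntz_algebra
begin

lemma indecomposable_unitsD:
  assumes "z \<in> indecomposable_units n"
  obtains m where "z \<in> unit_tensors n m" "m \<ge> 1" "indecomposable n z" "nonperiodic n z"
  using assms indecomposable_nonperiodic by (auto simp: indecomposable_units_def)

lemma gns_class_spectrum: "gns_equiv_class n \<in> indecomposable_units n \<rightarrow> cstar_spectrum A"
proof
  fix z assume "z \<in> indecomposable_units n"
  then obtain m where z: "z \<in> unit_tensors n m" "m \<ge> 1" "indecomposable n z" "nonperiodic n z"
    by (rule indecomposable_unitsD)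
  note oz = omega_tilde(1,2)[OF z(1,2,4)]
  interpret cuntz_state n "omega_tilde n z" by unfold_locales (rule oz(1))
  show "gns_equiv_class n z \<in> cstar_spectrum A"
    unfolding gns_equiv_class_def cstar_spectrum_def
    by (rule quotientI) (simp add: gns_irreducible[OF z(1,2,4) oz(2)])
qed

text \<open>An intertwining unitary carries the cyclic vector of z to a unit vector fixed by s(z) in
  the representation of y, where \<open>no_fixed_vector\<close> leaves only zero.\<close>

lemma gns_class_inj: "inj_on (gns_equiv_class n) (indecomposable_units n)"
proof (rule inj_onI, rule ccontr)
  fix z y assume "z \<in> indecomposable_units n" "y \<in> indecomposable_units n"
    and eq: "gns_equiv_class n z = gns_equiv_class n y" and neq: "z \<noteq> y"
  then obtain m l where z: "z \<in> unit_tensors n m" "m \<ge> 1" "indecomposable n z" "nonperiodic n z"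
    and y: "y \<in> unit_tensors n l" "l \<ge> 1" "indecomposable n y" "nonperiodic n y"
    using indecomposable_unitsD by metis
  note oz = omega_tilde(1,2)[OF z(1,2,4)] and oy = omega_tilde(1,2)[OF y(1,2,4)]
  interpret Z: cuntz_state n "omega_tilde n z" by unfold_locales (rule oz(1))
  interpret Y: cuntz_state n "omega_tilde n y" by unfold_locales (rule oy(1))
  \<comment> \<open>Reflexivity puts the representation of y into its own class; equality of the
    classes then yields an intertwiner in the required direction, without symmetry or
    transitivity.\<close>
  have "gns_rep A (omega_tilde n y) \<in> gns_equiv_class n y"
    unfolding gns_equiv_class_def Y.T.gns_rep_eq
    using A.unitary_equiv_refl[OF Y.T.gns_representation] by blast
  then have "gns_rep A (omega_tilde n y) \<in> gns_equiv_class n z" by (simp only: eq)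
  then have "(gns_rep A (omega_tilde n z), gns_rep A (omega_tilde n y)) \<in> unitary_equiv A"
    unfolding gns_equiv_class_def by blast
  then obtain T where "intertwining_unitary A (Z.H, Z.T.act) (Y.H, Y.T.act) T"
    unfolding Z.T.gns_rep_eq Y.T.gns_rep_eq unitary_equiv_def by blast
  then have T: "bij_betw T (carrier Z.H) (carrier Y.H)"
    "\<And>x y. x \<in> carrier Z.H \<Longrightarrow> y \<in> carrier Z.H \<Longrightarrow> hinner Y.H (T x) (T y) = hinner Z.H x y"
    "\<And>a x. a \<in> carrier A \<Longrightarrow> x \<in> carrier Z.H \<Longrightarrow> T (Z.T.act a x) = Y.T.act a (T x)"
    by auto
  define v where "v = T Z.T.cyc"
  have v: "v \<in> carrier Y.H" using T(1) Z.T.cyc_closed unfolding v_def by (rule bij_betwE[rule_format])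
  have sz: "s z \<in> carrier A" using z s_closed by (auto simp: unit_tensors_def)
  have "Y.T.act (s z) v = v"
    using T(3)[OF sz Z.T.cyc_closed] Z.act_fixed[OF z(1) oz(2)] by (simp add: v_def)
  then have "v = \<zero>\<^bsub>Y.H\<^esub>" by (rule Y.no_fixed_vector[OF z(1-3) y(1-3) oy(2) v _ neq])
  then have "hinner Y.H v v = 0" using Y.H.B_zero[OF v] by simp
  moreover have "hinner Y.H v v = 1"
    using T(2)[OF Z.T.cyc_closed Z.T.cyc_closed] Z.cyc_norm by (simp add: v_def)
  ultimately show False by simp
qed

end

text \<open>The middle conjunct records that r takes values in the spectrum: indecomposable vectors
  are nonperiodic, so their GNS representations are irreducible. That q takes values in the pure
  sub-Cuntz states is part of the bijection.\<close>

theorem corollary1p9: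
  fixes n :: nat
  assumes "2 \<le> n"
  shows "bij_betw (omega_tilde n) (nonperiodic_units n) (pure_sub_cuntz_states n) \<and>
    gns_equiv_class n \<in> indecomposable_units n \<rightarrow> cstar_spectrum (cuntz n) \<and>
    inj_on (gns_equiv_class n) (indecomposable_units n)"
proof -
  interpret cuntz_algebra n by unfold_locales (rule assms)
  show ?thesis by (intro conjI omega_tilde_bij gns_class_spectrum gns_class_inj)
qed

end
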